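(* Let $n,\bar n \geq 0$ be integers, let $A \in GL_n(\mathbb{Q})$ and $\bar A \in GL_{\bar n}(\mathbb{Q})$, and let $L \leq \mathbb{Z}^n \cap A^{-1}(\mathbb{Z}^n)$ and $\bar L \leq \mathbb{Z}^{\bar n} \cap \bar A^{-1}(\mathbb{Z}^{\bar n})$ be finite index subgroups. Suppose that $G(A,L) \cong G(\bar A,\bar L)$. Then $n = \bar n$, and $\bar A$ is conjugate to either $A$ or $A^{-1}$ in $GL_n(\mathbb{Q})$.
   Context: For $n \geq 0$, $A \in GL_n(\mathbb{Q})$ and a finite index subgroup $L$ of $\mathbb{Z}^n \cap A^{-1}(\mathbb{Z}^n)$, the Leary--Minasyan group $G(A,L)$ is the group with presentation $$G(A,L) = \langle x_1,\ldots,x_n,t \mid [x_i,x_j]=1 \text{ for } 1 \leq i<j \leq n,\ t\mathbf{x}^{\mathbf{v}}t^{-1} = \mathbf{x}^{A\mathbf{v}} \text{ for } \mathbf{v} \in L\rangle,$$ where $\mathbf{x}^{\mathbf{w}} := x_1^{w_1}\cdots x_n^{w_n}$ for $\mathbf{w}=(w_1,\ldots,w_n) \in \mathbb{Z}^n$. *)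

theory Defs
  imports "Jordan_Normal_Form.Matrix" "HOL-Algebra.Coset"
begin

section \<open>Groups given by presentations\<close>

text \<open>A letter \<open>(x, True)\<close> stands for the generator \<open>x\<close> and \<open>(x, False)\<close> for its formal inverse.\<close>

type_synonym 'x word = "('x \<times> bool) list"

definition words :: "'x set \<Rightarrow> 'x word set" where
  "words X = lists (X \<times> UNIV)"

text \<open>
  A pair \<open>(l, r)\<close> in \<open>R\<close> stands for the defining relation \<open>l = r\<close>. The following is the least
  congruence on the monoid of words over \<open>X\<close> that contains the free cancellations and \<open>R\<close>
  (where \<open>R\<close> is meant to be a subset of \<open>words X \<times> words X\<close>); the quotient is the free group
  on \<open>X\<close> modulo the normal closure of the elements \<open>l r\<^sup>-\<^sup>1\<close>.
\<close>

inductive_set pres_cong :: "'x set \<Rightarrow> ('x word \<times> 'x word) set \<Rightarrow> ('x word \<times> 'x word) set"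
  for X :: "'x set" and R :: "('x word \<times> 'x word) set" where
  refl: "w \<in> words X \<Longrightarrow> (w, w) \<in> pres_cong X R"
| sym: "(u, v) \<in> pres_cong X R \<Longrightarrow> (v, u) \<in> pres_cong X R"
| trans: "(u, v) \<in> pres_cong X R \<Longrightarrow> (v, w) \<in> pres_cong X R \<Longrightarrow> (u, w) \<in> pres_cong X R"
| append: "(u, u') \<in> pres_cong X R \<Longrightarrow> (v, v') \<in> pres_cong X R \<Longrightarrow> (u @ v, u' @ v') \<in> pres_cong X R"
| cancel: "x \<in> X \<Longrightarrow> ([(x, e), (x, \<not> e)], []) \<in> pres_cong X R"
| rel: "(l, r) \<in> R \<Longrightarrow> (l, r) \<in> pres_cong X R"

definition presented_group :: "'x set \<Rightarrow> ('x word \<times> 'x word) set \<Rightarrow> 'x word set monoid" where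
  "presented_group X R =
     \<lparr>carrier = words X // pres_cong X R,
      mult = (\<lambda>C D. pres_cong X R `` {c @ d |c d. c \<in> C \<and> d \<in> D}),
      one = pres_cong X R `` {[]}\<rparr>"

lemma words_append: "u \<in> words X \<Longrightarrow> v \<in> words X \<Longrightarrow> u @ v \<in> words X"
  by (auto simp: words_def)

lemma Nil_in_words: "[] \<in> words X"
  by (auto simp: words_def)

lemma pres_cong_in_words:
  assumes "R \<subseteq> words X \<times> words X" "(u, v) \<in> pres_cong X R"
  shows "u \<in> words X \<and> v \<in> words X"
  using assms(2)
  by induction (use assms(1) in \<open>auto simp: words_def\<close>)

lemma equiv_pres_cong:
  assumes "R \<subseteq> words X \<times> words X"
  shows "equiv (words X) (pres_cong X R)"
proof (rule equivI)
  show "pres_cong X R \<subseteq> words X \<times> words X"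
    by (auto dest: pres_cong_in_words[OF assms])
  show "refl_on (words X) (pres_cong X R)"
    by (auto intro: refl_onI pres_cong.refl)
  show "sym (pres_cong X R)"
    by (blast intro: symI pres_cong.sym)
  show "trans (pres_cong X R)"
    by (blast intro: transI pres_cong.trans)
qed

lemma presented_group_mult_class:
  assumes "R \<subseteq> words X \<times> words X" "u \<in> words X" "v \<in> words X"
  shows "(pres_cong X R `` {u}) \<otimes>\<^bsub>presented_group X R\<^esub> (pres_cong X R `` {v}) =
         pres_cong X R `` {u @ v}"
proof -
  have "pres_cong X R `` {c @ d |c d. c \<in> pres_cong X R `` {u} \<and> d \<in> pres_cong X R `` {v}} =
        pres_cong X R `` {u @ v}" (is "?L = ?R")
  proof
    show "?L \<subseteq> ?R" 
      by (auto intro: pres_cong.trans pres_cong.append)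
    show "?R \<subseteq> ?L"
      using assms(2,3) by (auto intro!: pres_cong.refl)
  qed
  thus ?thesis by (simp add: presented_group_def)
qed

lemma group_presented_group:
  assumes R: "R \<subseteq> words X \<times> words X"
  shows "group (presented_group X R)"
proof -
  let ?G = "presented_group X R" and ?c = "\<lambda>w. pres_cong X R `` {w}"
  note mult = presented_group_mult_class[OF R]
  have carr: "carrier ?G = ?c ` words X" and one: "\<one>\<^bsub>?G\<^esub> = ?c []"
    by (auto simp: presented_group_def quotient_def)
  have eq: "?c u = ?c v" if "(u, v) \<in> pres_cong X R" for u v
    using equiv_class_eq[OF equiv_pres_cong[OF R] that] .
  have inv_word: "\<exists>v\<in>words X. (v @ w, []) \<in> pres_cong X R" if "w \<in> words X" for w
    using that
  proof (induction w)
    case Nil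
    show ?case by (rule bexI[of _ "[]"]) (auto intro: pres_cong.refl Nil_in_words)
  next
    case (Cons a w)
    obtain x e where a: "a = (x, e)" by (cases a)
    from Cons.prems have x: "x \<in> X" and w: "w \<in> words X" by (auto simp: words_def a)
    then obtain v where v: "v \<in> words X" "(v @ w, []) \<in> pres_cong X R" using Cons.IH by blast
    have "([(x, \<not> e), (x, e)], []) \<in> pres_cong X R"
      using pres_cong.cancel[OF x, of "\<not> e"] by simp
    from pres_cong.append[OF this pres_cong.refl[OF w]]
    have "([(x, \<not> e), (x, e)] @ w, w) \<in> pres_cong X R" by simp
    from pres_cong.append[OF pres_cong.refl[OF v(1)] this]
    have "((v @ [(x, \<not> e)]) @ a # w, v @ w) \<in> pres_cong X R" by (simp add: a)
    with v(2) have "((v @ [(x, \<not> e)]) @ a # w, []) \<in> pres_cong X R"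
      by (blast intro: pres_cong.trans)
    moreover have "v @ [(x, \<not> e)] \<in> words X" using v(1) x by (auto simp: words_def)
    ultimately show ?case by blast
  qed
  show ?thesis
  proof (rule groupI)
    fix C assume "C \<in> carrier ?G"
    then obtain w where w: "w \<in> words X" "C = ?c w" by (auto simp: carr)
    from inv_word[OF w(1)] obtain v where v: "v \<in> words X" "(v @ w, []) \<in> pres_cong X R"
      by blast
    have "?c v \<otimes>\<^bsub>?G\<^esub> C = \<one>\<^bsub>?G\<^esub>"
      using w v by (simp add: mult one eq)
    thus "\<exists>D\<in>carrier ?G. D \<otimes>\<^bsub>?G\<^esub> C = \<one>\<^bsub>?G\<^esub>"
      using v(1) by (auto simp: carr)
  qed (auto simp: carr one mult words_append Nil_in_words)
qed


section \<open>Leary--Minasyan groups\<close>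

definition GL :: "nat \<Rightarrow> rat mat monoid" where
  "GL n = units_of (ring_mat TYPE(rat) n ())"

lemma group_GL: "group (GL n)"
proof -
  interpret ring "ring_mat TYPE(rat) n ()" by (rule ring_mat)
  show ?thesis unfolding GL_def by (rule units_group)
qed

definition conjugate_in :: "('g, 'b) monoid_scheme \<Rightarrow> 'g \<Rightarrow> 'g \<Rightarrow> bool" where
  "conjugate_in G a b \<longleftrightarrow> (\<exists>g\<in>carrier G. a = g \<otimes>\<^bsub>G\<^esub> b \<otimes>\<^bsub>G\<^esub> inv\<^bsub>G\<^esub> g)"

definition finite_index_subgroup :: "'g set \<Rightarrow> ('g, 'b) monoid_scheme \<Rightarrow> bool" where
  "finite_index_subgroup H G \<longleftrightarrow> subgroup H G \<and> finite (rcosets\<^bsub>G\<^esub> H)"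

text \<open>
  Elements of \<open>\<int>\<^sup>n\<close> are integer vectors. As a set, the following group is
  \<open>\<int>\<^sup>n \<inter> A\<^sup>-\<^sup>1(\<int>\<^sup>n)\<close>, i.e. the integer vectors that \<open>A\<close> maps to integer vectors.
\<close>

definition integral_part :: "nat \<Rightarrow> rat mat \<Rightarrow> int vec monoid" where
  "integral_part n A = (monoid_vec TYPE(int) n)
     \<lparr>carrier := {v \<in> carrier_vec n. \<exists>w\<in>carrier_vec n.
        A *\<^sub>v map_vec rat_of_int v = map_vec rat_of_int w}\<rparr>"

lemma group_integral_part:
  assumes "A \<in> carrier_mat n n"
  shows "group (integral_part n A)"
proof -
  interpret Z: comm_group "monoid_vec TYPE(int) n" by (rule comm_group_vec)
  have inv: "inv\<^bsub>monoid_vec TYPE(int) n\<^esub> v = - v" if "v \<in> carrier_vec n" for v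
    by (rule Z.inv_equality) (use that in \<open>auto simp: monoid_vec_simps\<close>)
  have hom_add: "map_vec rat_of_int (v + w) = map_vec rat_of_int v + map_vec rat_of_int w"
    if "v \<in> carrier_vec n" "w \<in> carrier_vec n" for v w
    by (rule eq_vecI) (use that in auto)
  have hom_neg: "map_vec rat_of_int (- v) = - map_vec rat_of_int v" for v
    by (rule eq_vecI) auto
  have mult_neg: "A *\<^sub>v (- v) = - (A *\<^sub>v v)" if "v \<in> carrier_vec n" for v
    by (rule eq_vecI) (use that assms in auto)
  let ?S = "{v \<in> carrier_vec n. \<exists>w\<in>carrier_vec n.
        A *\<^sub>v map_vec rat_of_int v = map_vec rat_of_int w}"
  have "subgroup ?S (monoid_vec TYPE(int) n)"
  proof (rule Z.subgroupI)
    show "?S \<subseteq> carrier (monoid_vec TYPE(int) n)" by (auto simp: monoid_vec_simps)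
    have "A *\<^sub>v map_vec rat_of_int (0\<^sub>v n) = map_vec rat_of_int (0\<^sub>v n)"
      by (rule eq_vecI) (use assms in \<open>auto simp: scalar_prod_def\<close>)
    thus "?S \<noteq> {}" using zero_carrier_vec by blast
  next
    fix v assume "v \<in> ?S"
    then obtain w where v: "v \<in> carrier_vec n" and w: "w \<in> carrier_vec n"
      and "A *\<^sub>v map_vec rat_of_int v = map_vec rat_of_int w" by auto
    hence "A *\<^sub>v map_vec rat_of_int (- v) = map_vec rat_of_int (- w)"
      by (simp add: hom_neg mult_neg)
    thus "inv\<^bsub>monoid_vec TYPE(int) n\<^esub> v \<in> ?S"
      using v w by (auto simp: inv intro!: bexI[of _ "- w"])
  next
    fix v v' assume "v \<in> ?S" "v' \<in> ?S"
    then obtain w w' where v: "v \<in> carrier_vec n" "v' \<in> carrier_vec n"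
      and w: "w \<in> carrier_vec n" "w' \<in> carrier_vec n"
      and eqs: "A *\<^sub>v map_vec rat_of_int v = map_vec rat_of_int w"
        "A *\<^sub>v map_vec rat_of_int v' = map_vec rat_of_int w'" by auto
    have "A *\<^sub>v map_vec rat_of_int (v + v') = map_vec rat_of_int (w + w')"
      using v w assms by (simp add: hom_add mult_add_distrib_mat_vec[of A n n] eqs)
    thus "v \<otimes>\<^bsub>monoid_vec TYPE(int) n\<^esub> v' \<in> ?S"
      using v w by (auto simp: monoid_vec_simps intro!: bexI[of _ "w + w'"])
  qed
  thus ?thesis unfolding integral_part_def by (rule Z.subgroup_imp_group)
qed

text \<open>The generators \<open>x\<^sub>1, \<dots>, x\<^sub>n\<close> are indexed from zero, as vector entries are.\<close>

datatype lm_gen = X nat | T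

definition gens :: "nat \<Rightarrow> lm_gen set" where
  "gens n = insert T (X ` {..<n})"

definition gen_power :: "'x \<Rightarrow> int \<Rightarrow> 'x word" where
  "gen_power x k = replicate (nat \<bar>k\<bar>) (x, k \<ge> 0)"

definition x_power :: "int vec \<Rightarrow> lm_gen word" where
  "x_power w = concat (map (\<lambda>i. gen_power (X i) (w $ i)) [0..<dim_vec w])"

definition lm_relations :: "nat \<Rightarrow> rat mat \<Rightarrow> int vec set \<Rightarrow> (lm_gen word \<times> lm_gen word) set" where
  "lm_relations n A L =
     {([(X i, True), (X j, True), (X i, False), (X j, False)], []) |i j. i < j \<and> j < n} \<union>
     {([(T, True)] @ x_power v @ [(T, False)], x_power w) |v w.
        v \<in> L \<and> w \<in> carrier_vec n \<and> A *\<^sub>v map_vec rat_of_int v = map_vec rat_of_int w}"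

definition LM_group :: "nat \<Rightarrow> rat mat \<Rightarrow> int vec set \<Rightarrow> lm_gen word set monoid" where
  "LM_group n A L = presented_group (gens n) (lm_relations n A L)"

lemma x_power_in_words: "w \<in> carrier_vec n \<Longrightarrow> x_power w \<in> words (gens n)"
  by (auto simp: x_power_def gen_power_def words_def gens_def)

lemma group_LM_group:
  assumes "L \<subseteq> carrier_vec n"
  shows "group (LM_group n A L)"
  unfolding LM_group_def
proof (rule group_presented_group)
  have T: "[(T, e)] \<in> words (gens n)" for e by (auto simp: words_def gens_def)
  have X: "[(X i, True), (X j, True), (X i, False), (X j, False)] \<in> words (gens n)"
    if "i < j" "j < n" for i j
    using that by (auto simp: words_def gens_def)
  show "lm_relations n A L \<subseteq> words (gens n) \<times> words (gens n)"
    unfolding lm_relations_def using assms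
    by (auto intro!: words_append x_power_in_words T X Nil_in_words
        simp del: append_Cons append_Nil)
qed

end

theory Submission
  imports Defs "Jordan_Normal_Form.Determinant" "HOL-Number_Theory.Residues"
begin

text \<open>
  Write \<open>H\<close> for the image of \<open>\<int>\<^sup>n\<close> in \<open>G = G(A, L)\<close>, and \<open>\<tau> : G \<rightarrow> \<int>\<close> for the map killing \<open>H\<close> with \<open>\<tau>(t) = 1\<close>;
  conjugation by \<open>g\<close> acts on \<open>H\<close>, up to finite index, as \<open>A\<^bsup>\<tau>(g)\<^esup>\<close>. Consider the set of all \<open>g\<close> such
  that every commutator commutes with some positive power of \<open>g\<close>. It is invariant under
  isomorphisms and contains all roots of elements of \<open>H\<close>. If \<open>L\<close> and \<open>A L\<close> are both proper, normal
  forms in HNN extensions show that it contains nothing else; if \<open>L\<close> or \<open>A L\<close> is \<open>\<int>\<^sup>n\<close>, the same follows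
  from the affine representation of \<open>G\<close> on \<open>\<rat>\<^sup>n\<close>, unless \<open>L = A L = \<int>\<^sup>n\<close> and \<open>(A\<^sup>k - 1)(A - 1) = 0\<close> for some
  \<open>k > 0\<close>, in which case the set is all of \<open>G\<close>.

  In the generic case an isomorphism maps a finite index subgroup of \<open>H\<close> into \<open>H'\<close>, inducing a
  rational isomorphism that conjugates \<open>A\<close> to \<open>A'\<^bsup>\<plusminus>1\<^esup>\<close>. In the exceptional case it identifies the
  commutator subgroups \<open>(A - 1) \<int>\<^sup>n\<close>, on which \<open>A\<close> acts by a matrix \<open>B\<close> of finite order \<open>m\<close>; hence \<open>B'\<close> is
  similar to \<open>B\<^sup>k\<close> with \<open>k\<close> prime to \<open>m\<close>. As \<open>A\<close> is integral, \<open>tr(A\<^sup>q) \<equiv> tr(A)\<close> modulo primes \<open>q\<close>, and choosing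
  a representative of \<open>k\<close> modulo \<open>m\<close> without small prime factors shows that \<open>B\<close> and \<open>B\<^sup>k\<close> have the same character,
  so they are similar. Finally, \<open>A\<close> is determined up to similarity by \<open>n\<close> and \<open>B\<close>, and \<open>n\<close> is recovered from
  the rank of the abelianization.
\<close>

section \<open>Trace and rank normal form\<close>

text \<open>Commutators are the right test elements because \<tau> vanishes on them: each one
  commutes with a finite index subgroup of \<open>H\<close>, whereas \<open>t\<close> need not. As
  \<open>H\<close> is in general not normal, the abstract group determines it only up to finite
  index, which is why the comparison matrices are rational.

  The similarity is then regained from characters: two rational matrices of finite order with equal
  traces of powers are similar, shown by averaging over a cyclic group without leaving the
  rationals.

  All facts about the presented group come from actions on sets (the integers, rational space,
  normal forms), each obtained by checking the relations on letters.\<close>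

lemma mat_mult_assoc:
  fixes A B C :: "'a::semiring_0 mat"
  assumes "dim_col A = dim_row B" "dim_col B = dim_row C"
  shows "A * B * C = A * (B * C)"
  using assms by (intro assoc_mult_mat[of A "dim_row A" "dim_col A" B "dim_col B" C "dim_col C"]) auto

lemma mat_mult_regroup:
  fixes A B C M D E F :: "'a::semiring_0 mat"
  assumes "A \<in> carrier_mat n n" "B \<in> carrier_mat n n" "C \<in> carrier_mat n n" "M \<in> carrier_mat n m"
    "D \<in> carrier_mat m m" "E \<in> carrier_mat m m" "F \<in> carrier_mat m m"
  shows "A * (B * (C * M * D) * E) * F = (A * B * C) * M * (D * E * F)"
  using assms by (auto simp: mat_mult_assoc)

lemma mat_mult_regroup2:
  fixes A B M D E :: "'a::semiring_0 mat"
  assumes "A \<in> carrier_mat n n" "B \<in> carrier_mat n n" "M \<in> carrier_mat n m"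
    "D \<in> carrier_mat m m" "E \<in> carrier_mat m m"
  shows "A * (B * M * D) * E = (A * B) * M * (D * E)"
  using assms by (auto simp: mat_mult_assoc)

definition tr :: "'a::comm_monoid_add mat \<Rightarrow> 'a" where
  "tr A = (\<Sum>i<dim_row A. A $$ (i, i))"

lemma tr_mult_comm:
  fixes A B :: "'a::comm_semiring_0 mat"
  assumes "A \<in> carrier_mat n m" "B \<in> carrier_mat m n"
  shows "tr (A * B) = tr (B * A)"
proof -
  have "tr (A * B) = (\<Sum>i<n. \<Sum>j<m. A $$ (i,j) * B $$ (j,i))"
    unfolding tr_def using assms by (auto simp: scalar_prod_def atLeast0LessThan intro!: sum.cong)
  also have "\<dots> = (\<Sum>j<m. \<Sum>i<n. B $$ (j,i) * A $$ (i,j))"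
    by (subst sum.swap) (simp add: mult.commute)
  also have "\<dots> = tr (B * A)"
    unfolding tr_def using assms by (auto simp: scalar_prod_def atLeast0LessThan intro!: sum.cong)
  finally show ?thesis .
qed

lemma tr_one [simp]: "tr (1\<^sub>m n :: 'a::semiring_1 mat) = of_nat n"
  by (simp add: tr_def)

lemma tr_smult: "A \<in> carrier_mat n n \<Longrightarrow> tr (c \<cdot>\<^sub>m A) = c * tr (A :: 'a::semiring_0 mat)"
  by (simp add: tr_def sum_distrib_left)

lemma tr_four_block_mat:
  assumes "A \<in> carrier_mat n n" "D \<in> carrier_mat m m"
  shows "tr (four_block_mat A B C D) = tr A + tr (D :: 'a::comm_monoid_add mat)"
proof -
  have split: "(\<Sum>i<n+k. f i) = (\<Sum>i<n. f i) + (\<Sum>i<k. f (n+i))" for k and f :: "nat \<Rightarrow> 'a"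
    by (induction k) (simp_all add: add.assoc)
  show ?thesis using assms by (simp add: tr_def split)
qed

lemma tr_similar:
  assumes "similar_mat A (B :: 'a::comm_semiring_1 mat)"
  shows "tr A = tr B"
proof -
  obtain n P Q where c: "{A,B,P,Q} \<subseteq> carrier_mat n n" and q: "Q * P = 1\<^sub>m n" "A = P * B * Q"
    using similar_matD[OF assms] by blast
  have "tr A = tr (P * (B * Q))" using c q by (simp add: assoc_mult_mat[of _ n n _ n _ n])
  also have "\<dots> = tr (B * Q * P)" using c by (subst tr_mult_comm[of _ n n]) auto
  also have "B * Q * P = B"
    using c q by (simp add: assoc_mult_mat[of _ n n _ n _ n] right_mult_one_mat[of B n n])
  finally show ?thesis .
qed

lemma det_nonzeroE:
  fixes P :: "'a::field mat"
  assumes "P \<in> carrier_mat n n" "det P \<noteq> 0"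
  obtains P' where "P' \<in> carrier_mat n n" "P * P' = 1\<^sub>m n" "P' * P = 1\<^sub>m n"
  using det_non_zero_imp_unit[OF assms, of "()"] unfolding Units_def ring_mat_def by auto

lemma det_nonzeroI:
  fixes P :: "'a::field mat"
  assumes "P \<in> carrier_mat n n" "P' \<in> carrier_mat n n" "P * P' = 1\<^sub>m n"
  shows "det P \<noteq> 0"
  using det_mult[OF assms(1,2)] assms(3) by auto

lemma similar_matI_det:
  fixes A :: "'a::field mat"
  assumes "A \<in> carrier_mat n n" "B \<in> carrier_mat n n" "W \<in> carrier_mat n n" "det W \<noteq> 0"
    and "W * A = B * W"
  shows "similar_mat A B"
proof -
  obtain Y where Y: "Y \<in> carrier_mat n n" "W * Y = 1\<^sub>m n" "Y * W = 1\<^sub>m n"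
    using det_nonzeroE[OF assms(3,4)] by blast
  have "Y * B * W = Y * (W * A)" using assms Y by (simp add: assoc_mult_mat[of _ n n _ n _ n])
  also have "\<dots> = Y * W * A" using assms(1,3) Y(1) by (simp add: assoc_mult_mat[of _ n n _ n _ n])
  also have "\<dots> = A" using assms Y by simp
  finally show ?thesis using assms Y by (intro similar_matI[of _ _ Y W n]) auto
qed

lemma det_mult3_nonzero:
  fixes A B C :: "'a::field mat"
  assumes "A \<in> carrier_mat n n" "B \<in> carrier_mat n n" "C \<in> carrier_mat n n"
    "det A \<noteq> 0" "det B \<noteq> 0" "det C \<noteq> 0"
  shows "A * B * C \<in> carrier_mat n n \<and> det (A * B * C) \<noteq> 0"
  using assms by (simp add: det_mult[of _ n] mult_carrier_mat[of _ n n])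

definition swap_mat :: "nat \<Rightarrow> nat \<Rightarrow> 'a::field mat" where
  "swap_mat n a = mat n n (\<lambda>(i,j). if j = Transposition.transpose 0 a i then 1 else 0)"

lemma swap_mat_carrier [simp]: "swap_mat n a \<in> carrier_mat n n"
  by (simp add: swap_mat_def)

lemma transpose_less: "a < n \<Longrightarrow> i < n \<Longrightarrow> Transposition.transpose 0 a i < (n::nat)"
  by (auto simp: Transposition.transpose_def)

lemma swap_mat_mult_left:
  assumes "M \<in> carrier_mat n m" "a < n" "i < n" "j < m"
  shows "(swap_mat n a * M) $$ (i, j) = M $$ (Transposition.transpose 0 a i, j)"
  using assms transpose_less[OF assms(2,3)]
  by (simp add: swap_mat_def scalar_prod_def if_distrib[of "\<lambda>x. x * _"] sum.delta cong: if_cong)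

lemma swap_mat_mult_right:
  assumes "M \<in> carrier_mat m n" "a < n" "i < m" "j < n"
  shows "(M * swap_mat n a) $$ (i, j) = M $$ (i, Transposition.transpose 0 a j)"
proof -
  have "(M * swap_mat n a) $$ (i, j) =
      (\<Sum>k<n. M $$ (i,k) * (if j = Transposition.transpose 0 a k then 1 else 0))"
    using assms by (simp add: swap_mat_def scalar_prod_def atLeast0LessThan)
  also have "\<dots> = (\<Sum>k<n. if k = Transposition.transpose 0 a j then M $$ (i,k) else 0)"
    by (rule sum.cong) (auto simp: Transposition.transpose_def split: if_splits)
  finally show ?thesis using transpose_less[OF assms(2,4)] by simp
qed

lemma swap_mat_involution: "a < n \<Longrightarrow> swap_mat n a * swap_mat n a = (1\<^sub>m n :: 'a::field mat)"
  by (rule eq_matI, subst swap_mat_mult_left[of _ n n])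
     (use transpose_less in \<open>auto simp: swap_mat_def\<close>)

lemma det_swap_mat: "a < n \<Longrightarrow> det (swap_mat n a :: 'a::field mat) \<noteq> 0"
  by (rule det_nonzeroI[OF _ _ swap_mat_involution]) auto

definition rank_mat :: "nat \<Rightarrow> nat \<Rightarrow> nat \<Rightarrow> 'a::field mat" where
  "rank_mat nr nc r = mat nr nc (\<lambda>(i,j). if i = j \<and> i < r then 1 else 0)"

lemma rank_mat_carrier [simp]: "rank_mat nr nc r \<in> carrier_mat nr nc"
  by (simp add: rank_mat_def)

lemma rank_mat_dim [simp]: "dim_row (rank_mat nr nc r) = nr" "dim_col (rank_mat nr nc r) = nc"
  by (simp_all add: rank_mat_def)

lemma rank_mat_index:
  "i < nr \<Longrightarrow> j < nc \<Longrightarrow> rank_mat nr nc r $$ (i,j) = (if i = j \<and> i < r then 1 else 0)"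
  by (simp add: rank_mat_def)

lemma rank_mat_Suc:
  "rank_mat (Suc k) (Suc l) (Suc r) =
   four_block_mat (1\<^sub>m 1) (0\<^sub>m 1 l) (0\<^sub>m k 1) (rank_mat k l r :: 'a::field mat)"
  by (rule eq_matI) (auto simp: rank_mat_def)

text \<open>One step of Gaussian elimination: \<open>d'\<close> is the Schur complement of the pivot
  \<open>a\<close>. The pivot is kept in the left factor, so that the middle factor has corner 1 and
  matches the shape in \<open>rank_mat_Suc\<close>.\<close>

lemma pivot_block:
  fixes a b c d :: "'a::field mat"
  assumes a: "a \<in> carrier_mat 1 1" "a $$ (0,0) \<noteq> 0" and b: "b \<in> carrier_mat 1 l"
    and c: "c \<in> carrier_mat k 1" and d: "d \<in> carrier_mat k l"
  obtains C B d' where "C \<in> carrier_mat k 1" "B \<in> carrier_mat 1 l" "d' \<in> carrier_mat k l"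
    "four_block_mat a b c d = four_block_mat a (0\<^sub>m 1 k) C (1\<^sub>m k) *
       four_block_mat (1\<^sub>m 1) (0\<^sub>m 1 l) (0\<^sub>m k 1) d' * four_block_mat (1\<^sub>m 1) B (0\<^sub>m l 1) (1\<^sub>m l)"
proof -
  define B where "B = (1 / a $$ (0,0)) \<cdot>\<^sub>m b"
  define d' where "d' = d - c * B"
  have B: "B \<in> carrier_mat 1 l" using b by (simp add: B_def)
  have d': "d' \<in> carrier_mat k l" unfolding d'_def by (intro minus_carrier_mat mult_carrier_mat[OF c B])
  have aB: "a * B = b"
    by (rule eq_matI) (use a b in \<open>auto simp: B_def scalar_prod_def\<close>)
  have cBd: "c * B + d' = d"
    by (rule eq_matI) (use c d B in \<open>auto simp: d'_def\<close>)
  have "four_block_mat a (0\<^sub>m 1 k) c (1\<^sub>m k) * four_block_mat (1\<^sub>m 1) (0\<^sub>m 1 l) (0\<^sub>m k 1) d'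
      = four_block_mat a (0\<^sub>m 1 l) c d'"
    by (subst mult_four_block_mat) (use a c d' in auto)
  also have "\<dots> * four_block_mat (1\<^sub>m 1) B (0\<^sub>m l 1) (1\<^sub>m l) = four_block_mat a b c d"
    by (subst mult_four_block_mat[of _ 1 1 _ l _ k _ _ 1 _ l])
       (use a c d' B in \<open>auto simp: aB cBd right_mult_one_mat[of _ k l] right_add_zero_mat[OF b, simplified]\<close>)
  finally show ?thesis using that[OF c B d'] by simp
qed

lemma four_block_corner:
  assumes "N \<in> carrier_mat (Suc k) (Suc l)"
  obtains a b c d where "a \<in> carrier_mat 1 1" "b \<in> carrier_mat 1 l" "c \<in> carrier_mat k 1"
    "d \<in> carrier_mat k l" "N = four_block_mat a b c d"
proof -
  obtain a b c d where s: "split_block N 1 1 = (a,b,c,d)" by (metis prod_cases4)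
  from split_block[OF s, of k l] assms show ?thesis by (intro that[of a b c d]) auto
qed

text \<open>Induction on the number of rows: a nonzero entry is moved to the corner by two
  transpositions, split off by \<open>pivot_block\<close>, and the Schur complement is treated
  recursively. Images, kernels and complements are later read off in these coordinates.\<close>

theorem rank_normal_form:
  fixes M :: "'a::field mat"
  assumes "M \<in> carrier_mat nr nc"
  obtains P Q r where "P \<in> carrier_mat nr nr" "Q \<in> carrier_mat nc nc" "det P \<noteq> 0" "det Q \<noteq> 0"
    "r \<le> nr" "r \<le> nc" "M = P * rank_mat nr nc r * Q"
proof -
  have "\<exists>P Q r. P \<in> carrier_mat nr nr \<and> Q \<in> carrier_mat nc nc \<and> det P \<noteq> 0 \<and> det Q \<noteq> 0 \<and>
    r \<le> nr \<and> r \<le> nc \<and> M = P * rank_mat nr nc r * Q"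
    using assms
  proof (induction nr arbitrary: nc M)
    case (0 nc M)
    thus ?case
      by (intro exI[of _ "1\<^sub>m 0"] exI[of _ "1\<^sub>m nc"] exI[of _ 0]) auto
  next
    case (Suc k nc M)
    show ?case
    proof (cases "M = 0\<^sub>m (Suc k) nc")
      case True
      moreover have "rank_mat (Suc k) nc 0 = (0\<^sub>m (Suc k) nc :: 'a mat)"
        by (rule eq_matI) (auto simp: rank_mat_def)
      ultimately show ?thesis
        by (intro exI[of _ "1\<^sub>m (Suc k)"] exI[of _ "1\<^sub>m nc"] exI[of _ 0]) auto
    next
      case False
      then obtain i j where ij: "i < Suc k" "j < nc" "M $$ (i,j) \<noteq> 0"
        using Suc.prems by (metis carrier_matD eq_matI index_zero_mat(1,2,3))
      then obtain l where nc: "nc = Suc l" by (cases nc) auto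
      let ?S = "swap_mat (Suc k) i :: 'a mat" and ?S' = "swap_mat nc j :: 'a mat"
      define N where "N = ?S * M * ?S'"
      have N: "N \<in> carrier_mat (Suc k) (Suc l)" unfolding N_def using Suc.prems nc
        by (meson mult_carrier_mat swap_mat_carrier)
      have N00: "N $$ (0,0) = M $$ (i,j)"
        unfolding N_def
        using ij Suc.prems
        by (subst swap_mat_mult_right[OF mult_carrier_mat[of _ "Suc k" "Suc k"]])
           (auto simp: swap_mat_mult_left[of M "Suc k" nc] simp del: index_mult_mat(1))
      have M_eq: "M = ?S * N * ?S'"
      proof -
        have "?S * N * ?S' = (?S * ?S) * M * (?S' * ?S')"
          unfolding N_def by (rule mat_mult_regroup2[OF swap_mat_carrier swap_mat_carrier Suc.prems
              swap_mat_carrier swap_mat_carrier])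
        thus ?thesis using Suc.prems ij by (simp add: swap_mat_involution)
      qed
      obtain a b c d where abcd: "a \<in> carrier_mat 1 1" "b \<in> carrier_mat 1 l" "c \<in> carrier_mat k 1"
        "d \<in> carrier_mat k l" and Nabcd: "N = four_block_mat a b c d"
        using four_block_corner[OF N] by blast
      have a0: "a $$ (0,0) \<noteq> 0" using N00 ij(3) abcd unfolding Nabcd by simp
      obtain C B d' where CBd: "C \<in> carrier_mat k 1" "B \<in> carrier_mat 1 l" "d' \<in> carrier_mat k l"
        and Neq: "N = four_block_mat a (0\<^sub>m 1 k) C (1\<^sub>m k) *
       four_block_mat (1\<^sub>m 1) (0\<^sub>m 1 l) (0\<^sub>m k 1) d' * four_block_mat (1\<^sub>m 1) B (0\<^sub>m l 1) (1\<^sub>m l)"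
        using pivot_block[OF abcd(1) a0 abcd(2-4)] Nabcd by metis
      obtain P Q r where PQ: "P \<in> carrier_mat k k" "Q \<in> carrier_mat l l" "det P \<noteq> 0" "det Q \<noteq> 0"
        "r \<le> k" "r \<le> l" "d' = P * rank_mat k l r * Q" using Suc.IH[OF CBd(3)] by blast
      let ?L = "four_block_mat a (0\<^sub>m 1 k) C (1\<^sub>m k)" and ?R = "four_block_mat (1\<^sub>m 1) B (0\<^sub>m l 1) (1\<^sub>m l)"
      let ?L' = "four_block_mat (1\<^sub>m 1) (0\<^sub>m 1 k) (0\<^sub>m k 1) P" and ?R' = "four_block_mat (1\<^sub>m 1) (0\<^sub>m 1 l) (0\<^sub>m l 1) Q"
      have d'eq: "four_block_mat (1\<^sub>m 1) (0\<^sub>m 1 l) (0\<^sub>m k 1) d' = ?L' * rank_mat (Suc k) (Suc l) (Suc r) * ?R'"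
      proof -
        have PE: "P * rank_mat k l r \<in> carrier_mat k l"
          by (rule mult_carrier_mat[OF PQ(1) rank_mat_carrier])
        have "?L' * rank_mat (Suc k) (Suc l) (Suc r) = four_block_mat (1\<^sub>m 1) (0\<^sub>m 1 l) (0\<^sub>m k 1) (P * rank_mat k l r)"
          unfolding rank_mat_Suc by (subst mult_four_block_mat[of _ 1 1 _ k _ k]) (use PQ in \<open>auto simp: left_mult_zero_mat[OF rank_mat_carrier]\<close>)
        also have "\<dots> * ?R' = four_block_mat (1\<^sub>m 1) (0\<^sub>m 1 l) (0\<^sub>m k 1) d'"
          by (subst mult_four_block_mat[of _ 1 1 _ l _ k])
             (use PQ PE in \<open>auto simp: left_add_zero_mat[of _ k l] right_mult_zero_mat[OF PE]\<close>)
        finally show ?thesis by simp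
      qed
      have cL: "?S \<in> carrier_mat (Suc k) (Suc k)" "?L \<in> carrier_mat (Suc k) (Suc k)" "?L' \<in> carrier_mat (Suc k) (Suc k)"
        using four_block_carrier_mat[OF abcd(1), of "1\<^sub>m k" k k] four_block_carrier_mat[OF _ PQ(1), of "1\<^sub>m 1" 1 1] by auto
      have cR: "?S' \<in> carrier_mat nc nc" "?R \<in> carrier_mat nc nc" "?R' \<in> carrier_mat nc nc"
        using four_block_carrier_mat[of "1\<^sub>m 1" 1 1 "1\<^sub>m l" l l] four_block_carrier_mat[OF _ PQ(2), of "1\<^sub>m 1" 1 1] nc by auto
      have E: "rank_mat (Suc k) (Suc l) (Suc r) \<in> carrier_mat (Suc k) nc" using nc by simp
      have "M = (?S * ?L * ?L') * rank_mat (Suc k) nc (Suc r) * (?R' * ?R * ?S')"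
      proof -
        have "M = ?S * (?L * (?L' * rank_mat (Suc k) (Suc l) (Suc r) * ?R') * ?R) * ?S'"
          unfolding M_eq Neq d'eq ..
        thus ?thesis using mat_mult_regroup[OF cL E cR(3,2,1)] nc by simp
      qed
      moreover have "det ?L \<noteq> 0"
        using abcd CBd a0 by (subst det_four_block_mat_upper_right_zero) (auto simp: det_single)
      moreover have "det ?L' \<noteq> 0"
        using PQ by (subst det_four_block_mat_upper_right_zero) auto
      moreover have "det ?R \<noteq> 0"
        using CBd by (subst det_four_block_mat_lower_left_zero) auto
      moreover have "det ?R' \<noteq> 0"
        using PQ by (subst det_four_block_mat_lower_left_zero) auto
      moreover have "det ?S \<noteq> 0" "det ?S' \<noteq> 0" using det_swap_mat ij(1,2) by blast+
      ultimately have "?S * ?L * ?L' \<in> carrier_mat (Suc k) (Suc k) \<and> ?R' * ?R * ?S' \<in> carrier_mat nc nc \<and>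
         det (?S * ?L * ?L') \<noteq> 0 \<and> det (?R' * ?R * ?S') \<noteq> 0 \<and> Suc r \<le> Suc k \<and> Suc r \<le> nc \<and>
         M = (?S * ?L * ?L') * rank_mat (Suc k) nc (Suc r) * (?R' * ?R * ?S')"
        using det_mult3_nonzero[OF cL] det_mult3_nonzero[OF cR(3,2,1)] PQ nc by simp
      thus ?thesis by blast
    qed
  qed
  thus ?thesis using that by blast
qed

section \<open>Similarity of matrices of finite order\<close>

lemma pow_mat_plus:
  assumes "A \<in> carrier_mat n n"
  shows "A ^\<^sub>m (i + j) = A ^\<^sub>m i * (A ^\<^sub>m j :: 'a::semiring_1 mat)"
proof (induction j)
  case 0
  show ?case using assms by (simp add: right_mult_one_mat[of _ n n])
next
  case (Suc j)
  thus ?case using assms by (simp add: assoc_mult_mat[of _ n n _ n _ n])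
qed

lemma pow_mat_times:
  assumes "A \<in> carrier_mat n n"
  shows "A ^\<^sub>m (i * j) = (A ^\<^sub>m i :: 'a::semiring_1 mat) ^\<^sub>m j"
proof (induction j)
  case 0
  show ?case using assms by simp
next
  case (Suc j)
  have "A ^\<^sub>m (i * Suc j) = A ^\<^sub>m (i * j + i)" by (simp add: algebra_simps)
  thus ?case using Suc by (simp add: pow_mat_plus[OF assms])
qed

lemma one_pow_mat [simp]: "(1\<^sub>m n) ^\<^sub>m k = (1\<^sub>m n :: 'a::semiring_1 mat)"
  by (induction k) auto

lemma pow_mat_mod:
  assumes "A \<in> carrier_mat n n" "A ^\<^sub>m m = (1\<^sub>m n :: 'a::semiring_1 mat)"
  shows "A ^\<^sub>m (i mod m) = A ^\<^sub>m i"
proof -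
  have "A ^\<^sub>m i = A ^\<^sub>m (m * (i div m) + i mod m)" by simp
  also have "\<dots> = A ^\<^sub>m (i mod m)"
    using assms by (simp only: pow_mat_plus[OF assms(1)] pow_mat_times[OF assms(1)] one_pow_mat)
      (simp add: left_mult_one_mat[of _ n n])
  finally show ?thesis by simp
qed

lemma pow_mat_cong:
  assumes "A \<in> carrier_mat n n" "A ^\<^sub>m m = (1\<^sub>m n :: 'a::semiring_1 mat)" "i mod m = j mod m"
  shows "A ^\<^sub>m i = A ^\<^sub>m j"
  using pow_mat_mod[OF assms(1,2)] assms(3) by metis

lemma similar_mat_pow:
  assumes "similar_mat A (B :: 'a::comm_ring_1 mat)"
  shows "similar_mat (A ^\<^sub>m k) (B ^\<^sub>m k)"
  using assms unfolding similar_mat_def by (blast intro: similar_mat_wit_pow)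

lemma tr_pow_similar: "similar_mat A (B :: 'a::comm_ring_1 mat) \<Longrightarrow> tr (A ^\<^sub>m k) = tr (B ^\<^sub>m k)"
  by (intro tr_similar similar_mat_pow)

section \<open>Averaging over a finite cyclic group\<close>

definition msum :: "nat \<Rightarrow> nat \<Rightarrow> (nat \<Rightarrow> 'a::comm_monoid_add mat) \<Rightarrow> 'a mat" where
  "msum n m f = mat n n (\<lambda>(a,b). \<Sum>j<m. f j $$ (a,b))"

lemma msum_carrier [simp]: "msum n m f \<in> carrier_mat n n"
  by (simp add: msum_def)

lemma msum_mult_left:
  assumes "D \<in> carrier_mat n n" "\<And>j. f j \<in> carrier_mat n n"
  shows "D * msum n m f = msum n m (\<lambda>j. D * f j :: 'a::semiring_0 mat)"
proof (rule eq_matI)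
  fix a b assume "a < dim_row (msum n m (\<lambda>j. D * f j))" "b < dim_col (msum n m (\<lambda>j. D * f j))"
  hence ab: "a < n" "b < n" by (auto simp: msum_def)
  have "(D * msum n m f) $$ (a,b) = (\<Sum>i<n. \<Sum>j<m. D $$ (a,i) * f j $$ (i,b))"
    using ab assms by (simp add: msum_def scalar_prod_def atLeast0LessThan sum_distrib_left)
  also have "\<dots> = (\<Sum>j<m. (D * f j) $$ (a,b))"
    using ab assms by (subst sum.swap)
      (auto intro!: sum.cong simp: scalar_prod_def atLeast0LessThan carrier_matD[OF assms(2)])
  finally show "(D * msum n m f) $$ (a,b) = msum n m (\<lambda>j. D * f j) $$ (a,b)"
    using ab by (simp add: msum_def)
qed (use assms in \<open>auto simp: msum_def\<close>)

lemma msum_mult_right: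
  assumes "D \<in> carrier_mat n n" "\<And>j. f j \<in> carrier_mat n n"
  shows "msum n m f * D = msum n m (\<lambda>j. f j * D :: 'a::semiring_0 mat)"
proof (rule eq_matI)
  fix a b assume "a < dim_row (msum n m (\<lambda>j. f j * D))" "b < dim_col (msum n m (\<lambda>j. f j * D))"
  hence ab: "a < n" "b < n" by (auto simp: msum_def)
  have "(msum n m f * D) $$ (a,b) = (\<Sum>i<n. \<Sum>j<m. f j $$ (a,i) * D $$ (i,b))"
    using ab assms by (simp add: msum_def scalar_prod_def atLeast0LessThan sum_distrib_right)
  also have "\<dots> = (\<Sum>j<m. (f j * D) $$ (a,b))"
    using ab assms by (subst sum.swap)
      (auto intro!: sum.cong simp: scalar_prod_def atLeast0LessThan carrier_matD[OF assms(2)])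
  finally show "(msum n m f * D) $$ (a,b) = msum n m (\<lambda>j. f j * D) $$ (a,b)"
    using ab by (simp add: msum_def)
qed (use assms in \<open>auto simp: msum_def\<close>)

text \<open>For \<open>A\<close> and \<open>C\<close> of order dividing \<open>m\<close> this is the
  unnormalized average of \<open>C^(-j) W A^j\<close> over the cyclic group of order
  \<open>m\<close>; the exponent \<open>(m - 1) * j\<close> stands for \<open>-j\<close> and keeps
  all exponents natural.\<close>

definition intertwiner :: "nat \<Rightarrow> nat \<Rightarrow> 'a::semiring_1 mat \<Rightarrow> 'a mat \<Rightarrow> 'a mat \<Rightarrow> 'a mat" where
  "intertwiner n m C W A = msum n m (\<lambda>j. C ^\<^sub>m ((m - 1) * j) * W * A ^\<^sub>m j)"

lemma intertwiner_carrier [simp]: "intertwiner n m C W A \<in> carrier_mat n n"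
  by (simp add: intertwiner_def)

text \<open>Multiplication by \<open>A\<close> on the right and by \<open>C\<close> on the left
  shift the summation index against each other by one: with \<open>g j\<close> denoting
  \<open>C\<close> times the summand of index \<open>j\<close>, that summand times \<open>A\<close>
  is \<open>g (Suc j)\<close>. Since \<open>g m = g 0\<close>, the two sums agree.\<close>

lemma intertwiner:
  fixes A C W :: "'a::ring_1 mat"
  assumes A: "A \<in> carrier_mat n n" and C: "C \<in> carrier_mat n n" and W: "W \<in> carrier_mat n n"
    and m: "m > 0" "A ^\<^sub>m m = 1\<^sub>m n" "C ^\<^sub>m m = 1\<^sub>m n"
  shows "intertwiner n m C W A * A = C * intertwiner n m C W A"
proof -
  define g where "g j = C * (C ^\<^sub>m ((m - 1) * j) * W * A ^\<^sub>m j)" for j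
  have C1: "C * C ^\<^sub>m i = C ^\<^sub>m Suc i" for i
    using pow_mat_plus[OF C, of 1 i] C by (simp add: left_mult_one_mat[of C n n])
  have g: "g j = C ^\<^sub>m Suc ((m - 1) * j) * (W * A ^\<^sub>m j)" for j
    unfolding g_def C1[symmetric] using A C W by (simp add: assoc_mult_mat[of _ n n _ n _ n])
  have "Suc ((m - 1) * Suc j) mod m = (m - 1) * j mod m" for j
  proof -
    have "Suc ((m - 1) * Suc j) = (m - 1) * j + m" using m(1) by simp
    thus ?thesis by simp
  qed
  hence "g (Suc j) = C ^\<^sub>m ((m - 1) * j) * (W * A ^\<^sub>m Suc j)" for j
    unfolding g by (simp only: pow_mat_cong[OF C m(3), of "Suc ((m - 1) * Suc j)" "(m - 1) * j"])
  hence gS: "C ^\<^sub>m ((m - 1) * j) * W * A ^\<^sub>m j * A = g (Suc j)" for j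
    using A C W by (simp add: assoc_mult_mat[of _ n n _ n _ n])
  have "Suc ((m - 1) * m) mod m = Suc ((m - 1) * 0) mod m"
    using mod_mult_self2[of 1 m "m - 1"] by (simp add: mult.commute)
  hence "g m = g 0"
    unfolding g using pow_mat_cong[OF C m(3), of "Suc ((m - 1) * m)" "Suc ((m - 1) * 0)"] m(2) A by simp
  hence "(\<Sum>j<m. g (Suc j) $$ (a,b)) = (\<Sum>j<m. g j $$ (a,b))" for a b
    using sum.lessThan_Suc_shift[of "\<lambda>j. g j $$ (a,b)" m] by (simp add: add.commute)
  hence "msum n m (\<lambda>j. g (Suc j)) = msum n m g" by (simp add: msum_def)
  moreover have f: "C ^\<^sub>m ((m - 1) * j) * W * A ^\<^sub>m j \<in> carrier_mat n n" for j
    using A C W by (meson mult_carrier_mat pow_carrier_mat)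
  have "intertwiner n m C W A * A = msum n m (\<lambda>j. g (Suc j))"
    unfolding intertwiner_def msum_mult_right[OF A f] gS ..
  moreover have "C * intertwiner n m C W A = msum n m g"
    unfolding intertwiner_def msum_mult_left[OF C f] g_def ..
  ultimately show ?thesis by simp
qed

text \<open>The averaging operator on matrices has trace equal to the sum of the products of
  \<open>tr (C^(-j))\<close> and \<open>tr (A^j)\<close>, up to normalization an inner product of
  characters. The hypothesis pairs \<open>j\<close> with \<open>-j\<close>, so this is a sum of
  squares, with \<open>n^2\<close> at \<open>j = 0\<close>; an operator of positive trace is not
  zero.\<close>

lemma intertwiner_nonzero:
  fixes A C :: "rat mat"
  assumes A: "A \<in> carrier_mat n n" and C: "C \<in> carrier_mat n n"
    and m: "m > 0" and n: "n > 0" and tr: "\<And>j. tr (A ^\<^sub>m j) = tr (C ^\<^sub>m ((m - 1) * j))"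
  shows "\<exists>W \<in> carrier_mat n n. intertwiner n m C W A \<noteq> 0\<^sub>m n n"
proof (rule ccontr)
  assume contr: "\<not> ?thesis"
  \<comment> \<open>Matrix units: the \<open>(a, b)\<close> entry of the averaged
    \<open>E a b\<close>, summed over all \<open>a\<close> and \<open>b\<close>, is the trace of the
    averaging operator.\<close>
  define E where "E a b = (mat n n (\<lambda>(i,k). if i = a \<and> k = b then 1 else 0) :: rat mat)" for a b
  have E: "E a b \<in> carrier_mat n n" for a b by (simp add: E_def)
  have PEQ: "(P * E a b * Q) $$ (a, b) = P $$ (a,a) * Q $$ (b,b)"
    if "P \<in> carrier_mat n n" "Q \<in> carrier_mat n n" "a < n" "b < n" for P Q a b
  proof -
    have "(P * E a b) $$ (a, k) = (if k = b then P $$ (a,a) else 0)" if "k < n" for k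
    proof -
      have "(P * E a b) $$ (a, k) = (\<Sum>i<n. if i = a then (if k = b then P $$ (a,i) else 0) else 0)"
        using that \<open>a < n\<close> \<open>P \<in> _\<close>
        by (auto simp: E_def scalar_prod_def atLeast0LessThan if_distrib[of "(*) _"] cong: if_cong)
      thus ?thesis using \<open>a < n\<close> by simp
    qed
    hence "(P * E a b * Q) $$ (a, b) = (\<Sum>k<n. if k = b then P $$ (a,a) * Q $$ (k,b) else 0)"
      using that E[of a b]
      by (subst index_mult_mat) (auto simp: scalar_prod_def atLeast0LessThan if_distrib[of "\<lambda>x. x * _"] cong: if_cong)
    thus ?thesis using that by simp
  qed
  have "(\<Sum>a<n. \<Sum>b<n. intertwiner n m C (E a b) A $$ (a,b)) =
        (\<Sum>a<n. \<Sum>b<n. \<Sum>j<m. (C ^\<^sub>m ((m - 1) * j)) $$ (a,a) * (A ^\<^sub>m j) $$ (b,b))"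
    by (intro sum.cong refl) (auto simp: intertwiner_def msum_def PEQ A C)
  also have "\<dots> = (\<Sum>j<m. \<Sum>a<n. \<Sum>b<n. (C ^\<^sub>m ((m - 1) * j)) $$ (a,a) * (A ^\<^sub>m j) $$ (b,b))"
    by (simp only: sum.swap[where A = "{..<n}" and B = "{..<m}"])
  also have "\<dots> = (\<Sum>j<m. tr (C ^\<^sub>m ((m - 1) * j)) * tr (A ^\<^sub>m j))"
    using A C by (simp add: tr_def sum_product)
  also have "\<dots> = (\<Sum>j<m. tr (A ^\<^sub>m j) * tr (A ^\<^sub>m j))" by (simp add: tr)
  also have "\<dots> > 0"
  proof (rule sum_pos2[of _ 0])
    show "tr (A ^\<^sub>m 0) * tr (A ^\<^sub>m 0) > 0" using A n by simp
  qed (use m in auto)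
  finally have "(\<Sum>a<n. \<Sum>b<n. intertwiner n m C (E a b) A $$ (a,b)) > 0" .
  moreover have "(\<Sum>a<n. \<Sum>b<n. intertwiner n m C (E a b) A $$ (a,b)) = 0"
    using contr E by (intro sum.neutral ballI) auto
  ultimately show False by simp
qed

lemma four_block_mat_inject:
  assumes "A \<in> carrier_mat nr1 nc1" "B \<in> carrier_mat nr1 nc2" "C \<in> carrier_mat nr2 nc1" "D \<in> carrier_mat nr2 nc2"
    "A' \<in> carrier_mat nr1 nc1" "B' \<in> carrier_mat nr1 nc2" "C' \<in> carrier_mat nr2 nc1" "D' \<in> carrier_mat nr2 nc2"
    and eq: "four_block_mat A B C D = four_block_mat A' B' C' D'"
  shows "A = A'" "B = B'" "C = C'" "D = D'"
proof -
  have e: "four_block_mat A B C D $$ (i,j) = four_block_mat A' B' C' D' $$ (i,j)" for i j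
    using eq by simp
  show "A = A'"
  proof (rule eq_matI)
    fix i j assume "i < dim_row A'" "j < dim_col A'"
    thus "A $$ (i,j) = A' $$ (i,j)" using e[of i j] assms(1-8) by auto
  qed (use assms in auto)
  show "B = B'"
  proof (rule eq_matI)
    fix i j assume "i < dim_row B'" "j < dim_col B'"
    thus "B $$ (i,j) = B' $$ (i,j)" using e[of i "nc1 + j"] assms(1-8) by auto
  qed (use assms in auto)
  show "C = C'"
  proof (rule eq_matI)
    fix i j assume "i < dim_row C'" "j < dim_col C'"
    thus "C $$ (i,j) = C' $$ (i,j)" using e[of "nr1 + i" j] assms(1-8) by auto
  qed (use assms in auto)
  show "D = D'"
  proof (rule eq_matI)
    fix i j assume "i < dim_row D'" "j < dim_col D'"
    thus "D $$ (i,j) = D' $$ (i,j)" using e[of "nr1 + i" "nc1 + j"] assms(1-8) by auto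
  qed (use assms in auto)
qed

lemma four_block_split:
  assumes "N \<in> carrier_mat (nr1 + nr2) (nc1 + nc2)"
  obtains a b c d where "a \<in> carrier_mat nr1 nc1" "b \<in> carrier_mat nr1 nc2" "c \<in> carrier_mat nr2 nc1"
    "d \<in> carrier_mat nr2 nc2" "N = four_block_mat a b c d"
proof -
  obtain a b c d where s: "split_block N nr1 nc1 = (a,b,c,d)" by (metis prod_cases4)
  from split_block[OF s, of nr2 nc2] assms show ?thesis by (intro that[of a b c d]) auto
qed

lemma pow_lower_block:
  fixes a c d :: "'a::semiring_1 mat"
  assumes "a \<in> carrier_mat r r" "c \<in> carrier_mat s r" "d \<in> carrier_mat s s"
  shows "\<exists>z \<in> carrier_mat s r. four_block_mat a (0\<^sub>m r s) c d ^\<^sub>m k = four_block_mat (a ^\<^sub>m k) (0\<^sub>m r s) z (d ^\<^sub>m k)"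
proof (induction k)
  case 0
  show ?case using assms by (intro bexI[of _ "0\<^sub>m s r"]) auto
next
  case (Suc k)
  then obtain z where z: "z \<in> carrier_mat s r"
    "four_block_mat a (0\<^sub>m r s) c d ^\<^sub>m k = four_block_mat (a ^\<^sub>m k) (0\<^sub>m r s) z (d ^\<^sub>m k)" by blast
  have "four_block_mat a (0\<^sub>m r s) c d ^\<^sub>m Suc k =
      four_block_mat (a ^\<^sub>m k * a) (0\<^sub>m r s) (z * a + d ^\<^sub>m k * c) (d ^\<^sub>m k * d)"
    unfolding pow_mat.simps z(2)
    by (subst mult_four_block_mat[of _ r r _ s _ s]) (use assms z in auto)
  moreover have "z * a + d ^\<^sub>m k * c \<in> carrier_mat s r" using assms z by auto
  ultimately show ?case by auto
qed

lemma pow_upper_block: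
  fixes a b d :: "'a::semiring_1 mat"
  assumes "a \<in> carrier_mat r r" "b \<in> carrier_mat r s" "d \<in> carrier_mat s s"
  shows "\<exists>z \<in> carrier_mat r s. four_block_mat a b (0\<^sub>m s r) d ^\<^sub>m k = four_block_mat (a ^\<^sub>m k) z (0\<^sub>m s r) (d ^\<^sub>m k)"
proof (induction k)
  case 0
  show ?case using assms by (intro bexI[of _ "0\<^sub>m r s"]) auto
next
  case (Suc k)
  then obtain z where z: "z \<in> carrier_mat r s"
    "four_block_mat a b (0\<^sub>m s r) d ^\<^sub>m k = four_block_mat (a ^\<^sub>m k) z (0\<^sub>m s r) (d ^\<^sub>m k)" by blast
  have "four_block_mat a b (0\<^sub>m s r) d ^\<^sub>m Suc k =
      four_block_mat (a ^\<^sub>m k * a) (a ^\<^sub>m k * b + z * d) (0\<^sub>m s r) (d ^\<^sub>m k * d)"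
    unfolding pow_mat.simps z(2)
    by (subst mult_four_block_mat[of _ r r _ s _ s]) (use assms z in auto)
  moreover have "a ^\<^sub>m k * b + z * d \<in> carrier_mat r s" using assms z by auto
  ultimately show ?case by auto
qed


lemma rank_mat_square:
  "rank_mat (r + s) (r + s) r = four_block_mat (1\<^sub>m r) (0\<^sub>m r s) (0\<^sub>m s r) (0\<^sub>m s s :: 'a::field mat)"
  by (rule eq_matI) (auto simp: rank_mat_def)

lemma rank_mat_full: "rank_mat n n n = (1\<^sub>m n :: 'a::field mat)"
  by (rule eq_matI) (auto simp: rank_mat_def)

text \<open>This is the shape of an average of block unitriangular matrices: the diagonal blocks add
  up to a scalar, while the remaining block is arbitrary.\<close>

lemma det_scaled_unipotent_lower:
  assumes "W \<in> carrier_mat (r + s) (r + s)" "c \<noteq> (0::'a::field)"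
    and "\<And>i j. i < r + s \<Longrightarrow> j < r + s \<Longrightarrow> (i < r \<longleftrightarrow> j < r) \<Longrightarrow> W $$ (i,j) = (if i = j then c else 0)"
    and "\<And>i j. i < r \<Longrightarrow> r \<le> j \<Longrightarrow> j < r + s \<Longrightarrow> W $$ (i,j) = 0"
  shows "det W \<noteq> 0"
proof -
  obtain x y z u where b: "x \<in> carrier_mat r r" "y \<in> carrier_mat r s" "z \<in> carrier_mat s r" "u \<in> carrier_mat s s"
    "W = four_block_mat x y z u" using four_block_split[OF assms(1)] by blast
  have "x = c \<cdot>\<^sub>m 1\<^sub>m r"
  proof (rule eq_matI)
    fix i j assume "i < dim_row (c \<cdot>\<^sub>m 1\<^sub>m r)" "j < dim_col (c \<cdot>\<^sub>m 1\<^sub>m r)"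
    thus "x $$ (i,j) = (c \<cdot>\<^sub>m 1\<^sub>m r) $$ (i,j)" using assms(3)[of i j] b by auto
  qed (use b in auto)
  moreover have "u = c \<cdot>\<^sub>m 1\<^sub>m s"
  proof (rule eq_matI)
    fix i j assume "i < dim_row (c \<cdot>\<^sub>m 1\<^sub>m s)" "j < dim_col (c \<cdot>\<^sub>m 1\<^sub>m s)"
    thus "u $$ (i,j) = (c \<cdot>\<^sub>m 1\<^sub>m s) $$ (i,j)" using assms(3)[of "r + i" "r + j"] b by auto
  qed (use b in auto)
  moreover have "y = 0\<^sub>m r s"
  proof (rule eq_matI)
    fix i j assume "i < dim_row (0\<^sub>m r s)" "j < dim_col (0\<^sub>m r s)"
    thus "y $$ (i,j) = 0\<^sub>m r s $$ (i,j)" using assms(4)[of i "r + j"] b by auto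
  qed (use b in auto)
  ultimately show ?thesis
    unfolding b(5) using b assms(2) by (subst det_four_block_mat_upper_right_zero[of _ r _ s]) (auto simp: det_smult)
qed

lemma det_scaled_unipotent_upper:
  assumes "W \<in> carrier_mat (r + s) (r + s)" "c \<noteq> (0::'a::field)"
    and "\<And>i j. i < r + s \<Longrightarrow> j < r + s \<Longrightarrow> (i < r \<longleftrightarrow> j < r) \<Longrightarrow> W $$ (i,j) = (if i = j then c else 0)"
    and "\<And>i j. j < r \<Longrightarrow> r \<le> i \<Longrightarrow> i < r + s \<Longrightarrow> W $$ (i,j) = 0"
  shows "det W \<noteq> 0"
proof -
  have "det (transpose_mat W) \<noteq> 0"
    using assms by (intro det_scaled_unipotent_lower[of _ r s c]) auto
  thus ?thesis using det_transpose[OF assms(1)] by simp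
qed

lemma four_block_pow_one:
  fixes a d :: "'a::semiring_1 mat"
  assumes "a \<in> carrier_mat r r" "d \<in> carrier_mat s s" "b \<in> carrier_mat r s" "c \<in> carrier_mat s r"
    and "four_block_mat a b c d = 1\<^sub>m (r + s)"
  shows "a = 1\<^sub>m r" "d = 1\<^sub>m s"
  using four_block_mat_inject[of a r r b s c s d "1\<^sub>m r" "0\<^sub>m r s" "0\<^sub>m s r" "1\<^sub>m s"] assms
  by simp_all

lemma pow_lower_block_one:
  fixes a c d :: "'a::semiring_1 mat"
  assumes "a \<in> carrier_mat r r" "c \<in> carrier_mat s r" "d \<in> carrier_mat s s"
    and "four_block_mat a (0\<^sub>m r s) c d ^\<^sub>m k = 1\<^sub>m (r + s)"
  shows "a ^\<^sub>m k = 1\<^sub>m r" "d ^\<^sub>m k = 1\<^sub>m s"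
proof -
  obtain z where z: "z \<in> carrier_mat s r"
    "four_block_mat a (0\<^sub>m r s) c d ^\<^sub>m k = four_block_mat (a ^\<^sub>m k) (0\<^sub>m r s) z (d ^\<^sub>m k)"
    using pow_lower_block[OF assms(1-3)] by blast
  show "a ^\<^sub>m k = 1\<^sub>m r" "d ^\<^sub>m k = 1\<^sub>m s"
    using four_block_pow_one[OF pow_carrier_mat[OF assms(1)] pow_carrier_mat[OF assms(3)]
        zero_carrier_mat z(1)] z(2) assms(4) by metis+
qed

lemma pow_upper_block_one:
  fixes a b d :: "'a::semiring_1 mat"
  assumes "a \<in> carrier_mat r r" "b \<in> carrier_mat r s" "d \<in> carrier_mat s s"
    and "four_block_mat a b (0\<^sub>m s r) d ^\<^sub>m k = 1\<^sub>m (r + s)"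
  shows "a ^\<^sub>m k = 1\<^sub>m r" "d ^\<^sub>m k = 1\<^sub>m s"
proof -
  obtain z where z: "z \<in> carrier_mat r s"
    "four_block_mat a b (0\<^sub>m s r) d ^\<^sub>m k = four_block_mat (a ^\<^sub>m k) z (0\<^sub>m s r) (d ^\<^sub>m k)"
    using pow_upper_block[OF assms(1-3)] by blast
  show "a ^\<^sub>m k = 1\<^sub>m r" "d ^\<^sub>m k = 1\<^sub>m s"
    using four_block_pow_one[OF pow_carrier_mat[OF assms(1)] pow_carrier_mat[OF assms(3)]
        z(1) zero_carrier_mat] z(2) assms(4) by metis+
qed

lemma pow_inverse_cancel:
  assumes "A \<in> carrier_mat n n" "A ^\<^sub>m m = (1\<^sub>m n :: 'a::semiring_1 mat)" "m > 0"
  shows "A ^\<^sub>m ((m - 1) * j) * A ^\<^sub>m j = 1\<^sub>m n"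
proof -
  have "(m - 1) * j + j = m * j" using assms(3) by (cases m) auto
  thus ?thesis
    using pow_mat_plus[OF assms(1), of "(m - 1) * j" j] pow_mat_times[OF assms(1), of m j] assms(2) by simp
qed

text \<open>Maschke's theorem in matrix form: the identity is averaged into an intertwiner between
  the triangular and the diagonal matrix. Every summand has identity diagonal blocks, so the result
  is \<open>m\<close> times a unipotent matrix and hence invertible.\<close>

lemma similar_block_diag_lower:
  fixes a c d :: "rat mat"
  assumes a: "a \<in> carrier_mat r r" and c: "c \<in> carrier_mat s r" and d: "d \<in> carrier_mat s s"
    and m: "m > 0" "four_block_mat a (0\<^sub>m r s) c d ^\<^sub>m m = 1\<^sub>m (r + s)"
  shows "similar_mat (four_block_mat a (0\<^sub>m r s) c d) (four_block_mat a (0\<^sub>m r s) (0\<^sub>m s r) d)"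
proof -
  let ?A = "four_block_mat a (0\<^sub>m r s) c d" and ?D = "four_block_mat a (0\<^sub>m r s) (0\<^sub>m s r) d"
  have A: "?A \<in> carrier_mat (r + s) (r + s)" and D: "?D \<in> carrier_mat (r + s) (r + s)" using a d by auto
  have am: "a ^\<^sub>m m = 1\<^sub>m r" and dm: "d ^\<^sub>m m = 1\<^sub>m s"
    by (rule pow_lower_block_one[OF a c d m(2)])+
  have Dm: "?D ^\<^sub>m m = 1\<^sub>m (r + s)"
    using pow_four_block_mat[OF a d, of m] am dm by simp
  let ?f = "\<lambda>j. ?D ^\<^sub>m ((m - 1) * j) * 1\<^sub>m (r + s) * ?A ^\<^sub>m j"
  have f: "\<exists>z \<in> carrier_mat s r. ?f j = four_block_mat (1\<^sub>m r) (0\<^sub>m r s) z (1\<^sub>m s)" for j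
  proof -
    obtain z where z: "z \<in> carrier_mat s r" "?A ^\<^sub>m j = four_block_mat (a ^\<^sub>m j) (0\<^sub>m r s) z (d ^\<^sub>m j)"
      using pow_lower_block[OF a c d] by blast
    have "?f j = ?D ^\<^sub>m ((m - 1) * j) * ?A ^\<^sub>m j"
      using D by (simp add: right_mult_one_mat[of _ "r + s" "r + s"])
    also have "\<dots> = four_block_mat (1\<^sub>m r) (0\<^sub>m r s) (d ^\<^sub>m ((m - 1) * j) * z) (1\<^sub>m s)"
      unfolding z(2) pow_four_block_mat[OF a d]
      using z(1) pow_inverse_cancel[OF a am m(1), of j] pow_inverse_cancel[OF d dm m(1), of j] a d
      by (subst mult_four_block_mat[of _ r r _ s _ s]) (auto simp: left_add_zero_mat[of _ s r])
    finally show ?thesis using z(1) d by (metis mult_carrier_mat pow_carrier_mat)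
  qed
  show ?thesis
  proof (rule similar_matI_det[OF A D intertwiner_carrier _ intertwiner[OF A D one_carrier_mat m Dm]])
    show "det (intertwiner (r + s) m ?D (1\<^sub>m (r + s)) ?A) \<noteq> 0"
    proof (rule det_scaled_unipotent_lower[of _ r s "of_nat m"])
      fix i j assume ij: "i < r + s" "j < r + s" "i < r \<longleftrightarrow> j < r"
      have "?f k $$ (i,j) = (if i = j then 1 else 0)" for k using f[of k] ij by auto
      thus "intertwiner (r + s) m ?D (1\<^sub>m (r + s)) ?A $$ (i,j) = (if i = j then of_nat m else 0)"
        using ij unfolding intertwiner_def msum_def by simp
    next
      fix i j assume ij: "i < r" "r \<le> j" "j < r + s"
      have "?f k $$ (i,j) = 0" for k using f[of k] ij by auto
      thus "intertwiner (r + s) m ?D (1\<^sub>m (r + s)) ?A $$ (i,j) = 0"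
        using ij unfolding intertwiner_def msum_def by simp
    qed (use m in auto)
  qed
qed

lemma similar_block_diag_upper:
  fixes a b d :: "rat mat"
  assumes a: "a \<in> carrier_mat r r" and b: "b \<in> carrier_mat r s" and d: "d \<in> carrier_mat s s"
    and m: "m > 0" "four_block_mat a b (0\<^sub>m s r) d ^\<^sub>m m = 1\<^sub>m (r + s)"
  shows "similar_mat (four_block_mat a b (0\<^sub>m s r) d) (four_block_mat a (0\<^sub>m r s) (0\<^sub>m s r) d)"
proof -
  let ?A = "four_block_mat a b (0\<^sub>m s r) d" and ?D = "four_block_mat a (0\<^sub>m r s) (0\<^sub>m s r) d"
  have A: "?A \<in> carrier_mat (r + s) (r + s)" and D: "?D \<in> carrier_mat (r + s) (r + s)" using a d by auto
  have am: "a ^\<^sub>m m = 1\<^sub>m r" and dm: "d ^\<^sub>m m = 1\<^sub>m s"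
    by (rule pow_upper_block_one[OF a b d m(2)])+
  have Dm: "?D ^\<^sub>m m = 1\<^sub>m (r + s)"
    using pow_four_block_mat[OF a d, of m] am dm by simp
  let ?f = "\<lambda>j. ?D ^\<^sub>m ((m - 1) * j) * 1\<^sub>m (r + s) * ?A ^\<^sub>m j"
  have f: "\<exists>z \<in> carrier_mat r s. ?f j = four_block_mat (1\<^sub>m r) z (0\<^sub>m s r) (1\<^sub>m s)" for j
  proof -
    obtain z where z: "z \<in> carrier_mat r s" "?A ^\<^sub>m j = four_block_mat (a ^\<^sub>m j) z (0\<^sub>m s r) (d ^\<^sub>m j)"
      using pow_upper_block[OF a b d] by blast
    have "?f j = ?D ^\<^sub>m ((m - 1) * j) * ?A ^\<^sub>m j"
      using D by (simp add: right_mult_one_mat[of _ "r + s" "r + s"])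
    also have "\<dots> = four_block_mat (1\<^sub>m r) (a ^\<^sub>m ((m - 1) * j) * z) (0\<^sub>m s r) (1\<^sub>m s)"
      unfolding z(2) pow_four_block_mat[OF a d]
      using z(1) pow_inverse_cancel[OF a am m(1), of j] pow_inverse_cancel[OF d dm m(1), of j] a d
      by (subst mult_four_block_mat[of _ r r _ s _ s]) (auto simp: right_add_zero_mat[of _ r s])
    finally show ?thesis using z(1) a by (metis mult_carrier_mat pow_carrier_mat)
  qed
  show ?thesis
  proof (rule similar_matI_det[OF A D intertwiner_carrier _ intertwiner[OF A D one_carrier_mat m Dm]])
    show "det (intertwiner (r + s) m ?D (1\<^sub>m (r + s)) ?A) \<noteq> 0"
    proof (rule det_scaled_unipotent_upper[of _ r s "of_nat m"])
      fix i j assume ij: "i < r + s" "j < r + s" "i < r \<longleftrightarrow> j < r"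
      have "?f k $$ (i,j) = (if i = j then 1 else 0)" for k using f[of k] ij by auto
      thus "intertwiner (r + s) m ?D (1\<^sub>m (r + s)) ?A $$ (i,j) = (if i = j then of_nat m else 0)"
        using ij unfolding intertwiner_def msum_def by simp
    next
      fix i j assume ij: "j < r" "r \<le> i" "i < r + s"
      have "?f k $$ (i,j) = 0" for k using f[of k] ij by auto
      thus "intertwiner (r + s) m ?D (1\<^sub>m (r + s)) ?A $$ (i,j) = 0"
        using ij unfolding intertwiner_def msum_def by simp
    qed (use m in auto)
  qed
qed

text \<open>A nonzero intertwiner of rank \<open>r\<close> exhibits a common constituent
  \<open>a\<close> of size \<open>r\<close>; both matrices split it off by Maschke's theorem, and
  the complements \<open>d\<close> and \<open>d'\<close> are smaller. The powers of \<open>C\<close>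
  are negated in the trace condition because this is the form in which
  \<open>intertwiner_nonzero\<close> turns it into a sum of squares.\<close>

theorem similar_if_traces_eq:
  fixes A C :: "rat mat"
  assumes "A \<in> carrier_mat n n" "C \<in> carrier_mat n n" "m > 0" "A ^\<^sub>m m = 1\<^sub>m n" "C ^\<^sub>m m = 1\<^sub>m n"
    and "\<And>j. tr (A ^\<^sub>m j) = tr (C ^\<^sub>m ((m - 1) * j))"
  shows "similar_mat A C"
  using assms
proof (induction n arbitrary: A C rule: less_induct)
  case (less n)
  note A = less.prems(1) and C = less.prems(2) and m = less.prems(3) and Am = less.prems(4)
    and Cm = less.prems(5) and trAC = less.prems(6)
  show ?case
  proof (cases "n = 0")
    case True
    hence "A = C" using A C by (intro eq_matI) auto
    thus ?thesis using similar_mat_refl[OF A] by simp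
  next
    case False
    then obtain W0 where W0: "W0 \<in> carrier_mat n n" "intertwiner n m C W0 A \<noteq> 0\<^sub>m n n"
      using intertwiner_nonzero[OF A C m _ trAC] by auto
    define W where "W = intertwiner n m C W0 A"
    have W: "W \<in> carrier_mat n n" "W \<noteq> 0\<^sub>m n n" "W * A = C * W"
      using W0 intertwiner[OF A C W0(1) m Am Cm] by (auto simp: W_def)
    obtain P Q r where PQ: "P \<in> carrier_mat n n" "Q \<in> carrier_mat n n" "det P \<noteq> 0" "det Q \<noteq> 0"
      "r \<le> n" "W = P * rank_mat n n r * Q" using rank_normal_form[OF W(1)] by metis
    have "r \<noteq> 0"
    proof
      assume "r = 0"
      hence "rank_mat n n r = (0\<^sub>m n n :: rat mat)" by (intro eq_matI) (auto simp: rank_mat_def)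
      thus False using W(2) PQ by simp
    qed
    show ?thesis
    proof (cases "r = n")
      case True
      hence "det W \<noteq> 0" using PQ by (simp add: rank_mat_full det_mult[of _ n])
      thus ?thesis using similar_matI_det[OF A C W(1) _ W(3)] by simp
    next
      case False
      define s where "s = n - r"
      have n: "n = r + s" "s < n" "r < n" using False PQ(5) \<open>r \<noteq> 0\<close> by (auto simp: s_def)
      obtain P' where P': "P' \<in> carrier_mat n n" "P * P' = 1\<^sub>m n" "P' * P = 1\<^sub>m n"
        using det_nonzeroE[OF PQ(1,3)] by blast
      obtain Q' where Q': "Q' \<in> carrier_mat n n" "Q * Q' = 1\<^sub>m n" "Q' * Q = 1\<^sub>m n"
        using det_nonzeroE[OF PQ(2,4)] by blast
      \<comment> \<open>In bases adapted to \<open>W\<close>, the intertwining relation becomes a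
        relation with the rank matrix alone.\<close>
      define A1 where "A1 = Q * A * Q'"
      define C1 where "C1 = P' * C * P"
      have A1: "A1 \<in> carrier_mat n n" and C1: "C1 \<in> carrier_mat n n"
        using A C P' Q' PQ by (auto simp: A1_def C1_def)
      have simA: "similar_mat A1 A"
        using A A1 Q' PQ by (intro similar_matI[of _ _ Q Q' n]) (auto simp: A1_def)
      have simC: "similar_mat C1 C"
        using C C1 P' PQ by (intro similar_matI[of _ _ P' P n]) (auto simp: C1_def)
      let ?E = "rank_mat n n r :: rat mat"
      have E: "?E \<in> carrier_mat n n" by simp
      have "?E * A1 = (P' * P) * ?E * (Q * A * Q')"
        using A1 P' by (simp add: A1_def[symmetric] left_mult_one_mat[OF E])
      also have "\<dots> = P' * (W * A) * Q'"
        unfolding PQ(6) using A PQ(1,2) P'(1) Q'(1) by (auto simp: mat_mult_assoc)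
      also have "\<dots> = P' * C * P * ?E * (Q * Q')"
        unfolding W(3) unfolding PQ(6) using C PQ(1,2) P'(1) Q'(1) by (auto simp: mat_mult_assoc)
      also have "\<dots> = C1 * ?E" using C1 Q' E by (simp add: C1_def[symmetric] right_mult_one_mat[of _ n n])
      finally have EAC: "?E * A1 = C1 * ?E" .
      obtain a b c d where abcd: "a \<in> carrier_mat r r" "b \<in> carrier_mat r s" "c \<in> carrier_mat s r"
        "d \<in> carrier_mat s s" "A1 = four_block_mat a b c d" using four_block_split A1 n(1) by metis
      obtain a' b' c' d' where abcd': "a' \<in> carrier_mat r r" "b' \<in> carrier_mat r s" "c' \<in> carrier_mat s r"
        "d' \<in> carrier_mat s s" "C1 = four_block_mat a' b' c' d'" using four_block_split C1 n(1) by metis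
      \<comment> \<open>Multiplication by \<open>?E\<close> keeps the first \<open>r\<close> rows on
        the left and the first \<open>r\<close> columns on the right. Equality of the two products
        makes the upper right block of \<open>A1\<close> and the lower left block of
        \<open>C1\<close> vanish and identifies the upper left corners.\<close>
      have "?E * A1 = four_block_mat a b (0\<^sub>m s r) (0\<^sub>m s s)"
        unfolding n(1) rank_mat_square abcd(5)
        by (subst mult_four_block_mat[of _ r r _ s _ s]) (use abcd in \<open>auto simp: left_mult_zero_mat[of _ s]\<close>)
      moreover have "C1 * ?E = four_block_mat a' (0\<^sub>m r s) c' (0\<^sub>m s s)"
        unfolding n(1) rank_mat_square abcd'(5)
        by (subst mult_four_block_mat[of _ r r _ s _ s]) (use abcd' in \<open>auto simp: right_mult_zero_mat[of _ _ s]\<close>)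
      ultimately have "four_block_mat a b (0\<^sub>m s r) (0\<^sub>m s s) = four_block_mat a' (0\<^sub>m r s) c' (0\<^sub>m s s)"
        using EAC by simp
      from four_block_mat_inject[OF abcd(1,2) _ _ abcd'(1) _ abcd'(3) _ this]
      have e: "a' = a" "b = 0\<^sub>m r s" "c' = 0\<^sub>m s r" by auto
      note A1eq = abcd(5)[unfolded e] and C1eq = abcd'(5)[unfolded e]
      have A1m: "A1 ^\<^sub>m m = 1\<^sub>m (r + s)" and C1m: "C1 ^\<^sub>m m = 1\<^sub>m (r + s)"
      proof -
        have one: "similar_mat M (1\<^sub>m n) \<Longrightarrow> M \<in> carrier_mat n n \<Longrightarrow> M = 1\<^sub>m n" for M :: "rat mat"
          unfolding similar_mat_def similar_mat_wit_def Let_def by auto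
        show "A1 ^\<^sub>m m = 1\<^sub>m (r + s)" "C1 ^\<^sub>m m = 1\<^sub>m (r + s)"
          using one[of "A1 ^\<^sub>m m"] one[of "C1 ^\<^sub>m m"] similar_mat_pow[OF simA, of m] similar_mat_pow[OF simC, of m]
            Am Cm A1 C1 n(1) by auto
      qed
      have am: "a ^\<^sub>m m = 1\<^sub>m r" and dm: "d ^\<^sub>m m = 1\<^sub>m s"
        by (rule pow_lower_block_one[OF abcd(1,3,4) A1m[unfolded A1eq]])+
      have d'm: "d' ^\<^sub>m m = 1\<^sub>m s"
        by (rule pow_upper_block_one[OF abcd(1) abcd'(2,4) C1m[unfolded C1eq]])
      have trA: "tr (A ^\<^sub>m j) = tr (a ^\<^sub>m j) + tr (d ^\<^sub>m j)" for j
        using tr_pow_similar[OF simA, of j] pow_lower_block[OF abcd(1,3,4), of j] abcd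
        unfolding A1eq by (auto simp: tr_four_block_mat[of _ r _ s])
      have trC: "tr (C ^\<^sub>m j) = tr (a ^\<^sub>m j) + tr (d' ^\<^sub>m j)" for j
        using tr_pow_similar[OF simC, of j] pow_upper_block[OF abcd(1) abcd'(2,4), of j] abcd abcd'
        unfolding C1eq by (auto simp: tr_four_block_mat[of _ r _ s])
      \<comment> \<open>The induction hypothesis is applied to \<open>a\<close> and its own inverse,
        for which the trace condition holds by periodicity. The outcome
        \<open>tr (a^j) = tr (a^(-j))\<close> is what allows \<open>a\<close> to be cancelled from a
        condition that pairs \<open>j\<close> with \<open>-j\<close>.\<close>
      have "similar_mat a (a ^\<^sub>m (m - 1))"
      proof (rule less.IH[OF n(3) abcd(1) _ m am])
        show "(a ^\<^sub>m (m - 1)) ^\<^sub>m m = 1\<^sub>m r"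
          using pow_mat_times[OF abcd(1), of "m - 1" m] pow_mat_times[OF abcd(1), of m "m - 1"] am
          by (simp add: mult.commute)
        fix j
        have "((m - 1) * ((m - 1) * j)) mod m = j mod m"
        proof (cases "m = 1")
          case False
          hence "(m - 1) * ((m - 1) * j) = m * ((m - 2) * j) + j"
            using m by (auto simp: gr0_conv_Suc algebra_simps numeral_2_eq_2 split: nat_diff_split)
          thus ?thesis by simp
        qed simp
        hence "a ^\<^sub>m j = a ^\<^sub>m ((m - 1) * ((m - 1) * j))"
          by (intro pow_mat_cong[OF abcd(1) am]) simp
        thus "tr (a ^\<^sub>m j) = tr ((a ^\<^sub>m (m - 1)) ^\<^sub>m ((m - 1) * j))"
          by (simp add: pow_mat_times[OF abcd(1)])
      qed (use abcd in auto)
      hence tra: "tr (a ^\<^sub>m j) = tr (a ^\<^sub>m ((m - 1) * j))" for j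
        using tr_pow_similar[of a "a ^\<^sub>m (m - 1)" j] by (simp add: pow_mat_times[OF abcd(1)])
      have dd': "similar_mat d d'"
      proof (rule less.IH[OF n(2) abcd(4) abcd'(4) m dm d'm])
        show "tr (d ^\<^sub>m j) = tr (d' ^\<^sub>m ((m - 1) * j))" for j
          using trAC[of j] trA[of j] trC[of "(m - 1) * j"] tra[of j] by simp
      qed
      have "similar_mat A1 (four_block_mat a (0\<^sub>m r s) (0\<^sub>m s r) d)"
        unfolding A1eq using similar_block_diag_lower[OF abcd(1,3,4) m] A1m A1eq by simp
      moreover have "similar_mat C1 (four_block_mat a (0\<^sub>m r s) (0\<^sub>m s r) d')"
        unfolding C1eq using similar_block_diag_upper[OF abcd(1) abcd'(2,4) m] C1m C1eq by simp
      moreover have "similar_mat (four_block_mat a (0\<^sub>m r s) (0\<^sub>m s r) d) (four_block_mat a (0\<^sub>m r s) (0\<^sub>m s r) d')"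
        by (rule similar_mat_four_block_0_0[OF similar_mat_refl[OF abcd(1)] dd' abcd(1,4)])
      ultimately show ?thesis using simA simC by (meson similar_mat_sym similar_mat_trans)
    qed
  qed
qed


section \<open>Rank factorizations, and recovery of \<open>A\<close> from its restriction to the
  image of \<open>A - 1\<close>\<close>

lemma rank_mat_mult: "rank_mat n r r * rank_mat r m r = (rank_mat n m r :: 'a::field mat)"
proof (rule eq_matI)
  fix i j assume ij: "i < dim_row (rank_mat n m r)" "j < dim_col (rank_mat n m r)"
  have "(rank_mat n r r * rank_mat r m r) $$ (i,j) =
        (\<Sum>k<r. (if i = k \<and> i < r then 1 else 0) * (if k = j \<and> k < r then 1 else (0::'a)))"
    using ij by (simp add: rank_mat_def scalar_prod_def atLeast0LessThan)
  also have "\<dots> = (\<Sum>k<r. if k = i then (if i = j then 1 else (0::'a)) else 0)"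
    by (rule sum.cong) auto
  also have "\<dots> = rank_mat n m r $$ (i,j)" using ij by (simp add: rank_mat_def)
  finally show "(rank_mat n r r * rank_mat r m r) $$ (i,j) = (rank_mat n m r :: 'a mat) $$ (i,j)" .
qed auto

lemma rank_mat_mult':
  assumes "r \<le> n"
  shows "rank_mat r n r * rank_mat n r r = (1\<^sub>m r :: 'a::field mat)"
proof (rule eq_matI)
  fix i j assume ij: "i < dim_row (1\<^sub>m r)" "j < dim_col (1\<^sub>m r)"
  have "(rank_mat r n r * rank_mat n r r) $$ (i,j) =
        (\<Sum>k<n. (if i = k \<and> i < r then 1 else 0) * (if k = j \<and> k < r then 1 else (0::'a)))"
    using ij by (simp add: rank_mat_def scalar_prod_def atLeast0LessThan)
  also have "\<dots> = (\<Sum>k<n. if k = i then (if i = j then 1 else (0::'a)) else 0)"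
    using ij by (intro sum.cong) auto
  also have "\<dots> = 1\<^sub>m r $$ (i,j)" using ij assms by simp
  finally show "(rank_mat r n r * rank_mat n r r) $$ (i,j) = (1\<^sub>m r :: 'a mat) $$ (i,j)" .
qed auto

text \<open>The one-sided inverses \<open>V\<close> and \<open>W\<close> certify that
  \<open>U\<close> is injective and \<open>C\<close> surjective; having them as matrices turns
  cancellation into multiplication.\<close>

lemma rank_factorization:
  fixes N :: "'a::field mat"
  assumes "N \<in> carrier_mat n m"
  obtains r U C V W where "U \<in> carrier_mat n r" "C \<in> carrier_mat r m" "V \<in> carrier_mat r n" "W \<in> carrier_mat m r"
    "N = U * C" "V * U = 1\<^sub>m r" "C * W = 1\<^sub>m r"
proof -
  obtain P Q r where PQ: "P \<in> carrier_mat n n" "Q \<in> carrier_mat m m" "det P \<noteq> 0" "det Q \<noteq> 0"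
    "r \<le> n" "r \<le> m" "N = P * rank_mat n m r * Q" using rank_normal_form[OF assms] by metis
  obtain P' where P': "P' \<in> carrier_mat n n" "P' * P = 1\<^sub>m n" using det_nonzeroE[OF PQ(1,3)] by blast
  obtain Q' where Q': "Q' \<in> carrier_mat m m" "Q * Q' = 1\<^sub>m m" using det_nonzeroE[OF PQ(2,4)] by blast
  have "rank_mat r n r * P' * (P * rank_mat n r r) = rank_mat r n r * (P' * P) * rank_mat n r r"
    using PQ(1) P'(1) by (auto simp: mat_mult_assoc)
  hence 1: "rank_mat r n r * P' * (P * rank_mat n r r) = 1\<^sub>m r"
    using P'(2) PQ(5) by (simp add: right_mult_one_mat[OF rank_mat_carrier] rank_mat_mult')
  have "rank_mat r m r * Q * (Q' * rank_mat m r r) = rank_mat r m r * (Q * Q') * rank_mat m r r"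
    using PQ(2) Q'(1) by (auto simp: mat_mult_assoc)
  hence 2: "rank_mat r m r * Q * (Q' * rank_mat m r r) = 1\<^sub>m r"
    using Q'(2) PQ(6) by (simp add: right_mult_one_mat[OF rank_mat_carrier] rank_mat_mult')
  have 3: "N = P * rank_mat n r r * (rank_mat r m r * Q)"
    unfolding PQ(7) rank_mat_mult[of n r m, symmetric] using PQ(1,2) by (auto simp: mat_mult_assoc)
  show ?thesis
    by (rule that[OF _ _ _ _ 3 1 2])
       (use PQ(1,2) P'(1) Q'(1) rank_mat_carrier mult_carrier_mat in blast)+
qed

lemma left_invertible_normal_form:
  fixes U :: "'a::field mat"
  assumes U: "U \<in> carrier_mat n r" and V: "V \<in> carrier_mat r n" and VU: "V * U = 1\<^sub>m r"
  obtains R where "R \<in> carrier_mat n n" "det R \<noteq> 0" "U = R * rank_mat n r r" "r \<le> n"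
proof -
  obtain P Q k where PQ: "P \<in> carrier_mat n n" "Q \<in> carrier_mat r r" "det P \<noteq> 0" "det Q \<noteq> 0"
    "k \<le> n" "k \<le> r" "U = P * rank_mat n r k * Q" using rank_normal_form[OF U] by metis
  obtain Q' where Q': "Q' \<in> carrier_mat r r" "Q * Q' = 1\<^sub>m r" "Q' * Q = 1\<^sub>m r" using det_nonzeroE[OF PQ(2,4)] by blast
  have k: "k = r"
  proof (rule ccontr)
    assume "k \<noteq> r"
    hence kr: "k < r" using PQ(6) by simp
    \<comment> \<open>A basis column whose index lies beyond the rank, so the rank matrix kills it;
      \<open>Q' * M\<close> would be a nonzero vector in the kernel of the injective
      \<open>U\<close>.\<close>
    define M where "M = (mat r 1 (\<lambda>(i,j). if i = k then 1 else 0) :: 'a mat)"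
    have M: "M \<in> carrier_mat r 1" by (simp add: M_def)
    have EM: "rank_mat n r k * M = 0\<^sub>m n 1"
    proof (rule eq_matI)
      fix i j assume ij: "i < dim_row (0\<^sub>m n 1)" "j < dim_col (0\<^sub>m n 1)"
      thus "(rank_mat n r k * M) $$ (i,j) = 0\<^sub>m n 1 $$ (i,j)"
        by (auto simp: rank_mat_def M_def scalar_prod_def intro!: sum.neutral)
    qed (use M in auto)
    have "U * (Q' * M) = P * (rank_mat n r k * (Q * Q' * M))"
      unfolding PQ(7) using PQ(1,2) Q'(1) M by (auto simp: mat_mult_assoc)
    also have "\<dots> = 0\<^sub>m n 1" using EM M PQ(1) Q'(2) by (simp add: left_mult_one_mat[OF M] right_mult_zero_mat[OF PQ(1)])
    finally have z: "U * (Q' * M) = 0\<^sub>m n 1" .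
    have "M = Q * (V * U) * (Q' * M)"
      using VU Q' M PQ(2) by (simp add: right_mult_one_mat[OF PQ(2)] mat_mult_assoc[symmetric] left_mult_one_mat[OF M])
    also have "\<dots> = Q * V * (U * (Q' * M))" using U V Q'(1) M PQ(2) by (auto simp: mat_mult_assoc)
    also have "\<dots> = 0\<^sub>m r 1" unfolding z using PQ(2) V by (simp add: right_mult_zero_mat[of _ r n])
    finally have "M $$ (k,0) = 0\<^sub>m r 1 $$ (k,0)" by simp
    thus False using kr by (simp add: M_def)
  qed
  define s where "s = n - r"
  have n: "n = r + s" using PQ(5) k by (simp add: s_def)
  \<comment> \<open>The right factor \<open>Q\<close> moves to the left of the rank matrix once it
    is extended by an identity block to size \<open>n\<close>.\<close>
  let ?D = "four_block_mat Q (0\<^sub>m r s) (0\<^sub>m s r) (1\<^sub>m s)"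
  have D: "?D \<in> carrier_mat n n" using PQ(2) n by simp
  have dD: "det ?D \<noteq> 0"
    using PQ by (subst det_four_block_mat_upper_right_zero[of _ r _ s]) auto
  have "rank_mat n r r * Q = ?D * rank_mat n r r"
  proof -
    have e: "(rank_mat n r r :: 'a mat) = four_block_mat (1\<^sub>m r) (0\<^sub>m r 0) (0\<^sub>m s r) (0\<^sub>m s 0)"
      using n by (intro eq_matI) (auto simp: rank_mat_def)
    have Qe: "Q = four_block_mat Q (0\<^sub>m r 0) (0\<^sub>m 0 r) (0\<^sub>m 0 0)"
      using PQ(2) by (intro eq_matI) auto
    have "rank_mat n r r * Q = four_block_mat Q (0\<^sub>m r 0) (0\<^sub>m s r) (0\<^sub>m s 0)"
      unfolding e by (subst (1) Qe, subst mult_four_block_mat[of _ r r _ 0 _ s]) (use PQ(2) in auto)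
    moreover have "?D * rank_mat n r r = four_block_mat Q (0\<^sub>m r 0) (0\<^sub>m s r) (0\<^sub>m s 0)"
      unfolding e by (subst mult_four_block_mat[of _ r r _ s _ s]) (use PQ(2) in auto)
    ultimately show ?thesis by simp
  qed
  hence "U = P * ?D * rank_mat n r r"
    unfolding PQ(7) k using PQ(1,2) D by (simp add: assoc_mult_mat[of _ n n _ n _ r] assoc_mult_mat[of _ n n _ r _ r])
  moreover have "det (P * ?D) \<noteq> 0" using PQ D dD by (simp add: det_mult[of _ n])
  ultimately show ?thesis using that[of "P * ?D"] PQ(1,5) D k by (metis mult_carrier_mat)
qed

lemma right_invertible_normal_form:
  fixes F :: "'a::field mat"
  assumes F: "F \<in> carrier_mat r n" and H: "H \<in> carrier_mat n r" and FH: "F * H = 1\<^sub>m r"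
  obtains R where "R \<in> carrier_mat n n" "det R \<noteq> 0" "F = rank_mat r n r * R"
proof -
  have "transpose_mat H * transpose_mat F = 1\<^sub>m r"
    using transpose_mult[OF F H] FH by simp
  then obtain R where R: "R \<in> carrier_mat n n" "det R \<noteq> 0" "transpose_mat F = R * rank_mat n r r"
    using left_invertible_normal_form[of "transpose_mat F" n r "transpose_mat H"] F H by auto
  have "F = transpose_mat (rank_mat n r r) * transpose_mat R"
    using R(3) transpose_mult[OF R(1) rank_mat_carrier] transpose_transpose[of F] by metis
  moreover have "transpose_mat (rank_mat n r r) = (rank_mat r n r :: 'a mat)"
    by (rule eq_matI) (auto simp: rank_mat_def)
  ultimately show ?thesis using that[of "transpose_mat R"] R det_transpose[OF R(1)] by auto
qed

text \<open>The two identities say that \<open>(E F)\<close> and \<open>(E F')\<close> are onto, so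
  \<open>F\<close> and \<open>F'\<close> induce surjections from a space of dimension
  \<open>q\<close> onto the cokernel of \<open>E\<close>. Two such surjections differ by an
  automorphism \<open>Z\<close> of the source, and then the columns of \<open>F - F' Z\<close> lie
  in the image of \<open>E\<close>.\<close>

lemma similar_unipotent_corner:
  fixes E F F' :: "'a::field mat"
  assumes E: "E \<in> carrier_mat r r" and F: "F \<in> carrier_mat r q" and F': "F' \<in> carrier_mat r q"
    and G: "G \<in> carrier_mat r r" "G' \<in> carrier_mat r r" and H: "H \<in> carrier_mat q r" "H' \<in> carrier_mat q r"
    and inv: "E * G + F * H = 1\<^sub>m r" "E * G' + F' * H' = 1\<^sub>m r"
  obtains Y Z where "Y \<in> carrier_mat r q" "Z \<in> carrier_mat q q" "det Z \<noteq> 0" "F = E * Y + F' * Z"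
proof -
  obtain P Q s where PQ: "P \<in> carrier_mat r r" "Q \<in> carrier_mat r r" "det P \<noteq> 0" "det Q \<noteq> 0"
    "s \<le> r" "E = P * rank_mat r r s * Q" using rank_normal_form[OF E] by metis
  obtain P' where P': "P' \<in> carrier_mat r r" "P * P' = 1\<^sub>m r" "P' * P = 1\<^sub>m r"
    using det_nonzeroE[OF PQ(1,3)] by blast
  obtain Q' where Q': "Q' \<in> carrier_mat r r" "Q * Q' = 1\<^sub>m r" "Q' * Q = 1\<^sub>m r"
    using det_nonzeroE[OF PQ(2,4)] by blast
  define p where "p = r - s"
  \<comment> \<open>The last \<open>r - s\<close> coordinates; preceded by \<open>P'\<close> this is
    the projection onto the cokernel of \<open>E\<close>.\<close>
  define K where "K = (mat p r (\<lambda>(i,j). if j = s + i then 1 else 0) :: 'a mat)"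
  have K: "K \<in> carrier_mat p r" by (simp add: K_def)
  have Kmult: "(K * M) $$ (i,j) = M $$ (s + i, j)" if "M \<in> carrier_mat r m" "i < p" "j < m" for M i j m
    using that by (simp add: K_def p_def scalar_prod_def atLeast0LessThan if_distrib[of "\<lambda>x. x * _"] cong: if_cong)
  have Emult: "(rank_mat r r s * M) $$ (i,j) = (if i < s then M $$ (i,j) else 0)"
    if "M \<in> carrier_mat r m" "i < r" "j < m" for M :: "'a mat" and i j m
  proof -
    have "(rank_mat r r s * M) $$ (i,j) = (\<Sum>k<r. (if i = k \<and> i < s then 1 else 0) * M $$ (k,j))"
      using that by (simp add: rank_mat_def scalar_prod_def atLeast0LessThan)
    also have "\<dots> = (\<Sum>k<r. if k = i then (if i < s then M $$ (k,j) else 0) else 0)"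
      by (rule sum.cong) auto
    finally have "(rank_mat r r s * M) $$ (i,j) =
        (\<Sum>k<r. if k = i then (if i < s then M $$ (k,j) else 0) else 0)" .
    thus ?thesis using that by simp
  qed
  have KE: "K * rank_mat r r s = 0\<^sub>m p r"
    by (rule eq_matI)
       (use K in \<open>auto simp: Kmult[OF rank_mat_carrier] rank_mat_index p_def simp del: index_mult_mat(1)\<close>)
  have KK: "K * transpose_mat K = 1\<^sub>m p"
    by (rule eq_matI) (use K in \<open>auto simp: Kmult[of _ p] simp del: index_mult_mat(1)\<close>, auto simp: K_def p_def)
  \<comment> \<open>An explicit right inverse of the induced map to the cokernel; the summand
    containing \<open>E\<close> disappears because \<open>K * P' * E\<close> is zero.\<close>
  have full: "K * (P' * f) * (h * P * transpose_mat K) = 1\<^sub>m p"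
    if f: "f \<in> carrier_mat r q" and g: "g \<in> carrier_mat r r" and h: "h \<in> carrier_mat q r"
      and eq: "E * g + f * h = 1\<^sub>m r" for f g h
  proof -
    have c1: "E * g \<in> carrier_mat r r" "f * h \<in> carrier_mat r r" using E f g h by auto
    have c2: "K * P' \<in> carrier_mat p r" "P * transpose_mat K \<in> carrier_mat r p" using K P' PQ by auto
    have "K * P' * (E * g) * (P * transpose_mat K) = K * (P' * P) * rank_mat r r s * (Q * g * (P * transpose_mat K))"
      unfolding PQ(6) using K P'(1) PQ(1,2) g by (auto simp: mat_mult_assoc)
    also have "\<dots> = K * rank_mat r r s * (Q * g * (P * transpose_mat K))"
      using P'(3) by (simp add: right_mult_one_mat[OF K])
    also have "\<dots> = 0\<^sub>m p p" unfolding KE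
      using g PQ(1,2) K by (intro left_mult_zero_mat mult_carrier_mat[of _ r r] mult_carrier_mat[of _ r r]) auto
    finally have z: "K * P' * (E * g) * (P * transpose_mat K) = 0\<^sub>m p p" .
    have "1\<^sub>m p = K * (P' * P) * transpose_mat K" using P'(3) KK by (simp add: right_mult_one_mat[OF K])
    also have "\<dots> = K * P' * (E * g + f * h) * (P * transpose_mat K)"
      unfolding eq using K P'(1) PQ(1) by (auto simp: mat_mult_assoc right_mult_one_mat[OF P'(1)] left_mult_one_mat[OF PQ(1)])
    also have "\<dots> = (K * P' * (E * g) + K * P' * (f * h)) * (P * transpose_mat K)"
      using mult_add_distrib_mat[OF c2(1) c1] by simp
    also have "\<dots> = K * P' * (E * g) * (P * transpose_mat K) + K * P' * (f * h) * (P * transpose_mat K)"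
      using c1 c2 K P'(1) by (intro add_mult_distrib_mat[of _ p r _ _ p]) auto
    also have "\<dots> = K * P' * (f * h) * (P * transpose_mat K)"
      unfolding z using c1 c2 K P'(1) by (intro left_add_zero_mat mult_carrier_mat[of _ p r] mult_carrier_mat[of _ p r]) auto
    also have "\<dots> = K * (P' * f) * (h * P * transpose_mat K)"
      using K P'(1) PQ(1) f h by (auto simp: mat_mult_assoc)
    finally show ?thesis by simp
  qed
  have cK: "K * (P' * F) \<in> carrier_mat p q" "K * (P' * F') \<in> carrier_mat p q"
    "H * P * transpose_mat K \<in> carrier_mat q p" "H' * P * transpose_mat K \<in> carrier_mat q p"
    using K P'(1) PQ(1) F F' H by auto
  obtain R where R: "R \<in> carrier_mat q q" "det R \<noteq> 0" "K * (P' * F) = rank_mat p q p * R"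
    using right_invertible_normal_form[OF cK(1,3) full[OF F G(1) H(1) inv(1)]] by blast
  obtain R' where R': "R' \<in> carrier_mat q q" "det R' \<noteq> 0" "K * (P' * F') = rank_mat p q p * R'"
    using right_invertible_normal_form[OF cK(2,4) full[OF F' G(2) H(2) inv(2)]] by blast
  obtain S where S: "S \<in> carrier_mat q q" "R' * S = 1\<^sub>m q" "S * R' = 1\<^sub>m q"
    using det_nonzeroE[OF R'(1,2)] by blast
  define Z where "Z = S * R"
  have Z: "Z \<in> carrier_mat q q" using S R by (simp add: Z_def)
  have dZ: "det Z \<noteq> 0"
    using S R det_nonzeroI[OF S(1) R'(1) S(3)] by (simp add: Z_def det_mult[of _ q])
  define N where "N = P' * F - P' * F' * Z"
  have N: "N \<in> carrier_mat r q" using P' F F' Z by (auto simp: N_def)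
  have "K * (P' * F' * Z) = K * (P' * F') * Z"
    using K P'(1) F' Z by (auto simp: mat_mult_assoc)
  also have "\<dots> = rank_mat p q p * (R' * S) * R"
    unfolding R'(3) Z_def using R'(1) S(1) R(1) by (auto simp: mat_mult_assoc)
  finally have KFZ: "K * (P' * F' * Z) = K * (P' * F)"
    using S(2) R(3) by (simp add: right_mult_one_mat[OF rank_mat_carrier])
  have EN: "rank_mat r r s * N = N"
  proof (rule eq_matI)
    fix i j assume "i < dim_row N" "j < dim_col N"
    hence ij: "i < r" "j < q" using N by auto
    show "(rank_mat r r s * N) $$ (i,j) = N $$ (i,j)"
    proof (cases "i < s")
      case False
      have c: "P' * F \<in> carrier_mat r q" "P' * F' * Z \<in> carrier_mat r q" using P' F F' Z by auto
      have "i - s < p" using ij False by (simp add: p_def)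
      from Kmult[OF c(1) this ij(2)] Kmult[OF c(2) this ij(2)] KFZ False
      have "(P' * F) $$ (i,j) = (P' * F' * Z) $$ (i,j)" by simp
      hence "N $$ (i,j) = 0" unfolding N_def using c ij by (subst index_minus_mat) auto
      thus ?thesis using Emult[OF N ij] False by simp
    qed (simp add: Emult[OF N ij])
  qed (use N in auto)
  define Y where "Y = Q' * N"
  have Y: "Y \<in> carrier_mat r q" using Q' N by (simp add: Y_def)
  have "E * Y = P * (rank_mat r r s * (Q * Q' * N))"
    unfolding PQ(6) Y_def using PQ(1,2) Q'(1) N by (auto simp: mat_mult_assoc)
  also have "\<dots> = P * N" using Q'(2) EN by (simp add: left_mult_one_mat[OF N])
  also have "\<dots> = P * (P' * F) - P * (P' * F' * Z)"
    unfolding N_def using PQ(1) P' F F' Z by (intro mult_minus_distrib_mat[of _ r r _ q]) auto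
  also have "P * (P' * F) = F"
    using PQ(1) P' F by (simp add: mat_mult_assoc[symmetric] left_mult_one_mat[OF F])
  also have "P * (P' * F' * Z) = (P * P') * (F' * Z)"
    using PQ(1) P'(1) F' Z by (auto simp: mat_mult_assoc)
  also have "\<dots> = F' * Z" using P'(2) left_mult_one_mat[OF mult_carrier_mat[OF F' Z]] by simp
  finally have EY: "E * Y = F - F' * Z" .
  have "F = E * Y + F' * Z"
    unfolding EY using F F' Z by (intro eq_matI) auto
  thus ?thesis using that[OF Y Z dZ] by simp
qed


text \<open>The matrix \<open>R\<close> extends the columns of \<open>U\<close> to a basis. As
  \<open>A - 1 = U C\<close> maps into their span, \<open>A\<close> acts there as
  \<open>1 + C U\<close> and as the identity modulo it. The final identity preserves the
  surjectivity of \<open>C\<close> in the form required by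
  \<open>similar_unipotent_corner\<close>.\<close>

lemma block_form_of_factorization:
  fixes A U C V W :: "'a::field mat"
  assumes U: "U \<in> carrier_mat n r" and C: "C \<in> carrier_mat r n" and V: "V \<in> carrier_mat r n" and W: "W \<in> carrier_mat n r"
    and VU: "V * U = 1\<^sub>m r" and CW: "C * W = 1\<^sub>m r" and A: "A = 1\<^sub>m n + U * C" and n: "n = r + q"
  obtains F G H where "F \<in> carrier_mat r q" "G \<in> carrier_mat r r" "H \<in> carrier_mat q r"
    "similar_mat A (four_block_mat (1\<^sub>m r + C * U) F (0\<^sub>m q r) (1\<^sub>m q))" "C * U * G + F * H = 1\<^sub>m r"
proof -
  obtain R where R: "R \<in> carrier_mat n n" "det R \<noteq> 0" "U = R * rank_mat n r r"
    using left_invertible_normal_form[OF U V VU] by blast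
  obtain R' where R': "R' \<in> carrier_mat n n" "R * R' = 1\<^sub>m n" "R' * R = 1\<^sub>m n"
    using det_nonzeroE[OF R(1,2)] by blast
  \<comment> \<open>A block row is treated as a four block matrix whose lower blocks have height
    zero, so that the rules for block products apply.\<close>
  have "C * R \<in> carrier_mat (r + 0) (r + q)" using C R(1) n by auto
  then obtain E F z1 z2 where EF: "E \<in> carrier_mat r r" "F \<in> carrier_mat r q"
    "z1 \<in> carrier_mat 0 r" "z2 \<in> carrier_mat 0 q" "C * R = four_block_mat E F z1 z2"
    using four_block_split by blast
  have "R' * W \<in> carrier_mat (r + q) (r + 0)" using W R'(1) n by auto
  then obtain G H z3 z4 where GH: "G \<in> carrier_mat r r" "z3 \<in> carrier_mat r 0"
    "H \<in> carrier_mat q r" "z4 \<in> carrier_mat q 0" "R' * W = four_block_mat G z3 H z4"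
    using four_block_split by blast
  have e: "(rank_mat n r r :: 'a mat) = four_block_mat (1\<^sub>m r) (0\<^sub>m r 0) (0\<^sub>m q r) (0\<^sub>m q 0)"
    using n by (intro eq_matI) (auto simp: rank_mat_def)
  have sub: "M = N" if "four_block_mat M a b c = four_block_mat N a' b' c'" "M \<in> carrier_mat r r" "N \<in> carrier_mat r r"
    "a \<in> carrier_mat r 0" "b \<in> carrier_mat 0 r" "c \<in> carrier_mat 0 0"
    "a' \<in> carrier_mat r 0" "b' \<in> carrier_mat 0 r" "c' \<in> carrier_mat 0 0" for M N a b c a' b' c' :: "'a mat"
    using four_block_mat_inject(1)[OF that(2,4,5,6,3,7,8,9) that(1)] .
  have pad: "M = four_block_mat M (0\<^sub>m r 0) (0\<^sub>m 0 r) (0\<^sub>m 0 0)" if "M \<in> carrier_mat r r" for M :: "'a mat"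
    using that by (intro eq_matI) auto
  have "C * U = C * R * rank_mat n r r"
    unfolding R(3) using C R(1) by (auto simp: mat_mult_assoc)
  also have "\<dots> = four_block_mat E (0\<^sub>m r 0) z1 (0\<^sub>m 0 0)"
    unfolding EF(5) e using EF(1-4) by (subst mult_four_block_mat[of _ r r _ q _ 0]) auto
  finally have CU: "C * U = E"
    using pad[of "C * U"] C U EF by (intro sub[of "C * U" "0\<^sub>m r 0" "0\<^sub>m 0 r" "0\<^sub>m 0 0" E "0\<^sub>m r 0" z1 "0\<^sub>m 0 0"]) auto
  have "1\<^sub>m r = C * R * (R' * W)"
    using CW C R(1) R' W by (auto simp: mat_mult_assoc) (simp add: mat_mult_assoc[symmetric] left_mult_one_mat[OF W])
  also have "\<dots> = four_block_mat (E * G + F * H) (E * z3 + F * z4) (z1 * G + z2 * H) (z1 * z3 + z2 * z4)"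
    unfolding EF(5) GH(5) using EF(1-4) GH(1-4) by (subst mult_four_block_mat[of _ r r _ q _ 0]) auto
  finally have "four_block_mat (1\<^sub>m r) (0\<^sub>m r 0) (0\<^sub>m 0 r) (0\<^sub>m 0 0) =
      four_block_mat (E * G + F * H) (E * z3 + F * z4) (z1 * G + z2 * H) (z1 * z3 + z2 * z4)"
    by (rule HOL.trans[OF pad[OF one_carrier_mat, symmetric]])
  hence EG: "C * U * G + F * H = 1\<^sub>m r"
    unfolding CU using EF(1-4) GH(1-4) sub[OF _ one_carrier_mat, symmetric] by simp
  have "R' * (1\<^sub>m n + U * C) * R = 1\<^sub>m n + rank_mat n r r * (C * R)"
  proof -
    have cUC: "U * C \<in> carrier_mat n n" using U C by simp
    have "R' * (1\<^sub>m n + U * C) * R = (R' + R' * (U * C)) * R"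
      using R'(1) cUC by (subst mult_add_distrib_mat[of _ n n]) (auto simp: right_mult_one_mat[OF R'(1)])
    also have "\<dots> = R' * R + R' * (U * C) * R"
      using R'(1) R(1) cUC by (intro add_mult_distrib_mat[of _ n n]) auto
    also have "R' * (U * C) * R = (R' * R) * (rank_mat n r r * (C * R))"
      unfolding R(3) using R'(1) R(1) C by (auto simp: mat_mult_assoc)
    also have "\<dots> = rank_mat n r r * (C * R)"
      unfolding R'(3) using C R(1) by (intro left_mult_one_mat mult_carrier_mat[OF rank_mat_carrier]) auto
    finally show ?thesis using R'(3) by simp
  qed
  also have "rank_mat n r r * (C * R) = four_block_mat E F (0\<^sub>m q r) (0\<^sub>m q q)"
    unfolding EF(5) e using EF(1-4)
    by (subst mult_four_block_mat[of _ r r _ 0 _ q]) (auto simp: left_mult_zero_mat[OF EF(1)] left_mult_zero_mat[OF EF(2)])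
  also have "1\<^sub>m n + \<dots> = four_block_mat (1\<^sub>m r + E) F (0\<^sub>m q r) (1\<^sub>m q)"
    unfolding n four_block_one_mat[symmetric] using EF(1,2)
    by (subst add_four_block_mat[of _ r r _ q _ q]) auto
  finally have eq: "R' * A * R = four_block_mat (1\<^sub>m r + C * U) F (0\<^sub>m q r) (1\<^sub>m q)"
    unfolding A CU .
  have cA: "A \<in> carrier_mat n n" using U C by (simp add: A)
  have "similar_mat (R' * A * R) A"
    using R' R(1) cA by (intro similar_matI[of _ _ R' R n]) auto
  hence "similar_mat A (four_block_mat (1\<^sub>m r + C * U) F (0\<^sub>m q r) (1\<^sub>m q))"
    unfolding eq by (rule similar_mat_sym)
  thus ?thesis using that[OF EF(2) GH(1,3) _ EG] by blast
qed

text \<open>If \<open>A = 1 + U C\<close> is a rank factorization, then \<open>A U = U (1 + C U)\<close>, so \<open>1 + C U\<close> is the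
  restriction of \<open>A\<close> to the image of \<open>A - 1\<close>.\<close>

theorem similar_if_restrictions_similar:
  fixes U C V W U' C' V' W' :: "'a::field mat"
  assumes c: "U \<in> carrier_mat n r" "C \<in> carrier_mat r n" "V \<in> carrier_mat r n" "W \<in> carrier_mat n r"
    and inv: "V * U = 1\<^sub>m r" "C * W = 1\<^sub>m r"
    and c': "U' \<in> carrier_mat n r" "C' \<in> carrier_mat r n" "V' \<in> carrier_mat r n" "W' \<in> carrier_mat n r"
    and inv': "V' * U' = 1\<^sub>m r" "C' * W' = 1\<^sub>m r"
    and sim: "similar_mat (1\<^sub>m r + C * U) (1\<^sub>m r + C' * U')"
  shows "similar_mat (1\<^sub>m n + U * C) (1\<^sub>m n + U' * C')"
proof -
  have "r \<le> n" using left_invertible_normal_form[OF c(1,3) inv(1)] by metis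
  then obtain q where n: "n = r + q" using le_Suc_ex by blast
  obtain S S' where S: "S \<in> carrier_mat r r" "S' \<in> carrier_mat r r" "S * S' = 1\<^sub>m r" "S' * S = 1\<^sub>m r"
    "1\<^sub>m r + C * U = S * (1\<^sub>m r + C' * U') * S'"
    using sim c unfolding similar_mat_def similar_mat_wit_def Let_def by auto
  have cc: "C' * U' \<in> carrier_mat r r" "C * U \<in> carrier_mat r r" using c c' by auto
  \<comment> \<open>Transporting the second factorization along the similarity leaves
    \<open>U' * C'\<close> unchanged and makes the two restrictions equal instead of merely
    similar.\<close>
  define U1 C1 V1 W1 where "U1 = U' * S'" and "C1 = S * C'" and "V1 = S * V'" and "W1 = W' * S'"
  have c1: "U1 \<in> carrier_mat n r" "C1 \<in> carrier_mat r n" "V1 \<in> carrier_mat r n" "W1 \<in> carrier_mat n r"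
    using c' S by (auto simp: U1_def C1_def V1_def W1_def)
  have "V1 * U1 = S * (V' * U') * S'" "C1 * W1 = S * (C' * W') * S'"
    using c' S(1,2) by (auto simp: U1_def C1_def V1_def W1_def mat_mult_assoc)
  hence inv1: "V1 * U1 = 1\<^sub>m r" "C1 * W1 = 1\<^sub>m r"
    using inv' S by (auto simp: right_mult_one_mat[OF S(1)])
  have "U1 * C1 = U' * ((S' * S) * C')"
    using c' S(1,2) by (auto simp: U1_def C1_def mat_mult_assoc)
  hence UC1: "U1 * C1 = U' * C'" using S(4) left_mult_one_mat[OF c'(2)] by simp
  have "S * (1\<^sub>m r + C' * U') * S' = (S + S * (C' * U')) * S'"
    using S(1) cc by (subst mult_add_distrib_mat[of _ r r]) (auto simp: right_mult_one_mat[OF S(1)])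
  also have "\<dots> = S * S' + S * (C' * U') * S'"
    using S(1,2) cc by (intro add_mult_distrib_mat[of _ r r]) auto
  also have "S * (C' * U') * S' = C1 * U1"
    using c' S(1,2) by (auto simp: U1_def C1_def mat_mult_assoc)
  finally have eq: "1\<^sub>m r + C * U = 1\<^sub>m r + C1 * U1" using S(3,5) by simp
  have CU1: "C1 * U1 = C * U"
  proof -
    have "C1 * U1 = (1\<^sub>m r + C1 * U1) - 1\<^sub>m r" using c1 by (intro eq_matI) auto
    also have "\<dots> = C * U" unfolding eq[symmetric] using c by (intro eq_matI) auto
    finally show "C1 * U1 = C * U" .
  qed
  obtain F G H where F: "F \<in> carrier_mat r q" "G \<in> carrier_mat r r" "H \<in> carrier_mat q r"
    "similar_mat (1\<^sub>m n + U * C) (four_block_mat (1\<^sub>m r + C * U) F (0\<^sub>m q r) (1\<^sub>m q))" "C * U * G + F * H = 1\<^sub>m r"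
    using block_form_of_factorization[OF c inv HOL.refl n] by metis
  obtain F' G' H' where F': "F' \<in> carrier_mat r q" "G' \<in> carrier_mat r r" "H' \<in> carrier_mat q r"
    "similar_mat (1\<^sub>m n + U' * C') (four_block_mat (1\<^sub>m r + C * U) F' (0\<^sub>m q r) (1\<^sub>m q))" "C * U * G' + F' * H' = 1\<^sub>m r"
    using block_form_of_factorization[OF c1 inv1 HOL.refl n] unfolding UC1 CU1 by metis
  obtain Y Z where YZ: "Y \<in> carrier_mat r q" "Z \<in> carrier_mat q q" "det Z \<noteq> 0" "F = C * U * Y + F' * Z"
    using similar_unipotent_corner[OF cc(2) F(1) F'(1) F(2) F'(2) F(3) F'(3) F(5) F'(5)] by blast
  let ?M = "four_block_mat (1\<^sub>m r + C * U) F (0\<^sub>m q r) (1\<^sub>m q)"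
  let ?M' = "four_block_mat (1\<^sub>m r + C * U) F' (0\<^sub>m q r) (1\<^sub>m q)"
  \<comment> \<open>A change of the complement by \<open>Y\<close> and of its basis by
    \<open>Z\<close>, which turns one corner into the other.\<close>
  let ?X = "four_block_mat (1\<^sub>m r) Y (0\<^sub>m q r) Z"
  have B: "1\<^sub>m r + C * U \<in> carrier_mat r r" using cc by simp
  have "similar_mat ?M ?M'"
  proof (rule similar_matI_det[of _ "r + q" _ ?X])
    show "det ?X \<noteq> 0" using YZ by (subst det_four_block_mat_lower_left_zero[of _ r _ q]) auto
    have 1: "?X * ?M = four_block_mat (1\<^sub>m r + C * U) (F + Y) (0\<^sub>m q r) Z"
      using YZ(1,2) F(1) B
      by (subst mult_four_block_mat[of _ r r _ q _ q])
        (auto simp: left_mult_one_mat[OF B] left_mult_one_mat[OF F(1)] left_mult_zero_mat[OF B] left_mult_zero_mat[OF F(1)])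
    have 2: "?M' * ?X = four_block_mat (1\<^sub>m r + C * U) ((1\<^sub>m r + C * U) * Y + F' * Z) (0\<^sub>m q r) Z"
      using YZ(1,2) F'(1) B
      by (subst mult_four_block_mat[of _ r r _ q _ q])
        (auto simp: right_mult_one_mat[OF B] left_mult_one_mat[OF YZ(2)] left_mult_zero_mat[OF YZ(1)])
    have "(1\<^sub>m r + C * U) * Y = Y + C * U * Y"
      using YZ(1) cc(2) by (subst add_mult_distrib_mat[of _ r r]) (auto simp: left_mult_one_mat[OF YZ(1)])
    hence 3: "(1\<^sub>m r + C * U) * Y + F' * Z = F + Y"
      unfolding YZ(4) using YZ(1,2) cc(2) F'(1) by (intro eq_matI) auto
    show "?X * ?M = ?M' * ?X" unfolding 1 2 3 ..
  qed (use B F(1) F'(1) YZ in auto)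
  thus ?thesis using F(4) F'(4) by (meson similar_mat_sym similar_mat_trans)
qed

section \<open>Traces of powers of integer matrices\<close>

text \<open>Every orbit has exactly \<open>q\<close> elements, since a shorter period would be prime
  to \<open>q\<close> and then force a fixed point. Orbits are removed one at a time.\<close>

lemma prime_dvd_card_free_action:
  assumes "finite S" "\<And>x. x \<in> S \<Longrightarrow> \<sigma> x \<in> S" "\<And>x. x \<in> S \<Longrightarrow> (\<sigma> ^^ q) x = x"
    "\<And>x. x \<in> S \<Longrightarrow> \<sigma> x \<noteq> x" and q: "prime (q::nat)"
  shows "q dvd card S"
  using assms(1-4)
proof (induction S rule: finite_psubset_induct)
  case (psubset S)
  note closed = psubset.prems(1) and per = psubset.prems(2) and free = psubset.prems(3)
  show ?case
  proof (cases "S = {}")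
    case False
    then obtain x where x: "x \<in> S" by blast
    have q0: "q > 0" using q by (simp add: prime_gt_0_nat)
    define O' where "O' = (\<lambda>i. (\<sigma> ^^ i) x) ` {..<q}"
    have pow_closed: "(\<sigma> ^^ i) x \<in> S" for i by (induction i) (auto simp: x closed)
    have "inj_on (\<lambda>i. (\<sigma> ^^ i) x) {..<q}"
    proof (rule linorder_inj_onI)
      fix i j assume ij: "i < j" "i \<in> {..<q}" "j \<in> {..<q}"
      show "(\<sigma> ^^ i) x \<noteq> (\<sigma> ^^ j) x"
      proof
        assume eq: "(\<sigma> ^^ i) x = (\<sigma> ^^ j) x"
        define d where "d = j - i"
        have d: "0 < d" "d < q" using ij by (auto simp: d_def)
        have "(\<sigma> ^^ (q - i)) ((\<sigma> ^^ i) x) = (\<sigma> ^^ (q - i)) ((\<sigma> ^^ j) x)" using eq by simp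
        moreover have "q - i + j = d + q" "q - i + i = q" using ij by (auto simp: d_def)
        ultimately have "(\<sigma> ^^ q) x = (\<sigma> ^^ (d + q)) x"
          using funpow_add[of "q - i" i \<sigma>] funpow_add[of "q - i" j \<sigma>] by simp
        hence dx: "(\<sigma> ^^ d) x = x" using per[OF x] by (simp add: funpow_add)
        have "coprime d q" using d q by (metis coprime_commute nat_dvd_not_less prime_imp_coprime)
        then obtain a where "[d * a = 1] (mod q)" using cong_solve_coprime_nat[of d q] by auto
        hence "(d * a) mod q = 1 mod q" by (simp add: cong_def)
        moreover have "(\<sigma> ^^ (d * a)) x = x"
          using dx by (induction a) (auto simp: funpow_add)
        ultimately have "(\<sigma> ^^ 1) x = x"
          using funpow_mod_eq[OF per[OF x]] by metis
        thus False using free[OF x] by simp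
      qed
    qed auto
    hence cardO: "card O' = q" by (simp add: O'_def card_image)
    have OS: "O' \<subseteq> S" using pow_closed by (auto simp: O'_def)
    have O_back: "y \<in> O'" if "y \<in> S" "\<sigma> y \<in> O'" for y
    proof -
      obtain i where i: "\<sigma> y = (\<sigma> ^^ i) x" using \<open>\<sigma> y \<in> O'\<close> by (auto simp: O'_def)
      have "y = (\<sigma> ^^ (q - 1)) (\<sigma> y)"
        using per[OF that(1)] q0 by (metis One_nat_def Suc_pred comp_apply funpow_Suc_right)
      also have "\<dots> = (\<sigma> ^^ ((q - 1 + i) mod q)) x"
        unfolding i funpow_mod_eq[OF per[OF x]] by (simp add: funpow_add)
      finally show ?thesis using q0 by (auto simp: O'_def)
    qed
    have "x \<in> O'" using q0 by (auto simp: O'_def intro!: image_eqI[of _ _ 0])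
    hence "q dvd card (S - O')"
      using OS O_back x by (intro psubset.IH) (auto simp: closed per free)
    moreover have "card S = card O' + card (S - O')"
      using psubset.hyps OS by (metis card_Diff_subset card_mono finite_subset le_add_diff_inverse)
    ultimately show ?thesis by (simp add: cardO)
  qed simp
qed

text \<open>Each level set of \<open>c\<close> is invariant under the action, so its cardinality is
  divisible by \<open>q\<close>.\<close>

lemma prime_dvd_sum_free_action:
  fixes c :: "'a \<Rightarrow> int"
  assumes "finite S" "\<And>x. x \<in> S \<Longrightarrow> \<sigma> x \<in> S" "\<And>x. x \<in> S \<Longrightarrow> (\<sigma> ^^ q) x = x"
    "\<And>x. x \<in> S \<Longrightarrow> \<sigma> x \<noteq> x" "\<And>x. x \<in> S \<Longrightarrow> c (\<sigma> x) = c x" "prime (q::nat)"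
  shows "int q dvd sum c S"
proof -
  have "sum c S = (\<Sum>v\<in>c ` S. \<Sum>x\<in>{x\<in>S. c x = v}. c x)"
    using assms(1) by (subst sum.group) auto
  also have "\<dots> = (\<Sum>v\<in>c ` S. int (card {x\<in>S. c x = v}) * v)"
    by (intro sum.cong refl) auto
  also have "int q dvd \<dots>"
  proof (intro dvd_sum dvd_mult2)
    fix v
    have "q dvd card {x\<in>S. c x = v}"
      using assms by (intro prime_dvd_card_free_action[of _ \<sigma>]) auto
    thus "int q dvd int (card {x\<in>S. c x = v})" by simp
  qed
  finally show ?thesis .
qed

lemma prime_dvd_power_diff:
  fixes a :: int
  assumes q: "prime (q::nat)"
  shows "int q dvd a ^ q - a"
proof -
  have q1: "q > 0" using q by (simp add: prime_gt_0_nat)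
  define b where "b = nat (a mod int q)"
  have ab: "[a = int b] (mod int q)" using q1 by (simp add: b_def cong_def)
  have "[b ^ q = b] (mod q)"
  proof (cases "q dvd b")
    case True
    moreover have "q dvd b ^ q" using True q1 by (meson dvd_power dvd_trans)
    ultimately show ?thesis by (simp add: cong_def mod_eq_0_iff_dvd)
  next
    case False
    have "[b ^ (q - 1) * b = 1 * b] (mod q)"
      using fermat_theorem[OF q False] by (intro cong_mult cong_refl)
    thus ?thesis using q1 by (cases q) (auto simp: mult.commute)
  qed
  hence "[int b ^ q = int b] (mod int q)" using cong_int_iff[of "b ^ q" b q] by simp
  moreover have "[a ^ q = int b ^ q] (mod int q)" using ab by (rule cong_pow)
  ultimately have "[a ^ q = a] (mod int q)" using ab by (meson cong_sym cong_trans)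
  thus ?thesis by (simp add: cong_iff_dvd_diff)
qed

section \<open>Closed walks and traces of powers\<close>

fun walk_weight :: "'a::semiring_1 mat \<Rightarrow> nat \<Rightarrow> nat list \<Rightarrow> nat \<Rightarrow> 'a" where
  "walk_weight A i [] j = A $$ (i, j)"
| "walk_weight A i (k # ks) j = A $$ (i, k) * walk_weight A k ks j"

definition cycle_weight :: "'a::semiring_1 mat \<Rightarrow> nat list \<Rightarrow> 'a" where
  "cycle_weight A ks = walk_weight A (hd ks) (tl ks) (hd ks)"

lemma walk_weight_append:
  "walk_weight A i (ks @ [l]) j = walk_weight A i ks l * A $$ (l, j)"
  by (induction ks arbitrary: i) (auto simp: mult.assoc)

lemma cycle_weight_rotate1:
  fixes A :: "'a::comm_semiring_1 mat"
  shows "cycle_weight A (rotate1 ks) = cycle_weight A ks"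
proof (cases ks)
  case (Cons k ls)
  thus ?thesis by (cases ls) (auto simp: cycle_weight_def walk_weight_append mult.commute)
qed auto

lemma sum_lists_Suc:
  "(\<Sum>ks\<in>{ks. set ks \<subseteq> {..<n} \<and> length ks = Suc k}. f ks) =
   (\<Sum>i<n. \<Sum>ks\<in>{ks. set ks \<subseteq> {..<n::nat} \<and> length ks = k}. f (i # ks) :: 'a::comm_monoid_add)"
proof -
  have "(\<Sum>ks\<in>{ks. set ks \<subseteq> {..<n} \<and> length ks = Suc k}. f ks) =
        (\<Sum>(ks, i)\<in>{ks. set ks \<subseteq> {..<n} \<and> length ks = k} \<times> {..<n}. f (i # ks))"
    unfolding lists_length_Suc_eq
    by (subst sum.reindex) (auto simp: inj_split_Cons intro!: sum.cong)
  also have "\<dots> = (\<Sum>i<n. \<Sum>ks\<in>{ks. set ks \<subseteq> {..<n} \<and> length ks = k}. f (i # ks))"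
    by (subst sum.cartesian_product[symmetric], subst sum.swap) auto
  finally show ?thesis .
qed

lemma pow_mat_walks:
  fixes A :: "'a::semiring_1 mat"
  assumes A: "A \<in> carrier_mat n n" and "i < n" "j < n"
  shows "(A ^\<^sub>m Suc k) $$ (i, j) = (\<Sum>ks\<in>{ks. set ks \<subseteq> {..<n} \<and> length ks = k}. walk_weight A i ks j)"
  using assms(2)
proof (induction k arbitrary: i)
  case 0
  have "{ks. set ks \<subseteq> {..<n} \<and> length ks = 0} = {[]}" by auto
  thus ?case using A by (simp add: left_mult_one_mat[of A n n])
next
  case (Suc k)
  have "A ^\<^sub>m Suc (Suc k) = A * A ^\<^sub>m Suc k"
    using pow_mat_plus[OF A, of 1 "Suc k"] A by (simp add: left_mult_one_mat[of A n n])
  hence "(A ^\<^sub>m Suc (Suc k)) $$ (i, j) = (\<Sum>l<n. A $$ (i,l) * (A ^\<^sub>m Suc k) $$ (l,j))"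
    using Suc.prems A \<open>j < n\<close> by (simp add: scalar_prod_def atLeast0LessThan del: pow_mat.simps)
  also have "\<dots> = (\<Sum>ks\<in>{ks. set ks \<subseteq> {..<n} \<and> length ks = Suc k}. walk_weight A i ks j)"
    by (simp add: sum_lists_Suc Suc.IH sum_distrib_left del: pow_mat.simps)
  finally show ?case .
qed

lemma tr_pow_cycles:
  fixes A :: "'a::semiring_1 mat"
  assumes A: "A \<in> carrier_mat n n"
  shows "tr (A ^\<^sub>m Suc k) = (\<Sum>ks\<in>{ks. set ks \<subseteq> {..<n} \<and> length ks = Suc k}. cycle_weight A ks)"
  using A by (simp add: tr_def sum_lists_Suc cycle_weight_def pow_mat_walks del: pow_mat.simps)

lemma walk_weight_replicate: "walk_weight A i (replicate k i) i = A $$ (i, i) ^ Suc k"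
  by (induction k) auto

text \<open>The trace of \<open>A^q\<close> is a weighted count of closed walks of length
  \<open>q\<close>, on which rotation acts with order dividing \<open>q\<close>. The fixed walks are
  constant and contribute the powers of the diagonal entries, which Fermat's theorem reduces to the
  entries themselves; all other walks lie in free orbits of constant weight.\<close>

theorem tr_pow_prime_cong:
  fixes A :: "int mat"
  assumes A: "A \<in> carrier_mat n n" and q: "prime (q::nat)"
  shows "int q dvd tr (A ^\<^sub>m q) - tr A"
proof -
  obtain k where k: "q = Suc k" using q by (metis not0_implies_Suc not_prime_0)
  define S where "S = {ks. set ks \<subseteq> {..<n} \<and> length ks = q}"
  have fin: "finite S" by (auto simp: S_def intro: finite_lists_length_eq)
  define F where "F = {ks \<in> S. rotate1 ks = ks}"
  have F_eq: "F = replicate q ` {..<n}"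
  proof (intro equalityI subsetI)
    fix ks assume ks: "ks \<in> F"
    hence "ks \<noteq> []" "card (set ks) = 1"
      using rotate1_fixpoint_card[of ks] k by (auto simp: F_def S_def)
    then obtain x where "set ks = {x}" by (auto simp: card_1_singleton_iff)
    hence "ks = replicate (length ks) x" by (metis replicate_eqI singletonD)
    thus "ks \<in> replicate q ` {..<n}" using ks \<open>set ks = {x}\<close> by (auto simp: F_def S_def)
  qed (auto simp: F_def S_def)
  have "sum (cycle_weight A) F = (\<Sum>i<n. A $$ (i,i) ^ q)"
    unfolding F_eq
    by (subst sum.reindex) (auto simp: inj_on_def k cycle_weight_def walk_weight_replicate)
  moreover have "int q dvd sum (cycle_weight A) (S - F)"
  proof (rule prime_dvd_sum_free_action[OF _ _ _ _ _ q])
    fix ks assume ks: "ks \<in> S - F"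
    show "rotate1 ks \<in> S - F"
    proof -
      have "rotate1 (rotate1 ks) \<noteq> rotate1 ks"
      proof
        assume e: "rotate1 (rotate1 ks) = rotate1 ks"
        have rk: "rotate1 ks = replicate q x" if "set ks = {x}" for x
          using that ks by (intro replicate_eqI) (auto simp: S_def)
        have "rotate1 ks \<noteq> []" using ks k by (auto simp: S_def)
        hence "card (set ks) = 1" using rotate1_fixpoint_card[OF e] by auto
        then obtain x where x: "set ks = {x}" by (auto simp: card_1_singleton_iff)
        have "ks = replicate q x" using x ks by (intro replicate_eqI) (auto simp: S_def)
        thus False using ks by (auto simp: F_def)
      qed
      thus ?thesis using ks by (auto simp: S_def F_def)
    qed
    show "(rotate1 ^^ q) ks = ks" using ks by (auto simp: S_def rotate_def[symmetric])
    show "rotate1 ks \<noteq> ks" using ks by (auto simp: F_def)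
    show "cycle_weight A (rotate1 ks) = cycle_weight A ks" by (rule cycle_weight_rotate1)
  qed (use fin in auto)
  moreover have "sum (cycle_weight A) S = sum (cycle_weight A) F + sum (cycle_weight A) (S - F)"
    using fin by (subst sum.subset_diff[of F S]) (auto simp: F_def)
  moreover have "tr (A ^\<^sub>m q) = sum (cycle_weight A) S"
    unfolding k S_def by (rule tr_pow_cycles[OF A])
  moreover have "int q dvd (\<Sum>i<n. A $$ (i,i) ^ q) - (\<Sum>i<n. A $$ (i,i))"
    unfolding sum_subtractf[symmetric] by (intro dvd_sum prime_dvd_power_diff q)
  ultimately have "int q dvd ((\<Sum>i<n. A $$ (i,i) ^ q) - (\<Sum>i<n. A $$ (i,i))) + sum (cycle_weight A) (S - F)"
    and "tr (A ^\<^sub>m q) - tr A = ((\<Sum>i<n. A $$ (i,i) ^ q) - (\<Sum>i<n. A $$ (i,i))) + sum (cycle_weight A) (S - F)"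
    using A by (auto simp: tr_def)
  thus ?thesis by simp
qed

text \<open>The exponent \<open>k\<close> may be replaced by \<open>N \<equiv> k (mod m)\<close> all of whose prime factors \<open>q\<close> exceed twice
  the bound on the traces; the congruence modulo \<open>q\<close> is then an equality.\<close>

theorem tr_pow_coprime:
  fixes A :: "int mat"
  assumes A: "A \<in> carrier_mat n n" and m: "m > 0" and per: "\<And>j. tr (A ^\<^sub>m (j + m)) = tr (A ^\<^sub>m j)"
    and k: "coprime k m"
  shows "tr (A ^\<^sub>m (k * j)) = tr (A ^\<^sub>m j)"
proof -
  have per': "tr (A ^\<^sub>m (i + m * l)) = tr (A ^\<^sub>m i)" for i l
  proof (induction l)
    case (Suc l)
    have "i + m * Suc l = (i + m * l) + m" by simp
    thus ?case using per[of "i + m * l"] Suc by metis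
  qed simp
  have permod: "tr (A ^\<^sub>m (i mod m)) = tr (A ^\<^sub>m i)" for i
    using per'[of "i mod m" "i div m"] by simp
  define B where "B = (\<Sum>i<m. nat \<bar>tr (A ^\<^sub>m i)\<bar>)"
  have B: "\<bar>tr (A ^\<^sub>m i)\<bar> \<le> int B" for i
  proof -
    have "nat \<bar>tr (A ^\<^sub>m (i mod m))\<bar> \<le> B"
      unfolding B_def using m by (intro member_le_sum) auto
    thus ?thesis unfolding permod by simp
  qed
  have big_prime: "tr (A ^\<^sub>m (q * i)) = tr (A ^\<^sub>m i)" if "prime q" "q > 2 * B" for q i
  proof -
    have "int q dvd tr ((A ^\<^sub>m i) ^\<^sub>m q) - tr (A ^\<^sub>m i)"
      using A that(1) by (intro tr_pow_prime_cong[of _ n]) auto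
    hence "int q dvd tr (A ^\<^sub>m (q * i)) - tr (A ^\<^sub>m i)"
      by (simp add: pow_mat_times[OF A, symmetric] mult.commute)
    moreover have "\<bar>tr (A ^\<^sub>m (q * i)) - tr (A ^\<^sub>m i)\<bar> < int q"
      using B[of "q * i"] B[of i] that(2) by linarith
    ultimately have "tr (A ^\<^sub>m (q * i)) - tr (A ^\<^sub>m i) = 0"
      using zdvd_not_zless[of "\<bar>tr (A ^\<^sub>m (q * i)) - tr (A ^\<^sub>m i)\<bar>" "int q"] by (cases "tr (A ^\<^sub>m (q * i)) - tr (A ^\<^sub>m i) = 0") auto
    thus ?thesis by simp
  qed
  have big: "tr (A ^\<^sub>m (N * i)) = tr (A ^\<^sub>m i)" if "N > 0" "\<And>q. prime q \<Longrightarrow> q dvd N \<Longrightarrow> q > 2 * B" for N i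
    using that
  proof (induction N arbitrary: i rule: less_induct)
    case (less N)
    show ?case
    proof (cases "N = 1")
      case False
      then obtain q where q: "prime q" "q dvd N" using prime_factor_nat by blast
      then obtain N' where N': "N = q * N'" by blast
      have "N' > 0" "N' < N" using N' less.prems(1) prime_gt_1_nat[OF q(1)] by auto
      hence "tr (A ^\<^sub>m (N' * i)) = tr (A ^\<^sub>m i)"
        using less.prems(2) by (intro less.IH) (auto simp: N')
      thus ?thesis
        using big_prime[OF q(1) less.prems(2)[OF q], of "N' * i"] by (simp add: N' mult.assoc)
    qed simp
  qed
  \<comment> \<open>Chosen so that no prime up to \<open>2 * B\<close> divides
    \<open>N = k + m * M\<close>: such a prime divides exactly one of the two summands. If it
    divides \<open>k\<close>, it divides neither \<open>m\<close>, by coprimality, nor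
    \<open>M\<close>; otherwise it divides \<open>M\<close>.\<close>
  define M where "M = \<Prod>{q. prime q \<and> q \<le> 2 * B \<and> \<not> q dvd k}"
  have finP: "finite {q::nat. prime q \<and> q \<le> 2 * B \<and> \<not> q dvd k}"
    by (rule finite_subset[of _ "{..2 * B}"]) auto
  have Mpos: "M > 0" unfolding M_def by (intro prod_pos) (auto simp: prime_gt_0_nat)
  define N where "N = k + m * M"
  have "tr (A ^\<^sub>m (N * j)) = tr (A ^\<^sub>m j)"
  proof (rule big)
    show "N > 0" using m Mpos by (simp add: N_def)
    fix q assume q: "prime q" "q dvd N"
    show "q > 2 * B"
    proof (rule ccontr)
      assume le: "\<not> q > 2 * B"
      show False
      proof (cases "q dvd k")
        case True
        hence qm: "\<not> q dvd m" using k q(1) by (metis coprime_common_divisor not_prime_unit)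
        have "q dvd m * M" using q(2) True by (simp add: N_def dvd_add_right_iff)
        hence "q dvd M" using qm q(1) by (simp add: prime_dvd_mult_iff)
        then obtain q' where "prime q'" "\<not> q' dvd k" "q dvd q'"
          unfolding M_def using q(1) finP by (auto simp: prime_dvd_prod_iff)
        thus False using q(1) True primes_dvd_imp_eq by blast
      next
        case False
        hence "q dvd M" unfolding M_def using q(1) le finP by (intro dvd_prodI) auto
        hence "q dvd k" using q(2) by (simp add: N_def dvd_add_left_iff)
        thus False using False by simp
      qed
    qed
  qed
  moreover have "N * j = k * j + m * (M * j)" by (simp add: N_def algebra_simps)
  ultimately show ?thesis using per' by metis
qed

section \<open>Words, integral vectors and lattices\<close>

lemma carrier_GL: "carrier (GL n) = {A \<in> carrier_mat n n. \<exists>B \<in> carrier_mat n n. B * A = 1\<^sub>m n \<and> A * B = 1\<^sub>m n}"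
  by (auto simp: GL_def units_of_carrier Units_def ring_mat_simps)

lemma mult_GL [simp]: "x \<otimes>\<^bsub>GL n\<^esub> y = x * y"
  by (simp add: GL_def units_of_mult ring_mat_simps)

lemma one_GL [simp]: "\<one>\<^bsub>GL n\<^esub> = 1\<^sub>m n"
  by (simp add: GL_def units_of_one ring_mat_simps)

lemma GL_carrier_mat: "A \<in> carrier (GL n) \<Longrightarrow> A \<in> carrier_mat n n"
  by (simp add: carrier_GL)

lemma GL_inv:
  assumes "A \<in> carrier (GL n)"
  shows "inv\<^bsub>GL n\<^esub> A \<in> carrier (GL n)" "inv\<^bsub>GL n\<^esub> A \<in> carrier_mat n n"
    "inv\<^bsub>GL n\<^esub> A * A = 1\<^sub>m n" "A * inv\<^bsub>GL n\<^esub> A = 1\<^sub>m n"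
proof -
  interpret group "GL n" by (rule group_GL)
  show "inv\<^bsub>GL n\<^esub> A \<in> carrier (GL n)" using assms by simp
  thus "inv\<^bsub>GL n\<^esub> A \<in> carrier_mat n n" by (rule GL_carrier_mat)
  show "inv\<^bsub>GL n\<^esub> A * A = 1\<^sub>m n" "A * inv\<^bsub>GL n\<^esub> A = 1\<^sub>m n"
    using l_inv[OF assms] r_inv[OF assms] by simp_all
qed

lemma similar_imp_conjugate_in:
  assumes "similar_mat A B" "B \<in> carrier_mat n n"
  shows "conjugate_in (GL n) A B"
proof -
  obtain P Q where PQ: "P \<in> carrier_mat n n" "Q \<in> carrier_mat n n" "P * Q = 1\<^sub>m n" "Q * P = 1\<^sub>m n" "A = P * B * Q"
    using similar_matD[OF assms(1)] assms(2) by auto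
  interpret group "GL n" by (rule group_GL)
  have P: "P \<in> carrier (GL n)" "Q \<in> carrier (GL n)" using PQ by (auto simp: carrier_GL)
  have "inv\<^bsub>GL n\<^esub> P = Q" using P PQ by (intro inv_equality) auto
  thus ?thesis unfolding conjugate_in_def using P PQ by (intro bexI[of _ P]) auto
qed

section \<open>Actions of words on sets that respect a presentation\<close>

lemma foldr_in_invariant:
  assumes "w \<in> words Y" "s \<in> V" "\<And>x b s. x \<in> Y \<Longrightarrow> s \<in> V \<Longrightarrow> a (x, b) s \<in> V"
  shows "foldr a w s \<in> V"
  using assms(1) by (induction w) (auto simp: words_def assms)

text \<open>Induction over the congruence. The last letter of a word acts first, so concatenation
  becomes composition of left actions. The set \<open>V\<close> confines the states to those on
  which inverse letters really cancel.\<close>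

lemma foldr_pres_cong:
  assumes "(u, v) \<in> pres_cong Y R" and R: "R \<subseteq> words Y \<times> words Y"
    and closed: "\<And>x b s. x \<in> Y \<Longrightarrow> s \<in> V \<Longrightarrow> a (x, b) s \<in> V"
    and cancel: "\<And>x b s. x \<in> Y \<Longrightarrow> s \<in> V \<Longrightarrow> a (x, b) (a (x, \<not> b) s) = s"
    and rel: "\<And>l r s. (l, r) \<in> R \<Longrightarrow> s \<in> V \<Longrightarrow> foldr a l s = foldr a r s"
    and "s \<in> V"
  shows "foldr a u s = foldr a v s"
  using assms(1,6)
proof (induction arbitrary: s)
  case (append u u' v v')
  have "v' \<in> words Y" using pres_cong_in_words[OF R append.hyps(2)] by simp
  hence "foldr a v' s \<in> V" using append.prems closed by (intro foldr_in_invariant)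
  thus ?case using append by simp
qed (simp_all add: cancel rel)

text \<open>Two inductions: over the power of a single generator, and over the truncations
  \<open>pre k\<close> of \<open>v\<close> to its first \<open>k\<close> coordinates.\<close>

lemma foldr_x_power:
  fixes P :: "int vec \<Rightarrow> 's \<Rightarrow> 's"
  assumes v: "v \<in> carrier_vec n" and s: "s \<in> V"
    and closed: "\<And>v s. v \<in> carrier_vec n \<Longrightarrow> s \<in> V \<Longrightarrow> P v s \<in> V"
    and pos: "\<And>i s. i < n \<Longrightarrow> s \<in> V \<Longrightarrow> a (X i, True) s = P (unit_vec n i) s"
    and neg: "\<And>i s. i < n \<Longrightarrow> s \<in> V \<Longrightarrow> a (X i, False) s = P (- unit_vec n i) s"
    and add: "\<And>v w s. v \<in> carrier_vec n \<Longrightarrow> w \<in> carrier_vec n \<Longrightarrow> s \<in> V \<Longrightarrow> P (v + w) s = P v (P w s)"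
    and zero: "\<And>s. s \<in> V \<Longrightarrow> P (0\<^sub>v n) s = s"
  shows "foldr a (x_power v) s = P v s"
proof -
  have gen: "foldr a (gen_power (X i) k) s = P (k \<cdot>\<^sub>v unit_vec n i) s" if i: "i < n" and s: "s \<in> V" for i k s
  proof -
    have p: "foldr a (replicate m (X i, True)) s = P (int m \<cdot>\<^sub>v unit_vec n i) s" for m
    proof (induction m)
      case 0
      have "int 0 \<cdot>\<^sub>v unit_vec n i = 0\<^sub>v n" by (intro eq_vecI) auto
      thus ?case using zero[OF s] by simp
    next
      case (Suc m)
      have "int (Suc m) \<cdot>\<^sub>v unit_vec n i = unit_vec n i + int m \<cdot>\<^sub>v unit_vec n i"
        by (intro eq_vecI) (auto simp: algebra_simps)
      moreover have "P (int m \<cdot>\<^sub>v unit_vec n i) s \<in> V" using closed s by simp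
      ultimately show ?case using Suc pos[OF i] add[of "unit_vec n i" "int m \<cdot>\<^sub>v unit_vec n i", OF _ _ s] by simp
    qed
    have q: "foldr a (replicate m (X i, False)) s = P ((- int m) \<cdot>\<^sub>v unit_vec n i) s" for m
    proof (induction m)
      case 0
      have "(- int 0) \<cdot>\<^sub>v unit_vec n i = 0\<^sub>v n" by (intro eq_vecI) auto
      thus ?case using zero[OF s] by simp
    next
      case (Suc m)
      have "(- int (Suc m)) \<cdot>\<^sub>v unit_vec n i = - unit_vec n i + (- int m) \<cdot>\<^sub>v unit_vec n i"
        by (intro eq_vecI) (auto simp: algebra_simps)
      moreover have "P ((- int m) \<cdot>\<^sub>v unit_vec n i) s \<in> V" using closed s by simp
      ultimately show ?case using Suc neg[OF i] add[of "- unit_vec n i" "(- int m) \<cdot>\<^sub>v unit_vec n i", OF _ _ s] by simp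
    qed
    show ?thesis
      using p[of "nat k"] q[of "nat (- k)"] by (cases "k \<ge> 0") (simp_all add: gen_power_def)
  qed
  define pre where "pre k = vec n (\<lambda>j. if j < k then v $ j else 0)" for k
  have pre: "pre k \<in> carrier_vec n" for k by (simp add: pre_def)
  have "foldr a (concat (map (\<lambda>i. gen_power (X i) (v $ i)) [0..<k])) s = P (pre k) s" if "k \<le> n" "s \<in> V" for k s
    using that
  proof (induction k arbitrary: s)
    case 0
    have "pre 0 = 0\<^sub>v n" by (intro eq_vecI) (auto simp: pre_def)
    thus ?case using zero[OF \<open>s \<in> V\<close>] by simp
  next
    case (Suc k)
    have "pre (Suc k) = pre k + v $ k \<cdot>\<^sub>v unit_vec n k"
      by (intro eq_vecI) (auto simp: pre_def less_Suc_eq unit_vec_def)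
    moreover have "P (v $ k \<cdot>\<^sub>v unit_vec n k) s \<in> V" using closed Suc.prems by simp
    ultimately show ?case
      using Suc gen[of k s "v $ k"] add[of "pre k" "v $ k \<cdot>\<^sub>v unit_vec n k" s] pre by simp
  qed
  moreover have "pre n = v" using v by (intro eq_vecI) (auto simp: pre_def)
  ultimately show ?thesis using s v by (simp add: x_power_def)
qed

section \<open>Integral vectors in rational space and common denominators\<close>

abbreviation rv :: "int vec \<Rightarrow> rat vec" where "rv \<equiv> map_vec rat_of_int"

lemma rv_add: "v \<in> carrier_vec n \<Longrightarrow> w \<in> carrier_vec n \<Longrightarrow> rv (v + w) = rv v + rv w"
  by (rule eq_vecI) auto

lemma rv_smult: "rv (k \<cdot>\<^sub>v v) = rat_of_int k \<cdot>\<^sub>v rv v"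
  by (rule eq_vecI) auto

lemma rv_uminus: "rv (- v) = - rv v"
  by (rule eq_vecI) auto

lemma rv_zero [simp]: "rv (0\<^sub>v n) = 0\<^sub>v n"
  by (rule eq_vecI) auto

lemma rv_unit [simp]: "rv (unit_vec n i) = unit_vec n i"
  by (rule eq_vecI) (auto simp: unit_vec_def)

lemma rv_inject: "rv v = rv w \<longleftrightarrow> v = w"
proof
  assume eq: "rv v = rv w"
  have "dim_vec (rv v) = dim_vec (rv w)" unfolding eq ..
  moreover have "rv v $ i = rv w $ i" for i unfolding eq ..
  ultimately show "v = w"
    by (intro eq_vecI) (auto, metis index_map_vec(1) of_int_eq_iff)
qed simp

lemma mult_mat_vec_uminus: "A \<in> carrier_mat m n \<Longrightarrow> v \<in> carrier_vec n \<Longrightarrow> A *\<^sub>v (- v) = - (A *\<^sub>v (v :: rat vec))"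
  by (rule eq_vecI) auto

lemma common_denominator:
  fixes f :: "'a \<Rightarrow> rat"
  assumes "finite I"
  obtains d :: int where "d > 0" "\<And>i. i \<in> I \<Longrightarrow> rat_of_int d * f i \<in> \<int>"
proof -
  define den where "den i = snd (quotient_of (f i))" for i
  have den: "den i > 0" "rat_of_int (den i) * f i \<in> \<int>" for i
  proof -
    show p: "den i > 0" using quotient_of_denom_pos' by (simp add: den_def)
    have "f i = of_int (fst (quotient_of (f i))) / of_int (den i)"
      unfolding den_def by (rule quotient_of_div) simp
    thus "rat_of_int (den i) * f i \<in> \<int>" using p by (metis Ints_of_int less_irrefl nonzero_mult_div_cancel_left of_int_eq_0_iff times_divide_eq_right)
  qed
  show ?thesis
  proof
    show "(\<Prod>i\<in>I. den i) > 0" by (intro prod_pos) (simp add: den)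
    fix i assume i: "i \<in> I"
    have "rat_of_int (\<Prod>i\<in>I. den i) * f i = rat_of_int (\<Prod>j\<in>I - {i}. den j) * (rat_of_int (den i) * f i)"
      using prod.remove[OF assms i, of den] by simp
    also have "\<dots> \<in> \<int>" by (intro Ints_mult den) auto
    finally show "rat_of_int (\<Prod>i\<in>I. den i) * f i \<in> \<int>" .
  qed
qed

lemma rat_vec_integral:
  assumes "w \<in> carrier_vec n" "\<And>i. i < n \<Longrightarrow> w $ i \<in> \<int>"
  obtains v where "v \<in> carrier_vec n" "rv v = w"
proof
  show "vec n (\<lambda>i. \<lfloor>w $ i\<rfloor>) \<in> carrier_vec n" by simp
  show "rv (vec n (\<lambda>i. \<lfloor>w $ i\<rfloor>)) = w"
    using assms by (intro eq_vecI) (auto simp: of_int_floor)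
qed

lemma rat_mat_denominator:
  assumes "M \<in> carrier_mat m n"
  obtains d :: int where "d > 0"
    "\<And>v. v \<in> carrier_vec n \<Longrightarrow> \<exists>w \<in> carrier_vec m. M *\<^sub>v rv (d \<cdot>\<^sub>v v) = rv w"
proof -
  obtain d :: int where d: "d > 0" "\<And>ij. ij \<in> {..<m} \<times> {..<n} \<Longrightarrow> rat_of_int d * M $$ ij \<in> \<int>"
    using common_denominator[of "{..<m} \<times> {..<n}" "\<lambda>ij. M $$ ij"] by auto
  show ?thesis
  proof (rule that[OF d(1)])
    fix v :: "int vec" assume v: "v \<in> carrier_vec n"
    have int: "(M *\<^sub>v rv (d \<cdot>\<^sub>v v)) $ i \<in> \<int>" if "i < m" for i
    proof -
      have "(M *\<^sub>v rv (d \<cdot>\<^sub>v v)) $ i = (\<Sum>j<n. (rat_of_int d * M $$ (i,j)) * rat_of_int (v $ j))"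
        using that assms v by (auto simp: scalar_prod_def atLeast0LessThan intro!: sum.cong)
      also have "\<dots> \<in> \<int>" using d(2) that by (intro Ints_sum Ints_mult[of "rat_of_int d * M $$ (i, _)"]) auto
      finally show ?thesis .
    qed
    have "M *\<^sub>v rv (d \<cdot>\<^sub>v v) \<in> carrier_vec m" using assms v by auto
    from rat_vec_integral[OF this int] obtain w where "w \<in> carrier_vec m" "rv w = M *\<^sub>v rv (d \<cdot>\<^sub>v v)" by metis
    thus "\<exists>w \<in> carrier_vec m. M *\<^sub>v rv (d \<cdot>\<^sub>v v) = rv w" by (intro bexI[of _ w]) auto
  qed
qed

lemma (in group) commute_int_pow:
  assumes x: "x \<in> carrier G" "y \<in> carrier G" and xy: "x \<otimes> y = y \<otimes> x"
  shows "x \<otimes> y [^] (k::int) = y [^] k \<otimes> x"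
proof -
  have nat: "x \<otimes> y [^] (m::nat) = y [^] m \<otimes> x" for m
  proof (induction m)
    case (Suc m)
    thus ?case using x xy by (simp add: m_assoc[symmetric]) (simp add: m_assoc)
  qed (use x in simp)
  have inv: "x \<otimes> inv z = inv z \<otimes> x" if "z \<in> carrier G" "x \<otimes> z = z \<otimes> x" for z
  proof -
    have "x \<otimes> inv z = inv z \<otimes> (z \<otimes> x) \<otimes> inv z" using that(1) x m_assoc[of "inv z" z x] by simp
    also have "\<dots> = inv z \<otimes> (x \<otimes> z) \<otimes> inv z" using that(2) by simp
    also have "\<dots> = inv z \<otimes> x" using that(1) x by (simp add: m_assoc)
    finally show ?thesis .
  qed
  show ?thesis
  proof (cases "k < 0")
    case True
    show ?thesis using inv[OF _ nat[of "nat (- k)"]] x True by (simp only: int_pow_def2 if_True nat_pow_closed)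
  next
    case False
    show ?thesis using nat[of "nat k"] False by (simp only: int_pow_def2 if_False)
  qed
qed

locale leary_minasyan =
  fixes n :: nat and A :: "rat mat" and L :: "int vec set"
  assumes A_GL: "A \<in> carrier (GL n)" and L_index: "finite_index_subgroup L (integral_part n A)"
begin

abbreviation "R \<equiv> lm_relations n A L"
abbreviation "G \<equiv> LM_group n A L"
definition "cls w = pres_cong (gens n) R `` {w}"
definition "Ai = inv\<^bsub>GL n\<^esub> A"
definition "Ap (j::int) = A [^]\<^bsub>GL n\<^esub> j"
definition "XP v = cls (x_power v)"
definition "tt = cls [(T, True)]"
definition "ti = cls [(T, False)]"

lemma A [simp]: "A \<in> carrier_mat n n" using A_GL by (rule GL_carrier_mat)
lemma Ai [simp]: "Ai \<in> carrier_mat n n" and Ai_GL: "Ai \<in> carrier (GL n)"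
  and AiA: "Ai * A = 1\<^sub>m n" and AAi: "A * Ai = 1\<^sub>m n"
  using GL_inv[OF A_GL] by (auto simp: Ai_def)

lemma Ap_GL: "Ap j \<in> carrier (GL n)"
proof -
  interpret group "GL n" by (rule group_GL)
  show ?thesis using A_GL by (simp add: Ap_def)
qed

lemma Ap [simp]: "Ap j \<in> carrier_mat n n"
  using Ap_GL by (rule GL_carrier_mat)

lemma Ap_add: "Ap (i + j) = Ap i * Ap j"
proof -
  interpret group "GL n" by (rule group_GL)
  show ?thesis using int_pow_mult[OF A_GL, of i j] by (simp add: Ap_def)
qed

lemma Ap_0 [simp]: "Ap 0 = 1\<^sub>m n" by (simp add: Ap_def)

lemma Ap_1 [simp]: "Ap 1 = A"
proof -
  interpret group "GL n" by (rule group_GL)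
  show ?thesis using A_GL by (simp add: Ap_def)
qed

lemma Ap_m1 [simp]: "Ap (- 1) = Ai"
proof -
  interpret group "GL n" by (rule group_GL)
  show ?thesis using A_GL int_pow_neg[OF A_GL, of 1] by (simp add: Ap_def Ai_def)
qed

lemma Ap_nat: "Ap (int k) = A ^\<^sub>m k"
proof (induction k)
  case (Suc k)
  have "Ap (int (Suc k)) = Ap (int k) * Ap 1" unfolding Ap_add[symmetric] by (simp add: add.commute)
  thus ?case using Suc by simp
qed (simp add: carrier_matD[OF A])

lemma L_subgroup: "subgroup L (integral_part n A)"
  and L_finite: "finite (rcosets\<^bsub>integral_part n A\<^esub> L)"
  using L_index by (auto simp: finite_index_subgroup_def)

lemma carrier_integral_part:
  "carrier (integral_part n A) = {v \<in> carrier_vec n. \<exists>w\<in>carrier_vec n. A *\<^sub>v rv v = rv w}"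
  by (simp add: integral_part_def)

lemma mult_integral_part [simp]: "v \<otimes>\<^bsub>integral_part n A\<^esub> w = v + w"
  by (simp add: integral_part_def monoid_vec_simps)

lemma one_integral_part [simp]: "\<one>\<^bsub>integral_part n A\<^esub> = 0\<^sub>v n"
  by (simp add: integral_part_def monoid_vec_simps)

lemma L_carrier: "v \<in> L \<Longrightarrow> v \<in> carrier_vec n"
  using subgroup.subset[OF L_subgroup] carrier_integral_part by auto

lemma L_image: "v \<in> L \<Longrightarrow> \<exists>w\<in>carrier_vec n. A *\<^sub>v rv v = rv w"
  using subgroup.subset[OF L_subgroup] carrier_integral_part by auto

lemma L_add: "v \<in> L \<Longrightarrow> w \<in> L \<Longrightarrow> v + w \<in> L"
  using subgroup.m_closed[OF L_subgroup] by simp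

lemma L_zero: "0\<^sub>v n \<in> L"
  using subgroup.one_closed[OF L_subgroup] by simp

lemma L_uminus: assumes v: "v \<in> L" shows "- v \<in> L"
proof -
  interpret group "integral_part n A" by (rule group_integral_part) simp
  have "inv\<^bsub>integral_part n A\<^esub> v = - v"
  proof (rule inv_equality)
    show "- v \<otimes>\<^bsub>integral_part n A\<^esub> v = \<one>\<^bsub>integral_part n A\<^esub>" using L_carrier[OF v] by simp
    show "v \<in> carrier (integral_part n A)" using v subgroup.subset[OF L_subgroup] by auto
    obtain w where "w \<in> carrier_vec n" "A *\<^sub>v rv v = rv w" using L_image[OF v] by auto
    hence "A *\<^sub>v rv (- v) = rv (- w)" using L_carrier[OF v] by (simp add: rv_uminus mult_mat_vec_uminus[OF A])
    thus "- v \<in> carrier (integral_part n A)"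
      unfolding carrier_integral_part using L_carrier[OF v] \<open>w \<in> _\<close> by auto
  qed
  thus ?thesis using subgroup.m_inv_closed[OF L_subgroup v] by simp
qed

lemma L_nat_smult: "v \<in> L \<Longrightarrow> int k \<cdot>\<^sub>v v \<in> L"
proof (induction k)
  case 0
  have "int 0 \<cdot>\<^sub>v v = 0\<^sub>v n" using L_carrier[OF 0] by (intro eq_vecI) auto
  thus ?case using L_zero by simp
next
  case (Suc k)
  have "int (Suc k) \<cdot>\<^sub>v v = v + int k \<cdot>\<^sub>v v"
    using L_carrier[OF Suc.prems] by (intro eq_vecI) (auto simp: algebra_simps)
  thus ?case using Suc L_add by simp
qed

lemma L_smult: "v \<in> L \<Longrightarrow> k \<cdot>\<^sub>v v \<in> L"
proof (cases "k \<ge> 0")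
  case True
  thus "v \<in> L \<Longrightarrow> k \<cdot>\<^sub>v v \<in> L" using L_nat_smult[of v "nat k"] by simp
next
  case False
  assume v: "v \<in> L"
  have "k \<cdot>\<^sub>v v = - (int (nat (- k)) \<cdot>\<^sub>v v)" using False by (intro eq_vecI) auto
  thus ?thesis using L_uminus[OF L_nat_smult[OF v, of "nat (- k)"]] by (simp only:)
qed

text \<open>Pigeonhole for finite index: two of the cosets of the multiples of \<open>v\<close>
  coincide, and the difference of their indices is the multiplier.\<close>

lemma L_multiple_of_integral:
  assumes v: "v \<in> carrier (integral_part n A)"
  shows "\<exists>k>0. int k \<cdot>\<^sub>v v \<in> L"
proof -
  interpret group "integral_part n A" by (rule group_integral_part) simp
  have vc: "v \<in> carrier_vec n" using v by (simp add: carrier_integral_part)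
  have kv: "int k \<cdot>\<^sub>v v \<in> carrier (integral_part n A)" for k
  proof (induction k)
    case 0
    have "int 0 \<cdot>\<^sub>v v = 0\<^sub>v n" using vc by (intro eq_vecI) auto
    thus ?case using one_closed by simp
  next
    case (Suc k)
    have "int (Suc k) \<cdot>\<^sub>v v = v + int k \<cdot>\<^sub>v v"
      using vc by (intro eq_vecI) (auto simp: algebra_simps)
    thus ?case using m_closed[OF v Suc] by simp
  qed
  let ?f = "\<lambda>k. L #>\<^bsub>integral_part n A\<^esub> (int k \<cdot>\<^sub>v v)"
  have "range ?f \<subseteq> rcosets\<^bsub>integral_part n A\<^esub> L"
    using rcosetsI[OF subgroup.subset[OF L_subgroup] kv] by auto
  hence "finite (range ?f)" using L_finite finite_subset by blast
  hence "\<not> inj ?f" using finite_imageD by (meson infinite_UNIV_nat)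
  then obtain i j where ij: "i < j" "?f i = ?f j"
    unfolding inj_def by (metis linorder_neqE_nat)
  have "int j \<cdot>\<^sub>v v \<in> ?f i" unfolding ij(2) by (rule rcos_self[OF kv L_subgroup])
  then obtain l where l: "l \<in> L" "int j \<cdot>\<^sub>v v = l + int i \<cdot>\<^sub>v v" by (auto simp: r_coset_def)
  have "int (j - i) \<cdot>\<^sub>v v = l"
  proof (rule eq_vecI)
    fix a assume a: "a < dim_vec l"
    have "(int j \<cdot>\<^sub>v v) $ a = (l + int i \<cdot>\<^sub>v v) $ a" using l(2) by simp
    thus "(int (j - i) \<cdot>\<^sub>v v) $ a = l $ a"
      using a vc L_carrier[OF l(1)] ij(1) by (auto simp: algebra_simps of_nat_diff)
  qed (use vc L_carrier[OF l(1)] in auto)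
  thus ?thesis using l(1) ij(1) by (intro exI[of _ "j - i"]) auto
qed

lemma L_sum_closed:
  assumes "finite I" "\<And>i. i \<in> I \<Longrightarrow> f i \<in> L"
  shows "vec n (\<lambda>a. \<Sum>i\<in>I. f i $ a) \<in> L"
  using assms
proof (induction I rule: finite_induct)
  case empty
  have "vec n (\<lambda>a. \<Sum>i\<in>{}. f i $ a) = 0\<^sub>v n" by (intro eq_vecI) auto
  thus ?case using L_zero by simp
next
  case (insert x F)
  have "vec n (\<lambda>a. \<Sum>i\<in>insert x F. f i $ a) = f x + vec n (\<lambda>a. \<Sum>i\<in>F. f i $ a)"
    using insert L_carrier[of "f x"] by (intro eq_vecI) auto
  thus ?case using insert L_add by auto
qed

text \<open>One multiplier serves all vectors: \<open>d\<close> clears the denominators of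
  \<open>A\<close>, which brings the unit vectors into the group where \<open>L\<close> has finite
  index, and \<open>K\<close> is the product of the multipliers that move them on into
  \<open>L\<close>.\<close>

lemma L_multiple:
  obtains N :: int where "N > 0" "\<And>v. v \<in> carrier_vec n \<Longrightarrow> N \<cdot>\<^sub>v v \<in> L"
proof -
  obtain d :: int where d: "d > 0"
    "\<And>v. v \<in> carrier_vec n \<Longrightarrow> \<exists>w \<in> carrier_vec n. A *\<^sub>v rv (d \<cdot>\<^sub>v v) = rv w"
    using rat_mat_denominator[OF A] by metis
  have "d \<cdot>\<^sub>v unit_vec n i \<in> carrier (integral_part n A)" for i
    using d(2)[of "unit_vec n i"] by (auto simp: carrier_integral_part)
  hence "\<exists>k>0. int k \<cdot>\<^sub>v (d \<cdot>\<^sub>v unit_vec n i) \<in> L" for i by (rule L_multiple_of_integral)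
  then obtain k where k: "\<And>i. k i > 0" "\<And>i. int (k i) \<cdot>\<^sub>v (d \<cdot>\<^sub>v unit_vec n i) \<in> L" by metis
  define K where "K = (\<Prod>i<n. int (k i))"
  have K: "K > 0" unfolding K_def by (intro prod_pos) (use k in auto)
  have KL: "(K * d) \<cdot>\<^sub>v unit_vec n i \<in> L" if "i < n" for i
  proof -
    have "(K * d) \<cdot>\<^sub>v unit_vec n i = (\<Prod>j\<in>{..<n} - {i}. int (k j)) \<cdot>\<^sub>v (int (k i) \<cdot>\<^sub>v (d \<cdot>\<^sub>v unit_vec n i))"
      unfolding K_def using that
      by (subst prod.remove[of _ i]) (auto simp: smult_smult_assoc mult_ac)
    thus ?thesis using L_smult[OF k(2)] by simp
  qed
  show ?thesis
  proof (rule that[of "K * d"])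
    show "K * d > 0" using K d by simp
    fix v :: "int vec" assume v: "v \<in> carrier_vec n"
    have "vec n (\<lambda>a. \<Sum>i<n. (v $ i \<cdot>\<^sub>v ((K * d) \<cdot>\<^sub>v unit_vec n i)) $ a) \<in> L"
      by (intro L_sum_closed L_smult KL) auto
    moreover have "vec n (\<lambda>a. \<Sum>i<n. (v $ i \<cdot>\<^sub>v ((K * d) \<cdot>\<^sub>v unit_vec n i)) $ a) = (K * d) \<cdot>\<^sub>v v"
    proof (rule eq_vecI)
      fix a assume "a < dim_vec ((K * d) \<cdot>\<^sub>v v)"
      hence a: "a < n" using v by simp
      have "(\<Sum>i<n. (v $ i \<cdot>\<^sub>v ((K * d) \<cdot>\<^sub>v unit_vec n i)) $ a) = (\<Sum>i<n. if i = a then v $ i * (K * d) else 0)"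
        using a by (intro sum.cong) (auto simp: unit_vec_def)
      thus "vec n (\<lambda>a. \<Sum>i<n. (v $ i \<cdot>\<^sub>v ((K * d) \<cdot>\<^sub>v unit_vec n i)) $ a) $ a = ((K * d) \<cdot>\<^sub>v v) $ a"
        using a v by simp
    qed (use v in auto)
    ultimately show "(K * d) \<cdot>\<^sub>v v \<in> L" by simp
  qed
qed

text \<open>The preimage of \<open>w\<close> under \<open>A\<close> becomes integral after
  multiplication by a denominator \<open>d\<close> of the inverse matrix, and then lies in
  \<open>L\<close> after multiplication by \<open>N\<close>.\<close>

lemma AL_multiple:
  obtains N :: int where "N > 0" "\<And>w. w \<in> carrier_vec n \<Longrightarrow> \<exists>v \<in> L. A *\<^sub>v rv v = rv (N \<cdot>\<^sub>v w)"
proof -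
  obtain N :: int where N: "N > 0" "\<And>v. v \<in> carrier_vec n \<Longrightarrow> N \<cdot>\<^sub>v v \<in> L" using L_multiple by metis
  obtain d :: int where d: "d > 0"
    "\<And>v. v \<in> carrier_vec n \<Longrightarrow> \<exists>w \<in> carrier_vec n. Ai *\<^sub>v rv (d \<cdot>\<^sub>v v) = rv w"
    using rat_mat_denominator[OF Ai] by metis
  show ?thesis
  proof (rule that[of "N * d"])
    show "N * d > 0" using N d by simp
    fix w :: "int vec" assume w: "w \<in> carrier_vec n"
    obtain u where u: "u \<in> carrier_vec n" "Ai *\<^sub>v rv (d \<cdot>\<^sub>v w) = rv u" using d(2)[OF w] by auto
    have "A *\<^sub>v rv u = rv (d \<cdot>\<^sub>v w)"
      using w by (simp add: u(2)[symmetric] assoc_mult_mat_vec[OF A Ai, symmetric] AAi)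
    hence "A *\<^sub>v rv (N \<cdot>\<^sub>v u) = rv ((N * d) \<cdot>\<^sub>v w)"
      using u(1) by (simp add: rv_smult mult_mat_vec[OF A] smult_smult_assoc)
    thus "\<exists>v \<in> L. A *\<^sub>v rv v = rv ((N * d) \<cdot>\<^sub>v w)" using N(2)[OF u(1)] by blast
  qed
qed

lemma R_words: "R \<subseteq> words (gens n) \<times> words (gens n)"
proof -
  have T: "[(T, e)] \<in> words (gens n)" for e by (auto simp: words_def gens_def)
  have X: "[(X i, True), (X j, True), (X i, False), (X j, False)] \<in> words (gens n)"
    if "i < j" "j < n" for i j
    using that by (auto simp: words_def gens_def)
  show ?thesis
    unfolding lm_relations_def using L_carrier
    by (auto intro!: words_append x_power_in_words T X Nil_in_words simp del: append_Cons append_Nil)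
qed

sublocale group G
  by (rule group_LM_group) (auto dest: L_carrier)

lemma cls_mult: "u \<in> words (gens n) \<Longrightarrow> v \<in> words (gens n) \<Longrightarrow> cls u \<otimes>\<^bsub>G\<^esub> cls v = cls (u @ v)"
  unfolding cls_def LM_group_def by (rule presented_group_mult_class[OF R_words])

lemma carrier_G: "carrier G = cls ` words (gens n)"
  by (auto simp: LM_group_def presented_group_def quotient_def cls_def)

lemma one_G: "\<one>\<^bsub>G\<^esub> = cls []"
  by (simp add: LM_group_def presented_group_def cls_def)

lemma cls_carrier: "w \<in> words (gens n) \<Longrightarrow> cls w \<in> carrier G"
  by (simp add: carrier_G)

lemma cls_eqI: "(u, v) \<in> pres_cong (gens n) R \<Longrightarrow> cls u = cls v"
  unfolding cls_def by (rule equiv_class_eq[OF equiv_pres_cong[OF R_words]])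

lemma letter_in_words: "x \<in> gens n \<Longrightarrow> [(x, b)] \<in> words (gens n)"
  by (simp add: words_def)

lemma T_gens [simp]: "T \<in> gens n" and X_gens [simp]: "X i \<in> gens n \<longleftrightarrow> i < n"
  by (auto simp: gens_def)

lemma cls_letter_inv: "x \<in> gens n \<Longrightarrow> cls [(x, False)] = inv\<^bsub>G\<^esub> cls [(x, True)]"
proof -
  assume x: "x \<in> gens n"
  have "cls [(x, False)] \<otimes>\<^bsub>G\<^esub> cls [(x, True)] = \<one>\<^bsub>G\<^esub>"
    using cls_eqI[OF pres_cong.cancel[OF x, of False]] x by (simp add: cls_mult letter_in_words one_G)
  thus ?thesis using x by (intro inv_equality[symmetric]) (auto simp: cls_carrier letter_in_words)
qed

end

section \<open>The Leary--Minasyan group and its affine representation\<close>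

lemma (in group) intertwine_inv:
  assumes "x \<in> carrier G" "a \<in> carrier G" "b \<in> carrier G" "x \<otimes> a = b \<otimes> x"
  shows "inv x \<otimes> b = a \<otimes> inv x"
proof -
  have "inv x \<otimes> b = inv x \<otimes> ((b \<otimes> x) \<otimes> inv x)" using assms(1-3) by (simp add: m_assoc)
  also have "\<dots> = inv x \<otimes> (x \<otimes> a) \<otimes> inv x" unfolding assms(4)[symmetric] using assms(1-3) by (simp add: m_assoc)
  also have "\<dots> = a \<otimes> inv x" using assms(1-3) by (simp add: m_assoc[symmetric])
  finally show ?thesis .
qed

context leary_minasyan
begin

definition gx :: "nat \<Rightarrow> lm_gen word set" where "gx i = cls [(X i, True)]"

lemma gx_carrier [simp]: "i < n \<Longrightarrow> gx i \<in> carrier G"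
  by (simp add: gx_def cls_carrier letter_in_words)

lemma tt_carrier [simp]: "tt \<in> carrier G" and ti_carrier [simp]: "ti \<in> carrier G"
  by (simp_all add: tt_def ti_def cls_carrier letter_in_words)

lemma ti_eq: "ti = inv\<^bsub>G\<^esub> tt"
  by (simp add: tt_def ti_def cls_letter_inv)

lemma gx_inv: "i < n \<Longrightarrow> cls [(X i, False)] = inv\<^bsub>G\<^esub> (gx i)"
  by (simp add: gx_def cls_letter_inv)

lemma replicate_words: "x \<in> gens n \<Longrightarrow> replicate k (x, b) \<in> words (gens n)"
  by (induction k) (auto simp: words_def)

lemma cls_replicate:
  assumes "x \<in> gens n"
  shows "cls (replicate k (x, b)) = cls [(x, b)] [^]\<^bsub>G\<^esub> k"
proof (induction k)
  case 0
  thus ?case by (simp add: one_G)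
next
  case (Suc k)
  have "cls (replicate (Suc k) (x, b)) = cls (replicate k (x, b) @ [(x, b)])"
    by (simp add: replicate_append_same)
  thus ?case using Suc assms
    by (simp add: cls_mult[symmetric] replicate_words letter_in_words del: replicate_append_same)
qed

lemma cls_gen_power:
  assumes "i < n"
  shows "cls (gen_power (X i) k) = gx i [^]\<^bsub>G\<^esub> k"
proof (cases "k < 0")
  case False
  hence "gen_power (X i) k = replicate (nat k) (X i, True)" by (simp add: gen_power_def)
  hence "cls (gen_power (X i) k) = gx i [^]\<^bsub>G\<^esub> nat k"
    using cls_replicate[of "X i" "nat k" True] assms by (simp only: gx_def X_gens)
  thus ?thesis using False by (simp only: int_pow_def2 if_False)
next
  case True
  hence "gen_power (X i) k = replicate (nat (- k)) (X i, False)" by (simp add: gen_power_def)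
  hence "cls (gen_power (X i) k) = (inv\<^bsub>G\<^esub> (gx i)) [^]\<^bsub>G\<^esub> nat (- k)"
    using cls_replicate[of "X i" "nat (- k)" False] assms by (simp only: gx_inv X_gens)
  thus ?thesis using True assms by (simp only: int_pow_def2 if_True nat_pow_inv gx_carrier)
qed

lemma gx_commute:
  assumes "i < n" "j < n"
  shows "gx i \<otimes>\<^bsub>G\<^esub> gx j = gx j \<otimes>\<^bsub>G\<^esub> gx i"
proof -
  have *: "gx i \<otimes>\<^bsub>G\<^esub> gx j = gx j \<otimes>\<^bsub>G\<^esub> gx i" if ij: "i < j" "j < n" for i j
  proof -
    have i: "i < n" using ij by simp
    have "([(X i, True), (X j, True), (X i, False), (X j, False)], []) \<in> R"
      using ij by (auto simp: lm_relations_def)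
    hence "cls [(X i, True), (X j, True), (X i, False), (X j, False)] = \<one>\<^bsub>G\<^esub>"
      unfolding one_G by (intro cls_eqI pres_cong.rel)
    moreover have "cls [(X i, True), (X j, True), (X i, False), (X j, False)] =
       cls ([(X i, True)] @ ([(X j, True)] @ ([(X i, False)] @ [(X j, False)])))" by simp
    ultimately have "gx i \<otimes>\<^bsub>G\<^esub> (gx j \<otimes>\<^bsub>G\<^esub> (inv\<^bsub>G\<^esub> (gx i) \<otimes>\<^bsub>G\<^esub> inv\<^bsub>G\<^esub> (gx j))) = \<one>\<^bsub>G\<^esub>"
      using ij i unfolding gx_inv[OF i, symmetric] gx_inv[OF ij(2), symmetric] unfolding gx_def
      by (subst cls_mult, simp_all add: letter_in_words words_append cls_mult del: append.simps)
    hence "(gx i \<otimes>\<^bsub>G\<^esub> gx j) \<otimes>\<^bsub>G\<^esub> inv\<^bsub>G\<^esub> (gx j \<otimes>\<^bsub>G\<^esub> gx i) = \<one>\<^bsub>G\<^esub>"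
      using ij i by (simp add: inv_mult_group m_assoc)
    thus ?thesis using ij i by (metis gx_carrier inv_equality inv_inv inv_closed m_closed)
  qed
  show ?thesis using *[of i j] *[of j i] assms by (cases "i = j") (auto simp: linorder_neq_iff)
qed

text \<open>The product over the first \<open>k\<close> generators only; additivity of
  \<open>XP\<close> is proved by induction on this \<open>k\<close>.\<close>

definition XL :: "nat \<Rightarrow> int vec \<Rightarrow> lm_gen word set" where
  "XL k v = cls (concat (map (\<lambda>i. gen_power (X i) (v $ i)) [0..<k]))"

lemma gen_power_words: "i < n \<Longrightarrow> gen_power (X i) k \<in> words (gens n)"
  by (simp add: gen_power_def replicate_words)

lemma XL_words: "k \<le> n \<Longrightarrow> concat (map (\<lambda>i. gen_power (X i) (v $ i)) [0..<k]) \<in> words (gens n)"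
  by (induction k) (auto simp: Nil_in_words words_append gen_power_words)

lemma XL_carrier: "k \<le> n \<Longrightarrow> XL k v \<in> carrier G"
  by (simp add: XL_def cls_carrier XL_words)

lemma XL_0: "XL 0 v = \<one>\<^bsub>G\<^esub>"
  by (simp add: XL_def one_G)

lemma XL_Suc: "k < n \<Longrightarrow> XL (Suc k) v = XL k v \<otimes>\<^bsub>G\<^esub> gx k [^]\<^bsub>G\<^esub> (v $ k)"
  by (simp add: XL_def cls_mult[symmetric] XL_words gen_power_words cls_gen_power)

lemma XL_commute: "k \<le> n \<Longrightarrow> j < n \<Longrightarrow> gx j \<otimes>\<^bsub>G\<^esub> XL k v = XL k v \<otimes>\<^bsub>G\<^esub> gx j"
proof (induction k)
  case (Suc k)
  have c: "gx j \<in> carrier G" "XL k v \<in> carrier G" "gx k [^]\<^bsub>G\<^esub> (v $ k) \<in> carrier G" using Suc.prems by (auto intro: XL_carrier)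
  have "gx j \<otimes>\<^bsub>G\<^esub> gx k [^]\<^bsub>G\<^esub> (v $ k) = gx k [^]\<^bsub>G\<^esub> (v $ k) \<otimes>\<^bsub>G\<^esub> gx j"
    using Suc.prems by (intro commute_int_pow gx_commute) auto
  hence "XL k v \<otimes>\<^bsub>G\<^esub> (gx j \<otimes>\<^bsub>G\<^esub> gx k [^]\<^bsub>G\<^esub> (v $ k)) = XL k v \<otimes>\<^bsub>G\<^esub> (gx k [^]\<^bsub>G\<^esub> (v $ k) \<otimes>\<^bsub>G\<^esub> gx j)"
    by simp
  thus ?case using Suc c m_assoc[OF c(1,2,3)] m_assoc[OF c(2,1,3)] m_assoc[OF c(2,3,1)] by (simp add: XL_Suc)
qed (simp add: XL_0)

lemma XL_add:
  assumes "v \<in> carrier_vec n" "w \<in> carrier_vec n"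
  shows "k \<le> n \<Longrightarrow> XL k (v + w) = XL k v \<otimes>\<^bsub>G\<^esub> XL k w"
proof (induction k)
  case (Suc k)
  hence k: "k < n" by simp
  define a b x y where "a = gx k [^]\<^bsub>G\<^esub> (v $ k)" and "b = gx k [^]\<^bsub>G\<^esub> (w $ k)" and "x = XL k v" and "y = XL k w"
  have c: "a \<in> carrier G" "b \<in> carrier G" "x \<in> carrier G" "y \<in> carrier G"
    using k by (auto simp: a_def b_def x_def y_def intro: XL_carrier)
  have comm: "y \<otimes>\<^bsub>G\<^esub> a = a \<otimes>\<^bsub>G\<^esub> y"
    unfolding a_def y_def using k by (intro commute_int_pow XL_commute[symmetric] XL_carrier) auto
  have "XL (Suc k) (v + w) = (x \<otimes>\<^bsub>G\<^esub> y) \<otimes>\<^bsub>G\<^esub> (a \<otimes>\<^bsub>G\<^esub> b)"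
    using Suc k assms by (simp add: XL_Suc int_pow_mult a_def b_def x_def y_def)
  also have "\<dots> = x \<otimes>\<^bsub>G\<^esub> (y \<otimes>\<^bsub>G\<^esub> a) \<otimes>\<^bsub>G\<^esub> b" using c by (simp add: m_assoc)
  also have "\<dots> = (x \<otimes>\<^bsub>G\<^esub> a) \<otimes>\<^bsub>G\<^esub> (y \<otimes>\<^bsub>G\<^esub> b)" unfolding comm using c by (simp add: m_assoc)
  finally show ?case using k by (simp add: XL_Suc a_def b_def x_def y_def)
qed (simp add: XL_0)

lemma XP_XL: "v \<in> carrier_vec n \<Longrightarrow> XP v = XL n v"
  by (simp add: XP_def XL_def x_power_def)

lemma XP_carrier [simp]: "v \<in> carrier_vec n \<Longrightarrow> XP v \<in> carrier G"
  by (simp add: XP_XL XL_carrier)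

lemma XP_add: "v \<in> carrier_vec n \<Longrightarrow> w \<in> carrier_vec n \<Longrightarrow> XP (v + w) = XP v \<otimes>\<^bsub>G\<^esub> XP w"
  by (simp add: XP_XL XL_add)

lemma XP_zero [simp]: "XP (0\<^sub>v n) = \<one>\<^bsub>G\<^esub>"
proof -
  have "XP (0\<^sub>v n) \<otimes>\<^bsub>G\<^esub> XP (0\<^sub>v n) = XP (0\<^sub>v n)" by (subst XP_add[symmetric]) auto
  thus ?thesis by simp
qed

lemma XP_inv: "v \<in> carrier_vec n \<Longrightarrow> inv\<^bsub>G\<^esub> (XP v) = XP (- v)"
  by (rule inv_equality) (auto simp: XP_add[symmetric])

lemma XP_nat_pow: "v \<in> carrier_vec n \<Longrightarrow> XP v [^]\<^bsub>G\<^esub> (k::nat) = XP (int k \<cdot>\<^sub>v v)"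
proof (induction k)
  case 0
  have "int 0 \<cdot>\<^sub>v v = 0\<^sub>v n" using 0 by (intro eq_vecI) auto
  thus ?case by simp
next
  case (Suc k)
  have "int (Suc k) \<cdot>\<^sub>v v = int k \<cdot>\<^sub>v v + v" using Suc.prems by (intro eq_vecI) (auto simp: algebra_simps)
  thus ?case using Suc by (simp add: XP_add)
qed

lemma XP_unit: "i < n \<Longrightarrow> XP (unit_vec n i) = gx i"
proof -
  assume i: "i < n"
  have "XL k (unit_vec n i) = (if i < k then gx i else \<one>\<^bsub>G\<^esub>)" if "k \<le> n" for k
    using that
  proof (induction k)
    case (Suc k)
    thus ?case using i by (auto simp: XL_Suc less_Suc_eq)
  qed (simp add: XL_0)
  thus ?thesis using i by (simp add: XP_XL)
qed

lemma tt_conj: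
  assumes "v \<in> L" "w \<in> carrier_vec n" "A *\<^sub>v rv v = rv w"
  shows "tt \<otimes>\<^bsub>G\<^esub> XP v = XP w \<otimes>\<^bsub>G\<^esub> tt"
proof -
  have v: "v \<in> carrier_vec n" using assms(1) by (rule L_carrier)
  have "([(T, True)] @ x_power v @ [(T, False)], x_power w) \<in> R"
    using assms by (auto simp: lm_relations_def)
  hence "cls ([(T, True)] @ x_power v @ [(T, False)]) = XP w"
    unfolding XP_def by (intro cls_eqI pres_cong.rel)
  hence "tt \<otimes>\<^bsub>G\<^esub> (XP v \<otimes>\<^bsub>G\<^esub> inv\<^bsub>G\<^esub> tt) = XP w"
    unfolding ti_eq[symmetric] unfolding tt_def ti_def XP_def
    using v by (simp add: cls_mult letter_in_words x_power_in_words words_append del: append.simps)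
  hence "tt \<otimes>\<^bsub>G\<^esub> XP v \<otimes>\<^bsub>G\<^esub> inv\<^bsub>G\<^esub> tt = XP w" using v by (simp add: m_assoc)
  thus ?thesis using v assms(2) by (metis inv_solve_right' m_closed XP_carrier tt_carrier)
qed

text \<open>Words are built up at the front, and positive and negative letters \<open>X i\<close>
  are all absorbed into the case \<open>XP v\<close>. Statements about left actions thus reduce to
  three kinds of left multiplication.\<close>

lemma G_induct [consumes 1, case_names one XP tt ti]:
  assumes "g \<in> carrier G" and one: "P \<one>\<^bsub>G\<^esub>"
    and XP: "\<And>v g. v \<in> carrier_vec n \<Longrightarrow> g \<in> carrier G \<Longrightarrow> P g \<Longrightarrow> P (XP v \<otimes>\<^bsub>G\<^esub> g)"
    and tt: "\<And>g. g \<in> carrier G \<Longrightarrow> P g \<Longrightarrow> P (tt \<otimes>\<^bsub>G\<^esub> g)"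
    and ti: "\<And>g. g \<in> carrier G \<Longrightarrow> P g \<Longrightarrow> P (ti \<otimes>\<^bsub>G\<^esub> g)"
  shows "P g"
proof -
  have "P (cls w)" if "w \<in> words (gens n)" for w
    using that
  proof (induction w)
    case Nil
    thus ?case using one by (simp add: one_G)
  next
    case (Cons a w)
    obtain x b where a: "a = (x, b)" by (cases a)
    have w: "w \<in> words (gens n)" and x: "x \<in> gens n" using Cons.prems by (auto simp: words_def a)
    have "cls (a # w) = cls [(x, b)] \<otimes>\<^bsub>G\<^esub> cls w"
      using w x by (simp add: cls_mult letter_in_words a)
    moreover have "P (cls w)" using Cons.IH w .
    moreover have "cls [(x, b)] = tt \<or> cls [(x, b)] = ti \<or> (\<exists>v\<in>carrier_vec n. cls [(x, b)] = XP v)"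
    proof (cases x)
      case (X i)
      hence i: "i < n" using x by simp
      show ?thesis
      proof (cases b)
        case True
        hence "cls [(x, b)] = XP (unit_vec n i)" using i by (simp add: XP_unit X gx_def)
        thus ?thesis using unit_vec_carrier by blast
      next
        case False
        hence "cls [(x, b)] = XP (- unit_vec n i)"
          using i by (simp add: XP_inv[symmetric] XP_unit X gx_inv)
        thus ?thesis by (metis uminus_carrier_vec unit_vec_carrier)
      qed
    qed (cases b; simp add: tt_def ti_def)
    ultimately show ?case using XP tt ti cls_carrier[OF w] by auto
  qed
  thus ?thesis using assms(1) by (auto simp: carrier_G)
qed

text \<open>The conditions on letters under which \<open>a\<close> descends to an action of the
  group on \<open>V\<close> in which \<open>x^v\<close> acts as \<open>P v\<close>. Three instances
  are used: translations of the integers, affine maps of rational space, and HNN normal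
  forms.\<close>

definition word_action :: "(lm_gen \<times> bool \<Rightarrow> 's \<Rightarrow> 's) \<Rightarrow> (int vec \<Rightarrow> 's \<Rightarrow> 's) \<Rightarrow> 's set \<Rightarrow> bool" where
  "word_action a P V \<longleftrightarrow>
     (\<forall>v s. v \<in> carrier_vec n \<longrightarrow> s \<in> V \<longrightarrow> P v s \<in> V) \<and>
     (\<forall>i s. i < n \<longrightarrow> s \<in> V \<longrightarrow> a (X i, True) s = P (unit_vec n i) s) \<and>
     (\<forall>i s. i < n \<longrightarrow> s \<in> V \<longrightarrow> a (X i, False) s = P (- unit_vec n i) s) \<and>
     (\<forall>v w s. v \<in> carrier_vec n \<longrightarrow> w \<in> carrier_vec n \<longrightarrow> s \<in> V \<longrightarrow> P (v + w) s = P v (P w s)) \<and>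
     (\<forall>s. s \<in> V \<longrightarrow> P (0\<^sub>v n) s = s) \<and>
     (\<forall>b s. s \<in> V \<longrightarrow> a (T, b) s \<in> V) \<and>
     (\<forall>b s. s \<in> V \<longrightarrow> a (T, b) (a (T, \<not> b) s) = s) \<and>
     (\<forall>v w s. v \<in> L \<longrightarrow> w \<in> carrier_vec n \<longrightarrow> A *\<^sub>v rv v = rv w \<longrightarrow> s \<in> V \<longrightarrow>
        a (T, True) (P v s) = P w (a (T, True) s))"

text \<open>Group elements are classes of words; \<open>ev_cls\<close> shows that on an invariant
  set the chosen representative is immaterial.\<close>

definition ev :: "(lm_gen \<times> bool \<Rightarrow> 's \<Rightarrow> 's) \<Rightarrow> lm_gen word set \<Rightarrow> 's \<Rightarrow> 's" where
  "ev a C s = foldr a (SOME w. w \<in> C) s"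

lemma word_action_closed:
  assumes act: "word_action a P V" and "x \<in> gens n" "s \<in> V"
  shows "a (x, b) s \<in> V"
proof (cases x)
  case (X i)
  hence "i < n" using assms(2) by simp
  thus ?thesis using act assms(3) unfolding word_action_def X by (cases b) auto
next
  case T
  thus ?thesis using act assms(3) unfolding word_action_def by auto
qed

lemma word_action_x_power:
  assumes act: "word_action a P V" and "v \<in> carrier_vec n" "s \<in> V"
  shows "foldr a (x_power v) s = P v s"
  using assms unfolding word_action_def by (intro foldr_x_power[of _ n _ V]) auto

lemma word_action_cong:
  assumes act: "word_action a P V" and "(u, v) \<in> pres_cong (gens n) R" "s \<in> V"
  shows "foldr a u s = foldr a v s"
proof (rule foldr_pres_cong[OF assms(2) R_words _ _ _ assms(3)])
  fix x b s assume "x \<in> gens n" "s \<in> V"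
  thus "a (x, b) s \<in> V" by (rule word_action_closed[OF act])
next
  note P_add = act[unfolded word_action_def, THEN conjunct2, THEN conjunct2, THEN conjunct2, THEN conjunct1, rule_format]
  fix x b s assume x: "x \<in> gens n" and s: "s \<in> V"
  show "a (x, b) (a (x, \<not> b) s) = s"
  proof (cases x)
    case (X i)
    hence i: "i < n" using x by simp
    have P0: "P (0\<^sub>v n) s = s" using act s unfolding word_action_def by blast
    have "unit_vec n i + - unit_vec n i = (0\<^sub>v n :: int vec)" "- unit_vec n i + unit_vec n i = (0\<^sub>v n :: int vec)"
      by (auto intro!: eq_vecI)
    hence "P (unit_vec n i) (P (- unit_vec n i) s) = s" "P (- unit_vec n i) (P (unit_vec n i) s) = s"
      using P_add[of "unit_vec n i" "- unit_vec n i" s] P_add[of "- unit_vec n i" "unit_vec n i" s] P0 s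
      by (metis uminus_carrier_vec unit_vec_carrier)+
    moreover have "P (unit_vec n i) s \<in> V" "P (- unit_vec n i) s \<in> V"
      using act s unfolding word_action_def by auto
    ultimately show ?thesis using act s i unfolding word_action_def X by (cases b) auto
  next
    case T
    thus ?thesis using act s unfolding word_action_def by auto
  qed
next
  note P_add = act[unfolded word_action_def, THEN conjunct2, THEN conjunct2, THEN conjunct2, THEN conjunct1, rule_format]
  fix l r s assume lr: "(l, r) \<in> R" and s: "s \<in> V"
  from lr consider (comm) i j where "i < j" "j < n" "l = [(X i, True), (X j, True), (X i, False), (X j, False)]" "r = []"
    | (conj) v w where "v \<in> L" "w \<in> carrier_vec n" "A *\<^sub>v rv v = rv w" "l = [(T, True)] @ x_power v @ [(T, False)]" "r = x_power w"
    unfolding lm_relations_def by blast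
  thus "foldr a l s = foldr a r s"
  proof cases
    case comm
    let ?e = "unit_vec n i :: int vec" and ?f = "unit_vec n j :: int vec"
    have i: "i < n" using comm by simp
    have V1: "P (- ?f) s \<in> V" using act s unfolding word_action_def by auto
    have V2: "P (- ?e) (P (- ?f) s) \<in> V" using act V1 unfolding word_action_def by auto
    have V3: "P ?f (P (- ?e) (P (- ?f) s)) \<in> V" using act V2 unfolding word_action_def by auto
    have "foldr a l s = P ?e (P ?f (P (- ?e) (P (- ?f) s)))"
      using act s i comm V1 V2 V3 unfolding word_action_def by simp
    also have "\<dots> = P (?e + (?f + (- ?e + (- ?f)))) s"
      using s V1 V2 V3 by (simp add: P_add)
    also have "?e + (?f + (- ?e + (- ?f))) = 0\<^sub>v n" by (intro eq_vecI) auto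
    also have "P (0\<^sub>v n) s = s" using act s unfolding word_action_def by auto
    finally show ?thesis using comm by simp
  next
    case conj
    have V1: "a (T, False) s \<in> V" using act s unfolding word_action_def by auto
    have "a (T, True) (a (T, \<not> True) s) = s" using act s unfolding word_action_def by blast
    hence TT: "a (T, True) (a (T, False) s) = s" by simp
    have "foldr a l s = a (T, True) (P v (a (T, False) s))"
      using conj word_action_x_power[OF act L_carrier V1] by simp
    also have "\<dots> = P w (a (T, True) (a (T, False) s))"
      using act conj V1 unfolding word_action_def by blast
    finally show ?thesis using conj TT word_action_x_power[OF act _ s] by simp
  qed
qed

lemma ev_cls:
  assumes act: "word_action a P V" and w: "w \<in> words (gens n)" and s: "s \<in> V"
  shows "ev a (cls w) s = foldr a w s"
proof -
  have "w \<in> cls w" using w by (simp add: cls_def pres_cong.refl)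
  hence "(SOME u. u \<in> cls w) \<in> cls w" by (rule someI)
  hence "(w, SOME u. u \<in> cls w) \<in> pres_cong (gens n) R" by (simp add: cls_def)
  thus ?thesis using word_action_cong[OF act _ s] by (simp add: ev_def)
qed

lemma ev_facts:
  assumes act: "word_action a P V" and s: "s \<in> V"
  shows ev_closed: "g \<in> carrier G \<Longrightarrow> ev a g s \<in> V"
    and ev_mult: "g \<in> carrier G \<Longrightarrow> h \<in> carrier G \<Longrightarrow> ev a (g \<otimes>\<^bsub>G\<^esub> h) s = ev a g (ev a h s)"
    and ev_one: "ev a \<one>\<^bsub>G\<^esub> s = s"
    and ev_XP: "v \<in> carrier_vec n \<Longrightarrow> ev a (XP v) s = P v s"
    and ev_tt: "ev a tt s = a (T, True) s"
    and ev_ti: "ev a ti s = a (T, False) s"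
proof -
  have closed: "foldr a w s \<in> V" if "w \<in> words (gens n)" for w
    by (rule foldr_in_invariant[OF that s]) (rule word_action_closed[OF act])
  show "ev a g s \<in> V" if "g \<in> carrier G" for g
    using that closed by (auto simp: carrier_G ev_cls[OF act _ s])
  show "ev a (g \<otimes>\<^bsub>G\<^esub> h) s = ev a g (ev a h s)" if "g \<in> carrier G" "h \<in> carrier G" for g h
    using that closed by (auto simp: carrier_G cls_mult words_append ev_cls[OF act])
      (simp add: ev_cls[OF act] words_append s)
  show "ev a \<one>\<^bsub>G\<^esub> s = s" by (simp add: one_G ev_cls[OF act _ s] Nil_in_words)
  show "ev a (XP v) s = P v s" if "v \<in> carrier_vec n" for v
    using that by (simp add: XP_def ev_cls[OF act _ s] x_power_in_words word_action_x_power[OF act _ s])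
  show "ev a tt s = a (T, True) s" "ev a ti s = a (T, False) s"
    by (simp_all add: tt_def ti_def ev_cls[OF act _ s] letter_in_words)
qed

section \<open>The height homomorphism and the affine representation\<close>

definition tact :: "lm_gen \<times> bool \<Rightarrow> int \<Rightarrow> int" where
  "tact xb j = (case fst xb of X i \<Rightarrow> j | T \<Rightarrow> if snd xb then j + 1 else j - 1)"

definition dact :: "lm_gen \<times> bool \<Rightarrow> rat vec \<Rightarrow> rat vec" where
  "dact xb u = (case fst xb of X i \<Rightarrow> u + rv (if snd xb then unit_vec n i else - unit_vec n i)
     | T \<Rightarrow> (if snd xb then A else Ai) *\<^sub>v u)"

definition "tau g = ev tact g 0"
text \<open>The image of the origin, that is, the translation part of the affine map by which
  \<open>g\<close> acts. Its linear part is \<open>Ap (tau g)\<close>, by \<open>ev_dact\<close>, so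
  that \<open>delta\<close> is a cocycle.\<close>

definition "delta g = ev dact g (0\<^sub>v n)"

lemma tact: "word_action tact (\<lambda>v j. j) UNIV"
  by (auto simp: word_action_def tact_def)

lemma A_Ai_vec: "u \<in> carrier_vec n \<Longrightarrow> A *\<^sub>v (Ai *\<^sub>v u) = u" "u \<in> carrier_vec n \<Longrightarrow> Ai *\<^sub>v (A *\<^sub>v u) = u"
  using assoc_mult_mat_vec[OF A Ai] assoc_mult_mat_vec[OF Ai A] AAi AiA by simp_all

lemma dact: "word_action dact (\<lambda>v u. u + rv v) (carrier_vec n)"
proof -
  have "u + rv (v + w) = u + rv w + rv v" if "v \<in> carrier_vec n" "w \<in> carrier_vec n" "u \<in> carrier_vec n" for u v w
    using that by (intro eq_vecI) auto
  moreover have "A *\<^sub>v (u + rv v) = A *\<^sub>v u + rv w" if "v \<in> L" "w \<in> carrier_vec n" "A *\<^sub>v rv v = rv w" "u \<in> carrier_vec n" for u v w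
    using that L_carrier[OF that(1)] by (simp add: mult_add_distrib_mat_vec[OF A])
  ultimately show ?thesis
    by (auto simp: word_action_def dact_def A_Ai_vec mult_mat_vec_carrier[OF A] mult_mat_vec_carrier[OF Ai])
qed

lemma ev_tact: "g \<in> carrier G \<Longrightarrow> ev tact g j = tau g + j"
proof (induction g arbitrary: j rule: G_induct)
  case one
  show ?case by (simp add: tau_def ev_one[OF tact])
next
  case (XP v g)
  have "ev tact (XP v \<otimes>\<^bsub>G\<^esub> g) j = ev tact g j" for j
    using XP.hyps by (simp add: ev_mult[OF tact] ev_XP[OF tact])
  thus ?case using XP.IH[of j] by (simp only: tau_def)
next
  case (tt g)
  have "ev tact (tt \<otimes>\<^bsub>G\<^esub> g) j = ev tact g j + 1" for j
    using tt.hyps by (simp add: ev_mult[OF tact] ev_tt[OF tact] tact_def)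
  thus ?case using tt.IH[of j] by (simp only: tau_def)
next
  case (ti g)
  have "ev tact (ti \<otimes>\<^bsub>G\<^esub> g) j = ev tact g j - 1" for j
    using ti.hyps by (simp add: ev_mult[OF tact] ev_ti[OF tact] tact_def)
  thus ?case using ti.IH[of j] by (simp only: tau_def)
qed

lemma tau_mult [simp]: "g \<in> carrier G \<Longrightarrow> h \<in> carrier G \<Longrightarrow> tau (g \<otimes>\<^bsub>G\<^esub> h) = tau g + tau h"
  by (simp add: tau_def ev_mult[OF tact]) (simp add: ev_tact tau_def[symmetric])

lemma tau_XP [simp]: "v \<in> carrier_vec n \<Longrightarrow> tau (XP v) = 0" and tau_tt [simp]: "tau tt = 1" and tau_ti [simp]: "tau ti = - 1"
  by (simp_all add: tau_def ev_XP[OF tact] ev_tt[OF tact] ev_ti[OF tact] tact_def)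

lemma tau_one [simp]: "tau \<one>\<^bsub>G\<^esub> = 0"
  by (simp add: tau_def ev_one[OF tact])

lemma tau_inv [simp]: "g \<in> carrier G \<Longrightarrow> tau (inv\<^bsub>G\<^esub> g) = - tau g"
  using tau_mult[of "inv\<^bsub>G\<^esub> g" g] by simp

lemma tau_nat_pow [simp]: "g \<in> carrier G \<Longrightarrow> tau (g [^]\<^bsub>G\<^esub> (k::nat)) = int k * tau g"
  by (induction k) (auto simp: algebra_simps)

lemma delta_carrier [simp]: "g \<in> carrier G \<Longrightarrow> delta g \<in> carrier_vec n"
  unfolding delta_def by (rule ev_closed[OF dact]) auto

lemma delta_XP [simp]: "v \<in> carrier_vec n \<Longrightarrow> delta (XP v) = rv v"
  and delta_tt [simp]: "delta tt = 0\<^sub>v n" and delta_ti [simp]: "delta ti = 0\<^sub>v n"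
  and delta_one [simp]: "delta \<one>\<^bsub>G\<^esub> = 0\<^sub>v n"
proof -
  show "v \<in> carrier_vec n \<Longrightarrow> delta (XP v) = rv v" by (simp add: delta_def ev_XP[OF dact])
  show "delta tt = 0\<^sub>v n" "delta ti = 0\<^sub>v n"
    by (simp_all add: delta_def ev_tt[OF dact] ev_ti[OF dact] dact_def) (auto intro!: eq_vecI simp: scalar_prod_def carrier_matD[OF A] carrier_matD[OF Ai])
  show "delta \<one>\<^bsub>G\<^esub> = 0\<^sub>v n" by (simp add: delta_def ev_one[OF dact])
qed

lemma vec_add_right_commute:
  "a \<in> carrier_vec m \<Longrightarrow> b \<in> carrier_vec m \<Longrightarrow> c \<in> carrier_vec m \<Longrightarrow>
    (a + b) + c = (a + c) + (b :: rat vec)"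
  by (rule eq_vecI) auto

lemma vec_add_cancel:
  assumes "a \<in> carrier_vec m" "b \<in> carrier_vec m" "c \<in> carrier_vec m" "a + b = c + (a :: rat vec)"
  shows "b = c"
proof (rule eq_vecI)
  fix i assume "i < dim_vec c"
  moreover have "(a + b) $ i = (c + a) $ i" by (simp only: assms(4))
  ultimately show "b $ i = c $ i" using assms(1-3) by simp
qed (use assms in simp)

lemma ev_dact: "g \<in> carrier G \<Longrightarrow> u \<in> carrier_vec n \<Longrightarrow> ev dact g u = delta g + Ap (tau g) *\<^sub>v u"
proof (induction g arbitrary: u rule: G_induct)
  case one
  thus ?case by (simp add: ev_one[OF dact])
next
  case (XP v g)
  have "ev dact (XP v \<otimes>\<^bsub>G\<^esub> g) u = ev dact g u + rv v" if "u \<in> carrier_vec n" for u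
    using that XP.hyps ev_closed[OF dact that XP.hyps(2)] by (simp add: ev_mult[OF dact that] ev_XP[OF dact])
  from this[OF XP.prems] this[of "0\<^sub>v n"]
  have "ev dact (XP v \<otimes>\<^bsub>G\<^esub> g) u = (delta g + Ap (tau g) *\<^sub>v u) + rv v" "delta (XP v \<otimes>\<^bsub>G\<^esub> g) = delta g + rv v"
    unfolding XP.IH[OF XP.prems] by (simp_all add: delta_def)
  moreover have "Ap (tau g) *\<^sub>v u \<in> carrier_vec n" using Ap XP.prems by (rule mult_mat_vec_carrier)
  ultimately show ?case
    using XP.hyps vec_add_right_commute[of "delta g" n "Ap (tau g) *\<^sub>v u" "rv v"] by simp
next
  case (tt g)
  have c: "Ap (tau g) *\<^sub>v u \<in> carrier_vec n" using Ap tt.prems by (rule mult_mat_vec_carrier)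
  have "ev dact (tt \<otimes>\<^bsub>G\<^esub> g) u = A *\<^sub>v ev dact g u" if "u \<in> carrier_vec n" for u
    using that tt ev_closed[OF dact that tt.hyps] by (simp add: ev_mult[OF dact that] ev_tt[OF dact] dact_def)
  from this[OF tt.prems] this[of "0\<^sub>v n"]
  have "ev dact (tt \<otimes>\<^bsub>G\<^esub> g) u = A *\<^sub>v (delta g + Ap (tau g) *\<^sub>v u)" "delta (tt \<otimes>\<^bsub>G\<^esub> g) = A *\<^sub>v delta g"
    unfolding tt.IH[OF tt.prems] by (simp_all add: delta_def)
  moreover have "Ap (tau (tt \<otimes>\<^bsub>G\<^esub> g)) = A * Ap (tau g)"
    using tt Ap_add[of 1 "tau g"] by simp
  ultimately show ?case
    using tt c by (simp add: mult_add_distrib_mat_vec[OF A] assoc_mult_mat_vec[OF A Ap])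
next
  case (ti g)
  have c: "Ap (tau g) *\<^sub>v u \<in> carrier_vec n" using Ap ti.prems by (rule mult_mat_vec_carrier)
  have "ev dact (ti \<otimes>\<^bsub>G\<^esub> g) u = Ai *\<^sub>v ev dact g u" if "u \<in> carrier_vec n" for u
    using that ti ev_closed[OF dact that ti.hyps] by (simp add: ev_mult[OF dact that] ev_ti[OF dact] dact_def)
  from this[OF ti.prems] this[of "0\<^sub>v n"]
  have "ev dact (ti \<otimes>\<^bsub>G\<^esub> g) u = Ai *\<^sub>v (delta g + Ap (tau g) *\<^sub>v u)" "delta (ti \<otimes>\<^bsub>G\<^esub> g) = Ai *\<^sub>v delta g"
    unfolding ti.IH[OF ti.prems] by (simp_all add: delta_def)
  moreover have "Ap (tau (ti \<otimes>\<^bsub>G\<^esub> g)) = Ai * Ap (tau g)"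
    using ti Ap_add[of "- 1" "tau g"] by simp
  ultimately show ?case
    using ti c by (simp add: mult_add_distrib_mat_vec[OF Ai] assoc_mult_mat_vec[OF Ai Ap])
qed

lemma delta_mult:
  assumes "g \<in> carrier G" "h \<in> carrier G"
  shows "delta (g \<otimes>\<^bsub>G\<^esub> h) = delta g + Ap (tau g) *\<^sub>v delta h"
proof -
  have "delta (g \<otimes>\<^bsub>G\<^esub> h) = ev dact g (delta h)"
    unfolding delta_def using assms by (simp add: ev_mult[OF dact])
  thus ?thesis using assms by (simp add: ev_dact)
qed

text \<open>The translation part recovers \<open>v\<close>, so the lattice embeds into the
  group.\<close>

lemma XP_eq_iff: "v \<in> carrier_vec n \<Longrightarrow> w \<in> carrier_vec n \<Longrightarrow> XP v = XP w \<longleftrightarrow> v = w"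
  using delta_XP rv_inject by metis

text \<open>Compare the translation parts of the two products. Whenever conjugation keeps a base
  element in the base, its effect depends on \<open>tau\<close> alone.\<close>

lemma XP_intertwine:
  assumes "g \<in> carrier G" "v \<in> carrier_vec n" "w \<in> carrier_vec n" "g \<otimes>\<^bsub>G\<^esub> XP v = XP w \<otimes>\<^bsub>G\<^esub> g"
  shows "Ap (tau g) *\<^sub>v rv v = rv w"
proof -
  have c: "Ap (tau g) *\<^sub>v rv v \<in> carrier_vec n" using Ap assms(2) by (intro mult_mat_vec_carrier) auto
  have "delta (g \<otimes>\<^bsub>G\<^esub> XP v) = delta (XP w \<otimes>\<^bsub>G\<^esub> g)" using assms(4) by simp
  hence "delta g + Ap (tau g) *\<^sub>v rv v = rv w + delta g"
    using assms(1-3) delta_mult[of g "XP v"] delta_mult[of "XP w" g] by simp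
  thus ?thesis using vec_add_cancel c assms(1,3) by (metis delta_carrier map_carrier_vec)
qed

lemma XP_intertwine_multiple:
  assumes g: "g \<in> carrier G" and v: "v \<in> carrier_vec n" and w: "w \<in> carrier_vec n"
    and e: "g \<otimes>\<^bsub>G\<^esub> XP v = XP w \<otimes>\<^bsub>G\<^esub> g"
  shows "g \<otimes>\<^bsub>G\<^esub> XP (int m \<cdot>\<^sub>v v) = XP (int m \<cdot>\<^sub>v w) \<otimes>\<^bsub>G\<^esub> g"
  unfolding XP_nat_pow[OF v, symmetric] XP_nat_pow[OF w, symmetric]
proof (induction m)
  case (Suc m)
  have "g \<otimes>\<^bsub>G\<^esub> XP v [^]\<^bsub>G\<^esub> Suc m = (g \<otimes>\<^bsub>G\<^esub> XP v [^]\<^bsub>G\<^esub> m) \<otimes>\<^bsub>G\<^esub> XP v" using g v by (simp add: m_assoc)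
  also have "\<dots> = XP w [^]\<^bsub>G\<^esub> m \<otimes>\<^bsub>G\<^esub> (g \<otimes>\<^bsub>G\<^esub> XP v)" unfolding Suc using g v w by (simp add: m_assoc)
  also have "\<dots> = XP w [^]\<^bsub>G\<^esub> Suc m \<otimes>\<^bsub>G\<^esub> g" unfolding e using g w by (simp add: m_assoc)
  finally show ?case .
qed (use g in simp)

section \<open>Commensuration of the base group\<close>

definition commensurates :: "lm_gen word set \<Rightarrow> bool" where
  "commensurates g \<longleftrightarrow> (\<exists>N>0. \<forall>v\<in>carrier_vec n. \<exists>w\<in>carrier_vec n. g \<otimes>\<^bsub>G\<^esub> XP (int N \<cdot>\<^sub>v v) = XP w \<otimes>\<^bsub>G\<^esub> g)"

lemma commensurates_mult:
  assumes g: "g \<in> carrier G" "commensurates g" and s: "s \<in> carrier G" "commensurates s"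
  shows "commensurates (s \<otimes>\<^bsub>G\<^esub> g)"
proof -
  obtain N where N: "N > 0" "\<And>v. v \<in> carrier_vec n \<Longrightarrow> \<exists>w\<in>carrier_vec n. g \<otimes>\<^bsub>G\<^esub> XP (int N \<cdot>\<^sub>v v) = XP w \<otimes>\<^bsub>G\<^esub> g"
    using g(2) unfolding commensurates_def by blast
  obtain M where M: "M > 0" "\<And>v. v \<in> carrier_vec n \<Longrightarrow> \<exists>w\<in>carrier_vec n. s \<otimes>\<^bsub>G\<^esub> XP (int M \<cdot>\<^sub>v v) = XP w \<otimes>\<^bsub>G\<^esub> s"
    using s(2) unfolding commensurates_def by blast
  have "\<exists>w\<in>carrier_vec n. (s \<otimes>\<^bsub>G\<^esub> g) \<otimes>\<^bsub>G\<^esub> XP (int (M * N) \<cdot>\<^sub>v v) = XP w \<otimes>\<^bsub>G\<^esub> (s \<otimes>\<^bsub>G\<^esub> g)"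
    if v: "v \<in> carrier_vec n" for v
  proof -
    obtain w where w: "w \<in> carrier_vec n" "g \<otimes>\<^bsub>G\<^esub> XP (int N \<cdot>\<^sub>v v) = XP w \<otimes>\<^bsub>G\<^esub> g" using N(2)[OF v] by blast
    obtain z where z: "z \<in> carrier_vec n" "s \<otimes>\<^bsub>G\<^esub> XP (int M \<cdot>\<^sub>v w) = XP z \<otimes>\<^bsub>G\<^esub> s" using M(2)[OF w(1)] by blast
    have MN: "int (M * N) \<cdot>\<^sub>v v = int M \<cdot>\<^sub>v (int N \<cdot>\<^sub>v v)" by (simp add: smult_smult_assoc)
    have "(s \<otimes>\<^bsub>G\<^esub> g) \<otimes>\<^bsub>G\<^esub> XP (int (M * N) \<cdot>\<^sub>v v) = s \<otimes>\<^bsub>G\<^esub> (XP (int M \<cdot>\<^sub>v w) \<otimes>\<^bsub>G\<^esub> g)"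
      unfolding MN using g s v XP_intertwine_multiple[OF g(1) _ w] by (simp add: m_assoc)
    also have "\<dots> = (s \<otimes>\<^bsub>G\<^esub> XP (int M \<cdot>\<^sub>v w)) \<otimes>\<^bsub>G\<^esub> g" using g s w by (simp add: m_assoc)
    also have "\<dots> = XP z \<otimes>\<^bsub>G\<^esub> (s \<otimes>\<^bsub>G\<^esub> g)" unfolding z(2) using g s z by (simp add: m_assoc)
    finally show ?thesis using z(1) by blast
  qed
  moreover have "M * N > 0" using M N by simp
  ultimately show ?thesis unfolding commensurates_def by blast
qed

lemma commensurates_XP:
  assumes u: "u \<in> carrier_vec n"
  shows "commensurates (XP u)"
  unfolding commensurates_def
proof (intro exI[of _ 1] conjI ballI)
  fix v :: "int vec" assume v: "v \<in> carrier_vec n"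
  have "XP u \<otimes>\<^bsub>G\<^esub> XP v = XP v \<otimes>\<^bsub>G\<^esub> XP u"
    using u v comm_add_vec[OF u v] by (simp flip: XP_add)
  thus "\<exists>w\<in>carrier_vec n. XP u \<otimes>\<^bsub>G\<^esub> XP (int 1 \<cdot>\<^sub>v v) = XP w \<otimes>\<^bsub>G\<^esub> XP u" using v by auto
qed simp

lemma commensurates_tt: "commensurates tt"
proof -
  obtain M where M: "M > 0" "\<And>v. v \<in> carrier_vec n \<Longrightarrow> M \<cdot>\<^sub>v v \<in> L" using L_multiple by metis
  have "\<exists>w\<in>carrier_vec n. tt \<otimes>\<^bsub>G\<^esub> XP (int (nat M) \<cdot>\<^sub>v v) = XP w \<otimes>\<^bsub>G\<^esub> tt" if v: "v \<in> carrier_vec n" for v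
    using L_image[OF M(2)[OF v]] tt_conj[OF M(2)[OF v]] M(1) by auto
  thus ?thesis using M(1) unfolding commensurates_def by (intro exI[of _ "nat M"]) simp
qed

lemma commensurates_ti: "commensurates ti"
proof -
  obtain M where M: "M > 0" "\<And>w. w \<in> carrier_vec n \<Longrightarrow> \<exists>v \<in> L. A *\<^sub>v rv v = rv (M \<cdot>\<^sub>v w)" using AL_multiple by metis
  have "\<exists>w\<in>carrier_vec n. ti \<otimes>\<^bsub>G\<^esub> XP (int (nat M) \<cdot>\<^sub>v v) = XP w \<otimes>\<^bsub>G\<^esub> ti" if v: "v \<in> carrier_vec n" for v
  proof -
    obtain z where z: "z \<in> L" "A *\<^sub>v rv z = rv (M \<cdot>\<^sub>v v)" using M(2)[OF v] by blast
    have "tt \<otimes>\<^bsub>G\<^esub> XP z = XP (M \<cdot>\<^sub>v v) \<otimes>\<^bsub>G\<^esub> tt" using v z by (intro tt_conj) auto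
    hence "ti \<otimes>\<^bsub>G\<^esub> XP (M \<cdot>\<^sub>v v) = XP z \<otimes>\<^bsub>G\<^esub> ti"
      unfolding ti_eq using v L_carrier[OF z(1)] by (intro intertwine_inv) auto
    thus ?thesis using M(1) L_carrier[OF z(1)] by auto
  qed
  thus ?thesis using M(1) unfolding commensurates_def by (intro exI[of _ "nat M"]) simp
qed

text \<open>For the generators this holds because \<open>L\<close> and \<open>A L\<close> contain a
  multiple of the whole lattice; for products the multipliers are multiplied.\<close>

lemma commensurated:
  assumes "g \<in> carrier G"
  shows "commensurates g"
  using assms
proof (induction g rule: G_induct)
  case one
  show ?case using commensurates_XP[of "0\<^sub>v n"] by simp
qed (auto intro: commensurates_mult commensurates_XP commensurates_tt commensurates_ti)

end

section \<open>HNN normal forms\<close>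

context leary_minasyan
begin

text \<open>The two associated subgroups of the HNN extension, indexed by sign: the vectors past
  which \<open>t\<close>, respectively its inverse, can be moved. Indexing by a boolean allows most
  statements to be proved for both signs at once.\<close>

definition Lb :: "bool \<Rightarrow> int vec set" where
  "Lb b = (if b then L else {w \<in> carrier_vec n. \<exists>v\<in>L. A *\<^sub>v rv v = rv w})"

definition Ab :: "bool \<Rightarrow> rat mat" where "Ab b = (if b then A else Ai)"

definition tb :: "bool \<Rightarrow> lm_gen word set" where "tb b = (if b then tt else ti)"

lemma Ab [simp]: "Ab b \<in> carrier_mat n n"
  by (simp add: Ab_def)

lemma Ab_cancel: "u \<in> carrier_vec n \<Longrightarrow> Ab (\<not> b) *\<^sub>v (Ab b *\<^sub>v u) = u"
  by (cases b) (simp_all add: Ab_def A_Ai_vec)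

lemma tb_carrier [simp]: "tb b \<in> carrier G"
  by (simp add: tb_def)

lemma tb_cancel: "tb b \<otimes>\<^bsub>G\<^esub> tb (\<not> b) = \<one>\<^bsub>G\<^esub>"
  by (simp add: tb_def ti_eq)

lemma tb_cancel_left: "g \<in> carrier G \<Longrightarrow> tb b \<otimes>\<^bsub>G\<^esub> (tb (\<not> b) \<otimes>\<^bsub>G\<^esub> g) = g"
  by (simp add: m_assoc[symmetric] tb_cancel)

lemma Lb_carrier: "v \<in> Lb b \<Longrightarrow> v \<in> carrier_vec n"
  by (auto simp: Lb_def L_carrier split: if_splits)

lemma Lb_image:
  assumes "v \<in> Lb b"
  shows "\<exists>w. w \<in> Lb (\<not> b) \<and> rv w = Ab b *\<^sub>v rv v"
proof (cases b)
  case True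
  then obtain w where "w \<in> carrier_vec n" "A *\<^sub>v rv v = rv w" using assms L_image by (auto simp: Lb_def)
  thus ?thesis using True assms by (intro exI[of _ w]) (auto simp: Lb_def Ab_def)
next
  case False
  then obtain w where w: "w \<in> L" "A *\<^sub>v rv w = rv v" using assms by (auto simp: Lb_def)
  have "rv w = Ai *\<^sub>v rv v" unfolding w(2)[symmetric] using L_carrier[OF w(1)] by (simp add: A_Ai_vec)
  thus ?thesis using False w by (intro exI[of _ w]) (auto simp: Lb_def Ab_def)
qed

lemma Lb_zero: "0\<^sub>v n \<in> Lb b"
proof -
  have "A *\<^sub>v 0\<^sub>v n = 0\<^sub>v n" by (auto intro!: eq_vecI simp: carrier_matD[OF A])
  thus ?thesis using L_zero by (auto simp: Lb_def intro!: bexI[of _ "0\<^sub>v n"])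
qed

lemma Lb_add:
  assumes "v \<in> Lb b" "w \<in> Lb b"
  shows "v + w \<in> Lb b"
proof (cases b)
  case True
  thus ?thesis using assms L_add by (simp add: Lb_def)
next
  case False
  then obtain v' w' where "v' \<in> L" "w' \<in> L" "A *\<^sub>v rv v' = rv v" "A *\<^sub>v rv w' = rv w" "v \<in> carrier_vec n" "w \<in> carrier_vec n"
    using assms by (auto simp: Lb_def)
  hence "A *\<^sub>v rv (v' + w') = rv (v + w)" "v' + w' \<in> L" "v + w \<in> carrier_vec n"
    using L_add by (auto simp: rv_add[OF L_carrier L_carrier] rv_add mult_add_distrib_mat_vec[OF A] L_carrier)
  thus ?thesis using False by (auto simp: Lb_def)
qed

lemma Lb_uminus:
  assumes "v \<in> Lb b"
  shows "- v \<in> Lb b"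
proof (cases b)
  case True
  thus ?thesis using assms L_uminus by (simp add: Lb_def)
next
  case False
  then obtain v' where "v' \<in> L" "A *\<^sub>v rv v' = rv v" "v \<in> carrier_vec n"
    using assms by (auto simp: Lb_def)
  hence "A *\<^sub>v rv (- v') = rv (- v)" "- v' \<in> L" "- v \<in> carrier_vec n"
    using L_uminus by (auto simp: rv_uminus mult_mat_vec_uminus[OF A] L_carrier)
  thus ?thesis using False by (auto simp: Lb_def)
qed

lemma Lb_add_iff:
  assumes "v \<in> Lb b" "h \<in> carrier_vec n"
  shows "h + v \<in> Lb b \<longleftrightarrow> h \<in> Lb b" "v + h \<in> Lb b \<longleftrightarrow> h \<in> Lb b"
proof -
  have v: "v \<in> carrier_vec n" using assms(1) by (rule Lb_carrier)
  have "h = (h + v) + - v" using assms(2) v by (intro eq_vecI) auto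
  thus 1: "h + v \<in> Lb b \<longleftrightarrow> h \<in> Lb b" using Lb_add Lb_uminus assms(1) by metis
  have "v + h = h + v" using assms(2) v by (rule comm_add_vec[symmetric])
  thus "v + h \<in> Lb b \<longleftrightarrow> h \<in> Lb b" using 1 by simp
qed

lemma Lb_uminus_iff: "v \<in> carrier_vec n \<Longrightarrow> - v \<in> Lb b \<longleftrightarrow> v \<in> Lb b"
  using Lb_uminus[of v b] Lb_uminus[of "- v" b] by auto

text \<open>The isomorphism from \<open>Lb b\<close> to \<open>Lb (\<not> b)\<close> induced by
  conjugation with \<open>tb b\<close>; values outside \<open>Lb b\<close> are unspecified.\<close>

definition Am :: "bool \<Rightarrow> int vec \<Rightarrow> int vec" where
  "Am b v = (SOME w. w \<in> Lb (\<not> b) \<and> rv w = Ab b *\<^sub>v rv v)"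

lemma Am: "v \<in> Lb b \<Longrightarrow> Am b v \<in> Lb (\<not> b)" "v \<in> Lb b \<Longrightarrow> rv (Am b v) = Ab b *\<^sub>v rv v"
  unfolding Am_def by (rule someI2_ex[OF Lb_image], simp_all)+

lemma Am_unique: "v \<in> Lb b \<Longrightarrow> rv w = Ab b *\<^sub>v rv v \<Longrightarrow> Am b v = w"
  using Am(2) rv_inject by metis

lemma Am_carrier [simp]: "v \<in> Lb b \<Longrightarrow> Am b v \<in> carrier_vec n"
  using Am(1) Lb_carrier by blast

lemma Am_Am: "v \<in> Lb b \<Longrightarrow> Am (\<not> b) (Am b v) = v"
  using Am_unique[of "Am b v" "\<not> b" v] Am[of v b] Lb_carrier[of v b] by (simp add: Ab_cancel)

lemma Am_add: "v \<in> Lb b \<Longrightarrow> w \<in> Lb b \<Longrightarrow> Am b (v + w) = Am b v + Am b w"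
  using Lb_carrier
  by (intro Am_unique Lb_add) (auto simp: rv_add[of _ n] Am(2) mult_add_distrib_mat_vec[OF Ab])

lemma tb_conj:
  assumes "v \<in> Lb b"
  shows "tb b \<otimes>\<^bsub>G\<^esub> XP v = XP (Am b v) \<otimes>\<^bsub>G\<^esub> tb b"
proof (cases b)
  case True
  have "A *\<^sub>v rv v = rv (Am b v)" using Am(2)[OF assms] True by (simp add: Ab_def)
  moreover have "v \<in> L" using assms True by (simp add: Lb_def)
  ultimately show ?thesis using Am_carrier[OF assms] True by (simp add: tb_def tt_conj)
next
  case False
  let ?w = "Am False v"
  have w: "?w \<in> Lb True" "Am True ?w = v" "v \<in> carrier_vec n" "?w \<in> carrier_vec n"
    using False assms Am[of v False] Am_Am[of v False] Lb_carrier by auto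
  have "A *\<^sub>v rv ?w = rv v" using Am(2)[OF w(1)] w(2) by (simp add: Ab_def)
  hence "tt \<otimes>\<^bsub>G\<^esub> XP ?w = XP v \<otimes>\<^bsub>G\<^esub> tt" using w by (intro tt_conj) (auto simp: Lb_def)
  hence "ti \<otimes>\<^bsub>G\<^esub> XP v = XP ?w \<otimes>\<^bsub>G\<^esub> ti"
    unfolding ti_eq using w by (intro intertwine_inv) auto
  thus ?thesis using False by (simp add: tb_def)
qed

text \<open>A representative of the coset of \<open>h\<close> modulo \<open>Lb b\<close>. The choice
  depends only on the predicate describing the coset, and this is why \<open>rep_add\<close>
  holds.\<close>

definition rep :: "bool \<Rightarrow> int vec \<Rightarrow> int vec" where
  "rep b h = (if h \<in> Lb b then 0\<^sub>v n else SOME u. u \<in> carrier_vec n \<and> h - u \<in> Lb b)"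

lemma rep:
  assumes "h \<in> carrier_vec n"
  shows "rep b h \<in> carrier_vec n" "h - rep b h \<in> Lb b"
proof -
  have "h - h = 0\<^sub>v n" "h - 0\<^sub>v n = h" using assms by (auto intro!: eq_vecI)
  hence "h \<in> carrier_vec n \<and> h - h \<in> Lb b" and 0: "h - 0\<^sub>v n = h" using assms Lb_zero by auto
  hence "(SOME u. u \<in> carrier_vec n \<and> h - u \<in> Lb b) \<in> carrier_vec n \<and>
      h - (SOME u. u \<in> carrier_vec n \<and> h - u \<in> Lb b) \<in> Lb b"
    by (intro someI[of "\<lambda>u. u \<in> carrier_vec n \<and> h - u \<in> Lb b"])
  thus "rep b h \<in> carrier_vec n" "h - rep b h \<in> Lb b"
    using 0 by (auto simp: rep_def)
qed

lemma rep_add: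
  assumes h: "h \<in> carrier_vec n" and v: "v \<in> Lb b"
  shows "rep b (h + v) = rep b h" "rep b (v + h) = rep b h"
proof -
  have vc: "v \<in> carrier_vec n" using v by (rule Lb_carrier)
  have "h + v - u \<in> Lb b \<longleftrightarrow> h - u \<in> Lb b" if "u \<in> carrier_vec n" for u
  proof -
    have "h + v - u = (h - u) + v" using h vc that by (intro eq_vecI) auto
    thus ?thesis using Lb_add_iff(1)[OF v, of "h - u"] h that by simp
  qed
  hence "(\<lambda>u. u \<in> carrier_vec n \<and> h + v - u \<in> Lb b) = (\<lambda>u. u \<in> carrier_vec n \<and> h - u \<in> Lb b)" by auto
  thus 1: "rep b (h + v) = rep b h" by (simp add: rep_def Lb_add_iff(1)[OF v h])
  have "v + h = h + v" using h vc by (rule comm_add_vec[symmetric])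
  thus "rep b (v + h) = rep b h" using 1 by simp
qed

lemma rep_rep:
  assumes h: "h \<in> carrier_vec n"
  shows "rep b (rep b h) = rep b h"
proof -
  have "rep b h + (h - rep b h) = h" using h rep(1)[OF h, of b] by (intro eq_vecI) auto
  thus ?thesis using rep_add(1)[OF rep(1)[OF h] rep(2)[OF h]] by metis
qed

text \<open>The last clause excludes pinches \<open>t^e x^c t^-e\<close> with \<open>c\<close> in
  \<open>Lb e\<close>, which would collapse to a base element; the condition on \<open>rep\<close>
  makes the form unique.\<close>

fun normal_seq :: "(bool \<times> int vec) list \<Rightarrow> bool" where
  "normal_seq [] = True"
| "normal_seq ((e, c) # r) = (c \<in> carrier_vec n \<and> rep e c = c \<and> normal_seq r \<and>
     (r \<noteq> [] \<longrightarrow> fst (hd r) \<noteq> e \<longrightarrow> c \<notin> Lb e))"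

text \<open>Encodes \<open>t^b x^h = x^(Am b (h - c)) t^b x^c\<close>, where
  \<open>c = rep b h\<close>.\<close>

definition push :: "bool \<Rightarrow> int vec \<times> (bool \<times> int vec) list \<Rightarrow> int vec \<times> (bool \<times> int vec) list" where
  "push b s = (Am b (fst s - rep b (fst s)), (b, rep b (fst s)) # snd s)"

text \<open>Encodes \<open>t^b x^h t^-b x^c = x^(Am b h + c)\<close> for \<open>h\<close> in
  \<open>Lb b\<close>.\<close>

definition pop :: "bool \<Rightarrow> int vec \<times> (bool \<times> int vec) list \<Rightarrow> int vec \<times> (bool \<times> int vec) list" where
  "pop b s = (Am b (fst s) + snd (hd (snd s)), tl (snd s))"

definition pops :: "bool \<Rightarrow> int vec \<times> (bool \<times> int vec) list \<Rightarrow> bool" where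
  "pops b s \<longleftrightarrow> snd s \<noteq> [] \<and> fst (hd (snd s)) \<noteq> b \<and> fst s \<in> Lb b"

text \<open>A pair \<open>(h, [(e\<^sub>1, c\<^sub>1), \<dots>, (e\<^sub>k, c\<^sub>k)])\<close> encodes the HNN normal form
  \<open>x\<^sup>h t\<^sup>\<plusminus> x\<^sup>c\<^sub>1 \<dots> t\<^sup>\<plusminus> x\<^sup>c\<^sub>k\<close>, the signs being given by the \<open>e\<^sub>i\<close>; the following is left multiplication.\<close>

definition sact :: "lm_gen \<times> bool \<Rightarrow> int vec \<times> (bool \<times> int vec) list \<Rightarrow> int vec \<times> (bool \<times> int vec) list" where
  "sact xb s = (case fst xb of
      X i \<Rightarrow> (fst s + (if snd xb then unit_vec n i else - unit_vec n i), snd s)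
    | T \<Rightarrow> if pops (snd xb) s then pop (snd xb) s else push (snd xb) s)"

definition states :: "(int vec \<times> (bool \<times> int vec) list) set" where
  "states = {s. fst s \<in> carrier_vec n \<and> normal_seq (snd s)}"

lemma push_states:
  assumes "s \<in> states" "\<not> pops b s"
  shows "push b s \<in> states"
proof -
  have h: "fst s \<in> carrier_vec n" and r: "normal_seq (snd s)" using assms(1) by (auto simp: states_def)
  have "rep b (fst s) \<notin> Lb b" if "snd s \<noteq> []" "fst (hd (snd s)) \<noteq> b"
  proof
    assume "rep b (fst s) \<in> Lb b"
    moreover have "rep b (fst s) + (fst s - rep b (fst s)) = fst s"
      using h rep(1)[OF h, of b] by (intro eq_vecI) auto
    ultimately have "fst s \<in> Lb b" using rep(2)[OF h, of b] Lb_add by metis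
    thus False using assms(2) that by (simp add: pops_def)
  qed
  thus ?thesis using rep[OF h, of b] rep_rep[OF h, of b] r by (auto simp: states_def push_def)
qed

lemma pop_states:
  assumes "s \<in> states" "pops b s"
  shows "pop b s \<in> states"
proof -
  obtain h e c r where s: "s = (h, (e, c) # r)" using assms(2) by (cases s; cases "snd s") (auto simp: pops_def)
  show ?thesis using assms by (auto simp: s states_def pop_def pops_def)
qed

text \<open>The exponent left by a push lies in \<open>Lb (\<not> b)\<close>, so the inverse letter
  meets a pinch and undoes the push.\<close>

lemma pop_push:
  assumes "s \<in> states" "\<not> pops b s"
  shows "pops (\<not> b) (push b s)" "pop (\<not> b) (push b s) = s"
proof -
  have h: "fst s \<in> carrier_vec n" using assms(1) by (auto simp: states_def)
  show "pops (\<not> b) (push b s)" using Am(1)[OF rep(2)[OF h]] by (simp add: pops_def push_def)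
  have "(fst s - rep b (fst s)) + rep b (fst s) = fst s" using h rep(1)[OF h, of b] by (intro eq_vecI) auto
  thus "pop (\<not> b) (push b s) = s"
    using Am_Am[OF rep(2)[OF h, of b]] by (simp add: pop_def push_def prod_eq_iff)
qed

text \<open>After a pop, a further pinch is excluded by \<open>normal_seq\<close>, so the inverse
  letter pushes; it recovers \<open>c\<close> because \<open>c\<close> is the chosen representative
  of its coset.\<close>

lemma push_pop:
  assumes "s \<in> states" "pops b s"
  shows "\<not> pops (\<not> b) (pop b s)" "push (\<not> b) (pop b s) = s"
proof -
  obtain h e c r where s: "s = (h, (e, c) # r)" using assms(2) by (cases s; cases "snd s") (auto simp: pops_def)
  have e: "e = (\<not> b)" and h: "h \<in> Lb b" using assms(2) by (auto simp: pops_def s)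
  have c: "c \<in> carrier_vec n" "rep e c = c" "r \<noteq> [] \<Longrightarrow> fst (hd r) \<noteq> e \<Longrightarrow> c \<notin> Lb e"
    using assms(1) by (auto simp: states_def s)
  have Ah: "Am b h \<in> Lb (\<not> b)" using Am(1)[OF h] .
  show "\<not> pops (\<not> b) (pop b s)"
    using c(3) Lb_add_iff(2)[OF Ah c(1)] by (auto simp: pops_def pop_def s e)
  have "rep (\<not> b) (Am b h + c) = c" using rep_add(2)[OF c(1) Ah] c(2) e by simp
  moreover have "Am b h + c - c = Am b h" using c(1) Lb_carrier[OF Ah] by (intro eq_vecI) auto
  ultimately show "push (\<not> b) (pop b s) = s"
    using Am_Am[OF h] by (simp add: push_def pop_def s e)
qed

text \<open>Van der Waerden's method: an action of the group on normal forms gives their uniqueness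
  without comparing sequences of cancellations. The relation that takes work is
  \<open>t x^v = x^w t\<close>; adding \<open>v\<close> from \<open>L\<close> changes neither the
  test for a pinch nor the coset representative.\<close>

lemma sact: "word_action sact (\<lambda>v s. (fst s + v, snd s)) states"
proof -
  have add: "h + (v + w) = h + w + v" if "h \<in> carrier_vec n" "v \<in> carrier_vec n" "w \<in> carrier_vec n" for h v w :: "int vec"
    using that by (intro eq_vecI) auto
  have cancel: "sact (T, b) (sact (T, \<not> b) s) = s" if "s \<in> states" for b s
    using pop_push[OF that, of "\<not> b"] push_pop[OF that, of "\<not> b"] by (auto simp: sact_def)
  have T: "sact (T, True) (fst s + v, snd s) = (fst (sact (T, True) s) + w, snd (sact (T, True) s))"
    if v: "v \<in> L" "w \<in> carrier_vec n" "A *\<^sub>v rv v = rv w" and s: "s \<in> states" for v w s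
  proof -
    have vL: "v \<in> Lb True" using v by (simp add: Lb_def)
    have Av: "Am True v = w" using v vL by (intro Am_unique) (auto simp: Ab_def)
    have h: "fst s \<in> carrier_vec n" using s by (simp add: states_def)
    have vc: "v \<in> carrier_vec n" using v L_carrier by blast
    have p: "pops True (fst s + v, snd s) \<longleftrightarrow> pops True s"
      by (simp add: pops_def Lb_add_iff(1)[OF vL h])
    show ?thesis
    proof (cases "pops True s")
      case True
      obtain h e c r where s': "s = (h, (e, c) # r)" using True by (cases s; cases "snd s") (auto simp: pops_def)
      have hL: "h \<in> Lb True" using True by (simp add: pops_def s')
      have "Am True h + w + c = Am True h + c + w"
        using Am_carrier[OF hL] v(2) s by (intro eq_vecI) (auto simp: states_def s')
      thus ?thesis using True p Am_add[OF hL vL] Av by (simp add: sact_def pop_def s')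
    next
      case False
      have r: "rep True (fst s + v) = rep True (fst s)" by (rule rep_add(1)[OF h vL])
      have "fst s + v - rep True (fst s) = (fst s - rep True (fst s)) + v"
        using h vc rep(1)[OF h, of True] by (intro eq_vecI) auto
      hence "Am True (fst s + v - rep True (fst s)) = Am True (fst s - rep True (fst s)) + w"
        using Am_add[OF rep(2)[OF h] vL] Av by simp
      thus ?thesis using False p r by (simp add: sact_def push_def)
    qed
  qed
  show ?thesis
    unfolding word_action_def
  proof (intro conjI allI impI)
    fix b s assume "s \<in> states"
    thus "sact (T, b) s \<in> states" using push_states pop_states by (auto simp: sact_def)
  next
    fix v s assume "v \<in> L" "s \<in> states"
    fix w assume "w \<in> carrier_vec n" "A *\<^sub>v rv v = rv w"
    thus "sact (T, True) (fst s + v, snd s) = (fst (sact (T, True) s) + w, snd (sact (T, True) s))"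
      using T \<open>v \<in> L\<close> \<open>s \<in> states\<close> by blast
  next
    fix b s assume "s \<in> states"
    thus "sact (T, b) (sact (T, \<not> b) s) = s" by (rule cancel)
  qed (auto simp: states_def sact_def add simp del: uminus_add_conv_diff)
qed

lemma ev_tb: "s \<in> states \<Longrightarrow> ev sact (tb b) s = sact (T, b) s"
  by (cases b) (simp_all add: tb_def ev_tt[OF sact] ev_ti[OF sact])

definition letter :: "bool \<times> int vec \<Rightarrow> lm_gen word set" where
  "letter ec = tb (fst ec) \<otimes>\<^bsub>G\<^esub> XP (snd ec)"

fun wordG :: "(bool \<times> int vec) list \<Rightarrow> lm_gen word set" where
  "wordG [] = \<one>\<^bsub>G\<^esub>"
| "wordG (ec # r) = letter ec \<otimes>\<^bsub>G\<^esub> wordG r"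

lemma letter_carrier [simp]: "snd ec \<in> carrier_vec n \<Longrightarrow> letter ec \<in> carrier G"
  by (simp add: letter_def)

lemma wordG_carrier: "(\<And>ec. ec \<in> set r \<Longrightarrow> snd ec \<in> carrier_vec n) \<Longrightarrow> wordG r \<in> carrier G"
  by (induction r) auto

lemma normal_seq_carrier: "normal_seq r \<Longrightarrow> ec \<in> set r \<Longrightarrow> snd ec \<in> carrier_vec n"
  by (induction r rule: normal_seq.induct) auto

definition eval :: "int vec \<times> (bool \<times> int vec) list \<Rightarrow> lm_gen word set" where
  "eval s = XP (fst s) \<otimes>\<^bsub>G\<^esub> wordG (snd s)"

lemma eval_carrier: "s \<in> states \<Longrightarrow> eval s \<in> carrier G"
  unfolding eval_def states_def by (auto intro!: wordG_carrier dest: normal_seq_carrier)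

lemma eval_tb:
  assumes s: "s \<in> states"
  shows "eval (sact (T, b) s) = tb b \<otimes>\<^bsub>G\<^esub> eval s"
proof (cases "pops b s")
  case True
  obtain h e c r where s': "s = (h, (e, c) # r)" using True by (cases s; cases "snd s") (auto simp: pops_def)
  have h: "h \<in> Lb b" "e = (\<not> b)" using True by (auto simp: pops_def s')
  have c: "c \<in> carrier_vec n" "h \<in> carrier_vec n" "wordG r \<in> carrier G" "Am b h \<in> carrier_vec n"
    using s h by (auto simp: states_def s' intro!: wordG_carrier dest: normal_seq_carrier)
  have "tb b \<otimes>\<^bsub>G\<^esub> eval s = (tb b \<otimes>\<^bsub>G\<^esub> XP h) \<otimes>\<^bsub>G\<^esub> (tb (\<not> b) \<otimes>\<^bsub>G\<^esub> (XP c \<otimes>\<^bsub>G\<^esub> wordG r))"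
    using c by (simp add: eval_def s' h(2) letter_def m_assoc)
  also have "\<dots> = XP (Am b h) \<otimes>\<^bsub>G\<^esub> (tb b \<otimes>\<^bsub>G\<^esub> (tb (\<not> b) \<otimes>\<^bsub>G\<^esub> (XP c \<otimes>\<^bsub>G\<^esub> wordG r)))"
    unfolding tb_conj[OF h(1)] using c by (simp add: m_assoc)
  also have "\<dots> = XP (Am b h) \<otimes>\<^bsub>G\<^esub> (XP c \<otimes>\<^bsub>G\<^esub> wordG r)"
    using c by (simp add: tb_cancel_left)
  also have "\<dots> = eval (pop b s)" using c by (simp add: eval_def pop_def s' XP_add m_assoc)
  finally show ?thesis using True by (simp add: sact_def)
next
  case False
  have h: "fst s \<in> carrier_vec n" and w: "wordG (snd s) \<in> carrier G"
    using s by (auto simp: states_def intro!: wordG_carrier dest: normal_seq_carrier)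
  note r = rep[OF h, of b]
  let ?d = "fst s - rep b (fst s)"
  have "?d + rep b (fst s) = fst s" using h r by (intro eq_vecI) auto
  hence "XP (fst s) = XP ?d \<otimes>\<^bsub>G\<^esub> XP (rep b (fst s))" using XP_add[of ?d "rep b (fst s)"] h r by simp
  hence "tb b \<otimes>\<^bsub>G\<^esub> eval s = (tb b \<otimes>\<^bsub>G\<^esub> XP ?d) \<otimes>\<^bsub>G\<^esub> (XP (rep b (fst s)) \<otimes>\<^bsub>G\<^esub> wordG (snd s))"
    using h r w by (simp add: eval_def m_assoc)
  also have "\<dots> = XP (Am b ?d) \<otimes>\<^bsub>G\<^esub> (tb b \<otimes>\<^bsub>G\<^esub> XP (rep b (fst s)) \<otimes>\<^bsub>G\<^esub> wordG (snd s))"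
    unfolding tb_conj[OF r(2)] using h r w Am_carrier[OF r(2)] by (simp add: m_assoc)
  also have "\<dots> = eval (push b s)" by (simp add: eval_def push_def letter_def)
  finally show ?thesis using False by (simp add: sact_def)
qed

lemma eval_ev: "g \<in> carrier G \<Longrightarrow> s \<in> states \<Longrightarrow> eval (ev sact g s) = g \<otimes>\<^bsub>G\<^esub> eval s"
proof (induction g rule: G_induct)
  case one
  thus ?case by (simp add: ev_one[OF sact] eval_carrier)
next
  case (XP v g)
  have s: "ev sact g s \<in> states" using XP by (intro ev_closed[OF sact])
  hence c: "fst (ev sact g s) \<in> carrier_vec n" "wordG (snd (ev sact g s)) \<in> carrier G"
    by (auto simp: states_def intro!: wordG_carrier dest: normal_seq_carrier)
  have "ev sact (XP v \<otimes>\<^bsub>G\<^esub> g) s = (fst (ev sact g s) + v, snd (ev sact g s))"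
    using XP s by (simp add: ev_mult[OF sact] ev_XP[OF sact])
  moreover have "fst (ev sact g s) + v = v + fst (ev sact g s)" using c XP.hyps by (intro comm_add_vec)
  ultimately have "eval (ev sact (XP v \<otimes>\<^bsub>G\<^esub> g) s) = XP v \<otimes>\<^bsub>G\<^esub> eval (ev sact g s)"
    using c XP.hyps by (simp add: eval_def XP_add m_assoc)
  thus ?case using XP eval_carrier by (simp add: m_assoc)
next
  case (tt g)
  have s: "ev sact g s \<in> states" using tt by (intro ev_closed[OF sact])
  have "eval (ev sact (tt \<otimes>\<^bsub>G\<^esub> g) s) = tt \<otimes>\<^bsub>G\<^esub> eval (ev sact g s)"
    using tt s eval_tb[OF s, of True] by (simp add: ev_mult[OF sact] ev_tt[OF sact] tb_def)
  thus ?case using tt eval_carrier by (simp add: m_assoc)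
next
  case (ti g)
  have s: "ev sact g s \<in> states" using ti by (intro ev_closed[OF sact])
  have "eval (ev sact (ti \<otimes>\<^bsub>G\<^esub> g) s) = ti \<otimes>\<^bsub>G\<^esub> eval (ev sact g s)"
    using ti s eval_tb[OF s, of False] by (simp add: ev_mult[OF sact] ev_ti[OF sact] tb_def)
  thus ?case using ti eval_carrier by (simp add: m_assoc)
qed

definition base :: "int vec \<times> (bool \<times> int vec) list" where "base = (0\<^sub>v n, [])"

lemma base: "base \<in> states" by (simp add: base_def states_def)

lemma normal_form: "g \<in> carrier G \<Longrightarrow> eval (ev sact g base) = g"
  by (simp add: eval_ev base) (simp add: eval_def base_def)

fun reduced_seq :: "(bool \<times> int vec) list \<Rightarrow> bool" where
  "reduced_seq [] = True"
| "reduced_seq ((e, c) # r) = (c \<in> carrier_vec n \<and> reduced_seq r \<and> (r \<noteq> [] \<longrightarrow> fst (hd r) \<noteq> e \<longrightarrow> c \<notin> Lb e))"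

lemma normal_seq_reduced: "normal_seq r \<Longrightarrow> reduced_seq r"
  by (induction r rule: normal_seq.induct) auto

lemma reduced_seq_carrier: "reduced_seq r \<Longrightarrow> ec \<in> set r \<Longrightarrow> snd ec \<in> carrier_vec n"
  by (induction r rule: reduced_seq.induct) auto

lemma ev_letter:
  assumes "s \<in> states" "snd ec \<in> carrier_vec n"
  shows "ev sact (letter ec) s = sact (T, fst ec) (fst s + snd ec, snd s)"
proof -
  have "(fst s + snd ec, snd s) \<in> states" using assms by (auto simp: states_def)
  thus ?thesis using assms by (simp add: letter_def ev_mult[OF sact] ev_XP[OF sact] ev_tb)
qed

text \<open>Britton's lemma: a reduced word only pushes, so lengths add up. The last hypothesis
  excludes a pinch where the word meets the state. The membership of the leading exponent in
  \<open>Lb\<close> is what the final push leaves behind.\<close>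

lemma ev_reduced:
  assumes "reduced_seq zs" "zs \<noteq> []" "s \<in> states"
    and "snd s \<noteq> [] \<Longrightarrow> fst (hd (snd s)) \<noteq> fst (last zs) \<Longrightarrow> fst s + snd (last zs) \<notin> Lb (fst (last zs))"
  shows "fst (ev sact (wordG zs) s) \<in> Lb (\<not> fst (hd zs)) \<and> snd (ev sact (wordG zs) s) \<noteq> [] \<and>
    fst (hd (snd (ev sact (wordG zs) s))) = fst (hd zs) \<and>
    length (snd (ev sact (wordG zs) s)) = length zs + length (snd s)"
  using assms
proof (induction zs rule: reduced_seq.induct)
  case (2 e c r)
  have push: "sact (T, e) u = push e u \<and> fst (push e u) \<in> Lb (\<not> e)" if "u \<in> states" "\<not> pops e u" for u
    using that Am(1)[OF rep(2)] by (auto simp: sact_def push_def states_def)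
  have c: "c \<in> carrier_vec n" using "2.prems" by simp
  have wr: "wordG r \<in> carrier G" using "2.prems"(1) by (auto intro!: wordG_carrier dest: reduced_seq_carrier)
  show ?case
  proof (cases "r = []")
    case True
    have u: "(fst s + c, snd s) \<in> states" using "2.prems"(3) c by (auto simp: states_def)
    have "\<not> pops e (fst s + c, snd s)" using "2.prems"(4) True by (auto simp: pops_def)
    moreover have "ev sact (wordG ((e, c) # r)) s = sact (T, e) (fst s + c, snd s)"
      using True ev_letter[OF "2.prems"(3), of "(e, c)"] c by simp
    ultimately show ?thesis using push[OF u] by (simp add: push_def True)
  next
    case False
    define s' where "s' = ev sact (wordG r) s"
    have s': "s' \<in> states" unfolding s'_def by (rule ev_closed[OF sact "2.prems"(3) wr])
    have IH: "fst s' \<in> Lb (\<not> fst (hd r))" "snd s' \<noteq> []" "fst (hd (snd s')) = fst (hd r)"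
      "length (snd s') = length r + length (snd s)"
      using "2.IH" "2.prems" False by (simp_all add: s'_def)
    have u: "(fst s' + c, snd s') \<in> states" using s' c by (auto simp: states_def)
    have "\<not> pops e (fst s' + c, snd s')"
    proof
      assume p: "pops e (fst s' + c, snd s')"
      hence ne: "fst (hd r) \<noteq> e" and m: "fst s' + c \<in> Lb e" using IH by (auto simp: pops_def)
      have "fst s' \<in> Lb e" using IH(1) ne by (cases e; cases "fst (hd r)") auto
      hence "c \<in> Lb e" using Lb_add_iff(2)[OF _ c] m by blast
      thus False using "2.prems"(1) False ne by simp
    qed
    moreover have "ev sact (wordG ((e, c) # r)) s = sact (T, e) (fst s' + c, snd s')"
      using ev_letter[OF s', of "(e, c)"] c wr "2.prems"(3) by (simp add: ev_mult[OF sact] s'_def)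
    ultimately show ?thesis using push[OF u] IH(4) by (simp add: push_def)
  qed
qed simp

text \<open>Each letter raises or lowers the length by one, so full length forces the leading
  letter, which acts last, to have been a push. The information about the leading term in
  \<open>ev_reduced\<close> thus follows from length alone, without knowing that the junction is
  free of pinches.\<close>

lemma ev_word_length:
  assumes "\<And>ec. ec \<in> set zs \<Longrightarrow> snd ec \<in> carrier_vec n" "s \<in> states"
  shows "length (snd (ev sact (wordG zs) s)) \<le> length zs + length (snd s)"
    and "zs \<noteq> [] \<Longrightarrow> length (snd (ev sact (wordG zs) s)) = length zs + length (snd s) \<Longrightarrow>
      fst (ev sact (wordG zs) s) \<in> Lb (\<not> fst (hd zs)) \<and>
      fst (hd (snd (ev sact (wordG zs) s))) = fst (hd zs)"
proof -
  have *: "length (snd (ev sact (wordG zs) s)) \<le> length zs + length (snd s) \<and>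
    (zs \<noteq> [] \<longrightarrow> length (snd (ev sact (wordG zs) s)) = length zs + length (snd s) \<longrightarrow>
      fst (ev sact (wordG zs) s) \<in> Lb (\<not> fst (hd zs)) \<and>
      fst (hd (snd (ev sact (wordG zs) s))) = fst (hd zs))"
    using assms(1)
  proof (induction zs)
    case Nil
    thus ?case using assms(2) by (simp add: ev_one[OF sact])
  next
    case (Cons ec r)
    define s' where "s' = ev sact (wordG r) s"
    have wr: "wordG r \<in> carrier G" using Cons.prems by (auto intro!: wordG_carrier)
    have s': "s' \<in> states" unfolding s'_def by (rule ev_closed[OF sact assms(2) wr])
    have c: "snd ec \<in> carrier_vec n" using Cons.prems by simp
    have len: "length (snd s') \<le> length r + length (snd s)" using Cons.IH Cons.prems by (auto simp: s'_def)
    define u where "u = (fst s' + snd ec, snd s')"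
    have u: "u \<in> states" using s' c by (auto simp: states_def u_def)
    have e: "ev sact (wordG (ec # r)) s = sact (T, fst ec) u"
      using ev_letter[OF s' c] c wr assms(2) by (simp add: ev_mult[OF sact] s'_def u_def)
    show ?case
    proof (cases "pops (fst ec) u")
      case True
      hence "length (snd (ev sact (wordG (ec # r)) s)) < length (snd u)"
        unfolding e by (cases "snd u") (auto simp: sact_def pop_def pops_def)
      thus ?thesis using len by (simp add: u_def)
    next
      case False
      have "fst u \<in> carrier_vec n" using u by (simp add: states_def)
      from Am(1)[OF rep(2)[OF this]] show ?thesis unfolding e using False len by (simp add: sact_def push_def u_def)
    qed
  qed
  show "length (snd (ev sact (wordG zs) s)) \<le> length zs + length (snd s)"
    and "zs \<noteq> [] \<Longrightarrow> length (snd (ev sact (wordG zs) s)) = length zs + length (snd s) \<Longrightarrow>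
      fst (ev sact (wordG zs) s) \<in> Lb (\<not> fst (hd zs)) \<and>
      fst (hd (snd (ev sact (wordG zs) s))) = fst (hd zs)"
    using * by auto
qed

definition bracket :: "lm_gen word set \<Rightarrow> lm_gen word set \<Rightarrow> lm_gen word set" where
  "bracket a b = a \<otimes>\<^bsub>G\<^esub> b \<otimes>\<^bsub>G\<^esub> inv\<^bsub>G\<^esub> a \<otimes>\<^bsub>G\<^esub> inv\<^bsub>G\<^esub> b"

lemma bracket_word:
  fixes b p q
  assumes p: "p \<in> carrier_vec n" and q: "q \<in> carrier_vec n"
  defines "y \<equiv> tb b \<otimes>\<^bsub>G\<^esub> XP p \<otimes>\<^bsub>G\<^esub> tb (\<not> b)"
  shows "bracket y (XP q) = wordG [(b, p), (\<not> b, q), (b, - p), (\<not> b, - q)]"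
    and "bracket (XP q) y = XP q \<otimes>\<^bsub>G\<^esub> wordG [(b, p), (\<not> b, - q), (b, - p), (\<not> b, 0\<^sub>v n)]"
    and "y \<in> carrier G"
proof -
  have tinv: "inv\<^bsub>G\<^esub> (tb b) = tb (\<not> b)" "inv\<^bsub>G\<^esub> (tb (\<not> b)) = tb b"
    by (cases b; simp add: tb_def ti_eq)+
  have yinv: "inv\<^bsub>G\<^esub> y = tb b \<otimes>\<^bsub>G\<^esub> XP (- p) \<otimes>\<^bsub>G\<^esub> tb (\<not> b)"
    using p by (simp add: y_def inv_mult_group tinv XP_inv m_assoc)
  show "y \<in> carrier G" using p by (simp add: y_def)
  show "bracket y (XP q) = wordG [(b, p), (\<not> b, q), (b, - p), (\<not> b, - q)]"
    unfolding bracket_def yinv using p q by (simp add: y_def letter_def XP_inv m_assoc)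
  show "bracket (XP q) y = XP q \<otimes>\<^bsub>G\<^esub> wordG [(b, p), (\<not> b, - q), (b, - p), (\<not> b, 0\<^sub>v n)]"
    unfolding bracket_def yinv using p q by (simp add: y_def letter_def XP_inv m_assoc)
qed

text \<open>If the normal form of \<open>z\<close> ends in \<open>t\<^sup>b x\<^sup>c\<close>, then no cancellation occurs in the products of \<open>z\<close> with
  the commutator of \<open>t\<^sup>b x\<^sup>p t\<^sup>-\<^sup>b\<close> and \<open>x\<^sup>q\<close> and with its inverse. Both products would have to start
  like the left factor after commuting, which is contradictory because \<open>x\<^sup>q\<close> tells the two apart.\<close>

lemma centralizer_in_base:
  assumes p: "\<And>b. p b \<in> carrier_vec n" "\<And>b. p b \<notin> Lb b" and z: "z \<in> carrier G"
    and comm: "\<And>b. let y = tb b \<otimes>\<^bsub>G\<^esub> XP (p b) \<otimes>\<^bsub>G\<^esub> tb (\<not> b); q = XP (p (\<not> b)) in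
       z \<otimes>\<^bsub>G\<^esub> bracket y q = bracket y q \<otimes>\<^bsub>G\<^esub> z \<and> z \<otimes>\<^bsub>G\<^esub> bracket q y = bracket q y \<otimes>\<^bsub>G\<^esub> z"
  shows "z \<in> XP ` carrier_vec n"
proof -
  obtain h zs where hz: "ev sact z base = (h, zs)" by (cases "ev sact z base")
  have st: "(h, zs) \<in> states" unfolding hz[symmetric] by (rule ev_closed[OF sact base z])
  have h: "h \<in> carrier_vec n" and zs: "normal_seq zs" using st by (auto simp: states_def)
  have zeq: "z = XP h \<otimes>\<^bsub>G\<^esub> wordG zs" using normal_form[OF z] by (simp add: hz eval_def)
  have wz: "wordG zs \<in> carrier G" using zs by (auto intro!: wordG_carrier dest: normal_seq_carrier)
  show ?thesis
  proof (cases "zs = []")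
    case True
    thus ?thesis using zeq h by simp
  next
    case False
    \<comment> \<open>The test words begin with the sign of the last letter of \<open>z\<close>, so
      equal signs meet where \<open>z\<close> is followed by one of them.\<close>
    define b where "b = fst (last zs)"
    define q where "q = p (\<not> b)"
    define ys where "ys = [(b, p b), (\<not> b, q), (b, - p b), (\<not> b, - q)]"
    define ys' where "ys' = [(b, p b), (\<not> b, - q), (b, - p b), (\<not> b, 0\<^sub>v n)]"
    have pc: "p b \<in> carrier_vec n" "q \<in> carrier_vec n" "p b \<notin> Lb b" "q \<notin> Lb (\<not> b)"
      "- p b \<notin> Lb b" "- q \<notin> Lb (\<not> b)"
      using p by (auto simp: q_def Lb_uminus_iff)
    have ys: "ys \<noteq> []" "ys' \<noteq> []" "fst (hd ys) = b" "fst (hd ys') = b" "length ys = 4" "length ys' = 4"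
      by (auto simp: ys_def ys'_def)
    have red: "reduced_seq ys" "reduced_seq ys'" using pc by (auto simp: ys_def ys'_def)
    have carr: "\<And>ec. ec \<in> set ys \<Longrightarrow> snd ec \<in> carrier_vec n" "\<And>ec. ec \<in> set ys' \<Longrightarrow> snd ec \<in> carrier_vec n"
      using pc by (auto simp: ys_def ys'_def)
    have wy: "wordG ys \<in> carrier G" "wordG ys' \<in> carrier G" using carr wordG_carrier by auto
    note br = bracket_word[OF pc(1,2), of b]
    have c1: "z \<otimes>\<^bsub>G\<^esub> wordG ys = wordG ys \<otimes>\<^bsub>G\<^esub> z"
      using comm[of b] br(1) by (simp add: Let_def ys_def q_def)
    have c2: "z \<otimes>\<^bsub>G\<^esub> (XP q \<otimes>\<^bsub>G\<^esub> wordG ys') = XP q \<otimes>\<^bsub>G\<^esub> wordG ys' \<otimes>\<^bsub>G\<^esub> z"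
      using comm[of b] br(2) by (simp add: Let_def ys'_def q_def)
    have ev_z: "ev sact z s = (fst (ev sact (wordG zs) s) + h, snd (ev sact (wordG zs) s))" if "s \<in> states" for s
      unfolding zeq using that wz h ev_closed[OF sact that wz] by (simp add: ev_mult[OF sact] ev_XP[OF sact])
    \<comment> \<open>When \<open>z\<close> acts on a state that begins with \<open>t^b\<close>, the
      leading letter of the result is that of \<open>z\<close>, and the leading exponent lies in the
      coset of \<open>h\<close>.\<close>
    have left: "length (snd (ev sact z s)) = length zs + length (snd s) \<and>
        (\<exists>l \<in> Lb (\<not> fst (hd zs)). fst (ev sact z s) = l + h) \<and> fst (hd (snd (ev sact z s))) = fst (hd zs)"
      if s: "s \<in> states" "snd s \<noteq> []" "fst (hd (snd s)) = b" for s
      using ev_reduced[OF normal_seq_reduced[OF zs] False s(1)] s by (auto simp: ev_z b_def)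
    define s1 where "s1 = ev sact (wordG ys) base"
    have s1: "s1 \<in> states" "snd s1 \<noteq> []" "fst (hd (snd s1)) = b" "length (snd s1) = 4"
      using ev_reduced[OF red(1) _ base] ev_closed[OF sact base wy(1)] ys by (auto simp: s1_def base_def)
    define s2 where "s2 = ev sact (XP q \<otimes>\<^bsub>G\<^esub> wordG ys') base"
    have s2': "s2 = (fst (ev sact (wordG ys') base) + q, snd (ev sact (wordG ys') base))"
      unfolding s2_def using pc wy base ev_closed[OF sact base wy(2)] by (simp add: ev_mult[OF sact] ev_XP[OF sact])
    have s2: "s2 \<in> states" "snd s2 \<noteq> []" "fst (hd (snd s2)) = b" "length (snd s2) = 4"
    proof -
      show "s2 \<in> states" unfolding s2_def using pc wy by (intro ev_closed[OF sact base]) auto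
      show "snd s2 \<noteq> []" "fst (hd (snd s2)) = b" "length (snd s2) = 4"
        unfolding s2' using ev_reduced[OF red(2) _ base] ys by (auto simp: base_def)
    qed
    have z1: "ev sact z s1 = ev sact (wordG ys) (h, zs)"
      unfolding s1_def hz[symmetric] using wy z base by (simp add: ev_mult[OF sact, symmetric] c1)
    have z2: "ev sact z s2 = (fst (ev sact (wordG ys') (h, zs)) + q, snd (ev sact (wordG ys') (h, zs)))"
    proof -
      have "ev sact z s2 = ev sact (XP q \<otimes>\<^bsub>G\<^esub> wordG ys' \<otimes>\<^bsub>G\<^esub> z) base"
        unfolding s2_def c2[symmetric] using wy z pc base by (simp add: ev_mult[OF sact])
      thus ?thesis using wy z pc base st ev_closed[OF sact st wy(2)]
        by (simp add: m_assoc ev_mult[OF sact] ev_XP[OF sact] hz)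
    qed
    obtain l1 where l1: "l1 \<in> Lb (\<not> fst (hd zs))" "fst (ev sact z s1) = l1 + h" using left[OF s1(1-3)] by blast
    obtain l2 where l2: "l2 \<in> Lb (\<not> fst (hd zs))" "fst (ev sact z s2) = l2 + h" using left[OF s2(1-3)] by blast
    \<comment> \<open>In the other order the same element has the same, full length, so the leading
      letter of the test word, which now acts last, was pushed.\<close>
    have 1: "fst (ev sact (wordG ys) (h, zs)) \<in> Lb (\<not> b) \<and> fst (hd (snd (ev sact (wordG ys) (h, zs)))) = b"
    proof -
      have len: "length (snd (ev sact (wordG ys) (h, zs))) = length ys + length (snd (h, zs))"
        using left[OF s1(1-3)] s1(4) ys(5) unfolding z1 by simp
      show ?thesis using ev_word_length(2)[OF _ st ys(1) len] carr(1) unfolding ys(3) by blast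
    qed
    have 2: "fst (ev sact (wordG ys') (h, zs)) \<in> Lb (\<not> b) \<and> fst (hd (snd (ev sact (wordG ys') (h, zs)))) = b"
    proof -
      have len: "length (snd (ev sact (wordG ys') (h, zs))) = length ys' + length (snd (h, zs))"
        using left[OF s2(1-3)] s2(4) ys(6) unfolding z2 by simp
      show ?thesis using ev_word_length(2)[OF _ st ys(2) len] carr(2) unfolding ys(4) by blast
    qed
    have e: "fst (hd zs) = b" using 1 left[OF s1(1-3)] unfolding z1 by simp
    have "l1 + h \<in> Lb (\<not> b)" using 1 l1 unfolding z1 by simp
    \<comment> \<open>The two descriptions of the leading exponent put \<open>h\<close> into
      \<open>Lb (\<not> b)\<close>. For the second test word the exponent is shifted by
      \<open>q\<close>, which would then lie there as well.\<close>
    hence hL: "h \<in> Lb (\<not> b)" using l1(1) h e Lb_add_iff(2)[of l1 "\<not> b" h] by simp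
    have "fst (ev sact (wordG ys') (h, zs)) + q \<in> Lb (\<not> b)"
      using l2 hL e Lb_add[of l2 "\<not> b" h] unfolding z2 by simp
    hence "q \<in> Lb (\<not> b)" using 2 pc(2) Lb_add_iff(2) by blast
    thus ?thesis using pc(4) by simp
  qed
qed

end

section \<open>Elements that virtually commute with all commutators\<close>

context leary_minasyan
begin

definition brackets :: "lm_gen word set set" where
  "brackets = {bracket a b |a b. a \<in> carrier G \<and> b \<in> carrier G}"

definition virt_central :: "lm_gen word set set" where
  "virt_central = {g \<in> carrier G. \<forall>c\<in>brackets. \<exists>k>0. g [^]\<^bsub>G\<^esub> (k::nat) \<otimes>\<^bsub>G\<^esub> c = c \<otimes>\<^bsub>G\<^esub> g [^]\<^bsub>G\<^esub> k}"

definition base_roots :: "lm_gen word set set" where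
  "base_roots = {g \<in> carrier G. \<exists>k>0. g [^]\<^bsub>G\<^esub> (k::nat) \<in> XP ` carrier_vec n}"

lemma bracket_carrier [simp]: "a \<in> carrier G \<Longrightarrow> b \<in> carrier G \<Longrightarrow> bracket a b \<in> carrier G"
  by (simp add: bracket_def)

lemma bracketsI: "a \<in> carrier G \<Longrightarrow> b \<in> carrier G \<Longrightarrow> bracket a b \<in> brackets"
  by (auto simp: brackets_def)

lemma brackets_carrier: "c \<in> brackets \<Longrightarrow> c \<in> carrier G"
  by (auto simp: brackets_def)

lemma tau_bracket: "c \<in> brackets \<Longrightarrow> tau c = 0"
  by (auto simp: brackets_def bracket_def)

lemma commute_nat_pow:
  assumes "x \<in> carrier G" "y \<in> carrier G" "x \<otimes>\<^bsub>G\<^esub> y = y \<otimes>\<^bsub>G\<^esub> x"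
  shows "x [^]\<^bsub>G\<^esub> (k::nat) \<otimes>\<^bsub>G\<^esub> y = y \<otimes>\<^bsub>G\<^esub> x [^]\<^bsub>G\<^esub> k"
  using commute_int_pow[OF assms(2,1) assms(3)[symmetric], of "int k"] by (simp add: int_pow_int)

text \<open>The product of the individual exponents serves all the commutators at once.\<close>

lemma virt_central_finite:
  assumes "g \<in> virt_central" "finite C" "C \<subseteq> brackets"
  shows "\<exists>k>0. \<forall>c\<in>C. g [^]\<^bsub>G\<^esub> (k::nat) \<otimes>\<^bsub>G\<^esub> c = c \<otimes>\<^bsub>G\<^esub> g [^]\<^bsub>G\<^esub> k"
  using assms(2,3)
proof (induction C rule: finite_induct)
  case (insert x F)
  have g: "g \<in> carrier G" using assms(1) by (simp add: virt_central_def)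
  obtain k where k: "k > 0" "\<And>c. c \<in> F \<Longrightarrow> g [^]\<^bsub>G\<^esub> (k::nat) \<otimes>\<^bsub>G\<^esub> c = c \<otimes>\<^bsub>G\<^esub> g [^]\<^bsub>G\<^esub> k"
    using insert by auto
  obtain l where l: "l > 0" "g [^]\<^bsub>G\<^esub> (l::nat) \<otimes>\<^bsub>G\<^esub> x = x \<otimes>\<^bsub>G\<^esub> g [^]\<^bsub>G\<^esub> l"
    using insert.prems assms(1) by (auto simp: virt_central_def)
  have "g [^]\<^bsub>G\<^esub> (k * l) \<otimes>\<^bsub>G\<^esub> c = c \<otimes>\<^bsub>G\<^esub> g [^]\<^bsub>G\<^esub> (k * l)" if cF: "c \<in> insert x F" for c
  proof -
    have c: "c \<in> carrier G" using cF insert.prems brackets_carrier by auto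
    consider "c = x" | "c \<in> F" using cF by blast
    thus ?thesis
    proof cases
      case 1
      thus ?thesis using commute_nat_pow[OF nat_pow_closed[OF g] c, of l k] l g
        by (simp add: nat_pow_pow mult.commute)
    next
      case 2
      thus ?thesis using commute_nat_pow[OF nat_pow_closed[OF g] c, of k l] k g
        by (simp add: nat_pow_pow)
    qed
  qed
  thus ?case using k(1) l(1) by (intro exI[of _ "k * l"]) auto
qed (auto intro: exI[of _ 1])

lemma tau_base_roots: "g \<in> base_roots \<Longrightarrow> tau g = 0"
proof -
  assume "g \<in> base_roots"
  then obtain k v where k: "k > 0" "g \<in> carrier G" "v \<in> carrier_vec n" "g [^]\<^bsub>G\<^esub> (k::nat) = XP v" by (auto simp: base_roots_def)
  hence "int k * tau g = 0" using tau_nat_pow[of g k] by simp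
  thus ?thesis using k(1) by simp
qed

lemma XP_base_roots: "v \<in> carrier_vec n \<Longrightarrow> XP v \<in> base_roots"
  by (auto simp: base_roots_def intro!: exI[of _ 1])

text \<open>A commutator has \<open>tau\<close> zero, hence linear part 1, so it commutes with
  \<open>x^(N v)\<close> as soon as conjugation keeps this element in the base.\<close>

lemma base_roots_subset_virt_central: "base_roots \<subseteq> virt_central"
proof
  fix g assume "g \<in> base_roots"
  then obtain k v where k: "k > 0" "g \<in> carrier G" "v \<in> carrier_vec n" "g [^]\<^bsub>G\<^esub> (k::nat) = XP v" by (auto simp: base_roots_def)
  have "\<exists>k>0. g [^]\<^bsub>G\<^esub> (k::nat) \<otimes>\<^bsub>G\<^esub> c = c \<otimes>\<^bsub>G\<^esub> g [^]\<^bsub>G\<^esub> k" if c: "c \<in> brackets" for c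
  proof -
    obtain N where N: "N > 0" "\<And>v. v \<in> carrier_vec n \<Longrightarrow> \<exists>w\<in>carrier_vec n. c \<otimes>\<^bsub>G\<^esub> XP (int N \<cdot>\<^sub>v v) = XP w \<otimes>\<^bsub>G\<^esub> c"
      using commensurated[OF brackets_carrier[OF c]] unfolding commensurates_def by blast
    obtain w where w: "w \<in> carrier_vec n" "c \<otimes>\<^bsub>G\<^esub> XP (int N \<cdot>\<^sub>v v) = XP w \<otimes>\<^bsub>G\<^esub> c" using N(2)[OF k(3)] by blast
    have "Ap (tau c) *\<^sub>v rv (int N \<cdot>\<^sub>v v) = rv w"
      using w k(3) by (intro XP_intertwine brackets_carrier[OF c]) auto
    hence "rv w = rv (int N \<cdot>\<^sub>v v)" using tau_bracket[OF c] k(3) by simp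
    hence "w = int N \<cdot>\<^sub>v v" by (simp only: rv_inject)
    moreover have "g [^]\<^bsub>G\<^esub> (k * N) = XP (int N \<cdot>\<^sub>v v)"
      using k by (simp add: nat_pow_pow[symmetric] XP_nat_pow)
    ultimately have "g [^]\<^bsub>G\<^esub> (k * N) \<otimes>\<^bsub>G\<^esub> c = c \<otimes>\<^bsub>G\<^esub> g [^]\<^bsub>G\<^esub> (k * N)" using w(2) by simp
    thus ?thesis using k(1) N(1) by (intro exI[of _ "k * N"]) auto
  qed
  thus "g \<in> virt_central" using k(2) by (simp add: virt_central_def)
qed

text \<open>Only finitely many commutators are tested in \<open>centralizer_in_base\<close>, so a
  single power of \<open>g\<close> commutes with all of them.\<close>

lemma virt_central_subset_base_roots_nonascending:
  assumes "\<And>b. \<exists>p \<in> carrier_vec n. p \<notin> Lb b"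
  shows "virt_central \<subseteq> base_roots"
proof
  fix g assume g: "g \<in> virt_central"
  obtain p where p: "\<And>b. p b \<in> carrier_vec n" "\<And>b. p b \<notin> Lb b" using assms by metis
  define y where "y b = tb b \<otimes>\<^bsub>G\<^esub> XP (p b) \<otimes>\<^bsub>G\<^esub> tb (\<not> b)" for b
  have y: "y b \<in> carrier G" for b using p by (simp add: y_def)
  define C where "C = (\<Union>b. {bracket (y b) (XP (p (\<not> b))), bracket (XP (p (\<not> b))) (y b)})"
  have "finite C" by (simp add: C_def)
  moreover have "C \<subseteq> brackets" unfolding C_def using bracketsI[OF y XP_carrier[OF p(1)]] bracketsI[OF XP_carrier[OF p(1)] y] by blast
  ultimately have "\<exists>k>0. \<forall>c\<in>C. g [^]\<^bsub>G\<^esub> (k::nat) \<otimes>\<^bsub>G\<^esub> c = c \<otimes>\<^bsub>G\<^esub> g [^]\<^bsub>G\<^esub> k"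
    by (rule virt_central_finite[OF g])
  then obtain k where k: "k > 0" "\<And>c. c \<in> C \<Longrightarrow> g [^]\<^bsub>G\<^esub> (k::nat) \<otimes>\<^bsub>G\<^esub> c = c \<otimes>\<^bsub>G\<^esub> g [^]\<^bsub>G\<^esub> k"
    by metis
  have gc: "g \<in> carrier G" using g by (simp add: virt_central_def)
  have "g [^]\<^bsub>G\<^esub> k \<in> XP ` carrier_vec n"
  proof (rule centralizer_in_base[OF p])
    fix b
    have "bracket (y b) (XP (p (\<not> b))) \<in> C" "bracket (XP (p (\<not> b))) (y b) \<in> C" by (auto simp: C_def)
    thus "let y = tb b \<otimes>\<^bsub>G\<^esub> XP (p b) \<otimes>\<^bsub>G\<^esub> tb (\<not> b); q = XP (p (\<not> b)) in
       g [^]\<^bsub>G\<^esub> k \<otimes>\<^bsub>G\<^esub> bracket y q = bracket y q \<otimes>\<^bsub>G\<^esub> g [^]\<^bsub>G\<^esub> k \<and>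
       g [^]\<^bsub>G\<^esub> k \<otimes>\<^bsub>G\<^esub> bracket q y = bracket q y \<otimes>\<^bsub>G\<^esub> g [^]\<^bsub>G\<^esub> k"
      using k(2) by (simp add: Let_def y_def)
  qed (use gc in simp)
  thus "g \<in> base_roots" using gc k(1) by (auto simp: base_roots_def)
qed

text \<open>When \<open>Lb b\<close> is the whole lattice, \<open>t^b\<close> moves to the right
  past every base element and \<open>t^-b\<close> to the left, which collects these letters at the
  two ends.\<close>

lemma ascending_form:
  assumes asc: "\<And>v. v \<in> carrier_vec n \<Longrightarrow> v \<in> Lb b" and "g \<in> carrier G"
  shows "\<exists>(i::nat) v (j::nat). v \<in> carrier_vec n \<and> g = tb (\<not> b) [^]\<^bsub>G\<^esub> i \<otimes>\<^bsub>G\<^esub> XP v \<otimes>\<^bsub>G\<^esub> tb b [^]\<^bsub>G\<^esub> j"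
proof -
  let ?s = "tb b" and ?s' = "tb (\<not> b)"
  have shift: "tb b \<otimes>\<^bsub>G\<^esub> XP v = XP (Am b v) \<otimes>\<^bsub>G\<^esub> tb b" "Am b v \<in> carrier_vec n" if "v \<in> carrier_vec n" for v
    using tb_conj[OF asc[OF that]] Am_carrier[OF asc[OF that]] by auto
  have ss': "?s \<otimes>\<^bsub>G\<^esub> ?s' = \<one>\<^bsub>G\<^esub>" "?s' \<otimes>\<^bsub>G\<^esub> ?s = \<one>\<^bsub>G\<^esub>" using tb_cancel[of b] tb_cancel[of "\<not> b"] by auto
  have tinv: "inv\<^bsub>G\<^esub> ?s = ?s'" using ss' by (intro inv_equality) auto
  define Q where "Q g \<longleftrightarrow> (\<exists>(i::nat) v (j::nat). v \<in> carrier_vec n \<and> g = ?s' [^]\<^bsub>G\<^esub> i \<otimes>\<^bsub>G\<^esub> XP v \<otimes>\<^bsub>G\<^esub> ?s [^]\<^bsub>G\<^esub> j)" for g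
  have shifts: "\<exists>w\<in>carrier_vec n. XP v \<otimes>\<^bsub>G\<^esub> ?s' [^]\<^bsub>G\<^esub> (i::nat) = ?s' [^]\<^bsub>G\<^esub> i \<otimes>\<^bsub>G\<^esub> XP w" if "v \<in> carrier_vec n" for v i
  proof (induction i)
    case 0
    show ?case using that by (intro bexI[of _ v]) auto
  next
    case (Suc i)
    then obtain w where w: "w \<in> carrier_vec n" "XP v \<otimes>\<^bsub>G\<^esub> ?s' [^]\<^bsub>G\<^esub> i = ?s' [^]\<^bsub>G\<^esub> i \<otimes>\<^bsub>G\<^esub> XP w" by blast
    have "?s' \<otimes>\<^bsub>G\<^esub> XP (Am b w) = XP w \<otimes>\<^bsub>G\<^esub> ?s'"
      using intertwine_inv[OF _ _ _ shift(1)[OF w(1)]] w shift(2)[OF w(1)] by (simp add: tinv)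
    moreover have "XP v \<otimes>\<^bsub>G\<^esub> ?s' [^]\<^bsub>G\<^esub> Suc i = ?s' [^]\<^bsub>G\<^esub> i \<otimes>\<^bsub>G\<^esub> (XP w \<otimes>\<^bsub>G\<^esub> ?s')"
    proof -
      have "XP v \<otimes>\<^bsub>G\<^esub> ?s' [^]\<^bsub>G\<^esub> Suc i = (XP v \<otimes>\<^bsub>G\<^esub> ?s' [^]\<^bsub>G\<^esub> i) \<otimes>\<^bsub>G\<^esub> ?s'" using that by (simp add: m_assoc)
      thus ?thesis unfolding w(2) using w(1) by (simp add: m_assoc)
    qed
    ultimately have "XP v \<otimes>\<^bsub>G\<^esub> ?s' [^]\<^bsub>G\<^esub> Suc i = ?s' [^]\<^bsub>G\<^esub> Suc i \<otimes>\<^bsub>G\<^esub> XP (Am b w)"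
      using shift(2)[OF w(1)] by (simp add: m_assoc)
    thus ?case using shift(2)[OF w(1)] by blast
  qed
  have s: "Q (?s \<otimes>\<^bsub>G\<^esub> g)" if Qg: "Q g" for g
  proof -
    obtain i v j where g: "v \<in> carrier_vec n" "g = ?s' [^]\<^bsub>G\<^esub> (i::nat) \<otimes>\<^bsub>G\<^esub> XP v \<otimes>\<^bsub>G\<^esub> ?s [^]\<^bsub>G\<^esub> (j::nat)" using Qg unfolding Q_def by blast
    show ?thesis
    proof (cases i)
      case 0
      have "?s \<otimes>\<^bsub>G\<^esub> g = XP (Am b v) \<otimes>\<^bsub>G\<^esub> ?s \<otimes>\<^bsub>G\<^esub> ?s [^]\<^bsub>G\<^esub> j"
        using g 0 by (simp add: m_assoc[symmetric] shift)
      also have "\<dots> = ?s' [^]\<^bsub>G\<^esub> (0::nat) \<otimes>\<^bsub>G\<^esub> XP (Am b v) \<otimes>\<^bsub>G\<^esub> ?s [^]\<^bsub>G\<^esub> Suc j"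
        using shift(2)[OF g(1)] nat_pow_Suc2[of ?s j] by (simp add: m_assoc)
      finally show ?thesis unfolding Q_def using shift(2)[OF g(1)] by blast
    next
      case (Suc k)
      have "?s \<otimes>\<^bsub>G\<^esub> g = ?s \<otimes>\<^bsub>G\<^esub> (?s' \<otimes>\<^bsub>G\<^esub> (?s' [^]\<^bsub>G\<^esub> k \<otimes>\<^bsub>G\<^esub> XP v \<otimes>\<^bsub>G\<^esub> ?s [^]\<^bsub>G\<^esub> j))"
        using g(1) unfolding g(2) Suc by (simp only: nat_pow_Suc2[OF tb_carrier]) (simp add: m_assoc)
      also have "\<dots> = ?s' [^]\<^bsub>G\<^esub> k \<otimes>\<^bsub>G\<^esub> XP v \<otimes>\<^bsub>G\<^esub> ?s [^]\<^bsub>G\<^esub> j"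
        using g(1) by (simp add: tb_cancel_left)
      finally show ?thesis unfolding Q_def using g(1) by blast
    qed
  qed
  have s': "Q (?s' \<otimes>\<^bsub>G\<^esub> g)" if Qg: "Q g" for g
  proof -
    obtain i v j where g: "v \<in> carrier_vec n" "g = ?s' [^]\<^bsub>G\<^esub> (i::nat) \<otimes>\<^bsub>G\<^esub> XP v \<otimes>\<^bsub>G\<^esub> ?s [^]\<^bsub>G\<^esub> (j::nat)" using Qg unfolding Q_def by blast
    have "?s' \<otimes>\<^bsub>G\<^esub> g = ?s' [^]\<^bsub>G\<^esub> Suc i \<otimes>\<^bsub>G\<^esub> XP v \<otimes>\<^bsub>G\<^esub> ?s [^]\<^bsub>G\<^esub> j"
      using g(1) unfolding g(2) by (simp only: nat_pow_Suc2[OF tb_carrier]) (simp add: m_assoc)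
    thus ?thesis unfolding Q_def using g(1) by blast
  qed
  have t: "tt = ?s \<and> ti = ?s' \<or> tt = ?s' \<and> ti = ?s" by (cases b) (auto simp: tb_def)
  have "Q g"
    using assms(2)
  proof (induction g rule: G_induct)
    case one
    show ?case unfolding Q_def by (rule exI[of _ 0], rule exI[of _ "0\<^sub>v n"], rule exI[of _ 0]) simp
  next
    case (XP u g)
    then obtain i v j where g: "v \<in> carrier_vec n" "g = ?s' [^]\<^bsub>G\<^esub> (i::nat) \<otimes>\<^bsub>G\<^esub> XP v \<otimes>\<^bsub>G\<^esub> ?s [^]\<^bsub>G\<^esub> (j::nat)" unfolding Q_def by blast
    obtain w where w: "w \<in> carrier_vec n" "XP u \<otimes>\<^bsub>G\<^esub> ?s' [^]\<^bsub>G\<^esub> i = ?s' [^]\<^bsub>G\<^esub> i \<otimes>\<^bsub>G\<^esub> XP w" using shifts[OF XP.hyps(1)] by blast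
    have "XP u \<otimes>\<^bsub>G\<^esub> g = (XP u \<otimes>\<^bsub>G\<^esub> ?s' [^]\<^bsub>G\<^esub> i) \<otimes>\<^bsub>G\<^esub> XP v \<otimes>\<^bsub>G\<^esub> ?s [^]\<^bsub>G\<^esub> j"
      using g XP by (simp add: m_assoc)
    also have "\<dots> = ?s' [^]\<^bsub>G\<^esub> i \<otimes>\<^bsub>G\<^esub> XP (w + v) \<otimes>\<^bsub>G\<^esub> ?s [^]\<^bsub>G\<^esub> j"
      unfolding w(2) using w(1) g(1) by (simp add: m_assoc XP_add)
    finally show ?case unfolding Q_def using w(1) g(1) add_carrier_vec by blast
  qed (use t s s' in \<open>auto\<close>)
  thus ?thesis unfolding Q_def .
qed

text \<open>The outer exponents in \<open>ascending_form\<close> agree, so \<open>g\<close> is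
  conjugate to a base element, and a power of it lies in the base by commensuration.\<close>

lemma ascending_tau_zero:
  assumes asc: "\<And>v. v \<in> carrier_vec n \<Longrightarrow> v \<in> Lb b" and g: "g \<in> carrier G" and tau: "tau g = 0"
  shows "g \<in> base_roots"
proof -
  obtain i v j where v: "v \<in> carrier_vec n" and g_eq: "g = tb (\<not> b) [^]\<^bsub>G\<^esub> (i::nat) \<otimes>\<^bsub>G\<^esub> XP v \<otimes>\<^bsub>G\<^esub> tb b [^]\<^bsub>G\<^esub> (j::nat)"
    using ascending_form[OF asc g] by blast
  have "int j = int i" using tau v unfolding g_eq by (cases b) (auto simp: tb_def)
  hence ij: "j = i" by simp
  define x where "x = tb (\<not> b) [^]\<^bsub>G\<^esub> i"
  have x: "x \<in> carrier G" by (simp add: x_def)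
  have "inv\<^bsub>G\<^esub> (tb (\<not> b)) = tb b" using tb_cancel[of b] by (intro inv_equality) auto
  hence xi: "tb b [^]\<^bsub>G\<^esub> i = inv\<^bsub>G\<^esub> x" by (simp add: x_def nat_pow_inv[symmetric])
  obtain N where N: "N > 0" "\<And>v. v \<in> carrier_vec n \<Longrightarrow> \<exists>w\<in>carrier_vec n. x \<otimes>\<^bsub>G\<^esub> XP (int N \<cdot>\<^sub>v v) = XP w \<otimes>\<^bsub>G\<^esub> x"
    using commensurated[OF x] unfolding commensurates_def by blast
  obtain w where w: "w \<in> carrier_vec n" "x \<otimes>\<^bsub>G\<^esub> XP (int N \<cdot>\<^sub>v v) = XP w \<otimes>\<^bsub>G\<^esub> x" using N(2)[OF v] by blast
  have "g [^]\<^bsub>G\<^esub> m = x \<otimes>\<^bsub>G\<^esub> XP (int m \<cdot>\<^sub>v v) \<otimes>\<^bsub>G\<^esub> inv\<^bsub>G\<^esub> x" for m :: nat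
  proof (induction m)
    case 0
    have "int 0 \<cdot>\<^sub>v v = 0\<^sub>v n" using v by (intro eq_vecI) auto
    thus ?case using x by simp
  next
    case (Suc m)
    have "int (Suc m) \<cdot>\<^sub>v v = int m \<cdot>\<^sub>v v + v" using v by (intro eq_vecI) (auto simp: algebra_simps)
    hence "XP (int (Suc m) \<cdot>\<^sub>v v) = XP (int m \<cdot>\<^sub>v v) \<otimes>\<^bsub>G\<^esub> XP v" using v by (simp add: XP_add)
    moreover have "g = x \<otimes>\<^bsub>G\<^esub> XP v \<otimes>\<^bsub>G\<^esub> inv\<^bsub>G\<^esub> x" using g_eq ij xi by (simp add: x_def)
    ultimately show ?case using Suc x v
      by (simp add: m_assoc inv_solve_left' m_assoc[symmetric, of "inv\<^bsub>G\<^esub> x" x])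
  qed
  moreover have "x \<otimes>\<^bsub>G\<^esub> XP (int N \<cdot>\<^sub>v v) \<otimes>\<^bsub>G\<^esub> inv\<^bsub>G\<^esub> x = XP w"
    unfolding w(2) using w(1) x by (simp add: m_assoc)
  ultimately have "g [^]\<^bsub>G\<^esub> N = XP w" by simp
  thus ?thesis using N(1) w(1) g by (auto simp: base_roots_def)
qed

section \<open>The exceptional condition\<close>

definition quasi_unipotent :: "nat \<Rightarrow> bool" where
  "quasi_unipotent k \<longleftrightarrow> (\<forall>u\<in>carrier_vec n. A ^\<^sub>m k *\<^sub>v (A *\<^sub>v u - u) = A *\<^sub>v u - u)"

definition exceptional :: bool where
  "exceptional \<longleftrightarrow> (\<forall>b. \<forall>v\<in>carrier_vec n. v \<in> Lb b) \<and> (\<exists>k>0. quasi_unipotent k)"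

lemma Ap_add_vec: "u \<in> carrier_vec n \<Longrightarrow> Ap (i + j) *\<^sub>v u = Ap i *\<^sub>v (Ap j *\<^sub>v u)"
  by (simp add: Ap_add assoc_mult_mat_vec[OF Ap Ap])

lemma Ap_vec_carrier [simp]: "u \<in> carrier_vec n \<Longrightarrow> Ap i *\<^sub>v u \<in> carrier_vec n"
  using mult_mat_vec_carrier[OF Ap] .

lemma Ap_vec_dim [simp]: "dim_row (Ap i) = n" "dim_col (Ap i) = n"
  using carrier_matD[OF Ap] by auto

lemma Ap_minus: "u \<in> carrier_vec n \<Longrightarrow> w \<in> carrier_vec n \<Longrightarrow> Ap i *\<^sub>v (u - w) = Ap i *\<^sub>v u - Ap i *\<^sub>v w"
  by (rule mult_minus_distrib_mat_vec[OF Ap])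

lemma Ap_0_vec [simp]: "u \<in> carrier_vec n \<Longrightarrow> Ap 0 *\<^sub>v u = u"
  by simp

text \<open>Some power of \<open>g\<close>, of height \<open>m\<close>, commutes with every
  \<open>[t, x_i]\<close>, whose translation part is a column of \<open>A - 1\<close>. Comparing
  translation parts shows that \<open>A^m\<close> fixes these columns; if \<open>m\<close> is
  negative, the inverse power does so too.\<close>

lemma tau_virt_central:
  assumes g: "g \<in> virt_central" and nq: "\<not> (\<exists>k>0. quasi_unipotent k)"
  shows "tau g = 0"
proof (rule ccontr)
  assume tau: "tau g \<noteq> 0"
  have gc: "g \<in> carrier G" using g by (simp add: virt_central_def)
  let ?C = "(\<lambda>i. bracket tt (XP (unit_vec n i))) ` {..<n}"
  have "finite ?C" "?C \<subseteq> brackets" by (auto intro!: bracketsI)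
  hence "\<exists>k>0. \<forall>c\<in>?C. g [^]\<^bsub>G\<^esub> (k::nat) \<otimes>\<^bsub>G\<^esub> c = c \<otimes>\<^bsub>G\<^esub> g [^]\<^bsub>G\<^esub> k"
    by (rule virt_central_finite[OF g])
  then obtain k where k: "k > 0" "\<And>i. i < n \<Longrightarrow> g [^]\<^bsub>G\<^esub> (k::nat) \<otimes>\<^bsub>G\<^esub> bracket tt (XP (unit_vec n i)) = bracket tt (XP (unit_vec n i)) \<otimes>\<^bsub>G\<^esub> g [^]\<^bsub>G\<^esub> k"
    by auto
  define m where "m = tau (g [^]\<^bsub>G\<^esub> k)"
  have m0: "m \<noteq> 0" using tau k(1) gc by (simp add: m_def)
  have fix_unit: "Ap m *\<^sub>v (A *\<^sub>v unit_vec n i - unit_vec n i) = A *\<^sub>v unit_vec n i - unit_vec n i" if i: "i < n" for i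
  proof -
    let ?e = "unit_vec n i :: int vec"
    let ?c = "bracket tt (XP ?e)"
    have Ae: "A *\<^sub>v unit_vec n i \<in> carrier_vec n" using mult_mat_vec_carrier[OF A, of "unit_vec n i"] by simp
    have c: "?c \<in> carrier G" by simp
    have "delta ?c = A *\<^sub>v unit_vec n i - unit_vec n i"
    proof -
      have "delta (tt \<otimes>\<^bsub>G\<^esub> XP ?e \<otimes>\<^bsub>G\<^esub> ti) = A *\<^sub>v unit_vec n i"
        using Ae by (simp add: delta_mult) (auto intro!: eq_vecI simp: carrier_matD[OF A])
      thus ?thesis
        using Ae by (simp add: bracket_def ti_eq[symmetric] XP_inv delta_mult[of "tt \<otimes>\<^bsub>G\<^esub> XP ?e \<otimes>\<^bsub>G\<^esub> ti"] rv_uminus)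
          (auto intro!: eq_vecI)
    qed
    moreover have "tau ?c = 0" by (simp add: bracket_def)
    moreover have "delta (g [^]\<^bsub>G\<^esub> k) + Ap m *\<^sub>v delta ?c = delta ?c + Ap (tau ?c) *\<^sub>v delta (g [^]\<^bsub>G\<^esub> k)"
      unfolding m_def using k(2)[OF i] delta_mult[OF nat_pow_closed[OF gc] c] delta_mult[OF c nat_pow_closed[OF gc]] by metis
    ultimately show ?thesis
      using vec_add_cancel[of "delta (g [^]\<^bsub>G\<^esub> k)" n "Ap m *\<^sub>v delta ?c" "delta ?c"] gc c Ae by simp
  qed
  have fixm: "Ap m * (A - 1\<^sub>m n) = A - 1\<^sub>m n"
  proof (rule eq_matI)
    fix i j assume ij: "i < dim_row (A - 1\<^sub>m n)" "j < dim_col (A - 1\<^sub>m n)"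
    hence ij': "i < n" "j < n" by auto
    have "col (A - 1\<^sub>m n) j = A *\<^sub>v unit_vec n j - unit_vec n j"
      using ij' by (intro eq_vecI) (auto simp: carrier_matD[OF A])
    hence "col (Ap m * (A - 1\<^sub>m n)) j = col (A - 1\<^sub>m n) j"
      using fix_unit[OF ij'(2)] ij' by (simp add: col_mult2[OF Ap, of "A - 1\<^sub>m n" n j] minus_carrier_mat)
    thus "(Ap m * (A - 1\<^sub>m n)) $$ (i,j) = (A - 1\<^sub>m n) $$ (i,j)"
      using ij' by (metis (no_types, lifting) carrier_matD(1) carrier_matD(2) A Ap index_col index_minus_mat(2,3) index_mult_mat(2,3) index_one_mat(2,3))
  qed (auto simp: carrier_matD[OF A])
  have fixv: "Ap m *\<^sub>v (A *\<^sub>v u - u) = A *\<^sub>v u - u" if u: "u \<in> carrier_vec n" for u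
  proof -
    have "A *\<^sub>v u - u = (A - 1\<^sub>m n) *\<^sub>v u"
      using minus_mult_distrib_mat_vec[OF A one_carrier_mat u] u by simp
    moreover have "Ap m * (A - 1\<^sub>m n) *\<^sub>v u = Ap m *\<^sub>v ((A - 1\<^sub>m n) *\<^sub>v u)"
      using u by (intro assoc_mult_mat_vec[OF Ap]) (auto simp: minus_carrier_mat)
    ultimately show ?thesis using fixm by simp
  qed
  have "Ap (int (nat \<bar>m\<bar>)) *\<^sub>v (A *\<^sub>v u - u) = A *\<^sub>v u - u" if u: "u \<in> carrier_vec n" for u
  proof (cases "m > 0")
    case True
    thus ?thesis using fixv[OF u] by simp
  next
    case False
    have c: "A *\<^sub>v u - u \<in> carrier_vec n" using u mult_mat_vec_carrier[OF A u] by simp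
    have "Ap (- m) *\<^sub>v (Ap m *\<^sub>v (A *\<^sub>v u - u)) = A *\<^sub>v u - u"
      using Ap_add_vec[OF c, of "- m" m] c by simp
    thus ?thesis using fixv[OF u] False by simp
  qed
  hence "quasi_unipotent (nat \<bar>m\<bar>)" unfolding quasi_unipotent_def Ap_nat by blast
  moreover have "nat \<bar>m\<bar> > 0" using m0 by simp
  ultimately show False using nq by blast
qed

text \<open>By \<open>(A^k - 1)(A - 1) = 0\<close>, the vector \<open>A^i (A^k - 1) u\<close> does
  not change when \<open>i\<close> grows by one.\<close>

lemma quasi_unipotent_const:
  assumes q: "quasi_unipotent k" and u: "u \<in> carrier_vec n"
  shows "Ap (int k + i) *\<^sub>v u - Ap i *\<^sub>v u = Ap (int k) *\<^sub>v u - u"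
proof -
  have step: "Ap (int k + (i + 1)) *\<^sub>v u - Ap (i + 1) *\<^sub>v u = Ap (int k + i) *\<^sub>v u - Ap i *\<^sub>v u" for i
  proof -
    let ?u = "Ap i *\<^sub>v u"
    have c: "?u \<in> carrier_vec n" "A *\<^sub>v ?u \<in> carrier_vec n" using u mult_mat_vec_carrier[OF A] by auto
    have 1: "Ap (i + 1) *\<^sub>v u = A *\<^sub>v ?u" using Ap_add_vec[OF u, of 1 i] by (simp add: add.commute)
    have 2: "Ap (int k + (i + 1)) *\<^sub>v u = Ap (int k) *\<^sub>v (A *\<^sub>v ?u)" using Ap_add_vec[OF u, of "int k" "i + 1"] 1 by simp
    have 3: "Ap (int k + i) *\<^sub>v u = Ap (int k) *\<^sub>v ?u" using Ap_add_vec[OF u] .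
    have "Ap (int k) *\<^sub>v (A *\<^sub>v ?u - ?u) = A *\<^sub>v ?u - ?u" using q c(1) by (simp add: quasi_unipotent_def Ap_nat)
    hence e: "Ap (int k) *\<^sub>v (A *\<^sub>v ?u) - Ap (int k) *\<^sub>v ?u = A *\<^sub>v ?u - ?u" using c by (simp add: Ap_minus)
    have "(Ap (int k) *\<^sub>v (A *\<^sub>v ?u)) - A *\<^sub>v ?u = Ap (int k) *\<^sub>v ?u - ?u"
    proof (rule eq_vecI)
      fix j assume "j < dim_vec (Ap (int k) *\<^sub>v ?u - ?u)"
      hence j: "j < n" using c by simp
      have "(Ap (int k) *\<^sub>v (A *\<^sub>v ?u) - Ap (int k) *\<^sub>v ?u) $ j = (A *\<^sub>v ?u - ?u) $ j" by (simp only: e)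
      thus "(Ap (int k) *\<^sub>v (A *\<^sub>v ?u) - A *\<^sub>v ?u) $ j = (Ap (int k) *\<^sub>v ?u - ?u) $ j"
        using j c by (simp add: carrier_matD[OF A] del: index_mult_mat_vec)
    qed (simp add: carrier_matD[OF A])
    thus ?thesis unfolding 1 2 3 .
  qed
  have "Ap (int k + i) *\<^sub>v u - Ap i *\<^sub>v u = Ap (int k + 0) *\<^sub>v u - Ap 0 *\<^sub>v u"
  proof (induction i rule: int_induct[where k = 0])
    case (step2 i)
    thus ?case using step[of "i - 1"] by simp
  qed (simp_all only: step)
  thus ?thesis using u by simp
qed

text \<open>A vanishing second difference with step \<open>k\<close>. It expresses one power of
  \<open>A\<close> through two others with integer coefficients, which transfers integrality from
  powers of one sign to the other.\<close>

lemma quasi_unipotent_eq: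
  assumes q: "quasi_unipotent k" and u: "u \<in> carrier_vec n"
  shows "Ap i *\<^sub>v u = 2 \<cdot>\<^sub>v (Ap (int k + i) *\<^sub>v u) - Ap (2 * int k + i) *\<^sub>v u"
proof (rule eq_vecI)
  fix j assume "j < dim_vec (2 \<cdot>\<^sub>v (Ap (int k + i) *\<^sub>v u) - Ap (2 * int k + i) *\<^sub>v u)"
  hence j: "j < n" by simp
  have e: "Ap (int k + i) *\<^sub>v u - Ap i *\<^sub>v u = Ap (int k + (int k + i)) *\<^sub>v u - Ap (int k + i) *\<^sub>v u"
    using quasi_unipotent_const[OF q u] by metis
  have "(Ap (int k + i) *\<^sub>v u - Ap i *\<^sub>v u) $ j = (Ap (int k + (int k + i)) *\<^sub>v u - Ap (int k + i) *\<^sub>v u) $ j"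
    by (simp only: e)
  moreover have "int k + (int k + i) = 2 * int k + i" by simp
  ultimately show "(Ap i *\<^sub>v u) $ j = (2 \<cdot>\<^sub>v (Ap (int k + i) *\<^sub>v u) - Ap (2 * int k + i) *\<^sub>v u) $ j"
    using j by (simp del: index_mult_mat_vec)
qed simp

definition integral :: "rat vec set" where "integral = rv ` carrier_vec n"

lemma integral_closed:
  "x \<in> integral \<Longrightarrow> y \<in> integral \<Longrightarrow> x + y \<in> integral"
  "x \<in> integral \<Longrightarrow> y \<in> integral \<Longrightarrow> x - y \<in> integral"
  "x \<in> integral \<Longrightarrow> rat_of_int c \<cdot>\<^sub>v x \<in> integral"
  "x \<in> integral \<Longrightarrow> x \<in> carrier_vec n"
proof -
  show "x \<in> integral \<Longrightarrow> x \<in> carrier_vec n" by (auto simp: integral_def)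
  show "x + y \<in> integral" if "x \<in> integral" "y \<in> integral"
    using that by (auto simp: integral_def rv_add[symmetric] intro!: imageI)
  show "x - y \<in> integral" if xy: "x \<in> integral" "y \<in> integral"
  proof -
    obtain v w where vw: "v \<in> carrier_vec n" "w \<in> carrier_vec n" "x = rv v" "y = rv w" using xy by (auto simp: integral_def)
    hence "x - y = rv (v - w)" by (intro eq_vecI) auto
    thus ?thesis using vw by (auto simp: integral_def)
  qed
  show "rat_of_int c \<cdot>\<^sub>v x \<in> integral" if "x \<in> integral"
    using that by (auto simp: integral_def rv_smult[symmetric] intro!: imageI)
qed

lemma ascending_integral:
  assumes asc: "\<And>v. v \<in> carrier_vec n \<Longrightarrow> v \<in> Lb b" and x: "x \<in> integral"
  shows "Ap (if b then int i else - int i) *\<^sub>v x \<in> integral"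
proof (induction i)
  case 0
  show ?case using x integral_closed(4)[OF x] by simp
next
  case (Suc i)
  let ?j = "if b then int i else - int i" and ?s = "if b then 1 else - 1 :: int"
  have xc: "x \<in> carrier_vec n" using x by (rule integral_closed)
  obtain v where v: "v \<in> carrier_vec n" "Ap ?j *\<^sub>v x = rv v" using Suc by (auto simp: integral_def)
  have "Ap ?s = Ab b" by (auto simp: Ab_def)
  moreover have "?s + ?j = (if b then int (Suc i) else - int (Suc i))" by auto
  ultimately have "Ap (if b then int (Suc i) else - int (Suc i)) *\<^sub>v x = Ab b *\<^sub>v rv v"
    using Ap_add_vec[OF xc, of ?s ?j] v(2) by simp
  also have "\<dots> = rv (Am b v)" using Am(2)[OF asc[OF v(1)]] by simp
  finally show ?case using Am_carrier[OF asc[OF v(1)]] by (auto simp: integral_def)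
qed

text \<open>Integrality of \<open>A\<close> passes to the inverse by
  \<open>A^-1 = 2 A^(k-1) - A^(2k-1)\<close>, and integrality of the inverse passes to
  \<open>A\<close> by \<open>A = 2 A^(1-k) - A^(1-2k)\<close>. Hence the other associated subgroup
  is the full lattice as well.\<close>

lemma ascending_exceptional:
  assumes asc: "\<And>v. v \<in> carrier_vec n \<Longrightarrow> v \<in> Lb b" and q: "quasi_unipotent k" "k > 0"
  shows exceptional
proof -
  have "v \<in> Lb (\<not> b)" if v: "v \<in> carrier_vec n" for v
  proof -
    have rvv: "rv v \<in> carrier_vec n" "rv v \<in> integral" using v by (auto simp: integral_def)
    have 2: "(2::rat) = rat_of_int 2" by simp
    have "Ab (\<not> b) *\<^sub>v rv v \<in> integral"
    proof (cases b)
      case True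
      have "Ap (- 1) *\<^sub>v rv v = 2 \<cdot>\<^sub>v (Ap (int (k - 1)) *\<^sub>v rv v) - Ap (int (2 * k - 1)) *\<^sub>v rv v"
        using quasi_unipotent_eq[OF q(1) rvv(1), of "- 1"] q(2) by (simp add: of_nat_diff)
      also have "\<dots> \<in> integral"
        unfolding 2 using ascending_integral[OF asc rvv(2), of "k - 1"] ascending_integral[OF asc rvv(2), of "2 * k - 1"] True
        by (intro integral_closed) auto
      finally show ?thesis using True by (simp add: Ab_def)
    next
      case False
      let ?i = "1 - 2 * int k"
      have e: "Ap ?i *\<^sub>v rv v = 2 \<cdot>\<^sub>v (Ap (- int (k - 1)) *\<^sub>v rv v) - Ap 1 *\<^sub>v rv v"
        using quasi_unipotent_eq[OF q(1) rvv(1), of ?i] q(2) by (simp add: of_nat_diff)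
      have "Ap 1 *\<^sub>v rv v = 2 \<cdot>\<^sub>v (Ap (- int (k - 1)) *\<^sub>v rv v) - Ap ?i *\<^sub>v rv v"
        unfolding e by (intro eq_vecI) (auto simp: carrier_matD[OF A])
      also have "?i = - int (2 * k - 1)" using q(2) by (simp add: of_nat_diff)
      also have "2 \<cdot>\<^sub>v (Ap (- int (k - 1)) *\<^sub>v rv v) - Ap (- int (2 * k - 1)) *\<^sub>v rv v \<in> integral"
        unfolding 2 using ascending_integral[OF asc rvv(2), of "k - 1"] ascending_integral[OF asc rvv(2), of "2 * k - 1"] False
        by (intro integral_closed) auto
      finally show ?thesis using False by (simp add: Ab_def)
    qed
    then obtain u where u: "u \<in> carrier_vec n" "rv u = Ab (\<not> b) *\<^sub>v rv v" by (auto simp: integral_def)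
    have "rv v = Ab b *\<^sub>v rv u" unfolding u(2) using Ab_cancel[of "rv v" "\<not> b"] rvv by simp
    hence "Am b u = v" using Am_unique[OF asc[OF u(1)]] by blast
    thus ?thesis using Am(1)[OF asc[OF u(1)]] by simp
  qed
  hence "v \<in> Lb b'" if "v \<in> carrier_vec n" for v b' using asc that by (cases "b' = b") auto
  thus ?thesis using q by (auto simp: exceptional_def)
qed

theorem virt_central_subset_base_roots:
  assumes "\<not> exceptional"
  shows "virt_central \<subseteq> base_roots"
proof (cases "\<forall>b. \<exists>p \<in> carrier_vec n. p \<notin> Lb b")
  case True
  thus ?thesis using virt_central_subset_base_roots_nonascending by blast
next
  case False
  then obtain b where asc: "\<And>v. v \<in> carrier_vec n \<Longrightarrow> v \<in> Lb b" by blast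
  have "\<not> (\<exists>k>0. quasi_unipotent k)" using ascending_exceptional[OF asc] assms by blast
  thus ?thesis using tau_virt_central ascending_tau_zero[OF asc] by (auto simp: virt_central_def)
qed

end

section \<open>Structure of the exceptional groups\<close>

locale exceptional_leary_minasyan = leary_minasyan +
  assumes exceptional: exceptional
begin

lemma Lb_all: "v \<in> carrier_vec n \<Longrightarrow> v \<in> Lb b"
  using exceptional by (auto simp: exceptional_def)

lemma Ap_integral: "x \<in> integral \<Longrightarrow> Ap i *\<^sub>v x \<in> integral"
  using ascending_integral[of True x "nat i"] ascending_integral[of False x "nat (- i)"] Lb_all
  by (cases "i \<ge> 0") auto

text \<open>The base is now normal, and the group is the semidirect product of the lattice by the
  powers of \<open>t\<close>.\<close>

lemma exceptional_form:
  assumes "g \<in> carrier G"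
  shows "\<exists>v \<in> carrier_vec n. g = XP v \<otimes>\<^bsub>G\<^esub> tt [^]\<^bsub>G\<^esub> tau g"
  using assms
proof (induction g rule: G_induct)
  case one
  show ?case by (intro bexI[of _ "0\<^sub>v n"]) auto
next
  case (XP u g)
  then obtain v where v: "v \<in> carrier_vec n" "g = XP v \<otimes>\<^bsub>G\<^esub> tt [^]\<^bsub>G\<^esub> tau g" by blast
  have "XP u \<otimes>\<^bsub>G\<^esub> g = XP (u + v) \<otimes>\<^bsub>G\<^esub> tt [^]\<^bsub>G\<^esub> tau g"
    using XP v(1) by (subst v(2)) (simp add: XP_add m_assoc)
  moreover have "tau (XP u \<otimes>\<^bsub>G\<^esub> g) = tau g" using XP.hyps by simp
  moreover have "u + v \<in> carrier_vec n" using XP.hyps v(1) by simp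
  ultimately show ?case by metis
next
  case (tt g)
  then obtain v where v: "v \<in> carrier_vec n" "g = XP v \<otimes>\<^bsub>G\<^esub> tt [^]\<^bsub>G\<^esub> tau g" by blast
  have w: "tt \<otimes>\<^bsub>G\<^esub> XP v = XP (Am True v) \<otimes>\<^bsub>G\<^esub> tt" "Am True v \<in> carrier_vec n"
    using tb_conj[OF Lb_all[OF v(1)], of True] Am_carrier[OF Lb_all[OF v(1)], of True] by (auto simp: tb_def)
  have "tt \<otimes>\<^bsub>G\<^esub> g = (tt \<otimes>\<^bsub>G\<^esub> XP v) \<otimes>\<^bsub>G\<^esub> tt [^]\<^bsub>G\<^esub> tau g"
    using v(1) by (subst v(2)) (simp add: m_assoc)
  also have "\<dots> = XP (Am True v) \<otimes>\<^bsub>G\<^esub> (tt [^]\<^bsub>G\<^esub> (1::int) \<otimes>\<^bsub>G\<^esub> tt [^]\<^bsub>G\<^esub> tau g)"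
    unfolding w(1) using w(2) by (simp add: m_assoc)
  also have "\<dots> = XP (Am True v) \<otimes>\<^bsub>G\<^esub> tt [^]\<^bsub>G\<^esub> tau (tt \<otimes>\<^bsub>G\<^esub> g)"
    using tt by (simp only: int_pow_mult[OF tt_carrier, symmetric] tau_mult tt_carrier tau_tt)
  finally show ?case using w(2) by blast
next
  case (ti g)
  then obtain v where v: "v \<in> carrier_vec n" "g = XP v \<otimes>\<^bsub>G\<^esub> tt [^]\<^bsub>G\<^esub> tau g" by blast
  have w: "ti \<otimes>\<^bsub>G\<^esub> XP v = XP (Am False v) \<otimes>\<^bsub>G\<^esub> ti" "Am False v \<in> carrier_vec n"
    using tb_conj[OF Lb_all[OF v(1)], of False] Am_carrier[OF Lb_all[OF v(1)], of False] by (auto simp: tb_def)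
  have tm: "ti = tt [^]\<^bsub>G\<^esub> (- 1 :: int)" using int_pow_neg[OF tt_carrier, of 1] by (simp add: ti_eq)
  have "ti \<otimes>\<^bsub>G\<^esub> g = (ti \<otimes>\<^bsub>G\<^esub> XP v) \<otimes>\<^bsub>G\<^esub> tt [^]\<^bsub>G\<^esub> tau g"
    using v(1) by (subst v(2)) (simp add: m_assoc)
  also have "\<dots> = XP (Am False v) \<otimes>\<^bsub>G\<^esub> (tt [^]\<^bsub>G\<^esub> (- 1 :: int) \<otimes>\<^bsub>G\<^esub> tt [^]\<^bsub>G\<^esub> tau g)"
    unfolding w(1) using w(2) by (simp add: m_assoc tm)
  also have "\<dots> = XP (Am False v) \<otimes>\<^bsub>G\<^esub> tt [^]\<^bsub>G\<^esub> tau (ti \<otimes>\<^bsub>G\<^esub> g)"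
    using ti by (simp only: int_pow_mult[OF tt_carrier, symmetric] tau_mult ti_carrier tau_ti)
  finally show ?case using w(2) by blast
qed

lemma tau_zero_form:
  assumes "g \<in> carrier G" "tau g = 0"
  shows "\<exists>v \<in> carrier_vec n. g = XP v \<and> delta g = rv v"
proof -
  obtain v where v: "v \<in> carrier_vec n" "g = XP v \<otimes>\<^bsub>G\<^esub> tt [^]\<^bsub>G\<^esub> tau g" using exceptional_form[OF assms(1)] by blast
  have "g = XP v" using v assms(2) by simp
  thus ?thesis using v(1) by auto
qed

lemma delta_integral: "g \<in> carrier G \<Longrightarrow> delta g \<in> integral"
proof (induction g rule: G_induct)
  case one
  have "rv (0\<^sub>v n) \<in> integral" unfolding integral_def by (rule imageI) simp
  thus ?case by simp
next
  case (XP v g)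
  have "rv v \<in> integral" using XP by (simp add: integral_def)
  thus ?case using XP integral_closed(4)[of "delta g"] by (simp add: delta_mult integral_closed(1))
next
  case (tt g)
  have "Ap 1 *\<^sub>v delta g \<in> integral" using tt by (intro Ap_integral)
  thus ?case using tt integral_closed(4)[OF tt.IH] mult_mat_vec_carrier[OF A] by (simp add: delta_mult)
next
  case (ti g)
  have "Ap (- 1) *\<^sub>v delta g \<in> integral" using ti by (intro Ap_integral)
  thus ?case using ti integral_closed(4)[OF ti.IH] mult_mat_vec_carrier[OF Ai] by (simp add: delta_mult)
qed

text \<open>A geometric sum, accumulated in \<open>y\<close>; a negative exponent is reduced to a
  positive one by starting from \<open>A^i x\<close>.\<close>

lemma Ap_minus_one_image:
  assumes x: "x \<in> integral"
  shows "\<exists>y \<in> integral. Ap i *\<^sub>v x - x = A *\<^sub>v y - y"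
proof -
  have nat: "\<exists>y \<in> integral. Ap (int m) *\<^sub>v x - x = A *\<^sub>v y - y" if x: "x \<in> integral" for x m
  proof (induction m)
    case 0
    have xc: "x \<in> carrier_vec n" using x by (rule integral_closed)
    have z: "0\<^sub>v n \<in> integral" unfolding integral_def by (rule image_eqI[of _ _ "0\<^sub>v n"]) auto
    have "Ap (int 0) *\<^sub>v x - x = A *\<^sub>v 0\<^sub>v n - 0\<^sub>v n"
      using xc by (intro eq_vecI) (auto simp: carrier_matD[OF A])
    thus ?case using z by blast
  next
    case (Suc m)
    then obtain y where y: "y \<in> integral" "Ap (int m) *\<^sub>v x - x = A *\<^sub>v y - y" by blast
    let ?z = "Ap (int m) *\<^sub>v x"
    have z: "?z \<in> integral" using x by (rule Ap_integral)
    have c: "x \<in> carrier_vec n" "y \<in> carrier_vec n" "?z \<in> carrier_vec n" "A *\<^sub>v ?z \<in> carrier_vec n" "A *\<^sub>v y \<in> carrier_vec n"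
      using x y z integral_closed(4) mult_mat_vec_carrier[OF A] by auto
    have s: "Ap (int (Suc m)) *\<^sub>v x = A *\<^sub>v ?z" using Ap_add_vec[OF c(1), of 1 "int m"] by simp
    have "A *\<^sub>v ?z - x = A *\<^sub>v (?z + y) - (?z + y)"
    proof (rule eq_vecI)
      fix j assume "j < dim_vec (A *\<^sub>v (?z + y) - (?z + y))"
      hence j: "j < n" using c by simp
      have "(?z - x) $ j = (A *\<^sub>v y - y) $ j" by (simp only: y(2))
      thus "(A *\<^sub>v ?z - x) $ j = (A *\<^sub>v (?z + y) - (?z + y)) $ j"
        using j c unfolding mult_add_distrib_mat_vec[OF A c(3,2)] by (simp add: carrier_matD[OF A] del: index_mult_mat_vec)
    qed (use c in \<open>simp add: carrier_matD[OF A]\<close>)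
    thus ?case unfolding s using integral_closed(1)[OF z y(1)] by blast
  qed
  show ?thesis
  proof (cases "i \<ge> 0")
    case True
    thus ?thesis using nat[OF x, of "nat i"] by simp
  next
    case False
    let ?z = "Ap i *\<^sub>v x"
    have z: "?z \<in> integral" using x by (rule Ap_integral)
    obtain y where y: "y \<in> integral" "Ap (int (nat (- i))) *\<^sub>v ?z - ?z = A *\<^sub>v y - y" using nat[OF z] by blast
    have c: "x \<in> carrier_vec n" "y \<in> carrier_vec n" "?z \<in> carrier_vec n" "A *\<^sub>v y \<in> carrier_vec n"
      using x y z integral_closed(4) mult_mat_vec_carrier[OF A] by auto
    have "Ap (int (nat (- i))) *\<^sub>v ?z = x" using Ap_add_vec[OF c(1), of "- i" i] False c(1) by simp
    hence e: "x - ?z = A *\<^sub>v y - y" using y(2) by simp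
    have "- y = rat_of_int (- 1) \<cdot>\<^sub>v y" by (intro eq_vecI) auto
    hence my: "- y \<in> integral" using integral_closed(3)[OF y(1)] by metis
    have "?z - x = A *\<^sub>v (- y) - (- y)"
    proof (rule eq_vecI)
      fix j assume "j < dim_vec (A *\<^sub>v (- y) - (- y))"
      hence j: "j < n" using c by simp
      have "(x - ?z) $ j = (A *\<^sub>v y - y) $ j" by (simp only: e)
      thus "(?z - x) $ j = (A *\<^sub>v (- y) - (- y)) $ j"
        using j c unfolding mult_mat_vec_uminus[OF A c(2)] by (simp add: carrier_matD[OF A] del: index_mult_mat_vec)
    qed (use c in \<open>simp add: carrier_matD[OF A]\<close>)
    thus ?thesis using my by blast
  qed
qed

text \<open>The translation part of \<open>[a, b]\<close> is
  \<open>(A^(tau a) - 1) delta b - (A^(tau b) - 1) delta a\<close>, and both terms lie in the image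
  of the lattice under \<open>A - 1\<close>. Together with \<open>XP_image_bracket\<close>, the
  single commutators are exactly this image and already form a subgroup.\<close>

lemma bracket_form:
  assumes c: "c \<in> brackets"
  shows "\<exists>y\<in>carrier_vec n. \<exists>v\<in>carrier_vec n. c = XP v \<and> rv v = A *\<^sub>v rv y - rv y"
proof -
  obtain a b where ab: "a \<in> carrier G" "b \<in> carrier G" "c = bracket a b" using c by (auto simp: brackets_def)
  have cc: "c \<in> carrier G" using c by (rule brackets_carrier)
  have "c \<otimes>\<^bsub>G\<^esub> (b \<otimes>\<^bsub>G\<^esub> a) = a \<otimes>\<^bsub>G\<^esub> b"
  proof -
    have "c \<otimes>\<^bsub>G\<^esub> (b \<otimes>\<^bsub>G\<^esub> a) = a \<otimes>\<^bsub>G\<^esub> b \<otimes>\<^bsub>G\<^esub> inv\<^bsub>G\<^esub> (b \<otimes>\<^bsub>G\<^esub> a) \<otimes>\<^bsub>G\<^esub> (b \<otimes>\<^bsub>G\<^esub> a)"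
      unfolding ab(3) bracket_def using ab(1,2) by (simp add: inv_mult_group m_assoc)
    thus ?thesis using ab(1,2) by (simp add: m_assoc)
  qed
  hence "delta c + delta (b \<otimes>\<^bsub>G\<^esub> a) = delta (a \<otimes>\<^bsub>G\<^esub> b)"
    using delta_mult[OF cc, of "b \<otimes>\<^bsub>G\<^esub> a"] tau_bracket[OF c] ab(1,2) by simp
  hence e: "delta c + (delta b + Ap (tau b) *\<^sub>v delta a) = delta a + Ap (tau a) *\<^sub>v delta b"
    using ab(1,2) by (simp add: delta_mult)
  obtain y where y: "y \<in> integral" "Ap (tau a) *\<^sub>v delta b - delta b = A *\<^sub>v y - y"
    using Ap_minus_one_image[OF delta_integral[OF ab(2)]] by blast
  obtain z where z: "z \<in> integral" "Ap (tau b) *\<^sub>v delta a - delta a = A *\<^sub>v z - z"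
    using Ap_minus_one_image[OF delta_integral[OF ab(1)]] by blast
  have cr: "y \<in> carrier_vec n" "z \<in> carrier_vec n" "A *\<^sub>v y \<in> carrier_vec n" "A *\<^sub>v z \<in> carrier_vec n"
    using y z integral_closed(4) mult_mat_vec_carrier[OF A] by auto
  have d: "delta a \<in> carrier_vec n" "delta b \<in> carrier_vec n" "delta c \<in> carrier_vec n" using ab(1,2) cc by auto
  have "delta c = A *\<^sub>v (y - z) - (y - z)"
  proof (rule eq_vecI)
    fix j assume "j < dim_vec (A *\<^sub>v (y - z) - (y - z))"
    hence j: "j < n" using cr by simp
    have "(delta c + (delta b + Ap (tau b) *\<^sub>v delta a)) $ j = (delta a + Ap (tau a) *\<^sub>v delta b) $ j"
      "(Ap (tau a) *\<^sub>v delta b - delta b) $ j = (A *\<^sub>v y - y) $ j"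
      "(Ap (tau b) *\<^sub>v delta a - delta a) $ j = (A *\<^sub>v z - z) $ j" by (simp_all only: e y(2) z(2))
    thus "delta c $ j = (A *\<^sub>v (y - z) - (y - z)) $ j"
      using j cr d unfolding mult_minus_distrib_mat_vec[OF A cr(1,2)] by (simp add: carrier_matD[OF A] del: index_mult_mat_vec)
  qed (use cr d in \<open>simp add: carrier_matD[OF A]\<close>)
  moreover obtain w where "w \<in> carrier_vec n" "y - z = rv w" using integral_closed(2)[OF y(1) z(1)] by (auto simp: integral_def)
  moreover obtain v where "v \<in> carrier_vec n" "c = XP v" "delta c = rv v" using tau_zero_form[OF cc tau_bracket[OF c]] by blast
  ultimately show ?thesis by metis
qed

lemma XP_image_bracket:
  assumes y: "y \<in> carrier_vec n" and v: "v \<in> carrier_vec n" and e: "rv v = A *\<^sub>v rv y - rv y"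
  shows "XP v = bracket tt (XP y)"
proof -
  have "Am True y = v + y"
  proof (rule Am_unique[OF Lb_all[OF y]])
    have "rv v + rv y = A *\<^sub>v rv y" unfolding e using y by (intro eq_vecI) (auto simp: carrier_matD[OF A])
    thus "rv (v + y) = Ab True *\<^sub>v rv y" using v y by (simp add: Ab_def rv_add)
  qed
  hence "tt \<otimes>\<^bsub>G\<^esub> XP y = XP v \<otimes>\<^bsub>G\<^esub> XP y \<otimes>\<^bsub>G\<^esub> tt"
    using tb_conj[OF Lb_all[OF y], of True] v y by (simp add: tb_def XP_add)
  hence "bracket tt (XP y) = XP v \<otimes>\<^bsub>G\<^esub> XP y \<otimes>\<^bsub>G\<^esub> tt \<otimes>\<^bsub>G\<^esub> inv\<^bsub>G\<^esub> tt \<otimes>\<^bsub>G\<^esub> inv\<^bsub>G\<^esub> (XP y)" by (simp add: bracket_def)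
  thus ?thesis using v y by (simp add: m_assoc)
qed

lemma exceptional_conj:
  assumes g: "g \<in> carrier G" and v: "v \<in> carrier_vec n"
  shows "\<exists>w\<in>carrier_vec n. g \<otimes>\<^bsub>G\<^esub> XP v = XP w \<otimes>\<^bsub>G\<^esub> g \<and> rv w = Ap (tau g) *\<^sub>v rv v"
proof -
  define c where "c = g \<otimes>\<^bsub>G\<^esub> XP v \<otimes>\<^bsub>G\<^esub> inv\<^bsub>G\<^esub> g"
  have c: "c \<in> carrier G" "tau c = 0" using g v by (auto simp: c_def)
  obtain w where w: "w \<in> carrier_vec n" "c = XP w" using tau_zero_form[OF c] by blast
  have e: "g \<otimes>\<^bsub>G\<^esub> XP v = XP w \<otimes>\<^bsub>G\<^esub> g" unfolding w(2)[symmetric] c_def using g v by (simp add: m_assoc)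
  show ?thesis using XP_intertwine[OF g v w(1) e] w(1) e by auto
qed

text \<open>One exponent \<open>k\<close> works for all elements and commutators: \<open>g^k\<close>
  acts on commutators through a power of \<open>A^k\<close>, which is trivial on the image of
  \<open>A - 1\<close>.\<close>

lemma virt_central_eq: "virt_central = carrier G"
proof -
  obtain k where k: "k > 0" "quasi_unipotent k" using exceptional by (auto simp: exceptional_def)
  have "g \<in> virt_central" if g: "g \<in> carrier G" for g
  proof -
    have "g [^]\<^bsub>G\<^esub> k \<otimes>\<^bsub>G\<^esub> c = c \<otimes>\<^bsub>G\<^esub> g [^]\<^bsub>G\<^esub> k" if c: "c \<in> brackets" for c
    proof -
      obtain y v where y: "y \<in> carrier_vec n" "v \<in> carrier_vec n" "c = XP v" "rv v = A *\<^sub>v rv y - rv y" using bracket_form[OF c] by blast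
      have rvv: "rv v \<in> carrier_vec n" using y(2) by simp
      have fixv: "Ap (int k) *\<^sub>v rv v = rv v"
        using k(2) y unfolding quasi_unipotent_def Ap_nat by simp
      have fixm: "Ap (int k * int m) *\<^sub>v rv v = rv v" for m
      proof (induction m)
        case (Suc m)
        have "int k * int (Suc m) = int k + int k * int m" by (simp add: algebra_simps)
        thus ?case using Suc fixv Ap_add_vec[OF rvv, of "int k" "int k * int m"] by simp
      qed (use rvv in simp)
      have fixall: "Ap (int k * j) *\<^sub>v rv v = rv v" for j
      proof (cases "j \<ge> 0")
        case False
        have "int k * j + int k * int (nat (- j)) = 0" using False by (simp add: algebra_simps)
        thus ?thesis using Ap_add_vec[OF rvv, of "int k * j" "int k * int (nat (- j))"] fixm[of "nat (- j)"] rvv by simp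
      qed (use fixm[of "nat j"] in simp)
      obtain w where w: "w \<in> carrier_vec n" "g [^]\<^bsub>G\<^esub> k \<otimes>\<^bsub>G\<^esub> XP v = XP w \<otimes>\<^bsub>G\<^esub> g [^]\<^bsub>G\<^esub> k"
        "rv w = Ap (tau (g [^]\<^bsub>G\<^esub> k)) *\<^sub>v rv v" using exceptional_conj[OF nat_pow_closed[OF g] y(2)] by blast
      have "w = v" using w(3) fixall g by (simp add: rv_inject)
      thus ?thesis using w y(3) by simp
    qed
    thus ?thesis using g k(1) by (auto simp: virt_central_def)
  qed
  thus ?thesis by (auto simp: virt_central_def)
qed

end

section \<open>Isomorphisms: the generic case\<close>

text \<open>The word \<open>x_power v\<close> is reused as an expression of \<open>v\<close> as a
  sum of signed unit vectors: the letters \<open>X i\<close> act on vectors by addition and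
  \<open>T\<close> acts trivially.\<close>

lemma int_vec_generated:
  assumes S: "0\<^sub>v n \<in> S" "\<And>v w. v \<in> S \<Longrightarrow> w \<in> S \<Longrightarrow> v + w \<in> S" "\<And>v. v \<in> S \<Longrightarrow> - v \<in> S"
    and unit: "\<And>i. i < n \<Longrightarrow> unit_vec n i \<in> S" and sub: "S \<subseteq> carrier_vec n"
    and v: "(v :: int vec) \<in> carrier_vec n"
  shows "v \<in> S"
proof -
  define a :: "lm_gen \<times> bool \<Rightarrow> int vec \<Rightarrow> int vec" where
    "a xb u = (case fst xb of X i \<Rightarrow> (if snd xb then unit_vec n i else - unit_vec n i) + u | T \<Rightarrow> u)" for xb u
  have "foldr a (x_power v) (0\<^sub>v n) = v + 0\<^sub>v n"
    by (rule foldr_x_power[of v n _ "carrier_vec n"]) (use v in \<open>auto simp: a_def assoc_add_vec[of _ n]\<close>)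
  moreover have "foldr a (x_power v) (0\<^sub>v n) \<in> S"
    by (rule foldr_in_invariant[OF x_power_in_words[OF v] S(1)])
       (use S unit in \<open>auto simp: a_def gens_def\<close>)
  ultimately show ?thesis using v by simp
qed

lemma additive_matrix:
  fixes F :: "int vec \<Rightarrow> rat vec"
  assumes F: "\<And>v. v \<in> carrier_vec n \<Longrightarrow> F v \<in> carrier_vec m"
    and add: "\<And>v w. v \<in> carrier_vec n \<Longrightarrow> w \<in> carrier_vec n \<Longrightarrow> F (v + w) = F v + F w"
  obtains Y where "Y \<in> carrier_mat m n" "\<And>v. v \<in> carrier_vec n \<Longrightarrow> F v = Y *\<^sub>v rv v"
proof -
  define Y where "Y = mat m n (\<lambda>(i,j). F (unit_vec n j) $ i)"
  have Y: "Y \<in> carrier_mat m n" by (simp add: Y_def)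
  have zero: "F (0\<^sub>v n) = 0\<^sub>v m"
  proof -
    have "0\<^sub>v n + 0\<^sub>v n = (0\<^sub>v n :: int vec)" by simp
    hence e: "F (0\<^sub>v n) + F (0\<^sub>v n) = F (0\<^sub>v n)" using add[of "0\<^sub>v n" "0\<^sub>v n"] by (metis zero_carrier_vec)
    show ?thesis
    proof (rule eq_vecI)
      fix i assume i: "i < dim_vec (0\<^sub>v m)"
      have "(F (0\<^sub>v n) + F (0\<^sub>v n)) $ i = F (0\<^sub>v n) $ i" by (simp only: e)
      thus "F (0\<^sub>v n) $ i = 0\<^sub>v m $ i" using F[of "0\<^sub>v n"] i by simp
    qed (use F[of "0\<^sub>v n"] in simp)
  qed
  have neg: "F (- v) = - F v" if v: "v \<in> carrier_vec n" for v
  proof (rule eq_vecI)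
    fix i assume i: "i < dim_vec (- F v)"
    have "v + - v = 0\<^sub>v n" using v by (intro eq_vecI) auto
    hence "F v + F (- v) = 0\<^sub>v m" using add[OF v, of "- v"] zero v by simp
    hence "(F v + F (- v)) $ i = 0\<^sub>v m $ i" by simp
    thus "F (- v) $ i = (- F v) $ i" using F[OF v] F[of "- v"] v i by simp
  qed (use F[of v] F[of "- v"] v in simp)
  let ?S = "{v \<in> carrier_vec n. F v = Y *\<^sub>v rv v}"
  have "v \<in> ?S" if "v \<in> carrier_vec n" for v
  proof (rule int_vec_generated[OF _ _ _ _ _ that])
    have "Y *\<^sub>v rv (0\<^sub>v n) = 0\<^sub>v m" using Y by (intro eq_vecI) auto
    thus "0\<^sub>v n \<in> ?S" using zero by simp
    fix v assume v: "v \<in> ?S"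
    show "v + w \<in> ?S" if "w \<in> ?S" for w
      using v that by (simp add: add rv_add[of _ n] mult_add_distrib_mat_vec[OF Y])
    show "- v \<in> ?S" using v by (simp add: neg rv_uminus mult_mat_vec_uminus[OF Y])
  next
    fix i assume i: "i < n"
    have "F (unit_vec n i) = Y *\<^sub>v rv (unit_vec n i)"
      using i F[of "unit_vec n i"] by (intro eq_vecI) (auto simp: Y_def)
    thus "unit_vec n i \<in> ?S" by simp
  qed auto
  thus ?thesis using that[OF Y] by blast
qed

lemma mat_eq_on_integral:
  assumes M: "M \<in> carrier_mat m n" and N: "N \<in> carrier_mat m n"
    and eq: "\<And>v. v \<in> carrier_vec n \<Longrightarrow> M *\<^sub>v rv v = N *\<^sub>v rv v"
  shows "M = N"
proof (rule eq_matI)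
  fix i j assume "i < dim_row N" "j < dim_col N"
  hence ij: "i < m" "j < n" using N by auto
  have "(M *\<^sub>v rv (unit_vec n j)) $ i = (N *\<^sub>v rv (unit_vec n j)) $ i" using eq[of "unit_vec n j"] by simp
  thus "M $$ (i,j) = N $$ (i,j)" using M N ij by simp
qed (use M N in auto)

lemma mat_eq_on_multiples:
  assumes M: "M \<in> carrier_mat m n" and N: "N \<in> carrier_mat m n" and c: "c \<noteq> 0"
    and eq: "\<And>v. v \<in> carrier_vec n \<Longrightarrow> M *\<^sub>v rv (c \<cdot>\<^sub>v v) = N *\<^sub>v rv (c \<cdot>\<^sub>v v)"
  shows "M = N"
proof (rule mat_eq_on_integral[OF M N])
  fix v :: "int vec" assume v: "v \<in> carrier_vec n"
  have "of_int c \<cdot>\<^sub>v (M *\<^sub>v rv v) = of_int c \<cdot>\<^sub>v (N *\<^sub>v rv v)"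
    using eq[OF v] v by (simp add: rv_smult mult_mat_vec[OF M] mult_mat_vec[OF N])
  hence "(1 / of_int c) \<cdot>\<^sub>v (of_int c \<cdot>\<^sub>v (M *\<^sub>v rv v)) = (1 / of_int c) \<cdot>\<^sub>v (of_int c \<cdot>\<^sub>v (N *\<^sub>v rv v))"
    by (simp only:)
  thus "M *\<^sub>v rv v = N *\<^sub>v rv v" using c by (simp add: smult_smult_assoc)
qed

context leary_minasyan
begin

lemma additive_eqI:
  fixes f h :: "lm_gen word set \<Rightarrow> rat vec"
  assumes f: "\<And>g. g \<in> carrier G \<Longrightarrow> f g \<in> carrier_vec m" and h: "\<And>g. g \<in> carrier G \<Longrightarrow> h g \<in> carrier_vec m"
    and f_mult: "\<And>a b. a \<in> carrier G \<Longrightarrow> b \<in> carrier G \<Longrightarrow> f (a \<otimes>\<^bsub>G\<^esub> b) = f a + f b"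
    and h_mult: "\<And>a b. a \<in> carrier G \<Longrightarrow> b \<in> carrier G \<Longrightarrow> h (a \<otimes>\<^bsub>G\<^esub> b) = h a + h b"
    and XP: "\<And>v. v \<in> carrier_vec n \<Longrightarrow> f (XP v) = h (XP v)" and tt: "f tt = h tt"
    and g: "g \<in> carrier G"
  shows "f g = h g"
proof -
  have one: "f \<one>\<^bsub>G\<^esub> = h \<one>\<^bsub>G\<^esub>" using XP[of "0\<^sub>v n"] by simp
  have "tt \<otimes>\<^bsub>G\<^esub> ti = \<one>\<^bsub>G\<^esub>" by (simp add: ti_eq)
  hence e: "f tt + f ti = h tt + h ti" using f_mult[of tt ti] h_mult[of tt ti] one by simp
  have c: "f ti \<in> carrier_vec m" "h ti \<in> carrier_vec m" "h tt \<in> carrier_vec m" using f h by auto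
  have ti: "f ti = h ti"
    using vec_add_cancel[of "h tt" m "f ti" "h ti"] e c comm_add_vec[of "h tt" m "h ti"] by (simp add: tt)
  show ?thesis using g by (induction g rule: G_induct) (simp_all add: one XP tt ti f_mult h_mult)
qed

end

lemma mat_mult_regroup4:
  fixes A B C D :: "'a::semiring_0 mat"
  assumes "A \<in> carrier_mat n n" "B \<in> carrier_mat n n" "C \<in> carrier_mat n n" "D \<in> carrier_mat n n"
  shows "A * (B * C) * D = (A * B) * (C * D)"
  using assms by (auto simp: mat_mult_assoc)

text \<open>The inverse is a parameter of its own, so that \<open>swap\<close> exchanges the two
  groups and every statement is available in both directions.\<close>

locale lm_isos = P: leary_minasyan n A L + Q: leary_minasyan n' A' L'
  for n A L n' A' L' +
  fixes \<phi> \<psi> :: "lm_gen word set \<Rightarrow> lm_gen word set"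
  assumes phi_hom: "\<phi> \<in> hom P.G Q.G" and psi_hom: "\<psi> \<in> hom Q.G P.G"
    and psi_phi [simp]: "g \<in> carrier P.G \<Longrightarrow> \<psi> (\<phi> g) = g"
    and phi_psi [simp]: "h \<in> carrier Q.G \<Longrightarrow> \<phi> (\<psi> h) = h"
begin

lemma swap: "lm_isos n' A' L' n A L \<psi> \<phi>"
  by (intro lm_isos.intro lm_isos_axioms.intro Q.leary_minasyan_axioms P.leary_minasyan_axioms)
     (use phi_hom psi_hom in auto)

sublocale phi: group_hom P.G Q.G \<phi>
  by (intro group_hom.intro group_hom_axioms.intro P.group_axioms Q.group_axioms phi_hom)

lemma psi_closed [simp]: "h \<in> carrier Q.G \<Longrightarrow> \<psi> h \<in> carrier P.G"
  using psi_hom by (auto simp: hom_def)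

lemma psi_mult [simp]: "a \<in> carrier Q.G \<Longrightarrow> b \<in> carrier Q.G \<Longrightarrow> \<psi> (a \<otimes>\<^bsub>Q.G\<^esub> b) = \<psi> a \<otimes>\<^bsub>P.G\<^esub> \<psi> b"
  using psi_hom by (auto simp: hom_def)

lemma phi_bracket: "a \<in> carrier P.G \<Longrightarrow> b \<in> carrier P.G \<Longrightarrow> \<phi> (P.bracket a b) = Q.bracket (\<phi> a) (\<phi> b)"
  by (simp add: P.bracket_def Q.bracket_def)

lemma phi_brackets: "c \<in> P.brackets \<Longrightarrow> \<phi> c \<in> Q.brackets"
  by (auto simp: P.brackets_def phi_bracket intro!: Q.bracketsI)

lemma brackets_surj: "c \<in> Q.brackets \<Longrightarrow> \<exists>d\<in>P.brackets. c = \<phi> d"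
proof -
  assume "c \<in> Q.brackets"
  then obtain a b where ab: "a \<in> carrier Q.G" "b \<in> carrier Q.G" "c = Q.bracket a b" by (auto simp: Q.brackets_def)
  hence "c = \<phi> (P.bracket (\<psi> a) (\<psi> b))" by (simp add: phi_bracket)
  thus ?thesis using ab P.bracketsI[of "\<psi> a" "\<psi> b"] by auto
qed

lemma phi_virt_central: "g \<in> P.virt_central \<Longrightarrow> \<phi> g \<in> Q.virt_central"
proof -
  assume g: "g \<in> P.virt_central"
  have gc: "g \<in> carrier P.G" using g by (simp add: P.virt_central_def)
  have "\<exists>k>0. \<phi> g [^]\<^bsub>Q.G\<^esub> (k::nat) \<otimes>\<^bsub>Q.G\<^esub> c = c \<otimes>\<^bsub>Q.G\<^esub> \<phi> g [^]\<^bsub>Q.G\<^esub> k" if c: "c \<in> Q.brackets" for c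
  proof -
    obtain d where d: "d \<in> P.brackets" "c = \<phi> d" using brackets_surj[OF c] by blast
    obtain k where k: "k > 0" "g [^]\<^bsub>P.G\<^esub> (k::nat) \<otimes>\<^bsub>P.G\<^esub> d = d \<otimes>\<^bsub>P.G\<^esub> g [^]\<^bsub>P.G\<^esub> k"
      using g d(1) by (auto simp: P.virt_central_def)
    have "\<phi> (g [^]\<^bsub>P.G\<^esub> k \<otimes>\<^bsub>P.G\<^esub> d) = \<phi> (d \<otimes>\<^bsub>P.G\<^esub> g [^]\<^bsub>P.G\<^esub> k)" by (simp only: k(2))
    hence "\<phi> g [^]\<^bsub>Q.G\<^esub> k \<otimes>\<^bsub>Q.G\<^esub> c = c \<otimes>\<^bsub>Q.G\<^esub> \<phi> g [^]\<^bsub>Q.G\<^esub> k"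
      using gc P.brackets_carrier[OF d(1)] by (simp add: d(2) phi.hom_nat_pow)
    thus ?thesis using k(1) by blast
  qed
  thus ?thesis using gc by (simp add: Q.virt_central_def)
qed

text \<open>Each generator of the base is virtually central in the sense of
  \<open>virt_central\<close>, so its image is a root of a base element; \<open>K\<close> is the
  product of the exponents required.\<close>

lemma phi_XP_multiple:
  assumes Q: "\<not> Q.exceptional"
  shows "\<exists>K>0. \<forall>v\<in>carrier_vec n. \<exists>w\<in>carrier_vec n'. \<phi> (P.XP (int K \<cdot>\<^sub>v v)) = Q.XP w"
proof -
  have "\<phi> (P.XP (unit_vec n i)) \<in> Q.base_roots" for i
    using P.XP_base_roots[of "unit_vec n i"] P.base_roots_subset_virt_central phi_virt_central Q.virt_central_subset_base_roots[OF Q] by auto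
  hence "\<exists>k>0. \<phi> (P.XP (unit_vec n i)) [^]\<^bsub>Q.G\<^esub> (k::nat) \<in> Q.XP ` carrier_vec n'" for i by (auto simp: Q.base_roots_def)
  then obtain k :: "nat \<Rightarrow> nat" where k: "\<And>i. k i > 0" "\<And>i. \<phi> (P.XP (unit_vec n i)) [^]\<^bsub>Q.G\<^esub> k i \<in> Q.XP ` carrier_vec n'"
    by metis
  define K where "K = (\<Prod>i<n. k i)"
  have K: "K > 0" unfolding K_def by (intro prod_pos) (use k in auto)
  let ?S = "{v \<in> carrier_vec n. \<exists>w\<in>carrier_vec n'. \<phi> (P.XP (int K \<cdot>\<^sub>v v)) = Q.XP w}"
  have "v \<in> ?S" if "v \<in> carrier_vec n" for v
  proof (rule int_vec_generated[OF _ _ _ _ _ that])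
    have "int K \<cdot>\<^sub>v 0\<^sub>v n = (0\<^sub>v n :: int vec)" by (intro eq_vecI) auto
    thus "0\<^sub>v n \<in> ?S" by (auto intro!: bexI[of _ "0\<^sub>v n'"])
    show "v + w \<in> ?S" if vS: "v \<in> ?S" and wS: "w \<in> ?S" for v w
    proof -
      obtain v' w' where v': "v' \<in> carrier_vec n'" "w' \<in> carrier_vec n'" "\<phi> (P.XP (int K \<cdot>\<^sub>v v)) = Q.XP v'"
        "\<phi> (P.XP (int K \<cdot>\<^sub>v w)) = Q.XP w'" using vS wS by auto
      have "int K \<cdot>\<^sub>v (v + w) = int K \<cdot>\<^sub>v v + int K \<cdot>\<^sub>v w" using vS wS by (intro smult_add_distrib_vec) auto
      hence "\<phi> (P.XP (int K \<cdot>\<^sub>v (v + w))) = Q.XP (v' + w')"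
        using vS wS v' by (simp add: P.XP_add Q.XP_add)
      thus ?thesis using vS wS v' by auto
    qed
    show "- v \<in> ?S" if vS: "v \<in> ?S" for v
    proof -
      obtain v' where v': "v' \<in> carrier_vec n'" "\<phi> (P.XP (int K \<cdot>\<^sub>v v)) = Q.XP v'" using vS by auto
      have "int K \<cdot>\<^sub>v (- v) = - (int K \<cdot>\<^sub>v v)" by (intro eq_vecI) auto
      hence "\<phi> (P.XP (int K \<cdot>\<^sub>v (- v))) = Q.XP (- v')"
        using vS v' by (simp add: P.XP_inv[symmetric] Q.XP_inv[symmetric])
      thus ?thesis using vS v' by (auto intro!: bexI[of _ "- v'"])
    qed
    fix i assume i: "i < n"
    obtain w where w: "w \<in> carrier_vec n'" "\<phi> (P.XP (unit_vec n i)) [^]\<^bsub>Q.G\<^esub> k i = Q.XP w" using k(2)[of i] by auto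
    have "K = k i * (\<Prod>j\<in>{..<n} - {i}. k j)" unfolding K_def using i by (intro prod.remove) auto
    then obtain l where l: "K = k i * l" by blast
    have "\<phi> (P.XP (int K \<cdot>\<^sub>v unit_vec n i)) = \<phi> (P.XP (unit_vec n i)) [^]\<^bsub>Q.G\<^esub> K"
      by (simp add: P.XP_nat_pow[symmetric] phi.hom_nat_pow)
    also have "\<dots> = Q.XP (int l \<cdot>\<^sub>v w)"
      unfolding l using w by (simp add: Q.nat_pow_pow[symmetric] Q.XP_nat_pow)
    finally show "unit_vec n i \<in> ?S" using w(1) by auto
  qed auto
  thus ?thesis using K by blast
qed

text \<open>Only multiples by \<open>K\<close> are known to land in the base, so \<open>Y\<close> is
  \<open>K\<close> times the rational map induced by the isomorphism.\<close>

lemma generic_matrix: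
  assumes Q: "\<not> Q.exceptional"
  shows "\<exists>K>0. \<exists>Y\<in>carrier_mat n' n. \<forall>v\<in>carrier_vec n. \<exists>w\<in>carrier_vec n'.
    \<phi> (P.XP (int K \<cdot>\<^sub>v v)) = Q.XP w \<and> rv w = Y *\<^sub>v rv v"
proof -
  obtain K where K: "K > 0" "\<And>v. v \<in> carrier_vec n \<Longrightarrow> \<exists>w\<in>carrier_vec n'. \<phi> (P.XP (int K \<cdot>\<^sub>v v)) = Q.XP w"
    using phi_XP_multiple[OF Q] by blast
  then obtain F where F: "\<And>v. v \<in> carrier_vec n \<Longrightarrow> F v \<in> carrier_vec n'"
    "\<And>v. v \<in> carrier_vec n \<Longrightarrow> \<phi> (P.XP (int K \<cdot>\<^sub>v v)) = Q.XP (F v)" by metis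
  have add: "F (v + w) = F v + F w" if "v \<in> carrier_vec n" "w \<in> carrier_vec n" for v w
  proof -
    have "int K \<cdot>\<^sub>v (v + w) = int K \<cdot>\<^sub>v v + int K \<cdot>\<^sub>v w" using that by (intro smult_add_distrib_vec)
    hence "Q.XP (F (v + w)) = Q.XP (F v + F w)"
      using that F by (simp add: F(2)[symmetric] P.XP_add Q.XP_add)
    thus ?thesis using that F Q.XP_eq_iff by auto
  qed
  obtain Y where "Y \<in> carrier_mat n' n" "\<And>v. v \<in> carrier_vec n \<Longrightarrow> rv (F v) = Y *\<^sub>v rv v"
  proof (rule additive_matrix[of n "\<lambda>v. rv (F v)" n'])
    show "rv (F v) \<in> carrier_vec n'" if "v \<in> carrier_vec n" for v using F(1)[OF that] by simp
    show "rv (F (v + w)) = rv (F v) + rv (F w)" if "v \<in> carrier_vec n" "w \<in> carrier_vec n" for v w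
      using add[OF that] F(1)[OF that(1)] F(1)[OF that(2)] by (simp add: rv_add)
  qed blast
  thus ?thesis using K(1) F by blast
qed

text \<open>Base elements go to roots of base elements, on which \<open>tau\<close> vanishes; a
  homomorphism to the integers that kills the base is determined by its value at
  \<open>t\<close>.\<close>

lemma generic_tau:
  assumes Q: "\<not> Q.exceptional" and g: "g \<in> carrier P.G"
  shows "Q.tau (\<phi> g) = Q.tau (\<phi> P.tt) * P.tau g"
proof -
  have XP: "Q.tau (\<phi> (P.XP v)) = 0" if "v \<in> carrier_vec n" for v
    using P.XP_base_roots[OF that] P.base_roots_subset_virt_central phi_virt_central Q.virt_central_subset_base_roots[OF Q] Q.tau_base_roots by auto
  have "\<phi> P.ti = inv\<^bsub>Q.G\<^esub> (\<phi> P.tt)" by (simp add: P.ti_eq)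
  hence ti: "Q.tau (\<phi> P.ti) = - Q.tau (\<phi> P.tt)" by simp
  show ?thesis using g
    by (induction g rule: P.G_induct) (auto simp: XP ti algebra_simps)
qed

lemma multiple_matrices_inverse:
  assumes Y: "Y \<in> carrier_mat n' n" and Y': "Y' \<in> carrier_mat n n'"
    and KY: "\<And>v. v \<in> carrier_vec n \<Longrightarrow> \<exists>w\<in>carrier_vec n'. \<phi> (P.XP (int K \<cdot>\<^sub>v v)) = Q.XP w \<and> rv w = Y *\<^sub>v rv v"
    and KY': "\<And>v. v \<in> carrier_vec n' \<Longrightarrow> \<exists>w\<in>carrier_vec n. \<psi> (Q.XP (int K' \<cdot>\<^sub>v v)) = P.XP w \<and> rv w = Y' *\<^sub>v rv v"
  shows "Y' * Y = rat_of_nat (K * K') \<cdot>\<^sub>m 1\<^sub>m n"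
proof (rule mat_eq_on_integral[of _ n n])
  fix v :: "int vec" assume v: "v \<in> carrier_vec n"
  obtain w where w: "w \<in> carrier_vec n'" "\<phi> (P.XP (int K \<cdot>\<^sub>v v)) = Q.XP w" "rv w = Y *\<^sub>v rv v" using KY[OF v] by blast
  obtain u where u: "u \<in> carrier_vec n" "\<psi> (Q.XP (int K' \<cdot>\<^sub>v w)) = P.XP u" "rv u = Y' *\<^sub>v rv w" using KY'[OF w(1)] by blast
  have "Q.XP (int K' \<cdot>\<^sub>v w) = \<phi> (P.XP (int K' \<cdot>\<^sub>v (int K \<cdot>\<^sub>v v)))"
    using v w by (simp add: P.XP_nat_pow[symmetric] Q.XP_nat_pow[symmetric] phi.hom_nat_pow)
  hence "P.XP u = P.XP (int K' \<cdot>\<^sub>v (int K \<cdot>\<^sub>v v))" using u(2) v by simp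
  hence "u = int K' \<cdot>\<^sub>v (int K \<cdot>\<^sub>v v)" using u(1) v by (simp add: P.XP_eq_iff)
  hence "rv u = rat_of_nat (K * K') \<cdot>\<^sub>v rv v" by (simp add: rv_smult smult_smult_assoc mult.commute)
  moreover have "(rat_of_nat (K * K') \<cdot>\<^sub>m 1\<^sub>m n) *\<^sub>v rv v = rat_of_nat (K * K') \<cdot>\<^sub>v rv v"
    using v by (intro eq_vecI) (auto simp: row_smult)
  ultimately show "Y' * Y *\<^sub>v rv v = (rat_of_nat (K * K') \<cdot>\<^sub>m 1\<^sub>m n) *\<^sub>v rv v"
    using u(3) w(3) assoc_mult_mat_vec[OF Y' Y, of "rv v"] v by simp
qed (use Y Y' in auto)

lemma generic_case:
  assumes P: "\<not> P.exceptional" and Q: "\<not> Q.exceptional"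
  shows "n = n' \<and> (similar_mat A' A \<or> similar_mat A' P.Ai)"
proof -
  interpret J: lm_isos n' A' L' n A L \<psi> \<phi> by (rule swap)
  obtain K Y where K: "K > 0" and Y: "Y \<in> carrier_mat n' n"
    and KY: "\<And>v. v \<in> carrier_vec n \<Longrightarrow> \<exists>w\<in>carrier_vec n'. \<phi> (P.XP (int K \<cdot>\<^sub>v v)) = Q.XP w \<and> rv w = Y *\<^sub>v rv v"
    using generic_matrix[OF Q] by blast
  obtain K' Y' where K': "K' > 0" and Y': "Y' \<in> carrier_mat n n'"
    and KY': "\<And>v. v \<in> carrier_vec n' \<Longrightarrow> \<exists>w\<in>carrier_vec n. \<psi> (Q.XP (int K' \<cdot>\<^sub>v v)) = P.XP w \<and> rv w = Y' *\<^sub>v rv v"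
    using J.generic_matrix[OF P] by blast
  define c where "c = rat_of_nat (K * K')"
  have c: "c \<noteq> 0" using K K' by (simp add: c_def)
  have Y'Y: "Y' * Y = c \<cdot>\<^sub>m 1\<^sub>m n"
    unfolding c_def by (rule multiple_matrices_inverse[OF Y Y' KY KY'])
  have YY': "Y * Y' = c \<cdot>\<^sub>m 1\<^sub>m n'"
    unfolding c_def using J.multiple_matrices_inverse[OF Y' Y KY' KY] by (simp only: mult.commute)
  \<comment> \<open>The dimensions agree because \<open>Y' * Y\<close> and \<open>Y * Y'\<close>
    have the same trace.\<close>
  have "c * of_nat n = c * rat_of_nat n'"
    using tr_mult_comm[OF Y Y'] unfolding Y'Y YY' by (auto simp: tr_smult[of _ n] tr_smult[of _ n'])
  hence n: "n = n'" using c by simp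
  have "(1 / c) \<cdot>\<^sub>m Y' \<in> carrier_mat n n" "(1 / c) \<cdot>\<^sub>m Y' * Y = 1\<^sub>m n"
    using Y'Y Y Y' c n by (auto simp: mult_smult_assoc_mat[OF Y' Y])
  hence dY: "det Y \<noteq> 0"
    using Y n det_mult[of "(1 / c) \<cdot>\<^sub>m Y'" n Y] by auto
  define s where "s = Q.tau (\<phi> P.tt)"
  \<comment> \<open>Applied to the preimage of \<open>Q.tt\<close>, which has height 1 after \<phi>;
    so \<open>s\<close> is a unit of the integers.\<close>
  have "s * P.tau (\<psi> Q.tt) = 1" using generic_tau[OF Q, of "\<psi> Q.tt"] by (simp add: s_def)
  hence s: "s = 1 \<or> s = - 1" using zmult_eq_1_iff by auto
  \<comment> \<open>The defining relations move only vectors of \<open>L\<close> past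
    \<open>t\<close>; multiples of \<open>N\<close> lie in \<open>L\<close> and suffice to compare
    two matrices.\<close>
  obtain N :: int where N: "N > 0" "\<And>v. v \<in> carrier_vec n \<Longrightarrow> N \<cdot>\<^sub>v v \<in> L" using P.L_multiple by metis
  have eq: "Q.Ap s * Y = Y * A"
  proof (rule mat_eq_on_multiples[of _ n' n])
    fix v :: "int vec" assume v: "v \<in> carrier_vec n"
    let ?v = "N \<cdot>\<^sub>v v"
    have vL: "?v \<in> L" and vc: "?v \<in> carrier_vec n" using N(2) v by auto
    obtain w where w: "w \<in> carrier_vec n" "A *\<^sub>v rv ?v = rv w" using P.L_image[OF vL] by auto
    have "A *\<^sub>v rv (int K \<cdot>\<^sub>v ?v) = rv (int K \<cdot>\<^sub>v w)"
      using w vc by (simp add: rv_smult mult_mat_vec[OF P.A])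
    hence "P.tt \<otimes>\<^bsub>P.G\<^esub> P.XP (int K \<cdot>\<^sub>v ?v) = P.XP (int K \<cdot>\<^sub>v w) \<otimes>\<^bsub>P.G\<^esub> P.tt"
      using w by (intro P.tt_conj P.L_smult vL) auto
    hence e: "\<phi> (P.tt \<otimes>\<^bsub>P.G\<^esub> P.XP (int K \<cdot>\<^sub>v ?v)) = \<phi> (P.XP (int K \<cdot>\<^sub>v w) \<otimes>\<^bsub>P.G\<^esub> P.tt)" by (simp only:)
    obtain v' where v': "v' \<in> carrier_vec n'" "\<phi> (P.XP (int K \<cdot>\<^sub>v ?v)) = Q.XP v'" "rv v' = Y *\<^sub>v rv ?v" using KY[OF vc] by blast
    obtain w' where w': "w' \<in> carrier_vec n'" "\<phi> (P.XP (int K \<cdot>\<^sub>v w)) = Q.XP w'" "rv w' = Y *\<^sub>v rv w" using KY[OF w(1)] by blast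
    have "\<phi> P.tt \<otimes>\<^bsub>Q.G\<^esub> Q.XP v' = Q.XP w' \<otimes>\<^bsub>Q.G\<^esub> \<phi> P.tt"
      using e v' w' w vc by (simp del: Q.XP_carrier)
    hence "Q.Ap s *\<^sub>v rv v' = rv w'" unfolding s_def using v' w' by (intro Q.XP_intertwine) auto
    thus "Q.Ap s * Y *\<^sub>v rv ?v = Y * A *\<^sub>v rv ?v"
      using v' w' w vc by (simp add: assoc_mult_mat_vec[OF Q.Ap Y] assoc_mult_mat_vec[OF Y P.A])
  qed (use N Y in auto)
  have Yn: "Y \<in> carrier_mat n n" using Y n by simp
  have A': "A' \<in> carrier_mat n n" using Q.A n by simp
  from s show ?thesis
  proof
    assume "s = 1"
    hence "Y * A = A' * Y" using eq by simp
    hence "similar_mat A A'" using similar_matI_det[OF P.A A' Yn dY] by simp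
    thus ?thesis using n similar_mat_sym by blast
  next
    assume "s = - 1"
    hence "Q.Ai * Y = Y * A" using eq by simp
    hence "A' * (Q.Ai * Y) * P.Ai = A' * (Y * A) * P.Ai" by simp
    moreover have "A' * (Q.Ai * Y) * P.Ai = (A' * Q.Ai) * (Y * P.Ai)"
      using Q.Ai n by (intro mat_mult_regroup4[OF A' _ Yn P.Ai]) simp
    moreover have "A' * (Y * A) * P.Ai = A' * (Y * (A * P.Ai))"
      using A' Yn by (auto simp: mat_mult_assoc carrier_matD[OF P.A] carrier_matD[OF P.Ai])
    ultimately have "Y * P.Ai = A' * Y"
      using Q.AAi P.AAi Yn n P.Ai by (simp add: left_mult_one_mat[of _ n n] right_mult_one_mat[of _ n n])
    hence "similar_mat P.Ai A'" using similar_matI_det[OF P.Ai A' Yn dY] by simp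
    thus ?thesis using n similar_mat_sym by blast
  qed
qed

end

section \<open>Powers of \<open>A\<close> and their restriction to the image of
  \<open>A - 1\<close>\<close>

lemma mat_mult_regroup3:
  fixes V U B C W :: "'a::semiring_0 mat"
  assumes "V \<in> carrier_mat k n" "U \<in> carrier_mat n r" "B \<in> carrier_mat r r" "C \<in> carrier_mat r m" "W \<in> carrier_mat m l"
  shows "V * (U * B * C) * W = (V * U) * B * (C * W)"
  using assms by (auto simp: mat_mult_assoc)

text \<open>The same \<open>Z\<close> appears in both expansions, so that traces can be compared by
  \<open>tr (U Z) = tr (Z U)\<close>. It satisfies the recursion
  \<open>Z' = Z A + C\<close>.\<close>

lemma restriction_power_identity:
  fixes U C :: "'a::comm_ring_1 mat"
  assumes U: "U \<in> carrier_mat n r" and C: "C \<in> carrier_mat r n"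
  shows "\<exists>Z \<in> carrier_mat r n. (1\<^sub>m n + U * C) ^\<^sub>m j = 1\<^sub>m n + U * Z \<and> (1\<^sub>m r + C * U) ^\<^sub>m j = 1\<^sub>m r + Z * U"
proof (induction j)
  case 0
  show ?case using U C by (intro bexI[of _ "0\<^sub>m r n"]) auto
next
  case (Suc j)
  then obtain Z where Z: "Z \<in> carrier_mat r n" "(1\<^sub>m n + U * C) ^\<^sub>m j = 1\<^sub>m n + U * Z"
    "(1\<^sub>m r + C * U) ^\<^sub>m j = 1\<^sub>m r + Z * U" by blast
  define A where "A = 1\<^sub>m n + U * C"
  have c: "U * C \<in> carrier_mat n n" "U * Z \<in> carrier_mat n n" "C * U \<in> carrier_mat r r" "Z * U \<in> carrier_mat r r"
    "A \<in> carrier_mat n n" "Z * A \<in> carrier_mat r n" using U C Z(1) by (auto simp: A_def)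
  define Z' where "Z' = Z * A + C"
  have Z': "Z' \<in> carrier_mat r n" using c C by (simp add: Z'_def)
  have "(1\<^sub>m n + U * Z) * A = A + U * Z * A"
    using c by (subst add_mult_distrib_mat[of _ n n]) (auto simp: left_mult_one_mat[OF c(5)])
  also have "U * Z * A = U * (Z * A)" using U Z(1) c(5) by (rule assoc_mult_mat)
  also have "A + U * (Z * A) = 1\<^sub>m n + (U * C + U * (Z * A))"
    unfolding A_def using c(1) U c(6)[unfolded A_def] by (intro assoc_add_mat) auto
  also have "U * C + U * (Z * A) = U * Z'"
    unfolding Z'_def mult_add_distrib_mat[OF U c(6) C]
    by (rule comm_add_mat[OF c(1) mult_carrier_mat[OF U c(6)]])
  finally have 1: "(1\<^sub>m n + U * Z) * A = 1\<^sub>m n + U * Z'" .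
  have UB: "A * U = U * (1\<^sub>m r + C * U)"
  proof -
    have "A * U = U + U * C * U" unfolding A_def using U c
      by (subst add_mult_distrib_mat[of _ n n _ _ r]) (auto simp: left_mult_one_mat[OF U])
    also have "U * C * U = U * (C * U)" using U C by (intro assoc_mult_mat) auto
    finally show ?thesis using U c by (subst mult_add_distrib_mat[of _ n r]) (auto simp: right_mult_one_mat[OF U])
  qed
  have B: "1\<^sub>m r + C * U \<in> carrier_mat r r" using c by simp
  have "(1\<^sub>m r + Z * U) * (1\<^sub>m r + C * U) = (1\<^sub>m r + C * U) + Z * U * (1\<^sub>m r + C * U)"
    using add_mult_distrib_mat[OF one_carrier_mat c(4) B] left_mult_one_mat[OF B] by simp
  also have "Z * U * (1\<^sub>m r + C * U) = Z * (A * U)"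
    unfolding UB by (rule assoc_mult_mat[OF Z(1) U B])
  also have "\<dots> = Z * A * U" by (rule assoc_mult_mat[OF Z(1) c(5) U, symmetric])
  also have "(1\<^sub>m r + C * U) + Z * A * U = 1\<^sub>m r + (C * U + Z * A * U)"
    by (rule assoc_add_mat[OF one_carrier_mat c(3) mult_carrier_mat[OF c(6) U]])
  also have "C * U + Z * A * U = Z' * U"
    unfolding Z'_def add_mult_distrib_mat[OF c(6) C U]
    by (rule comm_add_mat[OF c(3) mult_carrier_mat[OF c(6) U]])
  finally have 2: "(1\<^sub>m r + Z * U) * (1\<^sub>m r + C * U) = 1\<^sub>m r + Z' * U" .
  show ?case using Z' 1 2 Z by (intro bexI[of _ Z']) (simp_all add: A_def)
qed

text \<open>For a rank factorization the constant \<open>n - r\<close> is the trace of the identity,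
  as which \<open>A\<close> acts on the quotient by the image of \<open>A - 1\<close>.\<close>

lemma tr_pow_restriction:
  fixes U C :: "rat mat"
  assumes U: "U \<in> carrier_mat n r" and C: "C \<in> carrier_mat r n"
  shows "tr ((1\<^sub>m n + U * C) ^\<^sub>m j) = tr ((1\<^sub>m r + C * U) ^\<^sub>m j) + of_nat n - of_nat r"
proof -
  obtain Z where Z: "Z \<in> carrier_mat r n" "(1\<^sub>m n + U * C) ^\<^sub>m j = 1\<^sub>m n + U * Z"
    "(1\<^sub>m r + C * U) ^\<^sub>m j = 1\<^sub>m r + Z * U" using restriction_power_identity[OF assms] by blast
  have "tr (1\<^sub>m n + U * Z) = of_nat n + tr (U * Z)" "tr (1\<^sub>m r + Z * U) = of_nat r + tr (Z * U)"
    using U Z(1) by (auto simp: tr_def sum.distrib)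
  thus ?thesis using Z tr_mult_comm[OF U Z(1)] by simp
qed

context exceptional_leary_minasyan
begin

lemma A_integral: obtains A0 :: "int mat" where "A0 \<in> carrier_mat n n" "A = map_mat rat_of_int A0"
proof -
  have "\<exists>w \<in> carrier_vec n. A *\<^sub>v unit_vec n j = rv w" for j
  proof -
    have "rv (unit_vec n j) \<in> integral" unfolding integral_def by (rule imageI) simp
    from Ap_integral[OF this, of 1] show ?thesis by (auto simp: integral_def)
  qed
  then obtain w where w: "\<And>j. w j \<in> carrier_vec n" "\<And>j. A *\<^sub>v unit_vec n j = rv (w j)" by metis
  define A0 where "A0 = mat n n (\<lambda>(i,j). w j $ i)"
  have "A = map_mat rat_of_int A0"
  proof (rule eq_matI)
    fix i j assume "i < dim_row (map_mat rat_of_int A0)" "j < dim_col (map_mat rat_of_int A0)"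
    hence ij: "i < n" "j < n" by (auto simp: A0_def)
    have "(A *\<^sub>v unit_vec n j) $ i = rv (w j) $ i" by (simp only: w(2))
    thus "A $$ (i,j) = map_mat rat_of_int A0 $$ (i,j)" using ij carrier_matD[OF A] w(1)[of j] by (simp add: A0_def)
  qed (auto simp: A0_def carrier_matD[OF A])
  thus ?thesis using that[of A0] by (simp add: A0_def)
qed

end

context leary_minasyan
begin

definition factorization :: "nat \<Rightarrow> rat mat \<Rightarrow> rat mat \<Rightarrow> rat mat \<Rightarrow> rat mat \<Rightarrow> bool" where
  "factorization r U C V W \<longleftrightarrow> U \<in> carrier_mat n r \<and> C \<in> carrier_mat r n \<and> V \<in> carrier_mat r n \<and>
     W \<in> carrier_mat n r \<and> A = 1\<^sub>m n + U * C \<and> V * U = 1\<^sub>m r \<and> C * W = 1\<^sub>m r"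

lemma factorization_exists: "\<exists>r U C V W. factorization r U C V W"
proof -
  have "A - 1\<^sub>m n \<in> carrier_mat n n" by (simp add: minus_carrier_mat)
  then obtain r U C V W where f: "U \<in> carrier_mat n r" "C \<in> carrier_mat r n" "V \<in> carrier_mat r n" "W \<in> carrier_mat n r"
    "A - 1\<^sub>m n = U * C" "V * U = 1\<^sub>m r" "C * W = 1\<^sub>m r" using rank_factorization by metis
  have "A = 1\<^sub>m n + (A - 1\<^sub>m n)" by (rule eq_matI) (auto simp: carrier_matD[OF A])
  thus ?thesis using f unfolding factorization_def by metis
qed

context
  fixes r U C V W
  assumes fac: "factorization r U C V W"
begin

lemma fac_facts:
  "U \<in> carrier_mat n r" "C \<in> carrier_mat r n" "V \<in> carrier_mat r n"
  "W \<in> carrier_mat n r" "A = 1\<^sub>m n + U * C" "V * U = 1\<^sub>m r" "C * W = 1\<^sub>m r"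
  using fac by (auto simp: factorization_def)

lemma A_minus_one: "u \<in> carrier_vec n \<Longrightarrow> A *\<^sub>v u - u = U *\<^sub>v (C *\<^sub>v u)"
proof -
  assume u: "u \<in> carrier_vec n"
  have "A *\<^sub>v u = u + U * C *\<^sub>v u"
    unfolding fac_facts(5) using fac_facts(1,2) u by (subst add_mult_distrib_mat_vec[of _ n n]) auto
  moreover have "U * C *\<^sub>v u = U *\<^sub>v (C *\<^sub>v u)" using fac_facts(1,2) u by (rule assoc_mult_mat_vec)
  moreover have "u + U *\<^sub>v (C *\<^sub>v u) - u = U *\<^sub>v (C *\<^sub>v u)" using fac_facts(1,2) u by (intro eq_vecI) auto
  ultimately show ?thesis by simp
qed

lemma A_pow_U: "A ^\<^sub>m j * U = U * (1\<^sub>m r + C * U) ^\<^sub>m j"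
proof -
  obtain Z where Z: "Z \<in> carrier_mat r n" "A ^\<^sub>m j = 1\<^sub>m n + U * Z"
    "(1\<^sub>m r + C * U) ^\<^sub>m j = 1\<^sub>m r + Z * U"
    using restriction_power_identity[OF fac_facts(1,2), of j] fac_facts(5) by auto
  have U: "U \<in> carrier_mat n r" by (rule fac_facts)
  have "A ^\<^sub>m j * U = U + U * Z * U" unfolding Z(2) using U Z(1)
    by (subst add_mult_distrib_mat[of _ n n _ _ r]) (auto simp: left_mult_one_mat[OF U])
  also have "U * Z * U = U * (Z * U)" using U Z(1) by (intro assoc_mult_mat) auto
  finally show ?thesis unfolding Z(3) using U Z(1)
    by (subst mult_add_distrib_mat[of _ n r]) (auto simp: right_mult_one_mat[OF U])
qed

lemma C_A: "C * A = (1\<^sub>m r + C * U) * C"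
proof -
  note f = fac_facts(1,2)
  have "C * A = C + C * (U * C)" unfolding fac_facts(5) using f
    by (subst mult_add_distrib_mat[of _ r n]) (auto simp: right_mult_one_mat[OF f(2)])
  also have "C * (U * C) = C * U * C" using f by (intro assoc_mult_mat[symmetric]) auto
  finally show ?thesis using f by (subst add_mult_distrib_mat[of _ r r]) (auto simp: left_mult_one_mat[OF f(2)])
qed

text \<open>The equation \<open>A^k U C = U C\<close> becomes \<open>U B^k C = U C\<close> with
  \<open>B = 1 + C U\<close>, and \<open>U\<close> and \<open>C\<close> are cancelled by their
  one-sided inverses.\<close>

lemma restriction_finite_order:
  assumes "quasi_unipotent k"
  shows "(1\<^sub>m r + C * U) ^\<^sub>m k = 1\<^sub>m r"
proof -
  note f = fac_facts
  let ?B = "1\<^sub>m r + C * U"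
  have B: "?B \<in> carrier_mat r r" using f by simp
  have Ak: "A ^\<^sub>m k \<in> carrier_mat n n" by simp
  have "A ^\<^sub>m k * (U * C) = U * C"
  proof (rule mat_eq_on_integral[of _ n n])
    fix v :: "int vec" assume v: "v \<in> carrier_vec n"
    have rvv: "rv v \<in> carrier_vec n" using v by simp
    have "A ^\<^sub>m k *\<^sub>v (A *\<^sub>v rv v - rv v) = A *\<^sub>v rv v - rv v" using assms rvv by (simp add: quasi_unipotent_def)
    hence "A ^\<^sub>m k *\<^sub>v (U * C *\<^sub>v rv v) = U * C *\<^sub>v rv v"
      using A_minus_one[OF rvv] assoc_mult_mat_vec[OF f(1,2) rvv] by simp
    thus "A ^\<^sub>m k * (U * C) *\<^sub>v rv v = U * C *\<^sub>v rv v"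
      using assoc_mult_mat_vec[OF Ak mult_carrier_mat[OF f(1,2)] rvv] by simp
  qed (use f Ak in auto)
  hence "V * (A ^\<^sub>m k * U * C) * W = V * (U * C) * W" using f(1,2) Ak by (simp add: assoc_mult_mat[OF Ak])
  hence "V * (U * ?B ^\<^sub>m k * C) * W = V * (U * C) * W" unfolding A_pow_U .
  moreover have "V * (U * ?B ^\<^sub>m k * C) * W = (V * U) * ?B ^\<^sub>m k * (C * W)"
    by (rule mat_mult_regroup3[OF f(3,1) pow_carrier_mat[OF B] f(2,4)])
  moreover have "V * (U * C) * W = (V * U) * (C * W)" using f(1-4) by (auto simp: mat_mult_assoc)
  ultimately show ?thesis using f(6,7) pow_carrier_mat[OF B, of k]
    by (simp add: left_mult_one_mat[of _ r r] right_mult_one_mat[of _ r r])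
qed

end

end

section \<open>Isomorphisms: the exceptional case\<close>

text \<open>Here \<open>K\<close> is a projection onto the cokernel of \<open>U\<close> and
  \<open>J\<close> a section of it. For the factorization of \<open>A - 1\<close> this cokernel is
  the part of rational space that survives in the abelianization.\<close>

lemma left_invertible_complement:
  fixes U :: "'a::field mat"
  assumes U: "U \<in> carrier_mat n r" and V: "V \<in> carrier_mat r n" and VU: "V * U = 1\<^sub>m r"
  obtains q K J Z where "n = r + q" "K \<in> carrier_mat q n" "J \<in> carrier_mat n q" "Z \<in> carrier_mat r n"
    "K * U = 0\<^sub>m q r" "K * J = 1\<^sub>m q" "U * Z + J * K = 1\<^sub>m n"
proof -
  obtain R where R: "R \<in> carrier_mat n n" "det R \<noteq> 0" "U = R * rank_mat n r r" "r \<le> n"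
    using left_invertible_normal_form[OF assms] by blast
  obtain R' where R': "R' \<in> carrier_mat n n" "R * R' = 1\<^sub>m n" "R' * R = 1\<^sub>m n"
    using det_nonzeroE[OF R(1,2)] by blast
  define q where "q = n - r"
  have n: "n = r + q" using R(4) by (simp add: q_def)
  define E where "E = (mat q n (\<lambda>(i,j). if j = r + i then 1 else 0) :: 'a mat)"
  define F where "F = (mat n q (\<lambda>(i,j). if i = r + j then 1 else 0) :: 'a mat)"
  have E: "E \<in> carrier_mat q n" and F: "F \<in> carrier_mat n q" by (auto simp: E_def F_def)
  have E_row: "(E * M) $$ (i,j) = M $$ (r + i, j)" if "M \<in> carrier_mat n m" "i < q" "j < m" for M i j m
    using that n by (simp add: E_def scalar_prod_def atLeast0LessThan if_distrib[of "\<lambda>x. x * _"] cong: if_cong)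
  have EU: "E * rank_mat n r r = 0\<^sub>m q r"
  proof (rule eq_matI)
    fix i j assume "i < dim_row (0\<^sub>m q r)" "j < dim_col (0\<^sub>m q r)"
    thus "(E * rank_mat n r r) $$ (i,j) = 0\<^sub>m q r $$ (i,j)"
      using E_row[OF rank_mat_carrier, of i j] n by (simp add: rank_mat_index del: index_mult_mat(1))
  qed (use E in auto)
  have EF: "E * F = 1\<^sub>m q"
  proof (rule eq_matI)
    fix i j assume "i < dim_row (1\<^sub>m q)" "j < dim_col (1\<^sub>m q)"
    thus "(E * F) $$ (i,j) = 1\<^sub>m q $$ (i,j)"
      using E_row[OF F, of i j] n by (simp add: F_def del: index_mult_mat(1))
  qed (use E F in auto)
  have FE: "rank_mat n r r * rank_mat r n r + F * E = 1\<^sub>m n"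
  proof (rule eq_matI)
    fix i j assume "i < dim_row (1\<^sub>m n)" "j < dim_col (1\<^sub>m n)"
    hence ij: "i < n" "j < n" by auto
    have "(F * E) $$ (i,j) = (\<Sum>k<q. (if i = r + k then 1 else 0) * (if j = r + k then 1 else 0))"
      using ij by (simp add: E_def F_def scalar_prod_def atLeast0LessThan)
    also have "\<dots> = (\<Sum>k<q. if k = i - r then (if i = j \<and> r \<le> i then 1 else 0) else 0)"
      by (rule sum.cong) auto
    also have "\<dots> = (if i = j \<and> r \<le> i then 1 else 0)" using ij n by auto
    finally have FE: "(F * E) $$ (i,j) = (if i = j \<and> r \<le> i then 1 else 0)" .
    have "(rank_mat n r r * rank_mat r n r + F * E) $$ (i,j) = rank_mat n n r $$ (i,j) + (F * E) $$ (i,j)"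
      unfolding rank_mat_mult using ij E F by (intro index_add_mat(1)) auto
    thus "(rank_mat n r r * rank_mat r n r + F * E) $$ (i,j) = 1\<^sub>m n $$ (i,j)"
      using ij unfolding FE by (simp add: rank_mat_index)
  qed (use E F in auto)
  have 1: "E * R' * U = 0\<^sub>m q r"
  proof -
    have "E * R' * U = E * (R' * R) * rank_mat n r r"
      unfolding R(3) using E R(1) R'(1) by (auto simp: mat_mult_assoc)
    thus ?thesis using R'(3) EU by (simp add: right_mult_one_mat[OF E])
  qed
  have 2: "E * R' * (R * F) = 1\<^sub>m q"
  proof -
    have "E * R' * (R * F) = E * (R' * R) * F" using E F R(1) R'(1) by (auto simp: mat_mult_assoc)
    thus ?thesis using R'(3) EF by (simp add: right_mult_one_mat[OF E])
  qed
  have 3: "U * (rank_mat r n r * R') + R * F * (E * R') = 1\<^sub>m n"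
  proof -
    have c: "rank_mat n r r * rank_mat r n r \<in> carrier_mat n n" "F * E \<in> carrier_mat n n"
      "R * (rank_mat n r r * rank_mat r n r) \<in> carrier_mat n n" "R * (F * E) \<in> carrier_mat n n"
      unfolding rank_mat_mult using E F R(1) by auto
    have "U * (rank_mat r n r * R') + R * F * (E * R') = R * (rank_mat n r r * rank_mat r n r) * R' + R * (F * E) * R'"
      unfolding R(3) using E F R(1) R'(1) by (auto simp: mat_mult_assoc)
    also have "\<dots> = R * (rank_mat n r r * rank_mat r n r + F * E) * R'"
      using add_mult_distrib_mat[OF c(3,4) R'(1)] mult_add_distrib_mat[OF R(1) c(1,2)] by simp
    finally show ?thesis unfolding FE using R(1) R'(2) by (simp add: right_mult_one_mat[OF R(1)])
  qed
  show ?thesis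
    by (rule that[OF n _ _ _ 1 2 3]) (use E F R(1) R'(1) in \<open>auto intro!: mult_carrier_mat[OF rank_mat_carrier]\<close>)
qed

lemma mult_mat_vec_cancel:
  assumes "V * U = 1\<^sub>m k" "U \<in> carrier_mat l k" "V \<in> carrier_mat k l" "x \<in> carrier_vec k" "y \<in> carrier_vec k"
    "U *\<^sub>v x = U *\<^sub>v (y :: rat vec)"
  shows "x = y"
proof -
  have "V * U *\<^sub>v x = V * U *\<^sub>v y"
    using assoc_mult_mat_vec[OF assms(3,2,4)] assoc_mult_mat_vec[OF assms(3,2,5)] assms(6) by simp
  thus ?thesis using assms(1,4,5) by simp
qed

section \<open>The rational abelianization\<close>

context leary_minasyan
begin

text \<open>Finite order on the image replaces an integer exponent of \<open>A\<close> by a natural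
  exponent of \<open>1 + C U\<close>, to which \<open>A_pow_U\<close> applies.\<close>

lemma Ap_mult_restriction:
  assumes fac: "factorization r U C V W" and k: "k > 0" "(1\<^sub>m r + C * U) ^\<^sub>m k = 1\<^sub>m r"
  shows "Ap s * U = U * (1\<^sub>m r + C * U) ^\<^sub>m nat (s mod int k)"
proof -
  note f = fac_facts[OF fac]
  let ?B = "1\<^sub>m r + C * U"
  have B: "?B \<in> carrier_mat r r" using f by simp
  have nat: "Ap (int k * int q) * U = U" for q
  proof -
    have "Ap (int k * int q) = A ^\<^sub>m (k * q)" using Ap_nat[of "k * q"] by simp
    moreover have "?B ^\<^sub>m (k * q) = 1\<^sub>m r" by (simp add: pow_mat_times[OF B] k(2))
    ultimately show ?thesis using A_pow_U[OF fac, of "k * q"] by (simp add: right_mult_one_mat[OF f(1)])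
  qed
  have all: "Ap (int k * q) * U = U" for q
  proof (cases "q \<ge> 0")
    case True
    thus ?thesis using nat[of "nat q"] by simp
  next
    case False
    have "Ap (int k * q) * U = Ap (int k * q) * (Ap (int k * int (nat (- q))) * U)" by (simp only: nat)
    also have "\<dots> = Ap (int k * q) * Ap (int k * int (nat (- q))) * U"
      by (rule assoc_mult_mat[OF Ap Ap f(1), symmetric])
    also have "Ap (int k * q) * Ap (int k * int (nat (- q))) = Ap 0"
      using False by (simp add: Ap_add[symmetric] algebra_simps)
    finally show ?thesis by (simp add: left_mult_one_mat[OF f(1)])
  qed
  have "s = int (nat (s mod int k)) + int k * (s div int k)" using k(1) by simp
  hence "Ap s * U = Ap (int (nat (s mod int k))) * (Ap (int k * (s div int k)) * U)"
    by (metis Ap_add assoc_mult_mat[OF Ap Ap f(1)])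
  thus ?thesis unfolding all Ap_nat A_pow_U[OF fac] .
qed

text \<open>The abelianization tensored with the rationals, once \<open>K\<close> is the projection
  modulo the image of \<open>A - 1\<close>: then \<open>K * A = K\<close> removes the linear parts
  from the cocycle, so that the first \<open>q\<close> coordinates are additive, and the last one is
  the height.\<close>

definition abel :: "nat \<Rightarrow> rat mat \<Rightarrow> lm_gen word set \<Rightarrow> rat vec" where
  "abel q K g = vec (Suc q) (\<lambda>i. if i < q then (K *\<^sub>v delta g) $ i else of_int (tau g))"

lemma abel_carrier [simp]: "abel q K g \<in> carrier_vec (Suc q)"
  by (simp add: abel_def)

lemma abel_mult:
  assumes K: "K \<in> carrier_mat q n" and KA: "K * A = K" and g: "g \<in> carrier G" "h \<in> carrier G"
  shows "abel q K (g \<otimes>\<^bsub>G\<^esub> h) = abel q K g + abel q K h"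
proof -
  have KAi: "K * Ai = K"
  proof -
    have "K * Ai = K * A * Ai" by (simp only: KA)
    also have "\<dots> = K" using AAi by (simp add: assoc_mult_mat[OF K A Ai] right_mult_one_mat[OF K])
    finally show ?thesis .
  qed
  have KAp: "K *\<^sub>v (Ap j *\<^sub>v u) = K *\<^sub>v u" if u: "u \<in> carrier_vec n" for j u
  proof (induction j rule: int_induct[where k = 0])
    case base
    thus ?case using u by simp
  next
    case (step1 i)
    have "K *\<^sub>v (Ap (1 + i) *\<^sub>v u) = K * A *\<^sub>v (Ap i *\<^sub>v u)"
      using u Ap_add_vec[OF u, of 1 i] by (simp add: assoc_mult_mat_vec[OF K A])
    thus ?case using step1 KA by (simp add: add.commute)
  next
    case (step2 i)
    have "K *\<^sub>v (Ap (- 1 + i) *\<^sub>v u) = K * Ai *\<^sub>v (Ap i *\<^sub>v u)"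
      using u Ap_add_vec[OF u, of "- 1" i] by (simp add: assoc_mult_mat_vec[OF K Ai])
    thus ?case using step2 KAi by simp
  qed
  have "K *\<^sub>v delta (g \<otimes>\<^bsub>G\<^esub> h) = K *\<^sub>v delta g + K *\<^sub>v delta h"
    using g by (simp add: delta_mult mult_add_distrib_mat_vec[OF K] KAp)
  thus ?thesis using K g by (intro eq_vecI) (auto simp: abel_def simp del: index_mult_mat_vec)
qed

text \<open>The values contain a positive multiple of every unit vector: the first \<open>q\<close>
  come from base elements through the section \<open>J\<close>, with \<open>d\<close> clearing its
  denominators, and the last one comes from \<open>t\<close>.\<close>

lemma abel_spans:
  assumes K: "K \<in> carrier_mat q n" and J: "J \<in> carrier_mat n q" and KJ: "K * J = 1\<^sub>m q"
    and N: "N \<in> carrier_mat (Suc q) (Suc q)" and fixed: "\<And>g. g \<in> carrier G \<Longrightarrow> N *\<^sub>v abel q K g = abel q K g"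
  shows "N = 1\<^sub>m (Suc q)"
proof -
  obtain d :: int where d: "d > 0" "\<And>v. v \<in> carrier_vec q \<Longrightarrow> \<exists>w \<in> carrier_vec n. J *\<^sub>v rv (d \<cdot>\<^sub>v v) = rv w"
    using rat_mat_denominator[OF J] by metis
  have N_unit: "N *\<^sub>v unit_vec (Suc q) j = unit_vec (Suc q) j" if j: "j < Suc q" for j
  proof (cases "j < q")
    case True
    obtain w where w: "w \<in> carrier_vec n" "J *\<^sub>v rv (d \<cdot>\<^sub>v unit_vec q j) = rv w" using d(2)[of "unit_vec q j"] by auto
    have "K *\<^sub>v rv w = rv (d \<cdot>\<^sub>v unit_vec q j)"
      unfolding w(2)[symmetric] using KJ by (simp add: assoc_mult_mat_vec[OF K J, symmetric])
    hence e: "abel q K (XP w) = rat_of_int d \<cdot>\<^sub>v unit_vec (Suc q) j"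
      using w(1) True by (intro eq_vecI) (auto simp: abel_def unit_vec_def simp del: index_mult_mat_vec)
    have "rat_of_int d \<cdot>\<^sub>v (N *\<^sub>v unit_vec (Suc q) j) = rat_of_int d \<cdot>\<^sub>v unit_vec (Suc q) j"
      using fixed[of "XP w"] w(1) unfolding e by (simp add: mult_mat_vec[OF N])
    hence "(1 / rat_of_int d) \<cdot>\<^sub>v (rat_of_int d \<cdot>\<^sub>v (N *\<^sub>v unit_vec (Suc q) j)) = (1 / rat_of_int d) \<cdot>\<^sub>v (rat_of_int d \<cdot>\<^sub>v unit_vec (Suc q) j)"
      by (simp only:)
    thus ?thesis using d(1) by (simp add: smult_smult_assoc)
  next
    case False
    have "K *\<^sub>v 0\<^sub>v n = 0\<^sub>v q" using K by (intro eq_vecI) auto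
    hence "abel q K tt = unit_vec (Suc q) j"
      using False j by (intro eq_vecI) (auto simp: abel_def unit_vec_def simp del: index_mult_mat_vec)
    thus ?thesis using fixed[of tt] by simp
  qed
  show ?thesis
  proof (rule eq_matI)
    fix i j assume "i < dim_row (1\<^sub>m (Suc q))" "j < dim_col (1\<^sub>m (Suc q))"
    hence ij: "i < Suc q" "j < Suc q" by auto
    have "(N *\<^sub>v unit_vec (Suc q) j) $ i = unit_vec (Suc q) j $ i" by (simp only: N_unit[OF ij(2)])
    thus "N $$ (i,j) = 1\<^sub>m (Suc q) $$ (i,j)" using N ij by simp
  qed (use N in auto)
qed

end

context exceptional_leary_minasyan
begin

lemma image_vec:
  assumes y: "y \<in> carrier_vec n"
  obtains v where "v \<in> carrier_vec n" "rv v = A *\<^sub>v rv y - rv y" "XP v \<in> brackets"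
proof -
  have "rv y \<in> integral" using y by (simp add: integral_def)
  hence "A *\<^sub>v rv y - rv y \<in> integral" using Ap_integral[of "rv y" 1] integral_closed(2) by simp
  then obtain v where v: "v \<in> carrier_vec n" "rv v = A *\<^sub>v rv y - rv y" by (auto simp: integral_def)
  have "XP v = bracket tt (XP y)" using XP_image_bracket[OF y v] .
  hence "XP v \<in> brackets" using bracketsI[of tt "XP y"] y by simp
  thus ?thesis using that v by blast
qed

text \<open>As \<Theta> vanishes on commutators, its matrix \<open>Y\<close> on the base kills the
  image of \<open>A - 1\<close> and factors through \<open>K\<close> as \<open>Y = Y J K\<close>.
  What remains is the value at \<open>t\<close>, which becomes the last column of
  \<open>M\<close>.\<close>

lemma abel_universal:
  fixes \<Theta> :: "lm_gen word set \<Rightarrow> rat vec"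
  assumes fac: "factorization r U C V W" and K: "K \<in> carrier_mat q n" and J: "J \<in> carrier_mat n q"
    and Z: "Z \<in> carrier_mat r n" and KU: "K * U = 0\<^sub>m q r" and one: "U * Z + J * K = 1\<^sub>m n" and KA: "K * A = K"
    and \<Theta>: "\<And>g. g \<in> carrier G \<Longrightarrow> \<Theta> g \<in> carrier_vec a"
    and mult: "\<And>g h. g \<in> carrier G \<Longrightarrow> h \<in> carrier G \<Longrightarrow> \<Theta> (g \<otimes>\<^bsub>G\<^esub> h) = \<Theta> g + \<Theta> h"
  shows "\<exists>M \<in> carrier_mat a (Suc q). \<forall>g \<in> carrier G. \<Theta> g = M *\<^sub>v abel q K g"
proof -
  note f = fac_facts[OF fac]
  obtain Y where Y: "Y \<in> carrier_mat a n" "\<And>v. v \<in> carrier_vec n \<Longrightarrow> \<Theta> (XP v) = Y *\<^sub>v rv v"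
    using additive_matrix[of n "\<lambda>v. \<Theta> (XP v)" a] \<Theta> mult by (auto simp: XP_add)
  have bracket_zero: "\<Theta> (bracket x y) = 0\<^sub>v a" if xy: "x \<in> carrier G" "y \<in> carrier G" for x y
  proof -
    have "bracket x y \<otimes>\<^bsub>G\<^esub> (y \<otimes>\<^bsub>G\<^esub> x) = x \<otimes>\<^bsub>G\<^esub> y \<otimes>\<^bsub>G\<^esub> inv\<^bsub>G\<^esub> (y \<otimes>\<^bsub>G\<^esub> x) \<otimes>\<^bsub>G\<^esub> (y \<otimes>\<^bsub>G\<^esub> x)"
      unfolding bracket_def using xy by (simp add: inv_mult_group m_assoc)
    also have "\<dots> = x \<otimes>\<^bsub>G\<^esub> y" using xy by (simp add: m_assoc)
    finally have "\<Theta> (bracket x y) + (\<Theta> y + \<Theta> x) = \<Theta> x + \<Theta> y"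
      using xy mult bracket_carrier[OF xy] by (metis m_closed)
    moreover have c: "\<Theta> x \<in> carrier_vec a" "\<Theta> y \<in> carrier_vec a" "\<Theta> (bracket x y) \<in> carrier_vec a" using xy \<Theta> by auto
    ultimately have e: "\<Theta> (bracket x y) + (\<Theta> y + \<Theta> x) = \<Theta> x + \<Theta> y" by simp
    show ?thesis
    proof (rule eq_vecI)
      fix i assume i: "i < dim_vec (0\<^sub>v a)"
      have "(\<Theta> (bracket x y) + (\<Theta> y + \<Theta> x)) $ i = (\<Theta> x + \<Theta> y) $ i" by (simp only: e)
      thus "\<Theta> (bracket x y) $ i = 0\<^sub>v a $ i" using i c by simp
    qed (use c in simp)
  qed
  have "Y * (U * C) = 0\<^sub>m a n"
  proof (rule mat_eq_on_integral[of _ a n])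
    fix y :: "int vec" assume y: "y \<in> carrier_vec n"
    have rvy: "rv y \<in> carrier_vec n" using y by simp
    obtain v where v: "v \<in> carrier_vec n" "rv v = A *\<^sub>v rv y - rv y" "XP v \<in> brackets" using image_vec[OF y] by blast
    have "Y *\<^sub>v rv v = 0\<^sub>v a" using Y(2)[OF v(1)] v(3) bracket_zero by (auto simp: brackets_def)
    moreover have "rv v = U * C *\<^sub>v rv y" unfolding v(2) using A_minus_one[OF fac rvy] assoc_mult_mat_vec[OF f(1,2) rvy] by simp
    ultimately show "Y * (U * C) *\<^sub>v rv y = 0\<^sub>m a n *\<^sub>v rv y"
      using assoc_mult_mat_vec[OF Y(1) mult_carrier_mat[OF f(1,2)] rvy] y by (auto intro!: eq_vecI)
  qed (use Y f in auto)
  hence "Y * (U * C) * W = 0\<^sub>m a r" using f(4) by (simp add: left_mult_zero_mat[OF f(4)])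
  moreover have "Y * (U * C) * W = Y * (U * (C * W))" using Y(1) f(1,2,4) by (auto simp: mat_mult_assoc)
  ultimately have YU: "Y * U = 0\<^sub>m a r" using f(7) by (simp add: right_mult_one_mat[OF f(1)])
  define YJ where "YJ = Y * J"
  have YJ: "YJ \<in> carrier_mat a q" using Y J by (simp add: YJ_def)
  have "Y = Y * (U * Z + J * K)" unfolding one by (rule right_mult_one_mat[OF Y(1), symmetric])
  also have "\<dots> = Y * (U * Z) + Y * (J * K)"
    by (rule mult_add_distrib_mat[OF Y(1) mult_carrier_mat[OF f(1) Z] mult_carrier_mat[OF J K]])
  also have "Y * (U * Z) = Y * U * Z" by (rule assoc_mult_mat[OF Y(1) f(1) Z, symmetric])
  also have "\<dots> = 0\<^sub>m a n" unfolding YU by (rule left_mult_zero_mat[OF Z])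
  also have "Y * (J * K) = YJ * K" unfolding YJ_def by (rule assoc_mult_mat[OF Y(1) J K, symmetric])
  finally have YJK: "Y = YJ * K" using YJ K by (simp add: left_add_zero_mat[OF mult_carrier_mat[OF YJ K]])
  define M where "M = mat a (Suc q) (\<lambda>(i,j). if j < q then YJ $$ (i,j) else \<Theta> tt $ i)"
  have M: "M \<in> carrier_mat a (Suc q)" by (simp add: M_def)
  have M_abel: "M *\<^sub>v abel q K g = YJ *\<^sub>v (K *\<^sub>v delta g) + of_int (tau g) \<cdot>\<^sub>v \<Theta> tt" if g: "g \<in> carrier G" for g
  proof (rule eq_vecI)
    fix i assume "i < dim_vec (YJ *\<^sub>v (K *\<^sub>v delta g) + of_int (tau g) \<cdot>\<^sub>v \<Theta> tt)"
    hence i: "i < a" using \<Theta>[OF tt_carrier] by simp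
    have "(M *\<^sub>v abel q K g) $ i = (\<Sum>j<Suc q. M $$ (i,j) * abel q K g $ j)"
      using M i by (simp add: scalar_prod_def atLeast0LessThan abel_def)
    also have "\<dots> = (\<Sum>j<q. YJ $$ (i,j) * (K *\<^sub>v delta g) $ j) + \<Theta> tt $ i * of_int (tau g)"
      using i by (simp add: M_def abel_def del: index_mult_mat_vec)
    also have "(\<Sum>j<q. YJ $$ (i,j) * (K *\<^sub>v delta g) $ j) = (YJ *\<^sub>v (K *\<^sub>v delta g)) $ i"
      using i YJ K by (simp add: scalar_prod_def[of "row YJ i"] atLeast0LessThan)
    finally show "(M *\<^sub>v abel q K g) $ i = (YJ *\<^sub>v (K *\<^sub>v delta g) + of_int (tau g) \<cdot>\<^sub>v \<Theta> tt) $ i"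
      using i \<Theta>[OF tt_carrier] YJ by (simp add: mult.commute del: index_mult_mat_vec)
  qed (use M \<Theta>[OF tt_carrier] in auto)
  have "\<Theta> g = M *\<^sub>v abel q K g" if g: "g \<in> carrier G" for g
  proof (rule additive_eqI[where m = a, OF \<Theta> _ mult _ _ _ g])
    show "M *\<^sub>v abel q K g \<in> carrier_vec a" for g using mult_mat_vec_carrier[OF M abel_carrier] .
    show "M *\<^sub>v abel q K (x \<otimes>\<^bsub>G\<^esub> y) = M *\<^sub>v abel q K x + M *\<^sub>v abel q K y" if "x \<in> carrier G" "y \<in> carrier G" for x y
      unfolding abel_mult[OF K KA that] by (rule mult_add_distrib_mat_vec[OF M abel_carrier abel_carrier])
    show "\<Theta> (XP v) = M *\<^sub>v abel q K (XP v)" if v: "v \<in> carrier_vec n" for v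
    proof -
      have rvv: "rv v \<in> carrier_vec n" using v by simp
      have "\<Theta> (XP v) = YJ *\<^sub>v (K *\<^sub>v rv v)" using Y(2)[OF v] assoc_mult_mat_vec[OF YJ K rvv] YJK by simp
      moreover have "YJ *\<^sub>v (K *\<^sub>v rv v) + 0 \<cdot>\<^sub>v \<Theta> tt = YJ *\<^sub>v (K *\<^sub>v rv v)"
        using \<Theta>[OF tt_carrier] YJ by (intro eq_vecI) auto
      ultimately show ?thesis using M_abel[OF XP_carrier[OF v]] v by simp
    qed
    have "YJ *\<^sub>v (K *\<^sub>v 0\<^sub>v n) = 0\<^sub>v a" using YJ K by (intro eq_vecI) (auto simp: scalar_prod_def)
    thus "\<Theta> tt = M *\<^sub>v abel q K tt" using M_abel[OF tt_carrier] \<Theta>[OF tt_carrier] by simp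
  qed
  thus ?thesis using M by blast
qed

end

section \<open>Transport of the commutator subgroup and conclusion\<close>

context lm_isos
begin

text \<open>In both groups the commutators are the elements \<open>x^(U C y)\<close>, so the
  isomorphism acts on them by a rational matrix in the coordinates \<open>C y\<close>. The clause
  with \<open>y'\<close> keeps the image in the same form, so that the map in the other direction
  can be applied to it.\<close>

lemma image_restriction_map:
  assumes P: "P.exceptional" and Q: "Q.exceptional"
    and fac: "P.factorization r U C V W" and fac': "Q.factorization r' U' C' V' W'"
  shows "\<exists>S\<in>carrier_mat r' r. \<forall>y\<in>carrier_vec n. \<forall>v\<in>carrier_vec n. rv v = U *\<^sub>v (C *\<^sub>v rv y) \<longrightarrow>
    (\<exists>v'\<in>carrier_vec n'. \<exists>y'\<in>carrier_vec n'. \<phi> (P.XP v) = Q.XP v' \<and> rv v' = U' *\<^sub>v (S *\<^sub>v (C *\<^sub>v rv y)) \<and>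
       rv v' = U' *\<^sub>v (C' *\<^sub>v rv y'))"
proof -
  interpret PE: exceptional_leary_minasyan n A L by unfold_locales (rule P)
  interpret QE: exceptional_leary_minasyan n' A' L' by unfold_locales (rule Q)
  note f = P.fac_facts[OF fac] and f' = Q.fac_facts[OF fac']
  have "\<exists>v\<in>carrier_vec n. \<exists>v'\<in>carrier_vec n'. \<exists>y'\<in>carrier_vec n'. rv v = U *\<^sub>v (C *\<^sub>v rv y) \<and> \<phi> (P.XP v) = Q.XP v' \<and> rv v' = U' *\<^sub>v (C' *\<^sub>v rv y')"
    if y: "y \<in> carrier_vec n" for y
  proof -
    obtain v where v: "v \<in> carrier_vec n" "rv v = A *\<^sub>v rv y - rv y" "P.XP v \<in> P.brackets" using PE.image_vec[OF y] by blast
    obtain y' v' where y': "y' \<in> carrier_vec n'" "v' \<in> carrier_vec n'" "\<phi> (P.XP v) = Q.XP v'" "rv v' = A' *\<^sub>v rv y' - rv y'"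
      using QE.bracket_form[OF phi_brackets[OF v(3)]] by blast
    have "rv v = U *\<^sub>v (C *\<^sub>v rv y)" "rv v' = U' *\<^sub>v (C' *\<^sub>v rv y')"
      using P.A_minus_one[OF fac, of "rv y"] Q.A_minus_one[OF fac', of "rv y'"] v y y' by simp_all
    thus ?thesis using v(1) y' by blast
  qed
  hence "\<exists>p. fst p \<in> carrier_vec n \<and> fst (snd p) \<in> carrier_vec n' \<and> snd (snd p) \<in> carrier_vec n' \<and>
      rv (fst p) = U *\<^sub>v (C *\<^sub>v rv y) \<and> \<phi> (P.XP (fst p)) = Q.XP (fst (snd p)) \<and>
      rv (fst (snd p)) = U' *\<^sub>v (C' *\<^sub>v rv (snd (snd p)))" if "y \<in> carrier_vec n" for y
    using that by (metis fst_conv snd_conv)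
  then obtain p where p: "\<And>y. y \<in> carrier_vec n \<Longrightarrow> fst (p y) \<in> carrier_vec n \<and> fst (snd (p y)) \<in> carrier_vec n' \<and>
      snd (snd (p y)) \<in> carrier_vec n' \<and>
      rv (fst (p y)) = U *\<^sub>v (C *\<^sub>v rv y) \<and> \<phi> (P.XP (fst (p y))) = Q.XP (fst (snd (p y))) \<and>
      rv (fst (snd (p y))) = U' *\<^sub>v (C' *\<^sub>v rv (snd (snd (p y))))" by metis
  define D F Y' where "D y = fst (p y)" and "F y = fst (snd (p y))" and "Y' y = snd (snd (p y))" for y
  have D: "\<And>y. y \<in> carrier_vec n \<Longrightarrow> D y \<in> carrier_vec n"
    "\<And>y. y \<in> carrier_vec n \<Longrightarrow> rv (D y) = U *\<^sub>v (C *\<^sub>v rv y)"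
    and F: "\<And>y. y \<in> carrier_vec n \<Longrightarrow> F y \<in> carrier_vec n'" "\<And>y. y \<in> carrier_vec n \<Longrightarrow> \<phi> (P.XP (D y)) = Q.XP (F y)"
    and Y': "\<And>y. y \<in> carrier_vec n \<Longrightarrow> Y' y \<in> carrier_vec n'" "\<And>y. y \<in> carrier_vec n \<Longrightarrow> rv (F y) = U' *\<^sub>v (C' *\<^sub>v rv (Y' y))"
    using p by (simp_all add: D_def F_def Y'_def)
  have F_add: "rv (F (y + z)) = rv (F y) + rv (F z)" if yz: "y \<in> carrier_vec n" "z \<in> carrier_vec n" for y z
  proof -
    have c: "C *\<^sub>v rv y \<in> carrier_vec r" "C *\<^sub>v rv z \<in> carrier_vec r" using f(2) yz by auto
    have "rv (D (y + z)) = rv (D y + D z)"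
      using yz D c by (simp add: rv_add[of _ n] mult_add_distrib_mat_vec[OF f(2)] mult_add_distrib_mat_vec[OF f(1)])
    hence "D (y + z) = D y + D z" by (simp only: rv_inject)
    hence "Q.XP (F (y + z)) = Q.XP (F y + F z)"
      using yz D F by (simp add: F(2)[symmetric] P.XP_add Q.XP_add)
    thus ?thesis using yz F by (simp add: Q.XP_eq_iff rv_add[of _ n'])
  qed
  obtain M where M: "M \<in> carrier_mat n' n" "\<And>y. y \<in> carrier_vec n \<Longrightarrow> rv (F y) = M *\<^sub>v rv y"
    using additive_matrix[of n "\<lambda>y. rv (F y)" n'] F(1) F_add by auto
  \<comment> \<open>The values of \<open>M\<close> lie in the image of \<open>U'\<close>, on which
    \<open>U' * V'\<close> is the identity.\<close>
  have UVM: "U' * V' * M = M"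
  proof (rule mat_eq_on_integral[of _ n' n])
    fix y :: "int vec" assume y: "y \<in> carrier_vec n"
    have c: "rv y \<in> carrier_vec n" "C' *\<^sub>v rv (Y' y) \<in> carrier_vec r'" "U' * V' \<in> carrier_mat n' n'"
      using y f' Y'(1)[OF y] by auto
    have "U' * V' * M *\<^sub>v rv y = U' * V' *\<^sub>v (U' *\<^sub>v (C' *\<^sub>v rv (Y' y)))"
      using M(2)[OF y] Y'(2)[OF y] by (simp add: assoc_mult_mat_vec[OF c(3) M(1) c(1)])
    also have "\<dots> = U' * V' * U' *\<^sub>v (C' *\<^sub>v rv (Y' y))" by (rule assoc_mult_mat_vec[OF c(3) f'(1) c(2), symmetric])
    also have "U' * V' * U' = U'" using f'(6) by (simp add: assoc_mult_mat[OF f'(1,3,1)] right_mult_one_mat[OF f'(1)])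
    finally show "U' * V' * M *\<^sub>v rv y = M *\<^sub>v rv y" using M(2)[OF y] Y'(2)[OF y] by simp
  qed (use M f' in auto)
  have WC: "W * C \<in> carrier_mat n n" using f by simp
  obtain d :: int where d: "d > 0" "\<And>v. v \<in> carrier_vec n \<Longrightarrow> \<exists>w \<in> carrier_vec n. W * C *\<^sub>v rv (d \<cdot>\<^sub>v v) = rv w"
    using rat_mat_denominator[OF WC] by metis
  \<comment> \<open>The image of \<open>y\<close> depends only on \<open>C y\<close>: a vector and
    its image under \<open>W * C\<close> differ by an element of the kernel of \<open>C\<close>, on
    which \<open>D\<close> and hence \<open>F\<close> vanish. The multiple \<open>d\<close> keeps
    that image integral.\<close>
  have MWC: "M * (W * C) = M"
  proof (rule mat_eq_on_multiples[of _ n' n])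
    fix v :: "int vec" assume v: "v \<in> carrier_vec n"
    let ?v = "d \<cdot>\<^sub>v v"
    have vc: "rv ?v \<in> carrier_vec n" "?v \<in> carrier_vec n" using v by auto
    obtain w where w: "w \<in> carrier_vec n" "W * C *\<^sub>v rv ?v = rv w" using d(2)[OF v] by blast
    have z: "?v - w \<in> carrier_vec n" and rvz: "rv (?v - w) = rv ?v - rv w"
      using v w by (auto intro!: eq_vecI)
    have Cw: "C *\<^sub>v rv w = C *\<^sub>v rv ?v"
    proof -
      have "C *\<^sub>v rv w = C * (W * C) *\<^sub>v rv ?v" unfolding w(2)[symmetric] by (rule assoc_mult_mat_vec[OF f(2) WC vc(1), symmetric])
      also have "C * (W * C) = C" using f(7) by (simp add: assoc_mult_mat[OF f(2,4,2), symmetric] left_mult_one_mat[OF f(2)])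
      finally show ?thesis .
    qed
    have "C *\<^sub>v rv (?v - w) = C *\<^sub>v rv ?v - C *\<^sub>v rv w"
      unfolding rvz using vc w by (intro mult_minus_distrib_mat_vec[OF f(2)]) auto
    hence "C *\<^sub>v rv (?v - w) = 0\<^sub>v r" using Cw f(2) by (intro eq_vecI) auto
    hence "rv (D (?v - w)) = rv (0\<^sub>v n)" using D(2)[OF z] f(1) by (auto intro!: eq_vecI)
    hence "D (?v - w) = 0\<^sub>v n" by (simp only: rv_inject)
    hence "Q.XP (F (?v - w)) = Q.XP (0\<^sub>v n')" using F(2)[OF z] by simp
    hence "F (?v - w) = 0\<^sub>v n'" using F(1)[OF z] by (simp add: Q.XP_eq_iff del: Q.XP_zero)
    hence "M *\<^sub>v (rv ?v - rv w) = 0\<^sub>v n'" using M(2)[OF z] rvz by simp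
    hence "M *\<^sub>v rv ?v - M *\<^sub>v rv w = 0\<^sub>v n'" using vc w by (simp add: mult_minus_distrib_mat_vec[OF M(1)])
    hence e: "M *\<^sub>v rv ?v - M *\<^sub>v rv w = 0\<^sub>v n'" .
    have "M *\<^sub>v rv w = M *\<^sub>v rv ?v"
    proof (rule eq_vecI)
      fix i assume i: "i < dim_vec (M *\<^sub>v rv ?v)"
      have "(M *\<^sub>v rv ?v - M *\<^sub>v rv w) $ i = 0\<^sub>v n' $ i" by (simp only: e)
      thus "(M *\<^sub>v rv w) $ i = (M *\<^sub>v rv ?v) $ i" using i M(1) by (simp del: index_mult_mat_vec)
    qed simp
    thus "M * (W * C) *\<^sub>v rv ?v = M *\<^sub>v rv ?v" using w(2) by (simp add: assoc_mult_mat_vec[OF M(1) WC vc(1)])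
  qed (use M WC d in auto)
  define S where "S = V' * M * W"
  have S: "S \<in> carrier_mat r' r" using f f' M by (simp add: S_def)
  have "U' * S * C = U' * V' * M * (W * C)"
    unfolding S_def using f(2,4) f'(1,3) M(1) by (auto simp: mat_mult_assoc)
  hence USC: "U' * S * C = M" unfolding UVM MWC .
  show ?thesis
  proof (intro bexI[OF _ S] ballI impI)
    fix y v assume y: "y \<in> carrier_vec n" and v: "v \<in> carrier_vec n" and e: "rv v = U *\<^sub>v (C *\<^sub>v rv y)"
    have "v = D y" using e D(2)[OF y] rv_inject by metis
    moreover have "rv (F y) = U' *\<^sub>v (S *\<^sub>v (C *\<^sub>v rv y))"
    proof -
      have c: "rv y \<in> carrier_vec n" "C *\<^sub>v rv y \<in> carrier_vec r" using y f(2) by auto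
      show ?thesis unfolding M(2)[OF y] USC[symmetric]
        using assoc_mult_mat_vec[OF mult_carrier_mat[OF f'(1) S] f(2) c(1)] assoc_mult_mat_vec[OF f'(1) S c(2)] by simp
    qed
    ultimately show "\<exists>v'\<in>carrier_vec n'. \<exists>y'\<in>carrier_vec n'. \<phi> (P.XP v) = Q.XP v' \<and>
        rv v' = U' *\<^sub>v (S *\<^sub>v (C *\<^sub>v rv y)) \<and> rv v' = U' *\<^sub>v (C' *\<^sub>v rv y')"
      using F y Y' by blast
  qed
qed


lemma image_restriction_inverse:
  assumes P: "P.exceptional" and fac: "P.factorization r U C V W" and fac': "Q.factorization r' U' C' V' W'"
    and S: "S \<in> carrier_mat r' r" and S': "S' \<in> carrier_mat r r'"
    and SP: "\<And>y v. y \<in> carrier_vec n \<Longrightarrow> v \<in> carrier_vec n \<Longrightarrow> rv v = U *\<^sub>v (C *\<^sub>v rv y) \<Longrightarrow>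
      (\<exists>v'\<in>carrier_vec n'. \<exists>y'\<in>carrier_vec n'. \<phi> (P.XP v) = Q.XP v' \<and> rv v' = U' *\<^sub>v (S *\<^sub>v (C *\<^sub>v rv y)) \<and>
       rv v' = U' *\<^sub>v (C' *\<^sub>v rv y'))"
    and SP': "\<And>y v. y \<in> carrier_vec n' \<Longrightarrow> v \<in> carrier_vec n' \<Longrightarrow> rv v = U' *\<^sub>v (C' *\<^sub>v rv y) \<Longrightarrow>
      (\<exists>v'\<in>carrier_vec n. \<exists>y'\<in>carrier_vec n. \<psi> (Q.XP v) = P.XP v' \<and> rv v' = U *\<^sub>v (S' *\<^sub>v (C' *\<^sub>v rv y)) \<and>
       rv v' = U *\<^sub>v (C *\<^sub>v rv y'))"
  shows "S' * S = 1\<^sub>m r"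
proof -
  interpret PE: exceptional_leary_minasyan n A L by unfold_locales (rule P)
  note f = P.fac_facts[OF fac] and f' = Q.fac_facts[OF fac']
  have "S' * S * C = C"
  proof (rule mat_eq_on_integral[of _ r n])
    fix y :: "int vec" assume y: "y \<in> carrier_vec n"
    have rvy: "rv y \<in> carrier_vec n" using y by simp
    obtain v where v: "v \<in> carrier_vec n" "rv v = A *\<^sub>v rv y - rv y" using PE.image_vec[OF y] by blast
    have v2: "rv v = U *\<^sub>v (C *\<^sub>v rv y)" using v(2) P.A_minus_one[OF fac rvy] by simp
    obtain v' y' where v': "v' \<in> carrier_vec n'" "y' \<in> carrier_vec n'" "\<phi> (P.XP v) = Q.XP v'" "rv v' = U' *\<^sub>v (S *\<^sub>v (C *\<^sub>v rv y))"
      "rv v' = U' *\<^sub>v (C' *\<^sub>v rv y')" using SP[OF y v(1) v2] by blast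
    obtain u where u: "u \<in> carrier_vec n" "\<psi> (Q.XP v') = P.XP u" "rv u = U *\<^sub>v (S' *\<^sub>v (C' *\<^sub>v rv y'))" using SP'[OF v'(2,1,5)] by blast
    have "P.XP u = P.XP v" unfolding u(2)[symmetric] v'(3)[symmetric] using v(1) by simp
    hence uv: "u = v" using u(1) v(1) by (simp add: P.XP_eq_iff)
    have c: "C *\<^sub>v rv y \<in> carrier_vec r" "C' *\<^sub>v rv y' \<in> carrier_vec r'" using y v' f f' by auto
    have "S *\<^sub>v (C *\<^sub>v rv y) = C' *\<^sub>v rv y'"
      by (rule mult_mat_vec_cancel[OF f'(6,1,3)]) (use v'(4,5) S c in auto)
    moreover have "S' *\<^sub>v (C' *\<^sub>v rv y') = C *\<^sub>v rv y"
      by (rule mult_mat_vec_cancel[OF f(6,1,3)]) (use u(3) uv v2 S' c in auto)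
    ultimately have "S' *\<^sub>v (S *\<^sub>v (C *\<^sub>v rv y)) = C *\<^sub>v rv y" by simp
    thus "S' * S * C *\<^sub>v rv y = C *\<^sub>v rv y"
      using assoc_mult_mat_vec[OF mult_carrier_mat[OF S' S] f(2) rvy] assoc_mult_mat_vec[OF S' S c(1)] by simp
  qed (use f S S' in auto)
  hence "S' * S * (C * W) = C * W"
    using assoc_mult_mat[OF mult_carrier_mat[OF S' S] f(2,4)] by simp
  thus ?thesis using f(7) right_mult_one_mat[OF mult_carrier_mat[OF S' S]] by simp
qed

text \<open>In the coordinates \<open>C y\<close>, conjugation by \<open>t\<close> on the
  commutators is \<open>1 + C U\<close>. It is transported to conjugation by the image of
  \<open>t\<close>, which is some power of \<open>1 + C' U'\<close>.\<close>

lemma image_restriction_iso: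
  assumes P: "P.exceptional" and Q: "Q.exceptional"
    and fac: "P.factorization r U C V W" and fac': "Q.factorization r' U' C' V' W'"
    and m: "m > 0" "(1\<^sub>m r' + C' * U') ^\<^sub>m m = 1\<^sub>m r'"
  shows "\<exists>S\<in>carrier_mat r' r. \<exists>S'\<in>carrier_mat r r'. S' * S = 1\<^sub>m r \<and> S * S' = 1\<^sub>m r' \<and>
    (\<exists>e. S * (1\<^sub>m r + C * U) = (1\<^sub>m r' + C' * U') ^\<^sub>m e * S)"
proof -
  interpret J: lm_isos n' A' L' n A L \<psi> \<phi> by (rule swap)
  interpret PE: exceptional_leary_minasyan n A L by unfold_locales (rule P)
  interpret QE: exceptional_leary_minasyan n' A' L' by unfold_locales (rule Q)
  note f = P.fac_facts[OF fac] and f' = Q.fac_facts[OF fac']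
  obtain S where S: "S \<in> carrier_mat r' r" and SP: "\<And>y v. y \<in> carrier_vec n \<Longrightarrow> v \<in> carrier_vec n \<Longrightarrow> rv v = U *\<^sub>v (C *\<^sub>v rv y) \<Longrightarrow>
    (\<exists>v'\<in>carrier_vec n'. \<exists>y'\<in>carrier_vec n'. \<phi> (P.XP v) = Q.XP v' \<and> rv v' = U' *\<^sub>v (S *\<^sub>v (C *\<^sub>v rv y)) \<and>
       rv v' = U' *\<^sub>v (C' *\<^sub>v rv y'))"
    using image_restriction_map[OF P Q fac fac'] by blast
  obtain S' where S': "S' \<in> carrier_mat r r'" and SP': "\<And>y v. y \<in> carrier_vec n' \<Longrightarrow> v \<in> carrier_vec n' \<Longrightarrow> rv v = U' *\<^sub>v (C' *\<^sub>v rv y) \<Longrightarrow>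
    (\<exists>v'\<in>carrier_vec n. \<exists>y'\<in>carrier_vec n. \<psi> (Q.XP v) = P.XP v' \<and> rv v' = U *\<^sub>v (S' *\<^sub>v (C' *\<^sub>v rv y)) \<and>
       rv v' = U *\<^sub>v (C *\<^sub>v rv y'))"
    using J.image_restriction_map[OF Q P fac' fac] by blast
  have S'S: "S' * S = 1\<^sub>m r" using SP SP' by (rule image_restriction_inverse[OF P fac fac' S S'])
  have SS': "S * S' = 1\<^sub>m r'" using SP' SP by (rule J.image_restriction_inverse[OF Q fac' fac S' S])
  define s where "s = Q.tau (\<phi> P.tt)"
  \<comment> \<open>The image of \<open>t\<close> may have any height \<open>s\<close>; only its
    residue modulo \<open>m\<close> matters on the image of \<open>A' - 1\<close>, and this gives a
    natural exponent.\<close>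
  define e where "e = nat (s mod int m)"
  let ?B = "1\<^sub>m r + C * U" and ?B' = "1\<^sub>m r' + C' * U'"
  have B: "?B \<in> carrier_mat r r" and B': "?B' ^\<^sub>m e \<in> carrier_mat r' r'" using f f' by auto
  have "?B' ^\<^sub>m e * S * C = S * ?B * C"
  proof (rule mat_eq_on_integral[of _ r' n])
    fix y :: "int vec" assume y: "y \<in> carrier_vec n"
    have rvy: "rv y \<in> carrier_vec n" using y by simp
    have Cy: "C *\<^sub>v rv y \<in> carrier_vec r" using f(2) rvy by simp
    obtain v where v: "v \<in> carrier_vec n" "rv v = A *\<^sub>v rv y - rv y" using PE.image_vec[OF y] by blast
    have v2: "rv v = U *\<^sub>v (C *\<^sub>v rv y)" using v(2) P.A_minus_one[OF fac rvy] by simp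
    have "rv y \<in> P.integral" using y by (simp add: P.integral_def)
    hence "P.Ap 1 *\<^sub>v rv y \<in> P.integral" by (rule PE.Ap_integral)
    then obtain z where z: "z \<in> carrier_vec n" "A *\<^sub>v rv y = rv z" by (auto simp: P.integral_def)
    obtain w where w: "w \<in> carrier_vec n" "P.tt \<otimes>\<^bsub>P.G\<^esub> P.XP v = P.XP w \<otimes>\<^bsub>P.G\<^esub> P.tt" "rv w = P.Ap (P.tau P.tt) *\<^sub>v rv v"
      using PE.exceptional_conj[OF P.tt_carrier v(1)] by blast
    have w2: "rv w = U *\<^sub>v (C *\<^sub>v rv z)"
    proof -
      have "rv w = A *\<^sub>v (A *\<^sub>v rv y - rv y)" using w(3) v(2) by simp
      also have "\<dots> = A *\<^sub>v rv z - rv z"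
        using z rvy mult_minus_distrib_mat_vec[OF P.A, of "rv z" "rv y"] by simp
      finally show ?thesis using P.A_minus_one[OF fac, of "rv z"] z by simp
    qed
    obtain v' where v': "v' \<in> carrier_vec n'" "\<phi> (P.XP v) = Q.XP v'" "rv v' = U' *\<^sub>v (S *\<^sub>v (C *\<^sub>v rv y))"
      using SP[OF y v(1) v2] by blast
    obtain w' where w': "w' \<in> carrier_vec n'" "\<phi> (P.XP w) = Q.XP w'" "rv w' = U' *\<^sub>v (S *\<^sub>v (C *\<^sub>v rv z))"
      using SP[OF z(1) w(1) w2] by blast
    have "\<phi> (P.tt \<otimes>\<^bsub>P.G\<^esub> P.XP v) = \<phi> (P.XP w \<otimes>\<^bsub>P.G\<^esub> P.tt)" by (simp only: w(2))
    hence "\<phi> P.tt \<otimes>\<^bsub>Q.G\<^esub> Q.XP v' = Q.XP w' \<otimes>\<^bsub>Q.G\<^esub> \<phi> P.tt"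
      using phi.hom_mult[OF P.tt_carrier P.XP_carrier[OF v(1)]] phi.hom_mult[OF P.XP_carrier[OF w(1)] P.tt_carrier]
        v'(2) w'(2) by simp
    hence i: "Q.Ap s *\<^sub>v rv v' = rv w'" unfolding s_def using v' w' by (intro Q.XP_intertwine) auto
    have SCy: "S *\<^sub>v (C *\<^sub>v rv y) \<in> carrier_vec r'" "S *\<^sub>v (C *\<^sub>v rv z) \<in> carrier_vec r'" using S Cy f(2) z by auto
    have U1: "U' *\<^sub>v (?B' ^\<^sub>m e *\<^sub>v (S *\<^sub>v (C *\<^sub>v rv y))) = U' *\<^sub>v (S *\<^sub>v (C *\<^sub>v rv z))"
    proof -
      have "U' *\<^sub>v (?B' ^\<^sub>m e *\<^sub>v (S *\<^sub>v (C *\<^sub>v rv y))) = Q.Ap s * U' *\<^sub>v (S *\<^sub>v (C *\<^sub>v rv y))"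
        unfolding Q.Ap_mult_restriction[OF fac' m] e_def[symmetric]
        by (rule assoc_mult_mat_vec[OF f'(1) B' SCy(1), symmetric])
      also have "\<dots> = Q.Ap s *\<^sub>v rv v'" unfolding v'(3) by (rule assoc_mult_mat_vec[OF Q.Ap f'(1) SCy(1)])
      finally show ?thesis using i w'(3) by simp
    qed
    have k: "?B' ^\<^sub>m e *\<^sub>v (S *\<^sub>v (C *\<^sub>v rv y)) = S *\<^sub>v (C *\<^sub>v rv z)"
      by (rule mult_mat_vec_cancel[OF f'(6,1,3)]) (use U1 SCy B' in auto)
    have "C *\<^sub>v rv z = ?B *\<^sub>v (C *\<^sub>v rv y)"
      unfolding z(2)[symmetric] using P.C_A[OF fac] assoc_mult_mat_vec[OF f(2) P.A rvy] assoc_mult_mat_vec[OF B f(2) rvy] by simp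
    moreover have "?B' ^\<^sub>m e * S * C *\<^sub>v rv y = ?B' ^\<^sub>m e *\<^sub>v (S *\<^sub>v (C *\<^sub>v rv y))"
      using assoc_mult_mat_vec[OF mult_carrier_mat[OF B' S] f(2) rvy] assoc_mult_mat_vec[OF B' S Cy] by simp
    moreover have "S * ?B * C *\<^sub>v rv y = S *\<^sub>v (?B *\<^sub>v (C *\<^sub>v rv y))"
      using assoc_mult_mat_vec[OF mult_carrier_mat[OF S B] f(2) rvy] assoc_mult_mat_vec[OF S B Cy] by simp
    ultimately show "?B' ^\<^sub>m e * S * C *\<^sub>v rv y = S * ?B * C *\<^sub>v rv y" using k by simp
  qed (use f B B' S in auto)
  hence "?B' ^\<^sub>m e * S * (C * W) = S * ?B * (C * W)"
    using assoc_mult_mat[OF mult_carrier_mat[OF B' S] f(2,4)] assoc_mult_mat[OF mult_carrier_mat[OF S B] f(2,4)] by simp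
  hence "S * ?B = ?B' ^\<^sub>m e * S"
    using f(7) right_mult_one_mat[OF mult_carrier_mat[OF B' S]] right_mult_one_mat[OF mult_carrier_mat[OF S B]] by simp
  thus ?thesis using S S' S'S SS' by blast
qed

text \<open>Both differences are one less than the rational rank of the abelianization. The
  universal property applied to \<phi> and \<psi> gives matrices that are mutually inverse because
  the values of \<open>abel\<close> span.\<close>

lemma exceptional_dimension:
  assumes P: "P.exceptional" and Q: "Q.exceptional"
    and fac: "P.factorization r U C V W" and fac': "Q.factorization r' U' C' V' W'"
  shows "int n - int r = int n' - int r'"
proof -
  interpret J: lm_isos n' A' L' n A L \<psi> \<phi> by (rule swap)
  interpret PE: exceptional_leary_minasyan n A L by unfold_locales (rule P)
  interpret QE: exceptional_leary_minasyan n' A' L' by unfold_locales (rule Q)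
  note f = P.fac_facts[OF fac] and f' = Q.fac_facts[OF fac']
  obtain q K J Z where q: "n = r + q" and K: "K \<in> carrier_mat q n" "J \<in> carrier_mat n q" "Z \<in> carrier_mat r n"
    "K * U = 0\<^sub>m q r" "K * J = 1\<^sub>m q" "U * Z + J * K = 1\<^sub>m n" using left_invertible_complement[OF f(1,3,6)] by metis
  obtain q' K' J' Z' where q': "n' = r' + q'" and K': "K' \<in> carrier_mat q' n'" "J' \<in> carrier_mat n' q'" "Z' \<in> carrier_mat r' n'"
    "K' * U' = 0\<^sub>m q' r'" "K' * J' = 1\<^sub>m q'" "U' * Z' + J' * K' = 1\<^sub>m n'" using left_invertible_complement[OF f'(1,3,6)] by metis
  have KA: "K * A = K"
  proof -
    have "K * A = K * 1\<^sub>m n + K * (U * C)" unfolding f(5) by (rule mult_add_distrib_mat[OF K(1) one_carrier_mat mult_carrier_mat[OF f(1,2)]])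
    also have "K * (U * C) = 0\<^sub>m q n" using assoc_mult_mat[OF K(1) f(1,2), symmetric] K(4) left_mult_zero_mat[OF f(2)] by simp
    finally show ?thesis using K(1) by (simp add: right_mult_one_mat[OF K(1)])
  qed
  have KA': "K' * A' = K'"
  proof -
    have "K' * A' = K' * 1\<^sub>m n' + K' * (U' * C')" unfolding f'(5) by (rule mult_add_distrib_mat[OF K'(1) one_carrier_mat mult_carrier_mat[OF f'(1,2)]])
    also have "K' * (U' * C') = 0\<^sub>m q' n'" using assoc_mult_mat[OF K'(1) f'(1,2), symmetric] K'(4) left_mult_zero_mat[OF f'(2)] by simp
    finally show ?thesis using K'(1) by (simp add: right_mult_one_mat[OF K'(1)])
  qed
  have 1: "Q.abel q' K' (\<phi> (g \<otimes>\<^bsub>P.G\<^esub> h)) = Q.abel q' K' (\<phi> g) + Q.abel q' K' (\<phi> h)" if "g \<in> carrier P.G" "h \<in> carrier P.G" for g h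
    using that Q.abel_mult[OF K'(1) KA', of "\<phi> g" "\<phi> h"] by simp
  obtain M where M: "M \<in> carrier_mat (Suc q') (Suc q)" "\<And>g. g \<in> carrier P.G \<Longrightarrow> Q.abel q' K' (\<phi> g) = M *\<^sub>v P.abel q K g"
    using PE.abel_universal[OF fac K(1,2,3,4,6) KA Q.abel_carrier 1] by blast
  have 2: "P.abel q K (\<psi> (g \<otimes>\<^bsub>Q.G\<^esub> h)) = P.abel q K (\<psi> g) + P.abel q K (\<psi> h)" if "g \<in> carrier Q.G" "h \<in> carrier Q.G" for g h
    using that P.abel_mult[OF K(1) KA, of "\<psi> g" "\<psi> h"] by simp
  obtain M' where M': "M' \<in> carrier_mat (Suc q) (Suc q')" "\<And>g. g \<in> carrier Q.G \<Longrightarrow> P.abel q K (\<psi> g) = M' *\<^sub>v Q.abel q' K' g"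
    using QE.abel_universal[OF fac' K'(1,2,3,4,6) KA' P.abel_carrier 2] by blast
  have "M' * M = 1\<^sub>m (Suc q)"
  proof (rule P.abel_spans[OF K(1,2,5)])
    show "M' * M *\<^sub>v P.abel q K g = P.abel q K g" if "g \<in> carrier P.G" for g
      using M(2)[OF that] M'(2)[of "\<phi> g"] that assoc_mult_mat_vec[OF M'(1) M(1) P.abel_carrier] by simp
  qed (use M M' in auto)
  moreover have "M * M' = 1\<^sub>m (Suc q')"
  proof (rule Q.abel_spans[OF K'(1,2,5)])
    show "M * M' *\<^sub>v Q.abel q' K' g = Q.abel q' K' g" if "g \<in> carrier Q.G" for g
      using M'(2)[OF that] M(2)[of "\<psi> g"] that assoc_mult_mat_vec[OF M(1) M'(1) Q.abel_carrier] by simp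
  qed (use M M' in auto)
  ultimately have "q = q'" using tr_mult_comm[OF M(1) M'(1)] by simp
  thus ?thesis using q q' by simp
qed

lemma exceptional_case:
  assumes P: "P.exceptional" and Q: "Q.exceptional"
  shows "n = n' \<and> similar_mat A' A"
proof -
  interpret J: lm_isos n' A' L' n A L \<psi> \<phi> by (rule swap)
  interpret PE: exceptional_leary_minasyan n A L by unfold_locales (rule P)
  obtain r U C V W where fac: "P.factorization r U C V W" using P.factorization_exists by blast
  obtain r' U' C' V' W' where fac': "Q.factorization r' U' C' V' W'" using Q.factorization_exists by blast
  note f = P.fac_facts[OF fac] and f' = Q.fac_facts[OF fac']
  define B B' where "B = 1\<^sub>m r + C * U" and "B' = 1\<^sub>m r' + C' * U'"
  have B: "B \<in> carrier_mat r r" and B': "B' \<in> carrier_mat r' r'" using f f' by (auto simp: B_def B'_def)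
  obtain k where k: "k > 0" "B ^\<^sub>m k = 1\<^sub>m r"
    using P P.restriction_finite_order[OF fac] unfolding P.exceptional_def B_def by blast
  obtain k' where k': "k' > 0" "B' ^\<^sub>m k' = 1\<^sub>m r'"
    using Q Q.restriction_finite_order[OF fac'] unfolding Q.exceptional_def B'_def by blast
  obtain S S' e where S: "S \<in> carrier_mat r' r" "S' \<in> carrier_mat r r'" "S' * S = 1\<^sub>m r" "S * S' = 1\<^sub>m r'"
    "S * B = B' ^\<^sub>m e * S" using image_restriction_iso[OF P Q fac fac' k'(1) k'(2)[unfolded B'_def]] unfolding B_def B'_def by blast
  obtain S2 S2' e' where S2: "S2 \<in> carrier_mat r r'" "S2' \<in> carrier_mat r' r" "S2' * S2 = 1\<^sub>m r'" "S2 * S2' = 1\<^sub>m r"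
    "S2 * B' = B ^\<^sub>m e' * S2" using J.image_restriction_iso[OF Q P fac' fac k(1) k(2)[unfolded B_def]] unfolding B_def B'_def by blast
  have "rat_of_nat r = rat_of_nat r'" using tr_mult_comm[OF S(1,2)] S(3,4) by simp
  hence r: "r' = r" by simp
  hence n: "n' = n" using exceptional_dimension[OF P Q fac fac'] by simp
  note S = S[unfolded r] and S2 = S2[unfolded r] and B' = B'[unfolded r]
  have sim1: "similar_mat B (B' ^\<^sub>m e)"
    by (rule similar_matI_det[OF B pow_carrier_mat[OF B'] S(1) det_nonzeroI[OF S(1,2,4)] S(5)])
  have sim2: "similar_mat B' (B ^\<^sub>m e')"
    by (rule similar_matI_det[OF B' pow_carrier_mat[OF B] S2(1) det_nonzeroI[OF S2(1,2,4)] S2(5)])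
  have sim3: "similar_mat B (B ^\<^sub>m (e' * e))"
    using similar_mat_trans[OF sim1 similar_mat_pow[OF sim2, of e]] by (simp add: pow_mat_times[OF B])
  \<comment> \<open>The exact order of \<open>B\<close>; its minimality yields the coprimality
    below.\<close>
  define m where "m = (LEAST m. m > 0 \<and> B ^\<^sub>m m = 1\<^sub>m r)"
  have m: "m > 0" "B ^\<^sub>m m = 1\<^sub>m r"
    using LeastI[of "\<lambda>m. m > 0 \<and> B ^\<^sub>m m = 1\<^sub>m r" k] k by (auto simp: m_def)
  have m_le: "m \<le> l" if "l > 0" "B ^\<^sub>m l = 1\<^sub>m r" for l
    unfolding m_def using that by (intro Least_le) auto
  \<comment> \<open>For \<open>d = gcd e' m\<close> and \<open>b = m / d\<close>, the matrix
    \<open>B^b\<close> is similar to \<open>B^(e' e b)\<close>, which is 1 because \<open>m\<close>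
    divides \<open>e' b\<close>. Minimality of \<open>m\<close> then forces
    \<open>d = 1\<close>.\<close>
  have cop: "coprime e' m"
  proof -
    define d where "d = gcd e' m"
    have d: "d > 0" using m(1) by (simp add: d_def)
    obtain a b where ab: "e' = d * a" "m = d * b" by (metis d_def dvdE gcd_dvd1 gcd_dvd2)
    have b: "b > 0" using m(1) ab(2) by (cases b) auto
    have "B ^\<^sub>m (e' * e * b) = 1\<^sub>m r"
    proof -
      have "e' * e * b = m * (a * e)" by (simp add: ab mult_ac)
      thus ?thesis by (simp only: pow_mat_times[OF B] m(2) one_pow_mat)
    qed
    moreover have "similar_mat (B ^\<^sub>m b) (B ^\<^sub>m (e' * e * b))"
      using similar_mat_pow[OF sim3, of b] by (simp add: pow_mat_times[OF B])
    ultimately have "similar_mat (B ^\<^sub>m b) (1\<^sub>m r)" by simp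
    hence "B ^\<^sub>m b = 1\<^sub>m r"
      unfolding similar_mat_def similar_mat_wit_def Let_def using B by auto
    hence "d * b \<le> b" using m_le[OF b] ab(2) by simp
    hence "d = 1" using b d by auto
    thus ?thesis by (simp add: d_def coprime_iff_gcd_eq_1)
  qed
  obtain A0 :: "int mat" where A0: "A0 \<in> carrier_mat n n" "A = map_mat rat_of_int A0" using PE.A_integral by blast
  have A0_pow: "map_mat rat_of_int (A0 ^\<^sub>m j) = A ^\<^sub>m j" for j
    unfolding A0(2)
    by (induction j) (use A0(1) in \<open>auto simp: of_int_hom.mat_hom_mult[OF pow_carrier_mat[OF A0(1)] A0(1)] of_int_hom.mat_hom_one\<close>)
  \<comment> \<open>The congruences for traces require an integral matrix, so they are applied to
    \<open>A0\<close>; the result passes to \<open>B\<close>, whose traces differ by a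
    constant.\<close>
  have trA: "rat_of_int (tr (A0 ^\<^sub>m j)) = tr (B ^\<^sub>m j) + of_nat n - of_nat r" for j
  proof -
    have "rat_of_int (tr (A0 ^\<^sub>m j)) = tr (map_mat rat_of_int (A0 ^\<^sub>m j))"
      using A0(1) by (simp add: tr_def)
    thus ?thesis unfolding A0_pow using tr_pow_restriction[OF f(1,2), of j] f(5) by (simp add: B_def)
  qed
  have per: "tr (A0 ^\<^sub>m (j + m)) = tr (A0 ^\<^sub>m j)" for j
  proof -
    have "B ^\<^sub>m (j + m) = B ^\<^sub>m j" by (rule pow_mat_cong[OF B m(2)]) simp
    hence "rat_of_int (tr (A0 ^\<^sub>m (j + m))) = rat_of_int (tr (A0 ^\<^sub>m j))" unfolding trA by simp
    thus ?thesis by simp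
  qed
  have tr_coprime: "tr (B ^\<^sub>m (l * j)) = tr (B ^\<^sub>m j)" if "coprime l m" for l j
  proof -
    have "rat_of_int (tr (A0 ^\<^sub>m (l * j))) = rat_of_int (tr (A0 ^\<^sub>m j))"
      using tr_pow_coprime[OF A0(1) m(1) per that] by simp
    thus ?thesis unfolding trA by simp
  qed
  have cop1: "coprime (m - 1) m" using m(1) by (metis Suc_diff_1 coprime_Suc_left_nat coprime_commute)
  have "similar_mat B (B ^\<^sub>m e')"
  proof (rule similar_if_traces_eq[OF B pow_carrier_mat[OF B] m])
    show "(B ^\<^sub>m e') ^\<^sub>m m = 1\<^sub>m r"
      using pow_mat_times[OF B, of e' m] pow_mat_times[OF B, of m e'] m(2) by (simp add: mult.commute)
    \<comment> \<open>Both \<open>e'\<close> and \<open>m - 1\<close> are prime to \<open>m\<close>,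
      so the exponent \<open>e' (m - 1)\<close> demanded by the similarity criterion leaves all
      traces unchanged.\<close>
    show "tr (B ^\<^sub>m j) = tr ((B ^\<^sub>m e') ^\<^sub>m ((m - 1) * j))" for j
      using tr_coprime[OF cop, of "(m - 1) * j"] tr_coprime[OF cop1, of j] by (simp add: pow_mat_times[OF B, symmetric])
  qed
  hence "similar_mat B B'" using sim2 similar_mat_sym similar_mat_trans by blast
  hence "similar_mat (1\<^sub>m n + U * C) (1\<^sub>m n + U' * C')"
    unfolding B_def B'_def using f f' unfolding n r
    by (intro similar_if_restrictions_similar[of U n r C V W U' C' V' W']) auto
  thus ?thesis using f(5) f'(5) n similar_mat_sym by metis
qed

text \<open>In an exceptional group every element belongs to \<open>virt_central\<close>, whereas in
  the other groups such elements have height zero, unlike \<open>t\<close>.\<close>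

lemma exceptional_iff: "P.exceptional \<Longrightarrow> Q.exceptional"
proof (rule ccontr)
  interpret J: lm_isos n' A' L' n A L \<psi> \<phi> by (rule swap)
  assume P: "P.exceptional" and Q: "\<not> Q.exceptional"
  interpret PE: exceptional_leary_minasyan n A L by unfold_locales (rule P)
  have "\<psi> Q.tt \<in> P.virt_central" using PE.virt_central_eq by simp
  hence "Q.tt \<in> Q.virt_central" using phi_virt_central[of "\<psi> Q.tt"] by simp
  thus False using Q.virt_central_subset_base_roots[OF Q] Q.tau_base_roots[of Q.tt] by auto
qed

lemma conclusion: "n = n' \<and> (similar_mat A' A \<or> similar_mat A' P.Ai)"
proof -
  interpret J: lm_isos n' A' L' n A L \<psi> \<phi> by (rule swap)
  show ?thesis
    using generic_case exceptional_case exceptional_iff J.exceptional_iff by blast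
qed

end

theorem corollary1p3:
  fixes n n' :: nat and A A' :: "rat mat" and L L' :: "int vec set"
  assumes "A \<in> carrier (GL n)" and "A' \<in> carrier (GL n')"
    and "finite_index_subgroup L (integral_part n A)"
    and "finite_index_subgroup L' (integral_part n' A')"
    and "LM_group n A L \<cong> LM_group n' A' L'"
  shows "n = n' \<and> (conjugate_in (GL n) A' A \<or> conjugate_in (GL n) A' (inv\<^bsub>GL n\<^esub> A))"
proof -
  interpret P: leary_minasyan n A L by (rule leary_minasyan.intro[OF assms(1,3)])
  interpret Q: leary_minasyan n' A' L' by (rule leary_minasyan.intro[OF assms(2,4)])
  obtain \<phi> where phi: "\<phi> \<in> iso (LM_group n A L) (LM_group n' A' L')"
    using assms(5) by (auto simp: is_iso_def)
  define \<psi> where "\<psi> = inv_into (carrier (LM_group n A L)) \<phi>"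
  have bij: "bij_betw \<phi> (carrier (LM_group n A L)) (carrier (LM_group n' A' L'))"
    and hom: "\<phi> \<in> hom (LM_group n A L) (LM_group n' A' L')"
    using phi by (auto simp: iso_def)
  have "\<psi> \<in> hom (LM_group n' A' L') (LM_group n A L)"
    using P.iso_set_sym[OF phi] by (auto simp: iso_def \<psi>_def)
  then interpret lm_isos n A L n' A' L' \<phi> \<psi>
    using hom bij_betw_inv_into_left[OF bij] bij_betw_inv_into_right[OF bij]
    by unfold_locales (auto simp: \<psi>_def)
  have "n = n' \<and> (similar_mat A' A \<or> similar_mat A' P.Ai)" by (rule conclusion)
  thus ?thesis
    using similar_imp_conjugate_in[of A' A n] similar_imp_conjugate_in[of A' P.Ai n] P.A P.Ai
    unfolding P.Ai_def by blast
qed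

end
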